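(* (1) Let $A$ and $B$ be Artin algebras and $M$ an $A$-$B$-bimodule such that $\Lambda=\begin{pmatrix}A&M\\0&B\end{pmatrix}$ is an Artin algebra. Assume that ${}^{\perp}B=\mathrm{add}(B)$ with $\mathrm{proj.dim}\,M_B<\infty$, and that ${}_AM$ is torsionless with $\mathrm{proj.dim}\,{}_AM<\infty$. Then $\Lambda$ is weakly Gorenstein if and only if $A$ is weakly Gorenstein. Moreover, if in addition ${}_AM$ is projective, then $${}^{\perp}\Lambda=\mathrm{gp}(\Lambda)=\left\{\tbinom{M\otimes_BP}{P}_{\mathrm{Id}_{M\otimes_BP}}\oplus\tbinom{G}{0}\ \Big|\ P\in\mathrm{add}(B),\ G\in{}^{\perp}A=\mathrm{gp}(A)\right\}$$ and ${}^{\perp}\Lambda=\mathrm{add}(\Lambda)$ if and only if ${}^{\perp}A=\mathrm{add}(A)$. (2) Let $A$ be a finite-dimensional algebra over a field $k$, $Q$ a finite acyclic quiver, $I$ an admissible ideal of $kQ$, and $\Lambda=A\otimes_k(kQ/I)$. Then ${}^{\perp}\Lambda=\mathrm{add}(\Lambda)$ if and only if ${}^{\perp}A=\mathrm{add}(A)$.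
   Context: Quivers have at least one vertex. All modules are finitely generated, and are left modules unless otherwise stated; descriptions of full subcategories are understood up to isomorphism of modules. For an Artin algebra $R$: $\mathrm{add}(R)$ is the full subcategory of direct summands of finite direct sums of copies of $R$, i.e. of the projective left $R$-modules; ${}^{\perp}R$ is the full subcategory of left $R$-modules $X$ with $\mathrm{Ext}^i_R(X,R)=0$ for all $i\ge1$; modules in ${}^\perp R$ are called semi-Gorenstein-projective (similarly for right modules). For an $R$-module $N$ put $N^*=\mathrm{Hom}_R(N,R)$, with canonical map $\phi_N:N\to N^{**}$, $\phi_N(n)(f)=f(n)$; $N$ is torsionless if $\phi_N$ is a monomorphism (equivalently, $N$ is a submodule of a projective module) and reflexive if $\phi_N$ is an isomorphism. $N$ is Gorenstein-projective if $N$ and $N^*$ are semi-Gorenstein-projective and $N$ is reflexive; $\mathrm{gp}(R)$ is the full subcategory of Gorenstein-projective left $R$-modules. $R$ is (left) weakly Gorenstein if ${}^{\perp}R=\mathrm{gp}(R)$. A left module over $\begin{pmatrix}A&M\\0&B\end{pmatrix}$ is identified with a triple $\binom{X}{Y}_\varphi$, where $X$ is a left $A$-module, $Y$ is a left $B$-module and $\varphi:M\otimes_BY\to X$ is a left $A$-map; $\binom{G}{0}$ denotes the triple with $Y=0$ and zero map.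
   Formalization: The displayed description of ⊥Λ = gp(Λ) is stated only when A is weakly Gorenstein (⊥A = gp(A)), as its last clause presupposes; otherwise it fails, e.g. for M = 0, B = k and A not weakly Gorenstein. *)

theory Defs
  imports
    "HOL-Library.Extended_Nat"
    "Graph_Theory.Arc_Walk"
    "HOL-Algebra.Free_Abelian_Groups"
    "HOL-Algebra.Elementary_Groups"
    "HOL-Algebra.Ideal_Product"
    "HOL-Algebra.QuotRing"
    "HOL-Algebra.Module"
begin

section \<open>Left modules over noncommutative rings\<close>

text \<open>
  The library locale \<^locale>\<open>module\<close> is restricted to commutative rings. We keep its record type (whose
  fields \<^term>\<open>mult\<close> and \<^term>\<open>one\<close> are irrelevant for a module) and drop commutativity.
\<close>

locale lmodule = R?: ring R + M?: abelian_group M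
  for R :: "('r, 'e) ring_scheme" (structure) and M :: "('r, 'm, 'x) module_scheme" (structure) +
  assumes lsmult_closed: "\<lbrakk>a \<in> carrier R; x \<in> carrier M\<rbrakk> \<Longrightarrow> a \<odot>\<^bsub>M\<^esub> x \<in> carrier M"
    and lsmult_l_distr: "\<lbrakk>a \<in> carrier R; b \<in> carrier R; x \<in> carrier M\<rbrakk> \<Longrightarrow>
      (a \<oplus>\<^bsub>R\<^esub> b) \<odot>\<^bsub>M\<^esub> x = a \<odot>\<^bsub>M\<^esub> x \<oplus>\<^bsub>M\<^esub> b \<odot>\<^bsub>M\<^esub> x"
    and lsmult_r_distr: "\<lbrakk>a \<in> carrier R; x \<in> carrier M; y \<in> carrier M\<rbrakk> \<Longrightarrow>
      a \<odot>\<^bsub>M\<^esub> (x \<oplus>\<^bsub>M\<^esub> y) = a \<odot>\<^bsub>M\<^esub> x \<oplus>\<^bsub>M\<^esub> a \<odot>\<^bsub>M\<^esub> y"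
    and lsmult_assoc: "\<lbrakk>a \<in> carrier R; b \<in> carrier R; x \<in> carrier M\<rbrakk> \<Longrightarrow>
      (a \<otimes>\<^bsub>R\<^esub> b) \<odot>\<^bsub>M\<^esub> x = a \<odot>\<^bsub>M\<^esub> (b \<odot>\<^bsub>M\<^esub> x)"
    and lsmult_one: "x \<in> carrier M \<Longrightarrow> \<one>\<^bsub>R\<^esub> \<odot>\<^bsub>M\<^esub> x = x"

text \<open>Right \<open>R\<close>-modules are the left modules over the opposite ring, with \<open>r \<odot> x\<close> standing for \<open>x r\<close>.\<close>

definition opp :: "('r, 'e) ring_scheme \<Rightarrow> ('r, 'e) ring_scheme" where
  "opp R = R\<lparr>mult := (\<lambda>x y. y \<otimes>\<^bsub>R\<^esub> x)\<rparr>"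

lemma opp_opp [simp]: "opp (opp R) = R"
  by (simp add: opp_def)

definition fg_module :: "('r, 'e) ring_scheme \<Rightarrow> ('r, 'm, 'x) module_scheme \<Rightarrow> bool" where
  "fg_module R X \<longleftrightarrow> (\<exists>S. finite S \<and> S \<subseteq> carrier X \<and>
     (\<forall>x \<in> carrier X. \<exists>c \<in> S \<rightarrow>\<^sub>E carrier R. x = (\<Oplus>\<^bsub>X\<^esub>s\<in>S. c s \<odot>\<^bsub>X\<^esub> s)))"

text \<open>
  Homomorphisms are extensional functions, so that they are determined by their values on the
  carrier and \<open>lhom R X Y\<close> really is the set \<open>Hom\<^sub>R(X, Y)\<close>.
\<close>

definition lhom ::
  "('r, 'e) ring_scheme \<Rightarrow> ('r, 'm, 'x) module_scheme \<Rightarrow> ('r, 'n, 'y) module_scheme \<Rightarrow> ('m \<Rightarrow> 'n) set" where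
  "lhom R X Y = {f \<in> carrier X \<rightarrow>\<^sub>E carrier Y.
     (\<forall>x \<in> carrier X. \<forall>x' \<in> carrier X. f (x \<oplus>\<^bsub>X\<^esub> x') = f x \<oplus>\<^bsub>Y\<^esub> f x') \<and>
     (\<forall>r \<in> carrier R. \<forall>x \<in> carrier X. f (r \<odot>\<^bsub>X\<^esub> x) = r \<odot>\<^bsub>Y\<^esub> f x)}"

definition lisos ::
  "('r, 'e) ring_scheme \<Rightarrow> ('r, 'm, 'x) module_scheme \<Rightarrow> ('r, 'n, 'y) module_scheme \<Rightarrow> ('m \<Rightarrow> 'n) set" where
  "lisos R X Y = {f \<in> lhom R X Y. bij_betw f (carrier X) (carrier Y)}"

definition lisomorphic ::
  "('r, 'e) ring_scheme \<Rightarrow> ('r, 'm, 'x) module_scheme \<Rightarrow> ('r, 'n, 'y) module_scheme \<Rightarrow> bool" where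
  "lisomorphic R X Y \<longleftrightarrow> lisos R X Y \<noteq> {}"

definition reg_module :: "('r, 'e) ring_scheme \<Rightarrow> ('r, 'r) module" where
  "reg_module R = \<lparr>carrier = carrier R, mult = mult R, one = one R,
     zero = zero R, add = add R, smult = mult R\<rparr>"

definition zero_module :: "('r, unit) module" where
  "zero_module = \<lparr>carrier = {()}, mult = (\<lambda>_ _. ()), one = (),
     zero = (), add = (\<lambda>_ _. ()), smult = (\<lambda>_ _. ())\<rparr>"

definition free_module :: "('r, 'e) ring_scheme \<Rightarrow> nat \<Rightarrow> ('r, nat \<Rightarrow> 'r) module" where
  "free_module R n = \<lparr>carrier = {..<n} \<rightarrow>\<^sub>E carrier R, mult = undefined, one = undefined,
     zero = (\<lambda>i\<in>{..<n}. \<zero>\<^bsub>R\<^esub>),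
     add = (\<lambda>x y. \<lambda>i\<in>{..<n}. x i \<oplus>\<^bsub>R\<^esub> y i),
     smult = (\<lambda>r x. \<lambda>i\<in>{..<n}. r \<otimes>\<^bsub>R\<^esub> x i)\<rparr>"

definition direct_sum ::
  "('r, 'm, 'x) module_scheme \<Rightarrow> ('r, 'n, 'y) module_scheme \<Rightarrow> ('r, 'm \<times> 'n) module" where
  "direct_sum X Y = \<lparr>carrier = carrier X \<times> carrier Y, mult = undefined, one = undefined,
     zero = (\<zero>\<^bsub>X\<^esub>, \<zero>\<^bsub>Y\<^esub>),
     add = (\<lambda>(x, y) (x', y'). (x \<oplus>\<^bsub>X\<^esub> x', y \<oplus>\<^bsub>Y\<^esub> y')),
     smult = (\<lambda>r (x, y). (r \<odot>\<^bsub>X\<^esub> x, r \<odot>\<^bsub>Y\<^esub> y))\<rparr>"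

text \<open>
  \<open>add(R)\<close>: the direct summands of the \<open>R\<^sup>n\<close>. A complement of a summand of \<open>R\<^sup>n\<close> is isomorphic to a
  submodule of \<open>R\<^sup>n\<close>, so it may be taken on the type \<^typ>\<open>nat \<Rightarrow> 'r\<close>.
\<close>

definition add_modules :: "('r, 'e) ring_scheme \<Rightarrow> ('r, 'm, 'x) module_scheme set" where
  "add_modules R = {X. lmodule R X \<and>
     (\<exists>n. \<exists>Y :: ('r, nat \<Rightarrow> 'r) module. lmodule R Y \<and>
        lisomorphic R (direct_sum X Y) (free_module R n))}"


section \<open>Projective resolutions, Ext and projective dimension\<close>

text \<open>
  \<open>\<dots> \<rightarrow> P 2 \<rightarrow> P 1 \<rightarrow> P 0 \<rightarrow> X \<rightarrow> 0\<close> with \<open>d i : P (i + 1) \<rightarrow> P i\<close>, augmentation \<open>e : P 0 \<rightarrow> X\<close>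
  and all \<open>P i\<close> finitely generated projective. Over a Noetherian ring every finitely generated
  module has such a resolution; as every finitely generated projective module is isomorphic to a
  submodule of some \<open>R\<^sup>n\<close>, the terms may be taken on the type \<^typ>\<open>nat \<Rightarrow> 'r\<close>.
\<close>

definition is_proj_resolution ::
  "('r, 'e) ring_scheme \<Rightarrow> ('r, 'm, 'x) module_scheme \<Rightarrow> (nat \<Rightarrow> ('r, nat \<Rightarrow> 'r) module) \<Rightarrow>
   (nat \<Rightarrow> (nat \<Rightarrow> 'r) \<Rightarrow> (nat \<Rightarrow> 'r)) \<Rightarrow> ((nat \<Rightarrow> 'r) \<Rightarrow> 'm) \<Rightarrow> bool" where
  "is_proj_resolution R X P d e \<longleftrightarrow>
     (\<forall>i. P i \<in> add_modules R) \<and>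
     (\<forall>i. d i \<in> lhom R (P (Suc i)) (P i)) \<and>
     e \<in> lhom R (P 0) X \<and>
     e ` carrier (P 0) = carrier X \<and>
     d 0 ` carrier (P (Suc 0)) = a_kernel (P 0) X e \<and>
     (\<forall>i. d (Suc i) ` carrier (P (Suc (Suc i))) = a_kernel (P (Suc i)) (P i) (d i))"

definition proj_resolution ::
  "('r, 'e) ring_scheme \<Rightarrow> ('r, 'm, 'x) module_scheme \<Rightarrow>
   (nat \<Rightarrow> ('r, nat \<Rightarrow> 'r) module) \<times> (nat \<Rightarrow> (nat \<Rightarrow> 'r) \<Rightarrow> (nat \<Rightarrow> 'r))" where
  "proj_resolution R X = (SOME (P, d). \<exists>e. is_proj_resolution R X P d e)"

definition hom_group ::
  "('r, 'e) ring_scheme \<Rightarrow> ('r, 'm, 'x) module_scheme \<Rightarrow> ('r, 'n, 'y) module_scheme \<Rightarrow> ('m \<Rightarrow> 'n) monoid" where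
  "hom_group R X Y = \<lparr>carrier = lhom R X Y,
     monoid.mult = (\<lambda>f g. \<lambda>x\<in>carrier X. f x \<oplus>\<^bsub>Y\<^esub> g x),
     one = (\<lambda>x\<in>carrier X. \<zero>\<^bsub>Y\<^esub>)\<rparr>"

text \<open>
  \<open>Ext\<^sup>i\<^sub>R(X, Y)\<close> is the \<open>i\<close>-th cohomology group of \<open>Hom\<^sub>R(P, Y)\<close> for a (chosen) projective
  resolution \<open>P\<close> of \<open>X\<close>.
\<close>

definition Ext ::
  "('r, 'e) ring_scheme \<Rightarrow> nat \<Rightarrow> ('r, 'm, 'x) module_scheme \<Rightarrow> ('r, 'n, 'y) module_scheme \<Rightarrow>
   ((nat \<Rightarrow> 'r) \<Rightarrow> 'n) set monoid" where
  "Ext R i X Y = (case proj_resolution R X of (P, d) \<Rightarrow>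
     let \<delta> = (\<lambda>j f. compose (carrier (P (Suc j))) f (d j));
         Z = kernel (hom_group R (P i) Y) (hom_group R (P (Suc i)) Y) (\<delta> i);
         B = (case i of 0 \<Rightarrow> {\<one>\<^bsub>hom_group R (P 0) Y\<^esub>} | Suc j \<Rightarrow> \<delta> j ` lhom R (P j) Y)
     in (hom_group R (P i) Y)\<lparr>carrier := Z\<rparr> Mod B)"

definition proj_dim :: "('r, 'e) ring_scheme \<Rightarrow> ('r, 'm, 'x) module_scheme \<Rightarrow> enat" where
  "proj_dim R X = Inf {enat n | n. \<exists>P d e. is_proj_resolution R X P d e \<and>
     (\<forall>i > n. carrier (P i) = {\<zero>\<^bsub>P i\<^esub>})}"


section \<open>Semi-Gorenstein-projective and Gorenstein-projective modules\<close>

text \<open>The class \<open>\<^bold>\<bottom>R\<close> of finitely generated modules \<open>X\<close> with \<open>Ext\<^sup>i(X, R) = 0\<close> for all \<open>i \<ge> 1\<close>.\<close>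

definition perp :: "('r, 'e) ring_scheme \<Rightarrow> ('r, 'm, 'x) module_scheme set" where
  "perp R = {X. lmodule R X \<and> fg_module R X \<and> (\<forall>i \<ge> 1. trivial_group (Ext R i X (reg_module R)))}"

text \<open>
  \<open>X\<^sup>* = Hom\<^sub>R(X, R)\<close> with \<open>(f r)(x) = f(x) r\<close>, a module over \<^term>\<open>opp R\<close>. Since
  \<open>opp (opp R) = R\<close>, the double dual \<open>dual (opp R) (dual R X)\<close> is an \<open>R\<close>-module again.
\<close>

definition dual :: "('r, 'e) ring_scheme \<Rightarrow> ('r, 'm, 'x) module_scheme \<Rightarrow> ('r, 'm \<Rightarrow> 'r) module" where
  "dual R X = \<lparr>carrier = lhom R X (reg_module R), mult = undefined, one = undefined,
     zero = (\<lambda>x\<in>carrier X. \<zero>\<^bsub>R\<^esub>),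
     add = (\<lambda>f g. \<lambda>x\<in>carrier X. f x \<oplus>\<^bsub>R\<^esub> g x),
     smult = (\<lambda>r f. \<lambda>x\<in>carrier X. f x \<otimes>\<^bsub>R\<^esub> r)\<rparr>"

definition eval_map :: "('r, 'e) ring_scheme \<Rightarrow> ('r, 'm, 'x) module_scheme \<Rightarrow> 'm \<Rightarrow> ('m \<Rightarrow> 'r) \<Rightarrow> 'r" where
  "eval_map R X = (\<lambda>x\<in>carrier X. \<lambda>f\<in>carrier (dual R X). f x)"

definition torsionless :: "('r, 'e) ring_scheme \<Rightarrow> ('r, 'm, 'x) module_scheme \<Rightarrow> bool" where
  "torsionless R X \<longleftrightarrow> inj_on (eval_map R X) (carrier X)"

definition reflexive :: "('r, 'e) ring_scheme \<Rightarrow> ('r, 'm, 'x) module_scheme \<Rightarrow> bool" where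
  "reflexive R X \<longleftrightarrow> eval_map R X \<in> lisos R X (dual (opp R) (dual R X))"

definition gp :: "('r, 'e) ring_scheme \<Rightarrow> ('r, 'm, 'x) module_scheme set" where
  "gp R = {X. X \<in> perp R \<and> dual R X \<in> perp (opp R) \<and> reflexive R X}"

text \<open>
  Equalities between classes of finitely generated modules are stated on a fixed carrier type. Every
  finitely generated \<open>R\<close>-module is isomorphic to a quotient of some \<open>R\<^sup>n\<close>, whose elements are cosets,
  i.e. sets of tuples; so all isomorphism classes occur on the following type.
\<close>

type_synonym 'r fgmod = "('r, (nat \<Rightarrow> 'r) set) module"

definition weakly_Gorenstein :: "('r, 'e) ring_scheme \<Rightarrow> bool" where
  "weakly_Gorenstein R \<longleftrightarrow> (perp R :: 'r fgmod set) = gp R"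


section \<open>Artin algebras and triangular matrix rings\<close>

definition artinian_cring :: "('r, 'e) ring_scheme \<Rightarrow> bool" where
  "artinian_cring K \<longleftrightarrow> cring K \<and>
     (\<forall>J :: nat \<Rightarrow> 'r set. (\<forall>n. ideal (J n) K \<and> J (Suc n) \<subseteq> J n) \<longrightarrow> (\<exists>n. \<forall>m \<ge> n. J m = J n))"

definition ring_center :: "('r, 'e) ring_scheme \<Rightarrow> 'r set" where
  "ring_center R = {z \<in> carrier R. \<forall>x \<in> carrier R. z \<otimes>\<^bsub>R\<^esub> x = x \<otimes>\<^bsub>R\<^esub> z}"

text \<open>
  Replacing the commutative Artinian base ring \<open>K\<close> of an Artin algebra \<open>R\<close> by its image in \<open>R\<close>,
  one sees that it is no restriction to take \<open>K\<close> on the type of the elements of \<open>R\<close>.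
\<close>

definition artin_algebra :: "('r, 'e) ring_scheme \<Rightarrow> bool" where
  "artin_algebra R \<longleftrightarrow> ring R \<and>
     (\<exists>K :: 'r ring. \<exists>h. artinian_cring K \<and> h \<in> ring_hom K R \<and> h ` carrier K \<subseteq> ring_center R \<and>
        fg_module K ((reg_module R)\<lparr>smult := (\<lambda>c x. h c \<otimes>\<^bsub>R\<^esub> x)\<rparr>))"

record ('a, 'b, 'm) bimodule = "('a, 'm) module" +
  rsmult :: "'m \<Rightarrow> 'b \<Rightarrow> 'm"

definition right_module :: "('a, 'b, 'm, 'x) bimodule_scheme \<Rightarrow> ('b, 'm) module" where
  "right_module M = \<lparr>carrier = carrier M, mult = mult M, one = one M, zero = zero M, add = add M,
     smult = (\<lambda>b m. rsmult M m b)\<rparr>"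

locale bimodule = L?: lmodule A M + Rt: lmodule "opp B" "right_module M"
  for A :: "('a, 'e) ring_scheme" and B :: "('b, 'f) ring_scheme" and M :: "('a, 'b, 'm, 'x) bimodule_scheme" +
  assumes bimod_assoc: "\<lbrakk>a \<in> carrier A; m \<in> carrier M; b \<in> carrier B\<rbrakk> \<Longrightarrow>
    rsmult M (a \<odot>\<^bsub>M\<^esub> m) b = a \<odot>\<^bsub>M\<^esub> rsmult M m b"

text \<open>The triple \<open>(a, m, b)\<close> stands for the upper triangular matrix with rows \<open>(a, m)\<close> and \<open>(0, b)\<close>.\<close>

definition triangular_ring ::
  "('a, 'e) ring_scheme \<Rightarrow> ('a, 'b, 'm, 'x) bimodule_scheme \<Rightarrow> ('b, 'f) ring_scheme \<Rightarrow> ('a \<times> 'm \<times> 'b) ring" where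
  "triangular_ring A M B = \<lparr>carrier = carrier A \<times> carrier M \<times> carrier B,
     mult = (\<lambda>(a, m, b) (a', m', b').
       (a \<otimes>\<^bsub>A\<^esub> a', a \<odot>\<^bsub>M\<^esub> m' \<oplus>\<^bsub>M\<^esub> rsmult M m b', b \<otimes>\<^bsub>B\<^esub> b')),
     one = (\<one>\<^bsub>A\<^esub>, \<zero>\<^bsub>M\<^esub>, \<one>\<^bsub>B\<^esub>),
     zero = (\<zero>\<^bsub>A\<^esub>, \<zero>\<^bsub>M\<^esub>, \<zero>\<^bsub>B\<^esub>),
     add = (\<lambda>(a, m, b) (a', m', b'). (a \<oplus>\<^bsub>A\<^esub> a', m \<oplus>\<^bsub>M\<^esub> m', b \<oplus>\<^bsub>B\<^esub> b'))\<rparr>"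


section \<open>Tensor products\<close>

text \<open>
  \<open>M \<otimes>\<^bsub>B\<^esub> Y\<close> as the free abelian group on \<open>M \<times> Y\<close> modulo the usual relations. The right \<open>B\<close>-module \<open>M\<close>
  is given as a module over \<^term>\<open>opp B\<close>, so \<open>b \<odot>\<^bsub>M\<^esub> m\<close> is \<open>m b\<close>.
\<close>

definition tensor_free ::
  "('b, 'm, 'x) module_scheme \<Rightarrow> ('b, 'y, 'z) module_scheme \<Rightarrow> ('m \<times> 'y \<Rightarrow>\<^sub>0 int) monoid" where
  "tensor_free M Y = free_Abelian_group (carrier M \<times> carrier Y)"

definition tensor_rel ::
  "('b, 'e) ring_scheme \<Rightarrow> ('b, 'm, 'x) module_scheme \<Rightarrow> ('b, 'y, 'z) module_scheme \<Rightarrow>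
   ('m \<times> 'y \<Rightarrow>\<^sub>0 int) set" where
  "tensor_rel B M Y = generate (tensor_free M Y)
     ({frag_of (m \<oplus>\<^bsub>M\<^esub> m', y) - frag_of (m, y) - frag_of (m', y) | m m' y.
         m \<in> carrier M \<and> m' \<in> carrier M \<and> y \<in> carrier Y} \<union>
      {frag_of (m, y \<oplus>\<^bsub>Y\<^esub> y') - frag_of (m, y) - frag_of (m, y') | m y y'.
         m \<in> carrier M \<and> y \<in> carrier Y \<and> y' \<in> carrier Y} \<union>
      {frag_of (b \<odot>\<^bsub>M\<^esub> m, y) - frag_of (m, b \<odot>\<^bsub>Y\<^esub> y) | m b y.
         m \<in> carrier M \<and> b \<in> carrier B \<and> y \<in> carrier Y})"

definition tensor_class ::
  "('b, 'e) ring_scheme \<Rightarrow> ('b, 'm, 'x) module_scheme \<Rightarrow> ('b, 'y, 'z) module_scheme \<Rightarrow>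
   ('m \<times> 'y \<Rightarrow>\<^sub>0 int) \<Rightarrow> ('m \<times> 'y \<Rightarrow>\<^sub>0 int) set" where
  "tensor_class B M Y t = tensor_rel B M Y #>\<^bsub>tensor_free M Y\<^esub> t"

definition tensor_group ::
  "('b, 'e) ring_scheme \<Rightarrow> ('b, 'm, 'x) module_scheme \<Rightarrow> ('b, 'y, 'z) module_scheme \<Rightarrow>
   ('m \<times> 'y \<Rightarrow>\<^sub>0 int) set monoid" where
  "tensor_group B M Y = tensor_free M Y Mod tensor_rel B M Y"

text \<open>
  The left \<open>A\<close>-module \<open>M \<otimes>\<^bsub>B\<^esub> Y\<close> for an \<open>A\<close>-\<open>B\<close>-bimodule \<open>M\<close>, with \<open>a (m \<otimes> y) = a m \<otimes> y\<close>. All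
  representatives of a class contribute the same class to the union.
\<close>

definition tensor_module ::
  "('a, 'b, 'm, 'x) bimodule_scheme \<Rightarrow> ('b, 'e) ring_scheme \<Rightarrow> ('b, 'y, 'z) module_scheme \<Rightarrow>
   ('a, ('m \<times> 'y \<Rightarrow>\<^sub>0 int) set) module" where
  "tensor_module M B Y = \<lparr>carrier = carrier (tensor_group B (right_module M) Y),
     mult = undefined, one = undefined,
     zero = one (tensor_group B (right_module M) Y),
     add = monoid.mult (tensor_group B (right_module M) Y),
     smult = (\<lambda>a T. \<Union>t\<in>T. tensor_class B (right_module M) Y
                (frag_extend (\<lambda>(m, y). frag_of (a \<odot>\<^bsub>M\<^esub> m, y)) t))\<rparr>"

text \<open>
  The left module over the triangular matrix ring given by a left \<open>A\<close>-module \<open>X\<close>, a left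
  \<open>B\<close>-module \<open>Y\<close> and an \<open>A\<close>-linear map \<open>\<phi> : M \<otimes>\<^bsub>B\<^esub> Y \<rightarrow> X\<close>.
\<close>

definition triple_module ::
  "('a, 'b, 'm, 'x) bimodule_scheme \<Rightarrow> ('b, 'e) ring_scheme \<Rightarrow>
   ('a, 'u, 'v) module_scheme \<Rightarrow> ('b, 'y, 'z) module_scheme \<Rightarrow>
   (('m \<times> 'y \<Rightarrow>\<^sub>0 int) set \<Rightarrow> 'u) \<Rightarrow> ('a \<times> 'm \<times> 'b, 'u \<times> 'y) module" where
  "triple_module M B X Y \<phi> = \<lparr>carrier = carrier X \<times> carrier Y, mult = undefined, one = undefined,
     zero = (\<zero>\<^bsub>X\<^esub>, \<zero>\<^bsub>Y\<^esub>),
     add = (\<lambda>(x, y) (x', y'). (x \<oplus>\<^bsub>X\<^esub> x', y \<oplus>\<^bsub>Y\<^esub> y')),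
     smult = (\<lambda>(a, m, b) (x, y).
       (a \<odot>\<^bsub>X\<^esub> x \<oplus>\<^bsub>X\<^esub> \<phi> (tensor_class B (right_module M) Y (frag_of (m, y))), b \<odot>\<^bsub>Y\<^esub> y))\<rparr>"


section \<open>Algebras over a field, tensor products of algebras\<close>

text \<open>The library locale \<^locale>\<open>algebra\<close> is restricted to commutative algebras.\<close>

locale assoc_algebra = module K A + A?: ring A
  for K :: "('k, 'e) ring_scheme" and A :: "('k, 'c, 'x) module_scheme" (structure) +
  assumes smult_mult_left: "\<lbrakk>c \<in> carrier K; x \<in> carrier A; y \<in> carrier A\<rbrakk> \<Longrightarrow>
      (c \<odot>\<^bsub>A\<^esub> x) \<otimes>\<^bsub>A\<^esub> y = c \<odot>\<^bsub>A\<^esub> (x \<otimes>\<^bsub>A\<^esub> y)"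
    and smult_mult_right: "\<lbrakk>c \<in> carrier K; x \<in> carrier A; y \<in> carrier A\<rbrakk> \<Longrightarrow>
      x \<otimes>\<^bsub>A\<^esub> (c \<odot>\<^bsub>A\<^esub> y) = c \<odot>\<^bsub>A\<^esub> (x \<otimes>\<^bsub>A\<^esub> y)"

definition fin_dim_algebra :: "('k, 'e) ring_scheme \<Rightarrow> ('k, 'c, 'x) module_scheme \<Rightarrow> bool" where
  "fin_dim_algebra K A \<longleftrightarrow> assoc_algebra K A \<and> fg_module K A"

text \<open>
  \<open>A \<otimes>\<^bsub>K\<^esub> C\<close> as a ring, with \<open>(a \<otimes> c)(a' \<otimes> c') = a a' \<otimes> c c'\<close>. As \<open>K\<close> is commutative, the
  \<open>K\<close>-module \<open>A\<close> also serves as a right \<open>K\<close>-module.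
\<close>

definition tensor_algebra ::
  "('k, 'e) ring_scheme \<Rightarrow> ('k, 'c, 'x) module_scheme \<Rightarrow> ('k, 'd, 'y) module_scheme \<Rightarrow>
   ('c \<times> 'd \<Rightarrow>\<^sub>0 int) set ring" where
  "tensor_algebra K A C = \<lparr>carrier = carrier (tensor_group K A C),
     mult = (\<lambda>S T. \<Union>s\<in>S. \<Union>t\<in>T. tensor_class K A C
        (frag_extend (\<lambda>(a, c). frag_extend (\<lambda>(a', c'). frag_of (a \<otimes>\<^bsub>A\<^esub> a', c \<otimes>\<^bsub>C\<^esub> c')) t) s)),
     one = tensor_class K A C (frag_of (\<one>\<^bsub>A\<^esub>, \<one>\<^bsub>C\<^esub>)),
     zero = one (tensor_group K A C),
     add = monoid.mult (tensor_group K A C)\<rparr>"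

definition quot_algebra :: "('k, 'c, 'x) module_scheme \<Rightarrow> 'c set \<Rightarrow> ('k, 'c set) module" where
  "quot_algebra A J = ring.extend (A Quot J)
     (module.fields (\<lambda>c X. \<Union>x\<in>X. J +>\<^bsub>A\<^esub> (c \<odot>\<^bsub>A\<^esub> x)))"


section \<open>Path algebras of quivers\<close>

text \<open>
  Quivers are the multidigraphs of \<^theory>\<open>Graph_Theory.Digraph\<close> with at least one vertex. A path is
  encoded by its starting vertex and its list of arrows in order of traversal, the trivial path at \<open>u\<close>
  being \<open>(u, [])\<close>.
\<close>

definition finite_quiver :: "('v, 'e) pre_digraph \<Rightarrow> bool" where
  "finite_quiver Q \<longleftrightarrow> fin_digraph Q \<and> verts Q \<noteq> {}"

definition acyclic_quiver :: "('v, 'e) pre_digraph \<Rightarrow> bool" where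
  "acyclic_quiver Q \<longleftrightarrow> \<not> (\<exists>u p. pre_digraph.awalk Q u p u \<and> p \<noteq> [])"

definition quiver_paths :: "('v, 'e) pre_digraph \<Rightarrow> ('v \<times> 'e list) set" where
  "quiver_paths Q = {(u, p). \<exists>v. pre_digraph.awalk Q u p v}"

text \<open>
  Elements of \<open>KQ\<close> are the finitely supported \<open>K\<close>-valued functions on paths. Products of paths are
  written like compositions of maps: \<open>q p\<close> is \<open>p\<close> followed by \<open>q\<close> (and \<open>0\<close> if \<open>q\<close> does not start
  where \<open>p\<close> ends).
\<close>

definition path_algebra ::
  "('k, 'x) ring_scheme \<Rightarrow> ('v, 'e) pre_digraph \<Rightarrow> ('k, 'v \<times> 'e list \<Rightarrow> 'k) module" where
  "path_algebra K Q = \<lparr>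
     carrier = {f. (\<forall>w. f w \<in> carrier K) \<and> (\<forall>w. w \<notin> quiver_paths Q \<longrightarrow> f w = \<zero>\<^bsub>K\<^esub>) \<and>
                   finite {w. f w \<noteq> \<zero>\<^bsub>K\<^esub>}},
     mult = (\<lambda>f g (u, p). if (u, p) \<in> quiver_paths Q
       then (\<Oplus>\<^bsub>K\<^esub>i\<in>{..length p}.
               f (pre_digraph.awlast Q u (take i p), drop i p) \<otimes>\<^bsub>K\<^esub> g (u, take i p))
       else \<zero>\<^bsub>K\<^esub>),
     one = (\<lambda>(u, p). if u \<in> verts Q \<and> p = [] then \<one>\<^bsub>K\<^esub> else \<zero>\<^bsub>K\<^esub>),
     zero = (\<lambda>_. \<zero>\<^bsub>K\<^esub>),
     add = (\<lambda>f g w. f w \<oplus>\<^bsub>K\<^esub> g w),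
     smult = (\<lambda>c f w. c \<otimes>\<^bsub>K\<^esub> f w)\<rparr>"

definition path_elem :: "('k, 'x) ring_scheme \<Rightarrow> 'v \<times> 'e list \<Rightarrow> 'v \<times> 'e list \<Rightarrow> 'k" where
  "path_elem K w = (\<lambda>w'. if w' = w then \<one>\<^bsub>K\<^esub> else \<zero>\<^bsub>K\<^esub>)"

definition arrow_ideal :: "('k, 'x) ring_scheme \<Rightarrow> ('v, 'e) pre_digraph \<Rightarrow> ('v \<times> 'e list \<Rightarrow> 'k) set" where
  "arrow_ideal K Q = Idl\<^bsub>path_algebra K Q\<^esub> {path_elem K (tail Q \<alpha>, [\<alpha>]) | \<alpha>. \<alpha> \<in> arcs Q}"

text \<open>Powers of the arrow ideal are powers in the monoid of ideals under the ideal product.\<close>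

definition admissible_ideal ::
  "('k, 'x) ring_scheme \<Rightarrow> ('v, 'e) pre_digraph \<Rightarrow> ('v \<times> 'e list \<Rightarrow> 'k) set \<Rightarrow> bool" where
  "admissible_ideal K Q J \<longleftrightarrow> ideal J (path_algebra K Q) \<and>
     (\<exists>m \<ge> 2. arrow_ideal K Q [^]\<^bsub>ideals_set (path_algebra K Q)\<^esub> (m::nat) \<subseteq> J) \<and>
     J \<subseteq> arrow_ideal K Q [^]\<^bsub>ideals_set (path_algebra K Q)\<^esub> (2::nat)"

end

theory Submission
  imports Defs
begin

text \<open>
  Let \<open>L\<close> be a ring with a decomposition \<open>1 = e + f\<close> into idempotents such that \<open>fLe = 0\<close>, and put \<open>A = eLe\<close>,
  \<open>B = fLf\<close>. If \<open>Z\<close> is semi-Gorenstein-projective over \<open>L\<close>, then so is \<open>fZ\<close> over \<open>B\<close>; when \<open>\<^sup>\<bottom>B = add(B)\<close>, it has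
  a finite dual basis. Its linear forms extend to maps \<open>Z \<rightarrow> Lf\<close> as soon as \<open>Ext\<^sup>1(Z, eLf) = 0\<close>, which holds
  whenever \<open>eLf\<close> has finite projective dimension over \<open>A\<close>, and so they split off a projective summand of \<open>Z\<close> whose
  complement is annihilated by \<open>f\<close>, i.e. is a semi-Gorenstein-projective \<open>A\<close>-module. This compares \<open>\<^sup>\<bottom>L\<close> with
  \<open>\<^sup>\<bottom>A\<close>. It also settles weak Gorensteinness, since a ring that is Noetherian on both sides is weakly Gorenstein
  if and only if all its semi-Gorenstein-projective modules are torsionless: the cokernel of a left approximation
  \<open>X \<rightarrow> R\<^sup>n\<close> of \<open>X \<in> \<^sup>\<bottom>R\<close> is again in \<open>\<^sup>\<bottom>R\<close>.

  For \<open>\<Gamma> = A \<otimes> kQ/I\<close> the same comparison applies to the corners of \<open>\<Gamma>\<close> given by sets of vertices: a sink \<open>v\<close>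
  of a set \<open>U\<close> contributes the corner \<open>A\<close>, the set \<open>U - {v}\<close> the complementary one, and the bimodule between them
  is projective over \<open>A\<close>.
\<close>

section \<open>Linear maps and submodules\<close>

text \<open>\<open>Ext\<close> is computed from one chosen resolution, and modules over one ring
  occur on many carrier types, so no long exact sequence is ever formed. Vanishing is expressed by
  extension problems instead: for a presentation P -> X with kernel K, Ext^1(X, Y) = 0 says that
  every map K -> Y extends to P, and higher degrees are reached by replacing X with K. The point to
  settle is independence of the presentation; it follows because stable direct summands pass to
  kernels. Syzygies of a module in \<open>perp R\<close> are in \<open>perp R\<close> again, so
  Ext^1(Z, N) = 0 for all Z in \<open>perp R\<close> already contains all higher degrees. This is
  how finite projective dimension is exploited: by descending along a finite resolution of N. The
  condition fLe = 0 makes compression to eLe and to fLf multiplicative, so modules over either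
  corner become L-modules. For eLe this keeps projectivity, because Le = eLe is a left ideal summand
  of L; for fLf it need not, and the defect is measured by eLf.\<close>

definition lh :: "('r, 'e) ring_scheme \<Rightarrow> ('r, 'm, 'x) module_scheme \<Rightarrow> ('r, 'n, 'y) module_scheme \<Rightarrow> ('m \<Rightarrow> 'n) \<Rightarrow> bool" where
  "lh R X Y f \<longleftrightarrow> (\<forall>x\<in>carrier X. f x \<in> carrier Y) \<and>
     (\<forall>x\<in>carrier X. \<forall>x'\<in>carrier X. f (x \<oplus>\<^bsub>X\<^esub> x') = f x \<oplus>\<^bsub>Y\<^esub> f x') \<and>
     (\<forall>r\<in>carrier R. \<forall>x\<in>carrier X. f (r \<odot>\<^bsub>X\<^esub> x) = r \<odot>\<^bsub>Y\<^esub> f x)"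

lemma lhI:
  assumes "\<And>x. x \<in> carrier X \<Longrightarrow> f x \<in> carrier Y"
    and "\<And>x x'. x \<in> carrier X \<Longrightarrow> x' \<in> carrier X \<Longrightarrow> f (x \<oplus>\<^bsub>X\<^esub> x') = f x \<oplus>\<^bsub>Y\<^esub> f x'"
    and "\<And>r x. r \<in> carrier R \<Longrightarrow> x \<in> carrier X \<Longrightarrow> f (r \<odot>\<^bsub>X\<^esub> x) = r \<odot>\<^bsub>Y\<^esub> f x"
  shows "lh R X Y f"
  using assms by (auto simp: lh_def)

lemma lh_closed: "lh R X Y f \<Longrightarrow> x \<in> carrier X \<Longrightarrow> f x \<in> carrier Y"
  and lh_add: "lh R X Y f \<Longrightarrow> x \<in> carrier X \<Longrightarrow> x' \<in> carrier X \<Longrightarrow> f (x \<oplus>\<^bsub>X\<^esub> x') = f x \<oplus>\<^bsub>Y\<^esub> f x'"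
  and lh_smult: "lh R X Y f \<Longrightarrow> r \<in> carrier R \<Longrightarrow> x \<in> carrier X \<Longrightarrow> f (r \<odot>\<^bsub>X\<^esub> x) = r \<odot>\<^bsub>Y\<^esub> f x"
  by (auto simp: lh_def)

text \<open>\<open>lhom\<close> consists of extensional functions, a property lost under composition
  and pointwise sums written as lambda terms. The working notion \<open>lh\<close> looks at values
  on the carrier only, and \<open>lhom\<close> reappears just where the given definitions mention
  it.\<close>

lemma lhom_iff: "f \<in> lhom R X Y \<longleftrightarrow> lh R X Y f \<and> f \<in> extensional (carrier X)"
  by (auto simp: lhom_def lh_def PiE_def)

lemma lmodule_groupI:
  assumes "ring R"
    and "\<And>x y. x \<in> carrier X \<Longrightarrow> y \<in> carrier X \<Longrightarrow> x \<oplus>\<^bsub>X\<^esub> y \<in> carrier X" "\<zero>\<^bsub>X\<^esub> \<in> carrier X"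
    and "\<And>x y z. x \<in> carrier X \<Longrightarrow> y \<in> carrier X \<Longrightarrow> z \<in> carrier X \<Longrightarrow> (x \<oplus>\<^bsub>X\<^esub> y) \<oplus>\<^bsub>X\<^esub> z = x \<oplus>\<^bsub>X\<^esub> (y \<oplus>\<^bsub>X\<^esub> z)"
    and "\<And>x y. x \<in> carrier X \<Longrightarrow> y \<in> carrier X \<Longrightarrow> x \<oplus>\<^bsub>X\<^esub> y = y \<oplus>\<^bsub>X\<^esub> x"
    and "\<And>x. x \<in> carrier X \<Longrightarrow> \<zero>\<^bsub>X\<^esub> \<oplus>\<^bsub>X\<^esub> x = x"
    and "\<And>x. x \<in> carrier X \<Longrightarrow> \<exists>y\<in>carrier X. y \<oplus>\<^bsub>X\<^esub> x = \<zero>\<^bsub>X\<^esub>"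
    and "\<And>a x. \<lbrakk>a \<in> carrier R; x \<in> carrier X\<rbrakk> \<Longrightarrow> a \<odot>\<^bsub>X\<^esub> x \<in> carrier X"
    and "\<And>a b x. \<lbrakk>a \<in> carrier R; b \<in> carrier R; x \<in> carrier X\<rbrakk> \<Longrightarrow>
      (a \<oplus>\<^bsub>R\<^esub> b) \<odot>\<^bsub>X\<^esub> x = a \<odot>\<^bsub>X\<^esub> x \<oplus>\<^bsub>X\<^esub> b \<odot>\<^bsub>X\<^esub> x"
    and "\<And>a x y. \<lbrakk>a \<in> carrier R; x \<in> carrier X; y \<in> carrier X\<rbrakk> \<Longrightarrow>
      a \<odot>\<^bsub>X\<^esub> (x \<oplus>\<^bsub>X\<^esub> y) = a \<odot>\<^bsub>X\<^esub> x \<oplus>\<^bsub>X\<^esub> a \<odot>\<^bsub>X\<^esub> y"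
    and "\<And>a b x. \<lbrakk>a \<in> carrier R; b \<in> carrier R; x \<in> carrier X\<rbrakk> \<Longrightarrow>
      (a \<otimes>\<^bsub>R\<^esub> b) \<odot>\<^bsub>X\<^esub> x = a \<odot>\<^bsub>X\<^esub> (b \<odot>\<^bsub>X\<^esub> x)"
    and "\<And>x. x \<in> carrier X \<Longrightarrow> \<one>\<^bsub>R\<^esub> \<odot>\<^bsub>X\<^esub> x = x"
  shows "lmodule R X"
  using assms unfolding lmodule_def lmodule_axioms_def
  by (auto intro!: abelian_groupI)

lemma (in abelian_group) minus_eq_zero:
  assumes "x \<ominus> y = \<zero>" "x \<in> carrier G" "y \<in> carrier G" shows "x = y"
proof -
  have "x = (x \<ominus> y) \<oplus> y" using assms(2,3) by (simp add: minus_eq a_assoc l_neg)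
  then show ?thesis using assms by simp
qed

lemma lmodule_ring: "lmodule R X \<Longrightarrow> ring R"
  by (simp add: lmodule_def)

lemma lmodule_group: "lmodule R X \<Longrightarrow> abelian_group X"
  by (simp add: lmodule_def)

context lmodule begin

lemma ls_zero [simp]: "a \<in> carrier R \<Longrightarrow> a \<odot>\<^bsub>M\<^esub> \<zero>\<^bsub>M\<^esub> = \<zero>\<^bsub>M\<^esub>"
  using lsmult_r_distr[of a "\<zero>\<^bsub>M\<^esub>" "\<zero>\<^bsub>M\<^esub>"] lsmult_closed[of a "\<zero>\<^bsub>M\<^esub>"]
  by (metis M.add.l_cancel_one M.add.one_closed M.l_zero)

lemma ls_lzero [simp]: "x \<in> carrier M \<Longrightarrow> \<zero>\<^bsub>R\<^esub> \<odot>\<^bsub>M\<^esub> x = \<zero>\<^bsub>M\<^esub>"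
  using lsmult_l_distr[of "\<zero>\<^bsub>R\<^esub>" "\<zero>\<^bsub>R\<^esub>" x] lsmult_closed[of "\<zero>\<^bsub>R\<^esub>" x]
  by (metis M.add.l_cancel_one R.zero_closed R.l_zero)

lemma ls_neg: "a \<in> carrier R \<Longrightarrow> x \<in> carrier M \<Longrightarrow> a \<odot>\<^bsub>M\<^esub> (\<ominus>\<^bsub>M\<^esub> x) = \<ominus>\<^bsub>M\<^esub> (a \<odot>\<^bsub>M\<^esub> x)"
  using lsmult_r_distr[of a "\<ominus>\<^bsub>M\<^esub> x" x]
  by (metis M.add.inv_closed M.l_neg M.minus_equality ls_zero lsmult_closed)

lemma ls_lneg: "a \<in> carrier R \<Longrightarrow> x \<in> carrier M \<Longrightarrow> (\<ominus>\<^bsub>R\<^esub> a) \<odot>\<^bsub>M\<^esub> x = \<ominus>\<^bsub>M\<^esub> (a \<odot>\<^bsub>M\<^esub> x)"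
  using lsmult_l_distr[of "\<ominus>\<^bsub>R\<^esub> a" a x]
  by (metis R.add.inv_closed R.l_neg M.minus_equality ls_lzero lsmult_closed)

lemmas ls_simps [simp] = lsmult_closed lsmult_one

end

text \<open>Negatives are left to the scalar -1, which is how \<open>submod_neg\<close> obtains
  them.\<close>

definition submod :: "('r, 'e) ring_scheme \<Rightarrow> ('r, 'm, 'x) module_scheme \<Rightarrow> 'm set \<Rightarrow> bool" where
  "submod R X H \<longleftrightarrow> H \<subseteq> carrier X \<and> \<zero>\<^bsub>X\<^esub> \<in> H \<and> (\<forall>x\<in>H. \<forall>y\<in>H. x \<oplus>\<^bsub>X\<^esub> y \<in> H) \<and>
     (\<forall>r\<in>carrier R. \<forall>x\<in>H. r \<odot>\<^bsub>X\<^esub> x \<in> H)"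

lemma submod_subset: "submod R X H \<Longrightarrow> H \<subseteq> carrier X"
  and submod_zero: "submod R X H \<Longrightarrow> \<zero>\<^bsub>X\<^esub> \<in> H"
  and submod_add: "submod R X H \<Longrightarrow> x \<in> H \<Longrightarrow> y \<in> H \<Longrightarrow> x \<oplus>\<^bsub>X\<^esub> y \<in> H"
  and submod_smult: "submod R X H \<Longrightarrow> r \<in> carrier R \<Longrightarrow> x \<in> H \<Longrightarrow> r \<odot>\<^bsub>X\<^esub> x \<in> H"
  by (auto simp: submod_def)

lemma (in lmodule) submod_neg:
  assumes "submod R M H" "x \<in> H" shows "\<ominus>\<^bsub>M\<^esub> x \<in> H"
proof -
  have "x \<in> carrier M" using assms by (auto simp: submod_def)
  then have "\<ominus>\<^bsub>M\<^esub> x = (\<ominus>\<^bsub>R\<^esub> \<one>\<^bsub>R\<^esub>) \<odot>\<^bsub>M\<^esub> x" by (simp add: ls_lneg)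
  then show ?thesis using assms by (simp add: submod_smult)
qed

lemma submod_lmodule:
  assumes "lmodule R X" "submod R X H" shows "lmodule R (X\<lparr>carrier := H\<rparr>)"
proof -
  interpret X: lmodule R X by fact
  have H: "\<And>x. x \<in> H \<Longrightarrow> x \<in> carrier X" using assms(2) by (auto simp: submod_def)
  show ?thesis
  proof (rule lmodule_groupI, simp_all)
    show "ring R" by (rule X.R.ring_axioms)
    fix x assume x: "x \<in> H"
    show "\<exists>y\<in>H. y \<oplus>\<^bsub>X\<^esub> x = \<zero>\<^bsub>X\<^esub>"
      using X.submod_neg[OF assms(2) x] H[OF x] by (auto intro!: bexI[of _ "\<ominus>\<^bsub>X\<^esub> x"] simp: X.M.l_neg)
  qed (use assms(2) H in \<open>auto simp: submod_def X.lsmult_l_distr X.lsmult_r_distr X.lsmult_assoc X.M.a_assoc intro: X.M.a_comm\<close>)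
qed

lemma submod_carrier: "lmodule R X \<Longrightarrow> submod R X (carrier X)"
proof -
  assume "lmodule R X" then interpret X: lmodule R X .
  show ?thesis by (auto simp: submod_def)
qed

lemma submod_Int: "submod R X H \<Longrightarrow> submod R X H' \<Longrightarrow> submod R X (H \<inter> H')"
  by (auto simp: submod_def)

context
  fixes R :: "('r, 'e) ring_scheme" and X :: "('r, 'm, 'x) module_scheme" and Y :: "('r, 'n, 'y) module_scheme"
  assumes X: "lmodule R X" and Y: "lmodule R Y"
begin

interpretation X: lmodule R X by (rule X)
interpretation Y: lmodule R Y by (rule Y)

lemma lh_zero: "lh R X Y f \<Longrightarrow> f \<zero>\<^bsub>X\<^esub> = \<zero>\<^bsub>Y\<^esub>"
  using lh_smult[of R X Y f "\<zero>\<^bsub>R\<^esub>" "\<zero>\<^bsub>X\<^esub>"] lh_closed[of R X Y f "\<zero>\<^bsub>X\<^esub>"] by simp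

lemma lh_neg: assumes "lh R X Y f" "x \<in> carrier X" shows "f (\<ominus>\<^bsub>X\<^esub> x) = \<ominus>\<^bsub>Y\<^esub> f x"
proof -
  have "f (\<ominus>\<^bsub>X\<^esub> x) \<oplus>\<^bsub>Y\<^esub> f x = \<zero>\<^bsub>Y\<^esub>"
    using assms lh_add[OF assms(1), of "\<ominus>\<^bsub>X\<^esub> x" x] lh_zero[OF assms(1)] by (simp add: X.M.l_neg)
  then have "\<ominus>\<^bsub>Y\<^esub> f x = f (\<ominus>\<^bsub>X\<^esub> x)"
    by (rule Y.M.minus_equality) (use assms lh_closed[OF assms(1)] in auto)
  then show ?thesis by simp
qed

lemma lh_minus: "lh R X Y f \<Longrightarrow> x \<in> carrier X \<Longrightarrow> x' \<in> carrier X \<Longrightarrow> f (x \<ominus>\<^bsub>X\<^esub> x') = f x \<ominus>\<^bsub>Y\<^esub> f x'"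
  by (simp add: X.M.minus_eq Y.M.minus_eq lh_add lh_neg)

lemma lh_zero_map: "lh R X Y (\<lambda>_. \<zero>\<^bsub>Y\<^esub>)"
  by (auto simp: lh_def)

lemma lh_plus: assumes "lh R X Y f" "lh R X Y g" shows "lh R X Y (\<lambda>x. f x \<oplus>\<^bsub>Y\<^esub> g x)"
  using lh_closed[OF assms(1)] lh_closed[OF assms(2)]
  by (intro lhI) (simp_all add: lh_add[OF assms(1)] lh_add[OF assms(2)] lh_smult[OF assms(1)] lh_smult[OF assms(2)]
    Y.M.a_ac Y.lsmult_r_distr)

lemma lh_uminus: assumes "lh R X Y f" shows "lh R X Y (\<lambda>x. \<ominus>\<^bsub>Y\<^esub> f x)"
  using lh_closed[OF assms]
  by (intro lhI) (simp_all add: lh_add[OF assms] lh_smult[OF assms] Y.M.minus_add Y.ls_neg)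

lemma lh_diff: assumes "lh R X Y f" "lh R X Y g" shows "lh R X Y (\<lambda>x. f x \<ominus>\<^bsub>Y\<^esub> g x)"
  using lh_plus[OF assms(1) lh_uminus[OF assms(2)]] by (simp add: Y.M.minus_eq)

lemma lh_cong: assumes "lh R X Y f" "\<And>x. x \<in> carrier X \<Longrightarrow> g x = f x" shows "lh R X Y g"
  using assms(1) by (auto simp: lh_def assms(2))

lemma submod_kernel: assumes "lh R X Y f" shows "submod R X (a_kernel X Y f)"
  using assms by (auto simp: submod_def a_kernel_def' lh_zero lh_add lh_smult)

lemma submod_vimage: assumes "lh R X Y f" "submod R Y H" shows "submod R X {x\<in>carrier X. f x \<in> H}"
  using assms by (auto simp: submod_def lh_zero lh_add lh_smult)

lemma submod_image: assumes f: "lh R X Y f" and H: "submod R X H" shows "submod R Y (f ` H)"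
  unfolding submod_def
proof (intro conjI ballI)
  have H': "\<And>x. x \<in> H \<Longrightarrow> x \<in> carrier X" using H by (auto simp: submod_def)
  show "f ` H \<subseteq> carrier Y" using f H' by (auto simp: lh_closed)
  show "\<zero>\<^bsub>Y\<^esub> \<in> f ` H" using lh_zero[OF f] submod_zero[OF H] by (metis image_eqI)
  show "y \<oplus>\<^bsub>Y\<^esub> y' \<in> f ` H" if "y \<in> f ` H" "y' \<in> f ` H" for y y'
    using that by (auto simp: lh_add[OF f, symmetric] H' intro: submod_add[OF H])
  show "r \<odot>\<^bsub>Y\<^esub> y \<in> f ` H" if "r \<in> carrier R" "y \<in> f ` H" for r y
    using that by (auto simp: lh_smult[OF f, symmetric] H' intro: submod_smult[OF H])
qed

lemma lh_inj: assumes f: "lh R X Y f" and k: "\<And>x. x \<in> carrier X \<Longrightarrow> f x = \<zero>\<^bsub>Y\<^esub> \<Longrightarrow> x = \<zero>\<^bsub>X\<^esub>"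
  shows "inj_on f (carrier X)"
proof (rule inj_onI)
  fix x y assume a: "x \<in> carrier X" "y \<in> carrier X" "f x = f y"
  then have "f (x \<ominus>\<^bsub>X\<^esub> y) = \<zero>\<^bsub>Y\<^esub>" using lh_closed[OF f a(2)] by (simp add: lh_minus f Y.M.minus_eq Y.M.r_neg)
  then have "x \<ominus>\<^bsub>X\<^esub> y = \<zero>\<^bsub>X\<^esub>" using a k by simp
  then show "x = y" using a X.M.minus_eq_zero by blast
qed

lemma lh_inv:
  assumes f: "lh R X Y f" and b: "bij_betw f (carrier X) (carrier Y)"
  shows "lh R Y X (inv_into (carrier X) f)"
proof -
  let ?g = "inv_into (carrier X) f"
  have i: "inj_on f (carrier X)" and s: "f ` carrier X = carrier Y" using b by (auto simp: bij_betw_def)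
  have gc: "?g y \<in> carrier X" and fg: "f (?g y) = y" if "y \<in> carrier Y" for y
    using that s by (auto intro: inv_into_into f_inv_into_f)
  show ?thesis
  proof (rule lhI)
    show "?g (x \<oplus>\<^bsub>Y\<^esub> x') = ?g x \<oplus>\<^bsub>X\<^esub> ?g x'" if "x \<in> carrier Y" "x' \<in> carrier Y" for x x'
      by (rule inv_into_f_eq[OF i]) (use that in \<open>auto simp: gc fg lh_add[OF f]\<close>)
    show "?g (r \<odot>\<^bsub>Y\<^esub> x) = r \<odot>\<^bsub>X\<^esub> ?g x" if "r \<in> carrier R" "x \<in> carrier Y" for x r
      by (rule inv_into_f_eq[OF i]) (use that in \<open>auto simp: gc fg lh_smult[OF f]\<close>)
  qed (rule gc)
qed

end

lemma lh_comp: "lh R X Y f \<Longrightarrow> lh R Y Z g \<Longrightarrow> lh R X Z (\<lambda>x. g (f x))"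
  by (simp add: lh_def)

lemma lh_id: "lh R X X (\<lambda>x. x)"
  by (simp add: lh_def)

lemma lh_dom: "lh R X Y f \<Longrightarrow> H \<subseteq> carrier X \<Longrightarrow> lh R (X\<lparr>carrier := H\<rparr>) Y f"
  by (simp add: lh_def subset_iff)

lemma lh_cod: "lh R X Y f \<Longrightarrow> (\<And>x. x \<in> carrier X \<Longrightarrow> f x \<in> H) \<Longrightarrow> lh R X (Y\<lparr>carrier := H\<rparr>) f"
  by (auto simp: lh_def)

lemma lh_uncod: "lh R X (Y\<lparr>carrier := H\<rparr>) f \<Longrightarrow> H \<subseteq> carrier Y \<Longrightarrow> lh R X Y f"
  by (simp add: lh_def subset_iff)

lemma lisomorphicI:
  assumes "lmodule R X" "lh R X Y f" "bij_betw f (carrier X) (carrier Y)"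
  shows "lisomorphic R X Y"
proof -
  interpret X: lmodule R X by fact
  have "restrict f (carrier X) \<in> lisos R X Y"
    using assms(2,3) by (auto simp: lisos_def lhom_iff lh_def bij_betw_def inj_on_def image_def)
  then show ?thesis by (auto simp: lisomorphic_def)
qed

lemma lisomorphicE:
  assumes "lisomorphic R X Y"
  obtains f where "lh R X Y f" "bij_betw f (carrier X) (carrier Y)"
  using assms by (auto simp: lisomorphic_def lisos_def lhom_iff)

lemma lisomorphicE2:
  assumes "lisomorphic R X Y" "lmodule R X" "lmodule R Y"
  obtains f g where "lh R X Y f" "lh R Y X g" "\<And>x. x \<in> carrier X \<Longrightarrow> g (f x) = x" "\<And>y. y \<in> carrier Y \<Longrightarrow> f (g y) = y"
proof -
  obtain f where f: "lh R X Y f" "bij_betw f (carrier X) (carrier Y)" using assms(1) by (rule lisomorphicE)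
  show thesis
    by (rule that[OF f(1) lh_inv[OF assms(2,3) f]])
      (use f(2) in \<open>auto simp: bij_betw_def inv_into_f_f f_inv_into_f\<close>)
qed

lemma bij_betw_inverseI:
  assumes "\<And>x. x \<in> A \<Longrightarrow> f x \<in> B" "\<And>y. y \<in> B \<Longrightarrow> g y \<in> A" "\<And>x. x \<in> A \<Longrightarrow> g (f x) = x" "\<And>y. y \<in> B \<Longrightarrow> f (g y) = y"
  shows "bij_betw f A B"
  by (rule bij_betw_byWitness[where f' = g]) (use assms in auto)

text \<open>The homomorphism theorem without a quotient construction: g is f after an arbitrary
  choice of preimages under q. The choice does not matter, since two preimages differ by an element
  of the kernel of q, on which f vanishes; linearity follows from the same remark.\<close>

lemma lh_factor:
  assumes X: "lmodule R X" and Y: "lmodule R Y" and N: "lmodule R N"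
    and q: "lh R X N q" "q ` carrier X = carrier N" and f: "lh R X Y f"
    and k: "\<And>x. x \<in> carrier X \<Longrightarrow> q x = \<zero>\<^bsub>N\<^esub> \<Longrightarrow> f x = \<zero>\<^bsub>Y\<^esub>"
  obtains g where "lh R N Y g" "\<And>x. x \<in> carrier X \<Longrightarrow> g (q x) = f x"
proof -
  interpret X: lmodule R X by fact
  interpret Y: lmodule R Y by fact
  interpret N: lmodule R N by fact
  have wd: "f x = f y" if "x \<in> carrier X" "y \<in> carrier X" "q x = q y" for x y
  proof -
    have "q (x \<ominus>\<^bsub>X\<^esub> y) = \<zero>\<^bsub>N\<^esub>" using that lh_closed[OF q(1)] by (simp add: lh_minus[OF X N q(1)] N.M.minus_eq N.M.r_neg)
    then have "f x \<ominus>\<^bsub>Y\<^esub> f y = \<zero>\<^bsub>Y\<^esub>" using that k[of "x \<ominus>\<^bsub>X\<^esub> y"] by (simp add: lh_minus[OF X Y f])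
    then show ?thesis using that lh_closed[OF f] Y.M.minus_eq_zero by blast
  qed
  let ?i = "inv_into (carrier X) q"
  have ic: "?i y \<in> carrier X" and qi: "q (?i y) = y" if "y \<in> carrier N" for y
    using that q(2) by (auto intro: inv_into_into f_inv_into_f)
  have g: "f (?i (q x)) = f x" if "x \<in> carrier X" for x
    using that by (intro wd) (auto simp: ic qi lh_closed[OF q(1)])
  have "lh R N Y (\<lambda>y. f (?i y))"
  proof (rule lhI)
    fix x x' assume x: "x \<in> carrier N" "x' \<in> carrier N"
    have "f (?i (x \<oplus>\<^bsub>N\<^esub> x')) = f (?i x \<oplus>\<^bsub>X\<^esub> ?i x')"
      by (rule wd) (use x in \<open>auto simp: ic qi lh_add[OF q(1)]\<close>)
    then show "f (?i (x \<oplus>\<^bsub>N\<^esub> x')) = f (?i x) \<oplus>\<^bsub>Y\<^esub> f (?i x')" using x by (simp add: ic lh_add[OF f])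
  next
    fix r x assume x: "r \<in> carrier R" "x \<in> carrier N"
    have "f (?i (r \<odot>\<^bsub>N\<^esub> x)) = f (r \<odot>\<^bsub>X\<^esub> ?i x)"
      by (rule wd) (use x in \<open>auto simp: ic qi lh_smult[OF q(1)]\<close>)
    then show "f (?i (r \<odot>\<^bsub>N\<^esub> x)) = r \<odot>\<^bsub>Y\<^esub> f (?i x)" using x by (simp add: ic lh_smult[OF f])
  qed (auto simp: ic lh_closed[OF f])
  then show thesis using that g by blast
qed

lemma lmodule_cong:
  assumes "lmodule R X" "carrier Y = carrier X" "\<zero>\<^bsub>Y\<^esub> = \<zero>\<^bsub>X\<^esub>"
    "\<And>x y. x \<in> carrier X \<Longrightarrow> y \<in> carrier X \<Longrightarrow> x \<oplus>\<^bsub>Y\<^esub> y = x \<oplus>\<^bsub>X\<^esub> y"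
    "\<And>r x. r \<in> carrier R \<Longrightarrow> x \<in> carrier X \<Longrightarrow> r \<odot>\<^bsub>Y\<^esub> x = r \<odot>\<^bsub>X\<^esub> x"
  shows "lmodule R Y"
proof -
  interpret X: lmodule R X by fact
  show ?thesis
  proof (rule lmodule_groupI)
    fix x assume x: "x \<in> carrier Y"
    show "\<exists>y\<in>carrier Y. y \<oplus>\<^bsub>Y\<^esub> x = \<zero>\<^bsub>Y\<^esub>"
      by (rule bexI[of _ "\<ominus>\<^bsub>X\<^esub> x"]) (use x in \<open>auto simp: assms(2-) X.M.l_neg\<close>)
  qed (auto simp: assms(2-) X.R.ring_axioms X.lsmult_l_distr X.lsmult_r_distr X.lsmult_assoc X.M.a_assoc intro: X.M.a_comm)
qed

section \<open>Regular modules, free modules and direct sums\<close>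

lemma reg_simps [simp]: "carrier (reg_module R) = carrier R" "\<zero>\<^bsub>reg_module R\<^esub> = \<zero>\<^bsub>R\<^esub>"
  "x \<oplus>\<^bsub>reg_module R\<^esub> y = x \<oplus>\<^bsub>R\<^esub> y" "r \<odot>\<^bsub>reg_module R\<^esub> x = r \<otimes>\<^bsub>R\<^esub> x"
  by (auto simp: reg_module_def)

lemma reg_lmodule: assumes "ring R" shows "lmodule R (reg_module R)"
proof -
  interpret R: ring R by fact
  show ?thesis
  proof (rule lmodule_groupI)
    fix x assume x: "x \<in> carrier (reg_module R)"
    show "\<exists>y\<in>carrier (reg_module R). y \<oplus>\<^bsub>reg_module R\<^esub> x = \<zero>\<^bsub>reg_module R\<^esub>"
      by (rule bexI[of _ "\<ominus>\<^bsub>R\<^esub> x"]) (use x in \<open>auto simp: R.l_neg\<close>)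
  qed (auto simp: assms R.a_assoc R.m_assoc R.l_distr R.r_distr intro: R.a_comm)
qed

lemma free_simps [simp]: "carrier (free_module R n) = {..<n} \<rightarrow>\<^sub>E carrier R"
  "\<zero>\<^bsub>free_module R n\<^esub> = (\<lambda>i\<in>{..<n}. \<zero>\<^bsub>R\<^esub>)"
  "x \<oplus>\<^bsub>free_module R n\<^esub> y = (\<lambda>i\<in>{..<n}. x i \<oplus>\<^bsub>R\<^esub> y i)"
  "r \<odot>\<^bsub>free_module R n\<^esub> x = (\<lambda>i\<in>{..<n}. r \<otimes>\<^bsub>R\<^esub> x i)"
  by (auto simp: free_module_def)

lemma free_lmodule: assumes "ring R" shows "lmodule R (free_module R n)"
proof -
  interpret R: ring R by fact
  show ?thesis
  proof (rule lmodule_groupI)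
    fix x assume x: "x \<in> carrier (free_module R n)"
    show "\<exists>y\<in>carrier (free_module R n). y \<oplus>\<^bsub>free_module R n\<^esub> x = \<zero>\<^bsub>free_module R n\<^esub>"
      by (rule bexI[of _ "\<lambda>i\<in>{..<n}. \<ominus>\<^bsub>R\<^esub> x i"]) (use x in \<open>auto simp: fun_eq_iff PiE_iff R.l_neg\<close>)
  qed (auto simp: assms fun_eq_iff PiE_iff R.a_assoc R.m_assoc R.l_distr R.r_distr extensional_def intro: R.a_comm)
qed

lemma direct_sum_simps [simp]: "carrier (direct_sum X Y) = carrier X \<times> carrier Y"
  "\<zero>\<^bsub>direct_sum X Y\<^esub> = (\<zero>\<^bsub>X\<^esub>, \<zero>\<^bsub>Y\<^esub>)"
  "(x, y) \<oplus>\<^bsub>direct_sum X Y\<^esub> (x', y') = (x \<oplus>\<^bsub>X\<^esub> x', y \<oplus>\<^bsub>Y\<^esub> y')"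
  "r \<odot>\<^bsub>direct_sum X Y\<^esub> (x, y) = (r \<odot>\<^bsub>X\<^esub> x, r \<odot>\<^bsub>Y\<^esub> y)"
  by (auto simp: direct_sum_def)

lemma direct_sum_lmodule: assumes "lmodule R X" "lmodule R Y" shows "lmodule R (direct_sum X Y)"
proof -
  interpret X: lmodule R X by fact
  interpret Y: lmodule R Y by fact
  show ?thesis
  proof (rule lmodule_groupI)
    fix x assume x: "x \<in> carrier (direct_sum X Y)"
    show "\<exists>y\<in>carrier (direct_sum X Y). y \<oplus>\<^bsub>direct_sum X Y\<^esub> x = \<zero>\<^bsub>direct_sum X Y\<^esub>"
      by (rule bexI[of _ "(\<ominus>\<^bsub>X\<^esub> fst x, \<ominus>\<^bsub>Y\<^esub> snd x)"]) (use x in \<open>auto simp: X.M.l_neg Y.M.l_neg\<close>)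
  qed (auto simp: X.R.ring_axioms X.lsmult_l_distr X.lsmult_r_distr X.lsmult_assoc X.M.a_assoc
      Y.lsmult_l_distr Y.lsmult_r_distr Y.lsmult_assoc Y.M.a_assoc intro: X.M.a_comm Y.M.a_comm)
qed

section \<open>Finitely generated projective modules\<close>

text \<open>A sum over indices by recursion unfolds without side conditions and mentions only
  addition and zero, so it is unchanged when a module is cut down to a submodule
  (\<open>lsum_carrier\<close>) or restricted along a ring map (\<open>lsum_res\<close>).\<close>

primrec lsum :: "('m, 'x) ring_scheme \<Rightarrow> (nat \<Rightarrow> 'm) \<Rightarrow> nat \<Rightarrow> 'm" where
  "lsum X g 0 = \<zero>\<^bsub>X\<^esub>"
| "lsum X g (Suc n) = lsum X g n \<oplus>\<^bsub>X\<^esub> g n"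

lemma lsum_cong: "(\<And>i. i < n \<Longrightarrow> g i = h i) \<Longrightarrow> lsum X g n = lsum X h n"
  by (induction n) auto

lemma lsum_carrier: "lsum (X\<lparr>carrier := H\<rparr>) g n = lsum X g n"
  by (induction n) auto

lemma (in abelian_group) lsum_closed: "(\<And>i. i < n \<Longrightarrow> g i \<in> carrier G) \<Longrightarrow> lsum G g n \<in> carrier G"
  by (induction n) auto

lemma (in abelian_group) lsum_zero: "(\<And>i. i < n \<Longrightarrow> g i = \<zero>) \<Longrightarrow> lsum G g n = \<zero>"
  by (induction n) auto

lemma (in abelian_group) lsum_add:
  "(\<And>i. i < n \<Longrightarrow> g i \<in> carrier G) \<Longrightarrow> (\<And>i. i < n \<Longrightarrow> h i \<in> carrier G) \<Longrightarrow>
   lsum G (\<lambda>i. g i \<oplus> h i) n = lsum G g n \<oplus> lsum G h n"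
  by (induction n) (auto simp: lsum_closed a_ac)

lemma (in abelian_group) lsum_delta:
  "a \<in> carrier G \<Longrightarrow> lsum G (\<lambda>i. if i = j then a else \<zero>) n = (if j < n then a else \<zero>)"
proof (induction n)
  case (Suc n) then show ?case by (cases "j = n") auto
qed simp

lemma submod_lsum: "submod R X H \<Longrightarrow> (\<And>i. i < n \<Longrightarrow> g i \<in> H) \<Longrightarrow> lsum X g n \<in> H"
  by (induction n) (auto simp: submod_def)

lemma (in lmodule) smult_lsum:
  "r \<in> carrier R \<Longrightarrow> (\<And>i. i < n \<Longrightarrow> g i \<in> carrier M) \<Longrightarrow>
   r \<odot>\<^bsub>M\<^esub> lsum M g n = lsum M (\<lambda>i. r \<odot>\<^bsub>M\<^esub> g i) n"
  by (induction n) (auto simp: M.lsum_closed lsmult_r_distr)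

lemma lh_lsum:
  assumes X: "lmodule R X" and Y: "lmodule R Y" and f: "lh R X Y f" and g: "\<And>i. i < n \<Longrightarrow> g i \<in> carrier X"
  shows "f (lsum X g n) = lsum Y (\<lambda>i. f (g i)) n"
  using g
proof (induction n)
  case 0 then show ?case by (simp add: lh_zero[OF X Y f])
next
  case (Suc n)
  interpret X: lmodule R X by fact
  show ?case using Suc by (simp add: lh_add[OF f] X.M.lsum_closed)
qed

lemma lsum_lh:
  assumes X: "lmodule R X" and Y: "lmodule R Y" and "\<And>i. i < n \<Longrightarrow> lh R X Y (g i)"
  shows "lh R X Y (\<lambda>x. lsum Y (\<lambda>i. g i x) n)"
  using assms(3) by (induction n) (auto intro!: lh_zero_map[OF X Y] lh_plus[OF X Y])

lemma lh_scale:
  assumes Y: "lmodule R Y" and l: "lh R X (reg_module R) l" and p: "p \<in> carrier Y"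
  shows "lh R X Y (\<lambda>x. l x \<odot>\<^bsub>Y\<^esub> p)"
proof -
  interpret Y: lmodule R Y by fact
  have "\<And>x. x \<in> carrier X \<Longrightarrow> l x \<in> carrier R" using lh_closed[OF l] by simp
  then show ?thesis
    by (intro lhI) (use p in \<open>simp_all add: lh_add[OF l] lh_smult[OF l] Y.lsmult_l_distr Y.lsmult_assoc\<close>)
qed

text \<open>By the dual basis lemma the existence of such forms and elements characterises finitely
  generated projective modules. Unlike the complement in \<open>add_modules\<close> it refers to no
  auxiliary module or type.\<close>

definition dbasis where
  "dbasis R P n l p \<longleftrightarrow> (\<forall>i<n. lh R P (reg_module R) (l i) \<and> p i \<in> carrier P) \<and>
     (\<forall>x\<in>carrier P. x = lsum P (\<lambda>i. l i x \<odot>\<^bsub>P\<^esub> p i) n)"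

definition fgproj :: "('r, 'e) ring_scheme \<Rightarrow> ('r, 'm, 'x) module_scheme \<Rightarrow> bool" where
  "fgproj R P \<longleftrightarrow> lmodule R P \<and> (\<exists>n l p. dbasis R P n l p)"

lemma fgproj_lmodule: "fgproj R P \<Longrightarrow> lmodule R P"
  by (simp add: fgproj_def)

lemma combination_lh:
  assumes X: "lmodule R X" and p: "\<And>i. i < n \<Longrightarrow> p i \<in> carrier X"
  shows "lh R (free_module R n) X (\<lambda>x. lsum X (\<lambda>i. x i \<odot>\<^bsub>X\<^esub> p i) n)"
proof (rule lsum_lh[OF free_lmodule[OF lmodule_ring[OF X]] X])
  interpret X: lmodule R X by fact
  fix i assume "i < n"
  then have "lh R (free_module R n) (reg_module R) (\<lambda>x. x i)" by (intro lhI) auto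
  then show "lh R (free_module R n) X (\<lambda>x. x i \<odot>\<^bsub>X\<^esub> p i)" by (rule lh_scale[OF X _ p[OF \<open>i < n\<close>]])
qed

definition unit_vec :: "('r, 'e) ring_scheme \<Rightarrow> nat \<Rightarrow> nat \<Rightarrow> nat \<Rightarrow> 'r" where
  "unit_vec R n i = (\<lambda>j\<in>{..<n}. if j = i then \<one>\<^bsub>R\<^esub> else \<zero>\<^bsub>R\<^esub>)"

lemma unit_vec_closed: "ring R \<Longrightarrow> unit_vec R n i \<in> carrier (free_module R n)"
  by (auto simp: unit_vec_def ring.ring_simprules)

lemma free_expand:
  assumes "ring R" "x \<in> carrier (free_module R n)"
  shows "x = lsum (free_module R n) (\<lambda>i. x i \<odot>\<^bsub>free_module R n\<^esub> unit_vec R n i) n" (is "x = ?s")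
proof -
  interpret R: ring R by fact
  let ?F = "free_module R n"
  interpret F: lmodule R ?F by (rule free_lmodule) fact
  have xc: "x i \<in> carrier R" if "i < n" for i using assms(2) that by (auto simp: PiE_iff)
  have c: "x i \<odot>\<^bsub>?F\<^esub> unit_vec R n i \<in> carrier ?F" if "i < n" for i
    using that xc unit_vec_closed[OF assms(1)] by (intro F.lsmult_closed) auto
  have sc: "?s \<in> carrier ?F" by (rule F.M.lsum_closed) (use c in auto)
  have "x j = ?s j" if j: "j < n" for j
  proof -
    have l: "lh R ?F (reg_module R) (\<lambda>x. x j)" using j by (intro lhI) auto
    have "?s j = lsum (reg_module R) (\<lambda>i. (x i \<odot>\<^bsub>?F\<^esub> unit_vec R n i) j) n"
      by (rule lh_lsum[OF F.lmodule_axioms reg_lmodule[OF assms(1)] l c])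
    also have "\<dots> = lsum (reg_module R) (\<lambda>i. if i = j then x j else \<zero>\<^bsub>reg_module R\<^esub>) n"
      by (rule lsum_cong) (use j xc in \<open>auto simp: unit_vec_def\<close>)
    also have "\<dots> = x j"
      using abelian_group.lsum_delta[OF lmodule_group[OF reg_lmodule[OF assms(1)]], of "x j" j n] j xc by simp
    finally show ?thesis by simp
  qed
  moreover have "x j = ?s j" if "\<not> j < n" for j
    using assms(2) sc that PiE_arb[of x "{..<n}" "\<lambda>_. carrier R" j] PiE_arb[of ?s "{..<n}" "\<lambda>_. carrier R" j] by simp
  ultimately show ?thesis by blast
qed

lemma free_fgproj: assumes "ring R" shows "fgproj R (free_module R n)"
proof -
  have "dbasis R (free_module R n) n (\<lambda>i x. x i) (unit_vec R n)"
    unfolding dbasis_def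
  proof (intro conjI allI impI ballI)
    show "x = lsum (free_module R n) (\<lambda>i. x i \<odot>\<^bsub>free_module R n\<^esub> unit_vec R n i) n"
      if "x \<in> carrier (free_module R n)" for x
      using free_expand[OF assms that] .
  qed (use unit_vec_closed[OF assms] in \<open>auto intro!: lhI\<close>)
  then show ?thesis using free_lmodule[OF assms] unfolding fgproj_def by blast
qed

lemma combination_unit_vec:
  assumes X: "lmodule R X" and p: "\<And>i. i < n \<Longrightarrow> p i \<in> carrier X" and j: "j < n"
  shows "lsum X (\<lambda>i. unit_vec R n j i \<odot>\<^bsub>X\<^esub> p i) n = p j"
proof -
  interpret X: lmodule R X by fact
  have "lsum X (\<lambda>i. unit_vec R n j i \<odot>\<^bsub>X\<^esub> p i) n = lsum X (\<lambda>i. if i = j then p j else \<zero>\<^bsub>X\<^esub>) n"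
    by (rule lsum_cong) (use p in \<open>auto simp: unit_vec_def\<close>)
  then show ?thesis using X.M.lsum_delta[of "p j" j n] p j by simp
qed

text \<open>A dual basis of P is pulled back along a and pushed forward along b.\<close>

lemma fgproj_retract:
  assumes P: "fgproj R P" and X: "lmodule R X" and a: "lh R X P a" and b: "lh R P X b"
    and ba: "\<And>x. x \<in> carrier X \<Longrightarrow> b (a x) = x"
  shows "fgproj R X"
proof -
  obtain n l p where d: "dbasis R P n l p" using P by (auto simp: fgproj_def)
  note PM = fgproj_lmodule[OF P]
  interpret P: lmodule R P by (rule PM)
  have lc: "l i x \<in> carrier R" if "i < n" "x \<in> carrier P" for i x
    using d that lh_closed[of R P "reg_module R" "l i" x] by (auto simp: dbasis_def)
  have "x = lsum X (\<lambda>i. l i (a x) \<odot>\<^bsub>X\<^esub> b (p i)) n" if x: "x \<in> carrier X" for x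
  proof -
    have ax: "a x \<in> carrier P" using lh_closed[OF a x] .
    have "x = b (a x)" using ba x by simp
    also have "a x = lsum P (\<lambda>i. l i (a x) \<odot>\<^bsub>P\<^esub> p i) n" using d ax by (simp add: dbasis_def)
    also have "b \<dots> = lsum X (\<lambda>i. b (l i (a x) \<odot>\<^bsub>P\<^esub> p i)) n"
      by (rule lh_lsum[OF PM X b]) (use d lc ax in \<open>auto simp: dbasis_def\<close>)
    also have "\<dots> = lsum X (\<lambda>i. l i (a x) \<odot>\<^bsub>X\<^esub> b (p i)) n"
      by (rule lsum_cong) (use d lc ax in \<open>auto simp: dbasis_def lh_smult[OF b]\<close>)
    finally show ?thesis .
  qed
  moreover have "lh R X (reg_module R) (\<lambda>x. l i (a x))" if "i < n" for i
    using lh_comp[OF a, of "reg_module R" "l i"] d that by (auto simp: dbasis_def)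
  ultimately have "dbasis R X n (\<lambda>i x. l i (a x)) (\<lambda>i. b (p i))"
    using d by (auto simp: dbasis_def lh_closed[OF b])
  then show ?thesis using X unfolding fgproj_def by blast
qed

text \<open>The images of the finitely many p_i are lifted arbitrarily, and the forms l_i spread
  this choice linearly over P.\<close>

lemma fgproj_lift:
  assumes P: "fgproj R P" and N': "lmodule R N'" and N: "lmodule R N"
    and q: "lh R N' N q" and g: "lh R P N g" and s: "\<And>x. x \<in> carrier P \<Longrightarrow> g x \<in> q ` carrier N'"
  obtains h where "lh R P N' h" "\<And>x. x \<in> carrier P \<Longrightarrow> q (h x) = g x"
proof -
  obtain n l p where d: "dbasis R P n l p" using P by (auto simp: fgproj_def)
  interpret P: lmodule R P by (rule fgproj_lmodule[OF P])
  interpret N': lmodule R N' by fact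
  have lc: "l i x \<in> carrier R" if "i < n" "x \<in> carrier P" for i x
    using d that lh_closed[of R P "reg_module R" "l i" x] by (auto simp: dbasis_def)
  have "\<exists>m. \<forall>i<n. m i \<in> carrier N' \<and> q (m i) = g (p i)"
  proof -
    have "\<forall>i. \<exists>m. i < n \<longrightarrow> m \<in> carrier N' \<and> q m = g (p i)"
      using s d unfolding dbasis_def image_iff by metis
    then show ?thesis by metis
  qed
  then obtain m where m: "\<And>i. i < n \<Longrightarrow> m i \<in> carrier N'" "\<And>i. i < n \<Longrightarrow> q (m i) = g (p i)" by blast
  let ?h = "\<lambda>x. lsum N' (\<lambda>i. l i x \<odot>\<^bsub>N'\<^esub> m i) n"
  have "lh R P N' ?h"
    by (rule lsum_lh[OF P.lmodule_axioms N'], rule lh_scale[OF N']) (use d m in \<open>auto simp: dbasis_def\<close>)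
  moreover have "q (?h x) = g x" if x: "x \<in> carrier P" for x
  proof -
    have "q (?h x) = lsum N (\<lambda>i. q (l i x \<odot>\<^bsub>N'\<^esub> m i)) n"
      by (rule lh_lsum[OF N' N q]) (use x lc m in auto)
    also have "\<dots> = lsum N (\<lambda>i. g (l i x \<odot>\<^bsub>P\<^esub> p i)) n"
      by (rule lsum_cong) (use x lc m d in \<open>auto simp: lh_smult[OF q] lh_smult[OF g] dbasis_def\<close>)
    also have "\<dots> = g (lsum P (\<lambda>i. l i x \<odot>\<^bsub>P\<^esub> p i) n)"
      by (rule lh_lsum[OF P.lmodule_axioms N g, symmetric]) (use x lc d in \<open>auto simp: dbasis_def\<close>)
    finally show ?thesis using d x by (simp add: dbasis_def)
  qed
  ultimately show thesis using that by blast
qed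

text \<open>Forward, the free module passes its dual basis on to a retract. Backward, a dual basis
  amounts to a surjection q from a free module onto X together with a section s, and the kernel of q
  is a complement living on the type that \<open>add_modules\<close> demands.\<close>

lemma add_modules_iff:
  fixes R :: "('a, 'e) ring_scheme" and X :: "('a, 'm, 'x) module_scheme"
  shows "X \<in> add_modules R \<longleftrightarrow> fgproj R X"
proof
  assume "X \<in> add_modules R"
  then obtain n and Y :: "('a, nat \<Rightarrow> 'a) module" where X: "lmodule R X" and Y: "lmodule R Y"
    and iso: "lisomorphic R (direct_sum X Y) (free_module R n)" by (auto simp: add_modules_def)
  note S = direct_sum_lmodule[OF X Y]
  interpret X: lmodule R X by fact
  interpret Y: lmodule R Y by fact
  obtain h g where h: "lh R (direct_sum X Y) (free_module R n) h" and g: "lh R (free_module R n) (direct_sum X Y) g"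
    and gh: "\<And>x. x \<in> carrier (direct_sum X Y) \<Longrightarrow> g (h x) = x"
    by (rule lisomorphicE2[OF iso S free_lmodule[OF X.R.ring_axioms]]) auto
  have i: "lh R X (direct_sum X Y) (\<lambda>x. (x, \<zero>\<^bsub>Y\<^esub>))" by (rule lhI) auto
  have p: "lh R (direct_sum X Y) X fst" by (rule lhI) auto
  show "fgproj R X"
    by (rule fgproj_retract[OF free_fgproj X lh_comp[OF i h] lh_comp[OF g p]])
      (use gh in \<open>auto simp: X.R.ring_axioms\<close>)
next
  assume P: "fgproj R X"
  then obtain n l p where d: "dbasis R X n l p" by (auto simp: fgproj_def)
  note X = fgproj_lmodule[OF P]
  interpret X: lmodule R X by fact
  let ?F = "free_module R n"
  have F: "lmodule R ?F" by (rule free_lmodule[OF X.R.ring_axioms])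
  interpret F: lmodule R ?F by fact
  define q where "q = (\<lambda>x. lsum X (\<lambda>i. x i \<odot>\<^bsub>X\<^esub> p i) n)"
  define s where "s = (\<lambda>x. \<lambda>i\<in>{..<n}. l i x)"
  have q: "lh R ?F X q" unfolding q_def by (rule combination_lh[OF X]) (use d in \<open>auto simp: dbasis_def\<close>)
  have l: "lh R X (reg_module R) (l i)" if "i < n" for i using d that by (auto simp: dbasis_def)
  have s: "lh R X ?F s"
    by (rule lhI) (use lh_closed[OF l] lh_add[OF l] lh_smult[OF l] in \<open>auto simp: s_def\<close>)
  have qs: "q (s x) = x" if "x \<in> carrier X" for x
  proof -
    have "q (s x) = lsum X (\<lambda>i. l i x \<odot>\<^bsub>X\<^esub> p i) n" unfolding q_def s_def by (rule lsum_cong) auto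
    then show ?thesis using d that by (simp add: dbasis_def)
  qed
  let ?K = "a_kernel ?F X q"
  let ?Y = "?F\<lparr>carrier := ?K\<rparr>"
  have K: "submod R ?F ?K" by (rule submod_kernel[OF F X q])
  have Y: "lmodule R ?Y" by (rule submod_lmodule[OF F K])
  note S = direct_sum_lmodule[OF X Y]
  have Kc: "y \<in> carrier ?F" "q y = \<zero>\<^bsub>X\<^esub>" if "y \<in> ?K" for y using that by (auto simp: a_kernel_def')
  let ?h = "\<lambda>(x, y). s x \<oplus>\<^bsub>?F\<^esub> y"
  have h: "lh R (direct_sum X ?Y) ?F ?h"
  proof (rule lhI)
    fix u assume "u \<in> carrier (direct_sum X ?Y)" then show "?h u \<in> carrier ?F"
      by (auto simp: lh_closed[OF s] Kc simp del: free_simps)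
  next
    fix u v assume "u \<in> carrier (direct_sum X ?Y)" "v \<in> carrier (direct_sum X ?Y)"
    then show "?h (u \<oplus>\<^bsub>direct_sum X ?Y\<^esub> v) = ?h u \<oplus>\<^bsub>?F\<^esub> ?h v"
      by (cases u; cases v) (simp add: lh_add[OF s] lh_closed[OF s] Kc F.M.a_ac del: free_simps)
  next
    fix r u assume "r \<in> carrier R" "u \<in> carrier (direct_sum X ?Y)"
    then show "?h (r \<odot>\<^bsub>direct_sum X ?Y\<^esub> u) = r \<odot>\<^bsub>?F\<^esub> ?h u"
      by (cases u) (simp add: lh_smult[OF s] lh_closed[OF s] Kc F.lsmult_r_distr del: free_simps)
  qed
  \<comment> \<open>The inverse of \<open>?h\<close>: q reads off the X-component, and z - s (q z)
    lies in the kernel because q s = 1.\<close>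
  let ?g = "\<lambda>z. (q z, z \<ominus>\<^bsub>?F\<^esub> s (q z))"
  have "bij_betw ?h (carrier (direct_sum X ?Y)) (carrier ?F)"
  proof (rule bij_betw_inverseI[where g = ?g])
    fix u assume u: "u \<in> carrier (direct_sum X ?Y)"
    then show "?h u \<in> carrier ?F" by (rule lh_closed[OF h])
    obtain x y where xy: "u = (x, y)" "x \<in> carrier X" "y \<in> ?K" using u by auto
    have "q (s x \<oplus>\<^bsub>?F\<^esub> y) = x"
      using xy lh_add[OF q lh_closed[OF s xy(2)] Kc(1)[OF xy(3)]] by (simp add: Kc(2) qs del: free_simps)
    then show "?g (?h u) = u" using xy lh_closed[OF s xy(2)]
      by (simp add: F.M.minus_eq F.M.a_ac Kc F.M.r_neg1 F.M.r_neg2 F.M.r_neg del: free_simps)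
  next
    fix z assume z: "z \<in> carrier ?F"
    have qz: "q z \<in> carrier X" using lh_closed[OF q z] .
    have sz: "s (q z) \<in> carrier ?F" using lh_closed[OF s qz] .
    have "q (z \<ominus>\<^bsub>?F\<^esub> s (q z)) = \<zero>\<^bsub>X\<^esub>"
      using lh_minus[OF F X q z sz] qs[OF qz] qz by (simp add: X.M.minus_eq X.M.r_neg del: free_simps)
    then show "?g z \<in> carrier (direct_sum X ?Y)" using qz F.M.minus_closed[OF z sz]
      by (simp add: a_kernel_def' del: free_simps)
    show "?h (?g z) = z" using z sz
      by (simp add: F.M.minus_eq F.M.a_ac F.M.r_neg1 F.M.r_neg2 F.M.r_neg del: free_simps)
  qed
  then have "lisomorphic R (direct_sum X ?Y) ?F" by (rule lisomorphicI[OF S h])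
  then show "X \<in> add_modules R" using X Y by (auto simp: add_modules_def)
qed

section \<open>Finitely generated modules\<close>

text \<open>The linear combinations of S form the least submodule containing S, so generation can be
  phrased by minimality. Through \<open>fgE\<close> and \<open>fgI\<close>, sums over generating
  sets need not be handled again.\<close>

lemma fg_iff:
  assumes X: "lmodule R X"
  shows "fg_module R X \<longleftrightarrow> (\<exists>S. finite S \<and> S \<subseteq> carrier X \<and> (\<forall>H. submod R X H \<and> S \<subseteq> H \<longrightarrow> carrier X \<subseteq> H))"
proof -
  interpret X: lmodule R X by fact
  show ?thesis
  proof
    assume "fg_module R X"
    then obtain S where S: "finite S" "S \<subseteq> carrier X"
      and e: "\<And>x. x \<in> carrier X \<Longrightarrow> \<exists>c \<in> S \<rightarrow>\<^sub>E carrier R. x = (\<Oplus>\<^bsub>X\<^esub>s\<in>S. c s \<odot>\<^bsub>X\<^esub> s)"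
      unfolding fg_module_def by blast
    have "carrier X \<subseteq> H" if H: "submod R X H" "S \<subseteq> H" for H
    proof
      fix x assume "x \<in> carrier X"
      then obtain c where c: "c \<in> S \<rightarrow>\<^sub>E carrier R" and x: "x = (\<Oplus>\<^bsub>X\<^esub>s\<in>S. c s \<odot>\<^bsub>X\<^esub> s)" using e by blast
      have "(\<Oplus>\<^bsub>X\<^esub>s\<in>T. c s \<odot>\<^bsub>X\<^esub> s) \<in> H" if "T \<subseteq> S" for T
        using finite_subset[OF that S(1)] that
      proof (induction T)
        case empty then show ?case using H(1) by (simp add: submod_zero)
      next
        case (insert s T)
        have "(\<Oplus>\<^bsub>X\<^esub>s\<in>insert s T. c s \<odot>\<^bsub>X\<^esub> s) = c s \<odot>\<^bsub>X\<^esub> s \<oplus>\<^bsub>X\<^esub> (\<Oplus>\<^bsub>X\<^esub>s\<in>T. c s \<odot>\<^bsub>X\<^esub> s)"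
          using insert.prems c S(2) by (intro X.M.finsum_insert insert.hyps) (auto simp: PiE_iff subset_iff)
        then show ?case using insert H c by (auto intro!: submod_add[OF H(1)] submod_smult[OF H(1)] simp: PiE_iff)
      qed
      then show "x \<in> H" using x by auto
    qed
    then show "\<exists>S. finite S \<and> S \<subseteq> carrier X \<and> (\<forall>H. submod R X H \<and> S \<subseteq> H \<longrightarrow> carrier X \<subseteq> H)"
      using S by blast
  next
    assume "\<exists>S. finite S \<and> S \<subseteq> carrier X \<and> (\<forall>H. submod R X H \<and> S \<subseteq> H \<longrightarrow> carrier X \<subseteq> H)"
    then obtain S where S: "finite S" "S \<subseteq> carrier X"
      and e': "\<forall>H. submod R X H \<and> S \<subseteq> H \<longrightarrow> carrier X \<subseteq> H" by auto
    from e' have e: "carrier X \<subseteq> H" if "submod R X H" "S \<subseteq> H" for H using that by simp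
    let ?f = "\<lambda>c. (\<Oplus>\<^bsub>X\<^esub>s\<in>S. c s \<odot>\<^bsub>X\<^esub> s)"
    let ?H = "?f ` (S \<rightarrow>\<^sub>E carrier R)"
    have cl: "(\<lambda>s. c s \<odot>\<^bsub>X\<^esub> s) \<in> S \<rightarrow> carrier X" if "c \<in> S \<rightarrow> carrier R" for c
      using that S(2) by (auto simp: Pi_iff subset_iff)
    \<comment> \<open>The definition wants coefficient functions that are undefined outside S;
      cutting a function off leaves its combination unchanged.\<close>
    have r: "?f (restrict c S) = ?f c" if "c \<in> S \<rightarrow> carrier R" for c
      by (rule X.M.finsum_cong') (use cl[OF that] in auto)
    have H: "?f c \<in> ?H" if "c \<in> S \<rightarrow> carrier R" for c
      using r[OF that] that by (auto intro!: image_eqI[of _ _ "restrict c S"])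
    have sm: "r \<odot>\<^bsub>X\<^esub> (\<Oplus>\<^bsub>X\<^esub>s\<in>T. g s) = (\<Oplus>\<^bsub>X\<^esub>s\<in>T. r \<odot>\<^bsub>X\<^esub> g s)"
      if "r \<in> carrier R" "finite T" "g \<in> T \<rightarrow> carrier X" for r g and T :: "'c set"
      using that(2,3)
    proof (induction T)
      case (insert s T)
      have "(\<Oplus>\<^bsub>X\<^esub>s\<in>insert s T. r \<odot>\<^bsub>X\<^esub> g s) = r \<odot>\<^bsub>X\<^esub> g s \<oplus>\<^bsub>X\<^esub> (\<Oplus>\<^bsub>X\<^esub>s\<in>T. r \<odot>\<^bsub>X\<^esub> g s)"
        using insert that(1) by (intro X.M.finsum_insert) (auto simp: Pi_iff)
      then show ?case using insert that(1) by (simp add: X.lsmult_r_distr Pi_iff)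
    qed (simp add: that(1))
    have "submod R X ?H" unfolding submod_def
    proof (intro conjI ballI)
      show "?H \<subseteq> carrier X" using cl by (auto intro!: X.M.finsum_closed)
      have "?f (\<lambda>_. \<zero>\<^bsub>R\<^esub>) = (\<Oplus>\<^bsub>X\<^esub>s\<in>S. \<zero>\<^bsub>X\<^esub>)"
        using S(2) by (intro X.M.finsum_cong') auto
      then show "\<zero>\<^bsub>X\<^esub> \<in> ?H" using H[of "\<lambda>_. \<zero>\<^bsub>R\<^esub>"] by simp
    next
      fix x y assume "x \<in> ?H" "y \<in> ?H"
      then obtain c d where c: "c \<in> S \<rightarrow>\<^sub>E carrier R" "x = ?f c" and d: "d \<in> S \<rightarrow>\<^sub>E carrier R" "y = ?f d" by blast
      have "?f (\<lambda>s. c s \<oplus>\<^bsub>R\<^esub> d s) = (\<Oplus>\<^bsub>X\<^esub>s\<in>S. c s \<odot>\<^bsub>X\<^esub> s \<oplus>\<^bsub>X\<^esub> d s \<odot>\<^bsub>X\<^esub> s)"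
        by (rule X.M.finsum_cong') (use S(2) c(1) d(1) in \<open>auto simp: X.lsmult_l_distr PiE_iff subset_iff\<close>)
      also have "\<dots> = x \<oplus>\<^bsub>X\<^esub> y" unfolding c(2) d(2)
        by (rule X.M.finsum_addf) (use c(1) d(1) S(2) in \<open>auto simp: PiE_iff subset_iff\<close>)
      finally show "x \<oplus>\<^bsub>X\<^esub> y \<in> ?H" using H[of "\<lambda>s. c s \<oplus>\<^bsub>R\<^esub> d s"] c d by (auto simp: PiE_iff)
    next
      fix r x assume "r \<in> carrier R" "x \<in> ?H"
      then obtain c where r: "r \<in> carrier R" and c: "c \<in> S \<rightarrow>\<^sub>E carrier R" "x = ?f c" by blast
      have "?f (\<lambda>s. r \<otimes>\<^bsub>R\<^esub> c s) = (\<Oplus>\<^bsub>X\<^esub>s\<in>S. r \<odot>\<^bsub>X\<^esub> (c s \<odot>\<^bsub>X\<^esub> s))"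
        by (rule X.M.finsum_cong') (use S(2) c(1) r in \<open>auto simp: X.lsmult_assoc PiE_iff subset_iff\<close>)
      also have "\<dots> = r \<odot>\<^bsub>X\<^esub> x" unfolding c(2)
        by (rule sm[symmetric]) (use S r c(1) in \<open>auto simp: PiE_iff subset_iff\<close>)
      finally show "r \<odot>\<^bsub>X\<^esub> x \<in> ?H" using H[of "\<lambda>s. r \<otimes>\<^bsub>R\<^esub> c s"] c r by (auto simp: PiE_iff)
    qed
    moreover have "S \<subseteq> ?H"
    proof
      fix s assume s: "s \<in> S"
      have "?f (\<lambda>t. if s = t then \<one>\<^bsub>R\<^esub> else \<zero>\<^bsub>R\<^esub>) = (\<Oplus>\<^bsub>X\<^esub>t\<in>S. if s = t then t else \<zero>\<^bsub>X\<^esub>)"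
        by (rule X.M.finsum_cong') (use S(2) in auto)
      also have "\<dots> = s" by (rule X.M.finsum_singleton) (use s S in auto)
      finally show "s \<in> ?H" using H[of "\<lambda>t. if s = t then \<one>\<^bsub>R\<^esub> else \<zero>\<^bsub>R\<^esub>"] by auto
    qed
    ultimately have "carrier X \<subseteq> ?H" by (rule e)
    then show "fg_module R X" unfolding fg_module_def using S by (intro exI[of _ S]) blast
  qed
qed

lemma fgE:
  assumes "lmodule R X" "fg_module R X"
  obtains S where "finite S" "S \<subseteq> carrier X" "\<And>H. submod R X H \<Longrightarrow> S \<subseteq> H \<Longrightarrow> carrier X \<subseteq> H"
  using assms(2) unfolding fg_iff[OF assms(1)] by (elim exE conjE) (simp only: conj_imp_eq_imp_imp simp_thms)

lemma fgI:
  assumes "lmodule R X" "finite S" "S \<subseteq> carrier X" "\<And>H. submod R X H \<Longrightarrow> S \<subseteq> H \<Longrightarrow> carrier X \<subseteq> H"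
  shows "fg_module R X"
  unfolding fg_iff[OF assms(1)] by (intro exI[of _ S] conjI allI impI; (elim conjE)?; intro assms)

lemma fgproj_fg: assumes "fgproj R P" shows "fg_module R P"
proof -
  obtain n l p where d: "dbasis R P n l p" using assms by (auto simp: fgproj_def)
  have "carrier P \<subseteq> H" if H: "submod R P H" "p ` {..<n} \<subseteq> H" for H
  proof
    fix x assume x: "x \<in> carrier P"
    have "lsum P (\<lambda>i. l i x \<odot>\<^bsub>P\<^esub> p i) n \<in> H"
      using d x lh_closed[of R P "reg_module R" _ x]
      by (intro submod_lsum[OF H(1)] submod_smult[OF H(1)]) (use H(2) in \<open>auto simp: dbasis_def\<close>)
    then show "x \<in> H" using d x by (auto simp: dbasis_def)
  qed
  then show ?thesis
    by (intro fgI[OF fgproj_lmodule[OF assms], of "p ` {..<n}"]) (use d in \<open>auto simp: dbasis_def\<close>)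
qed

lemma fg_image:
  assumes X: "lmodule R X" and Y: "lmodule R Y" and "fg_module R X" and q: "lh R X Y q" "q ` carrier X = carrier Y"
  shows "fg_module R Y"
proof -
  obtain S where S: "finite S" "S \<subseteq> carrier X" "\<And>H. submod R X H \<Longrightarrow> S \<subseteq> H \<Longrightarrow> carrier X \<subseteq> H"
    by (rule fgE[OF X assms(3)]) (rule that, assumption+)
  have "carrier Y \<subseteq> H" if H: "submod R Y H" "q ` S \<subseteq> H" for H
  proof -
    have "S \<subseteq> {x \<in> carrier X. q x \<in> H}" using H(2) S(2) by auto
    then have "carrier X \<subseteq> {x \<in> carrier X. q x \<in> H}" by (rule S(3)[OF submod_vimage[OF X Y q(1) H(1)]])
    then show ?thesis unfolding q(2)[symmetric] by auto
  qed
  moreover have "q ` S \<subseteq> carrier Y" using S(2) q(2) by blast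
  ultimately show ?thesis using S(1) by (intro fgI[OF Y, of "q ` S"]) auto
qed

lemma fg_free_cover:
  assumes X: "lmodule R X" and "fg_module R X"
  obtains n q where "lh R (free_module R n) X q" "q ` carrier (free_module R n) = carrier X"
proof -
  obtain S where S: "finite S" "S \<subseteq> carrier X" "\<And>H. submod R X H \<Longrightarrow> S \<subseteq> H \<Longrightarrow> carrier X \<subseteq> H"
    by (rule fgE[OF X assms(2)]) (rule that, assumption+)
  obtain n p where p: "S = p ` {i::nat. i < n}" using finite_imp_nat_seg_image_inj_on[OF S(1)] by blast
  then have pc: "\<And>i. i < n \<Longrightarrow> p i \<in> carrier X" using S(2) by auto
  note R = lmodule_ring[OF X]
  let ?q = "\<lambda>x. lsum X (\<lambda>i. x i \<odot>\<^bsub>X\<^esub> p i) n"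
  have q: "lh R (free_module R n) X ?q" by (rule combination_lh[OF X pc])
  have "submod R X (?q ` carrier (free_module R n))"
    by (rule submod_image[OF free_lmodule[OF R] X q submod_carrier[OF free_lmodule[OF R]]])
  moreover have "S \<subseteq> ?q ` carrier (free_module R n)"
  proof
    fix s assume "s \<in> S" then obtain j where j: "j < n" "s = p j" using p by auto
    then have "s = ?q (unit_vec R n j)" using combination_unit_vec[OF X pc j(1)] by simp
    then show "s \<in> ?q ` carrier (free_module R n)" by (simp only:) (intro imageI unit_vec_closed[OF R])
  qed
  ultimately have "carrier X \<subseteq> ?q ` carrier (free_module R n)" by (rule S(3))
  then have "?q ` carrier (free_module R n) = carrier X"
    by (intro equalityI image_subsetI lh_closed[OF q])
  then show thesis using q by (intro that)
qed

text \<open>The condition is put on submodules of free modules of finite rank because it is applied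
  to kernels of free presentations; \<open>free_Suc_fg\<close> derives it from left ideals.\<close>

definition noeth :: "('r, 'e) ring_scheme \<Rightarrow> bool" where
  "noeth R \<longleftrightarrow> ring R \<and> (\<forall>n H. submod R (free_module R n) H \<longrightarrow> fg_module R ((free_module R n)\<lparr>carrier := H\<rparr>))"

lemma noeth_ring: "noeth R \<Longrightarrow> ring R" by (simp add: noeth_def)

lemma fg_image_submod:
  assumes X: "lmodule R X" and Y: "lmodule R Y" and q: "lh R X Y q" and H: "submod R X H"
    and fg: "fg_module R (X\<lparr>carrier := H\<rparr>)"
  shows "fg_module R (Y\<lparr>carrier := q ` H\<rparr>)"
proof (rule fg_image[OF submod_lmodule[OF X H] submod_lmodule[OF Y submod_image[OF X Y q H]] fg])
  show "lh R (X\<lparr>carrier := H\<rparr>) (Y\<lparr>carrier := q ` H\<rparr>) q"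
    by (rule lh_cod[OF lh_dom[OF q submod_subset[OF H]]]) auto
qed auto

text \<open>H is the image of its preimage in a free module covering X.\<close>

lemma noeth_sub:
  assumes N: "noeth R" and X: "lmodule R X" and fg: "fg_module R X" and H: "submod R X H"
  shows "fg_module R (X\<lparr>carrier := H\<rparr>)"
proof -
  obtain n q where q: "lh R (free_module R n) X q" "q ` carrier (free_module R n) = carrier X"
    by (rule fg_free_cover[OF X fg])
  note F = free_lmodule[OF noeth_ring[OF N], of n]
  let ?H = "{x \<in> carrier (free_module R n). q x \<in> H}"
  have s: "submod R (free_module R n) ?H" by (rule submod_vimage[OF F X q(1) H])
  then have "fg_module R ((free_module R n)\<lparr>carrier := ?H\<rparr>)" using N by (auto simp: noeth_def)
  moreover have "q ` ?H = H"
  proof (intro equalityI subsetI)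
    fix x assume "x \<in> H"
    moreover then have "x \<in> q ` carrier (free_module R n)" using q(2) submod_subset[OF H] by (simp add: subsetD)
    ultimately show "x \<in> q ` ?H" by auto
  qed auto
  ultimately show ?thesis using fg_image_submod[OF F X q(1) s] by metis
qed

section \<open>Presentations and vanishing of Ext\<close>

definition pres :: "('r, 'e) ring_scheme \<Rightarrow> ('r, 'm, 'x) module_scheme \<Rightarrow> ('r, 'p, 'y) module_scheme \<Rightarrow> ('p \<Rightarrow> 'm) \<Rightarrow> bool" where
  "pres R X P p \<longleftrightarrow> fgproj R P \<and> lh R P X p \<and> p ` carrier P = carrier X"

text \<open>For a projective module \<open>P\<close>, this says \<open>Ext\<^sup>1(P/K, Y) = 0\<close>.\<close>

definition xt :: "('r, 'e) ring_scheme \<Rightarrow> ('r, 'p, 'x) module_scheme \<Rightarrow> 'p set \<Rightarrow> ('r, 'n, 'y) module_scheme \<Rightarrow> bool" where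
  "xt R P K Y \<longleftrightarrow> (\<forall>f. lh R (P\<lparr>carrier := K\<rparr>) Y f \<longrightarrow> (\<exists>g. lh R P Y g \<and> (\<forall>x\<in>K. g x = f x)))"

text \<open>\<open>X'\<close> is a direct summand of \<open>X\<close> up to a projective summand; the error term factors through
  the cover \<open>p' : P' \<rightarrow> X'\<close>.\<close>

definition srt :: "('r, 'e) ring_scheme \<Rightarrow> ('r, 'm, 'x) module_scheme \<Rightarrow> ('r, 'n, 'y) module_scheme \<Rightarrow>
    ('r, 'p, 'z) module_scheme \<Rightarrow> ('p \<Rightarrow> 'm) \<Rightarrow> bool" where
  "srt R X' X P' p' \<longleftrightarrow> (\<exists>a b w. lh R X' X a \<and> lh R X X' b \<and> lh R X' P' w \<and>
     (\<forall>x\<in>carrier X'. x = b (a x) \<oplus>\<^bsub>X'\<^esub> p' (w x)))"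

lemma pres_kernel: assumes "lmodule R X" "pres R X P p"
  shows "submod R P (a_kernel P X p)" "lmodule R (P\<lparr>carrier := a_kernel P X p\<rparr>)"
proof -
  have P: "lmodule R P" and p: "lh R P X p" using assms(2) by (auto simp: pres_def fgproj_lmodule)
  show "submod R P (a_kernel P X p)" by (rule submod_kernel[OF P assms(1) p])
  then show "lmodule R (P\<lparr>carrier := a_kernel P X p\<rparr>)" by (rule submod_lmodule[OF P])
qed

lemma pres_fg: assumes "lmodule R X" "pres R X P p" shows "fg_module R X"
  using assms(2) fg_image[OF fgproj_lmodule assms(1) fgproj_fg, of P p] by (simp add: pres_def)

text \<open>A lift j of p' along p'' carries the error term from one cover to the other.\<close>

lemma srt_change:
  assumes X': "lmodule R X'" and s: "srt R X' X P' p'" and P': "pres R X' P' p'" and P'': "pres R X' P'' p''"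
  shows "srt R X' X P'' p''"
proof -
  obtain a b w where a: "lh R X' X a" and b: "lh R X X' b" and w: "lh R X' P' w"
    and e: "\<And>x. x \<in> carrier X' \<Longrightarrow> x = b (a x) \<oplus>\<^bsub>X'\<^esub> p' (w x)" using s by (auto simp: srt_def)
  obtain j where j: "lh R P' P'' j" "\<And>x. x \<in> carrier P' \<Longrightarrow> p'' (j x) = p' x"
    by (rule fgproj_lift[of R P' P'' X' p'' p'])
      (use P' P'' X' in \<open>auto simp: pres_def intro: fgproj_lmodule lh_closed\<close>)
  show ?thesis unfolding srt_def
    by (rule exI[of _ a], rule exI[of _ b], rule exI[of _ "\<lambda>x. j (w x)"])
      (use a b e lh_comp[OF w j(1)] j(2) lh_closed[OF w] in auto)
qed

text \<open>The engine of all dimension shifting. The maps a and b lift to a1 and b1 between P' and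
  P, and the remaining defect u = 1 - b1 a1 - w p' takes values in the kernel K' of p'. On K' the
  term w p' vanishes, so 1 = b1 a1 + u there: K' is a summand of K up to a map that is defined on
  all of P'.\<close>

lemma stable_step:
  assumes X: "lmodule R X" and X': "lmodule R X'" and P: "pres R X P p" and P': "pres R X' P' p'"
    and s: "srt R X' X P' p'"
  shows "lmodule R Y \<Longrightarrow> xt R P (a_kernel P X p) Y \<Longrightarrow> xt R P' (a_kernel P' X' p') Y"
    and "pres R (P'\<lparr>carrier := a_kernel P' X' p'\<rparr>) P2 p2 \<Longrightarrow>
      srt R (P'\<lparr>carrier := a_kernel P' X' p'\<rparr>) (P\<lparr>carrier := a_kernel P X p\<rparr>) P2 p2"
proof -
  obtain a b w where a: "lh R X' X a" and b: "lh R X X' b" and w: "lh R X' P' w"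
    and e: "\<And>x. x \<in> carrier X' \<Longrightarrow> x = b (a x) \<oplus>\<^bsub>X'\<^esub> p' (w x)" using s by (auto simp: srt_def)
  have p: "lh R P X p" "p ` carrier P = carrier X" and PP: "fgproj R P" using P by (auto simp: pres_def)
  have p': "lh R P' X' p'" "p' ` carrier P' = carrier X'" and PP': "fgproj R P'" using P' by (auto simp: pres_def)
  note PM = fgproj_lmodule[OF PP] and PM' = fgproj_lmodule[OF PP']
  interpret X': lmodule R X' by fact
  interpret P': lmodule R P' by fact
  obtain a1 where a1: "lh R P' P a1" "\<And>x. x \<in> carrier P' \<Longrightarrow> p (a1 x) = a (p' x)"
    by (rule fgproj_lift[OF PP' PM X p(1) lh_comp[OF p'(1) a]]) (use p(2) lh_closed[OF lh_comp[OF p'(1) a]] in auto)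
  obtain b1 where b1: "lh R P P' b1" "\<And>x. x \<in> carrier P \<Longrightarrow> p' (b1 x) = b (p x)"
    by (rule fgproj_lift[OF PP PM' X' p'(1) lh_comp[OF p(1) b]]) (use p'(2) lh_closed[OF lh_comp[OF p(1) b]] in auto)
  let ?K = "a_kernel P X p" and ?K' = "a_kernel P' X' p'"
  note K = pres_kernel[OF X P] and K' = pres_kernel[OF X' P']
  \<comment> \<open>p' u = 0, because p' b1 a1 + p' w p' = (b a + p' w) p' = p'.\<close>
  define u where "u x = x \<ominus>\<^bsub>P'\<^esub> (b1 (a1 x) \<oplus>\<^bsub>P'\<^esub> w (p' x))" for x
  have aux: "lh R P' P' (\<lambda>x. b1 (a1 x) \<oplus>\<^bsub>P'\<^esub> w (p' x))"
    by (rule lh_plus[OF PM' PM' lh_comp[OF a1(1) b1(1)] lh_comp[OF p'(1) w]])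
  have u0: "lh R P' P' u" unfolding u_def
    by (rule lh_diff[OF PM' PM' lh_id aux])
  have pc: "p' x \<in> carrier X'" "a1 x \<in> carrier P" "b1 (a1 x) \<in> carrier P'" "w (p' x) \<in> carrier P'"
    if "x \<in> carrier P'" for x
    using lh_closed[OF p'(1) that] lh_closed[OF a1(1) that] lh_closed[OF b1(1) lh_closed[OF a1(1) that]]
      lh_closed[OF w lh_closed[OF p'(1) that]] by auto
  have pu: "p' (u x) = \<zero>\<^bsub>X'\<^esub>" if x: "x \<in> carrier P'" for x
  proof -
    have "p' (b1 (a1 x) \<oplus>\<^bsub>P'\<^esub> w (p' x)) = p' x"
      using lh_add[OF p'(1) pc(3,4)[OF x]] b1(2)[OF pc(2)[OF x]] a1(2)[OF x] e[OF pc(1)[OF x]] by simp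
    then show ?thesis using lh_minus[OF PM' X' p'(1) x lh_closed[OF aux x]] pc(1)[OF x]
      by (simp add: u_def X'.M.minus_eq X'.M.r_neg)
  qed
  have u: "lh R P' (P'\<lparr>carrier := ?K'\<rparr>) u"
    by (rule lh_cod[OF u0]) (use pu lh_closed[OF u0] in \<open>auto simp: a_kernel_def'\<close>)
  have Kc: "x \<in> carrier P'" "p' x = \<zero>\<^bsub>X'\<^esub>" if "x \<in> ?K'" for x using that by (auto simp: a_kernel_def')
  have dec: "x = b1 (a1 x) \<oplus>\<^bsub>P'\<^esub> u x" if "x \<in> ?K'" for x
  proof -
    have "w (p' x) = \<zero>\<^bsub>P'\<^esub>" using Kc(2)[OF that] lh_zero[OF X' PM' w] by simp
    then show ?thesis using pc[OF Kc(1)[OF that]] Kc(1)[OF that]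
      by (simp add: u_def P'.M.minus_eq P'.M.a_ac P'.M.r_neg1 P'.M.r_neg2 P'.M.r_neg)
  qed
  have a2: "lh R (P'\<lparr>carrier := ?K'\<rparr>) (P\<lparr>carrier := ?K\<rparr>) a1"
    by (rule lh_cod[OF lh_dom[OF a1(1)]])
      (auto simp: a_kernel_def' a1(2) lh_closed[OF a1(1)] lh_zero[OF X' X a])
  have b2: "lh R (P\<lparr>carrier := ?K\<rparr>) (P'\<lparr>carrier := ?K'\<rparr>) b1"
    by (rule lh_cod[OF lh_dom[OF b1(1)]])
      (auto simp: a_kernel_def' b1(2) lh_closed[OF b1(1)] lh_zero[OF X X' b])
  show "xt R P' ?K' Y" if Y: "lmodule R Y" and xt: "xt R P ?K Y"
    unfolding xt_def
  proof (intro allI impI)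
    fix f assume f: "lh R (P'\<lparr>carrier := ?K'\<rparr>) Y f"
    obtain g where g: "lh R P Y g" "\<And>x. x \<in> ?K \<Longrightarrow> g x = f (b1 x)"
      using xt lh_comp[OF b2 f] by (auto simp: xt_def)
    \<comment> \<open>On K' one has f = f b1 a1 + f u. The map f b1 extends from K to P by
      hypothesis, and u is already defined on P'.\<close>
    have "lh R P' Y (\<lambda>x. g (a1 x) \<oplus>\<^bsub>Y\<^esub> f (u x))"
      by (rule lh_plus[OF PM' Y lh_comp[OF a1(1) g(1)] lh_comp[OF u f]])
    moreover have "g (a1 x) \<oplus>\<^bsub>Y\<^esub> f (u x) = f x" if x: "x \<in> ?K'" for x
    proof -
      have "a1 x \<in> ?K" using lh_closed[OF a2] x by simp
      moreover have "b1 (a1 x) \<in> ?K'" using lh_closed[OF b2] calculation by simp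
      moreover have "u x \<in> ?K'" using lh_closed[OF u Kc(1)[OF x]] by simp
      ultimately show ?thesis using dec[OF x] lh_add[OF f, of "b1 (a1 x)" "u x"] g(2) by simp
    qed
    ultimately show "\<exists>g. lh R P' Y g \<and> (\<forall>x\<in>?K'. g x = f x)" by blast
  qed
  show "srt R (P'\<lparr>carrier := ?K'\<rparr>) (P\<lparr>carrier := ?K\<rparr>) P2 p2" if P2: "pres R (P'\<lparr>carrier := ?K'\<rparr>) P2 p2"
  proof -
    have p2: "fgproj R P2" "lh R P2 (P'\<lparr>carrier := ?K'\<rparr>) p2" "p2 ` carrier P2 = ?K'" using P2 by (auto simp: pres_def)
    \<comment> \<open>As P' is projective, u lifts along p2; the restriction of the lift to K' is
      the new error term.\<close>
    obtain v where v: "lh R P' P2 v" "\<And>x. x \<in> carrier P' \<Longrightarrow> p2 (v x) = u x"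
      by (rule fgproj_lift[OF PP' fgproj_lmodule[OF p2(1)] K'(2) p2(2) u]) (auto simp: lh_closed[OF u, simplified] p2(3))
    have "lh R (P'\<lparr>carrier := ?K'\<rparr>) P2 v" by (rule lh_dom[OF v(1)]) (auto simp: Kc)
    moreover have "x = b1 (a1 x) \<oplus>\<^bsub>P'\<^esub> p2 (v x)" if "x \<in> ?K'" for x
      using dec[OF that] v(2)[OF Kc(1)[OF that]] by simp
    ultimately show ?thesis unfolding srt_def
      by (intro exI[of _ a1] exI[of _ b1] exI[of _ v] conjI a2 b2 ballI) simp_all
  qed
qed

lemma retract_srt:
  assumes X': "lmodule R X'" and p: "pres R X' P p" and a: "lh R X' X a" and b: "lh R X X' b"
    and e: "\<And>x. x \<in> carrier X' \<Longrightarrow> b (a x) = x"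
  shows "srt R X' X P p"
proof -
  interpret X': lmodule R X' by fact
  have P: "lmodule R P" using p by (simp add: pres_def fgproj_lmodule)
  have p0: "p \<zero>\<^bsub>P\<^esub> = \<zero>\<^bsub>X'\<^esub>" using p lh_zero[OF P X', of p] by (simp add: pres_def)
  show ?thesis unfolding srt_def
    by (intro exI[of _ a] exI[of _ b] exI[of _ "\<lambda>x. \<zero>\<^bsub>P\<^esub>"] conjI a b lh_zero_map[OF X' P]) (simp add: p0 e)
qed

lemma srt_refl: "lmodule R X \<Longrightarrow> pres R X P p \<Longrightarrow> srt R X X P p"
  by (rule retract_srt[OF _ _ lh_id lh_id]) auto

text \<open>X is a stable summand of itself with respect to any cover, so \<open>stable_step\<close>
  does the work of Schanuel's lemma.\<close>

lemma xt_indep: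
  assumes "lmodule R X" "pres R X P p" "pres R X P' p'" "lmodule R Y" "xt R P (a_kernel P X p) Y"
  shows "xt R P' (a_kernel P' X p') Y"
  using stable_step(1)[OF assms(1,1,2,3) srt_refl[OF assms(1,3)] assms(4,5)] .

section \<open>Iterated vanishing along syzygies\<close>

lemma fg_pres:
  assumes "lmodule R X" "fg_module R X"
  obtains n q where "pres R X (free_module R n) q"
  by (rule fg_free_cover[OF assms], rule that) (simp add: pres_def free_fgproj[OF lmodule_ring[OF assms(1)]])

lemma pres_kernel_fg:
  assumes "noeth R" "lmodule R X" "pres R X P p" shows "fg_module R (P\<lparr>carrier := a_kernel P X p\<rparr>)"
  by (rule noeth_sub[OF assms(1) _ _ pres_kernel(1)[OF assms(2,3)]])
    (use assms(3) in \<open>auto simp: pres_def fgproj_lmodule fgproj_fg\<close>)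

text \<open>Passing to a syzygy changes the carrier type from that of X to functions from
  \<open>nat\<close>, which a recursion on one polymorphic constant cannot follow. So the recursion
  runs on the latter type only, and \<open>ev\<close> puts a first step from an arbitrary type in
  front of it.\<close>

primrec evU :: "('r, 'e) ring_scheme \<Rightarrow> nat \<Rightarrow> ('r, nat \<Rightarrow> 'r) module \<Rightarrow> bool" where
  "evU R 0 X \<longleftrightarrow> lmodule R X \<and> fg_module R X"
| "evU R (Suc n) X \<longleftrightarrow> lmodule R X \<and> fg_module R X \<and> (\<exists>(P :: ('r, nat \<Rightarrow> 'r) module) p. pres R X P p \<and>
     xt R P (a_kernel P X p) (reg_module R) \<and> evU R n (P\<lparr>carrier := a_kernel P X p\<rparr>))"

text \<open>\<open>Ext\<^sup>i(X, R) = 0\<close> for \<open>1 \<le> i \<le> n\<close>\<close>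

definition ev :: "('r, 'e) ring_scheme \<Rightarrow> nat \<Rightarrow> ('r, 'm, 'x) module_scheme \<Rightarrow> bool" where
  "ev R n X \<longleftrightarrow> lmodule R X \<and> fg_module R X \<and> (case n of 0 \<Rightarrow> True | Suc m \<Rightarrow>
     (\<exists>(P :: ('r, nat \<Rightarrow> 'r) module) p. pres R X P p \<and>
     xt R P (a_kernel P X p) (reg_module R) \<and> evU R m (P\<lparr>carrier := a_kernel P X p\<rparr>)))"

lemma evU_ev: "evU R n X = ev R n X"
  by (cases n) (auto simp: ev_def)

lemma ev_lmodule: "ev R n X \<Longrightarrow> lmodule R X" and ev_fg: "ev R n X \<Longrightarrow> fg_module R X"
  and ev_0: "ev R 0 X \<longleftrightarrow> lmodule R X \<and> fg_module R X"
  by (auto simp: ev_def)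

text \<open>The two parts of \<open>stable_step\<close> keep the induction going: the first
  transfers the extension property, the second makes the kernel a stable summand again, with respect
  to a free cover that exists because R is Noetherian.\<close>

lemma ev_srtU:
  fixes X X' :: "('r, nat \<Rightarrow> 'r) module" and P' :: "('r, nat \<Rightarrow> 'r) module"
  assumes N: "noeth R" and "evU R n X" "lmodule R X'" "pres R X' P' p'" "srt R X' X P' p'"
  shows "evU R n X'"
  using assms(2-)
proof (induction n arbitrary: X X' P' p')
  case 0 then show ?case by (auto simp: pres_fg)
next
  case (Suc n)
  then obtain P :: "('r, nat \<Rightarrow> 'r) module" and p where P: "lmodule R X" "pres R X P p"
     "xt R P (a_kernel P X p) (reg_module R)" "evU R n (P\<lparr>carrier := a_kernel P X p\<rparr>)" by auto
  note R = noeth_ring[OF N]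
  note K = pres_kernel[OF Suc.prems(2,3)]
  obtain m q where mq: "pres R (P'\<lparr>carrier := a_kernel P' X' p'\<rparr>) (free_module R m) q"
    using fg_pres[OF K(2) pres_kernel_fg[OF N Suc.prems(2,3)]] .
  have "xt R P' (a_kernel P' X' p') (reg_module R)"
    using stable_step(1)[OF P(1) Suc.prems(2) P(2) Suc.prems(3,4) reg_lmodule[OF R] P(3)] .
  moreover have "evU R n (P'\<lparr>carrier := a_kernel P' X' p'\<rparr>)"
    by (rule Suc.IH[OF P(4) K(2) mq stable_step(2)[OF P(1) Suc.prems(2) P(2) Suc.prems(3,4) mq]])
  ultimately show ?case using Suc.prems pres_fg[OF Suc.prems(2,3)] by auto
qed

text \<open>X and X' may live on any types, so the first kernel is taken here and
  \<open>ev_srtU\<close> handles the later ones. The given cover is exchanged for a free one because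
  \<open>ev\<close> asks for a cover on functions from \<open>nat\<close>.\<close>

lemma ev_srt:
  assumes N: "noeth R" and X: "ev R n X" and X': "lmodule R X'" and P': "pres R X' P' p'" and s: "srt R X' X P' p'"
  shows "ev R n X'"
proof (cases n)
  case 0 then show ?thesis using X' pres_fg[OF X' P'] by (simp add: ev_0)
next
  case (Suc m)
  note fg = pres_fg[OF X' P']
  obtain k q where q: "pres R X' (free_module R k) q" by (rule fg_pres[OF X' fg])
  have s': "srt R X' X (free_module R k) q" by (rule srt_change[OF X' s P' q])
  obtain P :: "('a, nat \<Rightarrow> 'a) module" and p where P: "lmodule R X" "pres R X P p"
     "xt R P (a_kernel P X p) (reg_module R)" "evU R m (P\<lparr>carrier := a_kernel P X p\<rparr>)"
    using X Suc by (auto simp: ev_def)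
  note R = noeth_ring[OF N]
  note K = pres_kernel[OF X' q]
  obtain m' q' where mq: "pres R ((free_module R k)\<lparr>carrier := a_kernel (free_module R k) X' q\<rparr>) (free_module R m') q'"
    using fg_pres[OF K(2) pres_kernel_fg[OF N X' q]] .
  have "xt R (free_module R k) (a_kernel (free_module R k) X' q) (reg_module R)"
    using stable_step(1)[OF P(1) X' P(2) q s' reg_lmodule[OF R] P(3)] .
  moreover have "evU R m ((free_module R k)\<lparr>carrier := a_kernel (free_module R k) X' q\<rparr>)"
    by (rule ev_srtU[OF N P(4) K(2) mq stable_step(2)[OF P(1) X' P(2) q s' mq]])
  ultimately show ?thesis using X' q fg Suc by (auto simp: ev_def)
qed

lemma ev_retract:
  assumes N: "noeth R" and X: "ev R n X" and X': "lmodule R X'"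
    and a: "lh R X' X a" and b: "lh R X X' b" and e: "\<And>x. x \<in> carrier X' \<Longrightarrow> b (a x) = x"
  shows "ev R n X'"
proof -
  have "b ` carrier X = carrier X'" using lh_closed[OF a] lh_closed[OF b] e by (force simp: image_iff)
  then have "fg_module R X'" by (rule fg_image[OF ev_lmodule[OF X] X' ev_fg[OF X] b])
  then obtain n q where q: "pres R X' (free_module R n) q" by (rule fg_pres[OF X'])
  show ?thesis by (rule ev_srt[OF N X X' q retract_srt[OF X' q a b e]])
qed

text \<open>Dimension shift along a presentation chosen at will, whatever the type of P;
  \<open>ev\<close> itself only asserts that some presentation on functions from \<open>nat\<close>
  works.\<close>

lemma ev_Suc:
  assumes N: "noeth R" and X: "lmodule R X" and P: "pres R X P p"
  shows "ev R (Suc n) X \<longleftrightarrow> xt R P (a_kernel P X p) (reg_module R) \<and> ev R n (P\<lparr>carrier := a_kernel P X p\<rparr>)"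
proof
  note R = noeth_ring[OF N]
  note K = pres_kernel[OF X P]
  assume "ev R (Suc n) X"
  then obtain P' :: "('a, nat \<Rightarrow> 'a) module" and p' where P': "pres R X P' p'"
     "xt R P' (a_kernel P' X p') (reg_module R)" "ev R n (P'\<lparr>carrier := a_kernel P' X p'\<rparr>)"
    by (auto simp: ev_def[of R "Suc n"] evU_ev)
  obtain m q where q: "pres R (P\<lparr>carrier := a_kernel P X p\<rparr>) (free_module R m) q"
    using fg_pres[OF K(2) pres_kernel_fg[OF N X P]] .
  show "xt R P (a_kernel P X p) (reg_module R) \<and> ev R n (P\<lparr>carrier := a_kernel P X p\<rparr>)"
    using xt_indep[OF X P'(1) P reg_lmodule[OF R] P'(2)]
     ev_srt[OF N P'(3) K(2) q stable_step(2)[OF X X P'(1) P srt_refl[OF X P] q]] by (rule conjI)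
next
  note R = noeth_ring[OF N]
  assume a: "xt R P (a_kernel P X p) (reg_module R) \<and> ev R n (P\<lparr>carrier := a_kernel P X p\<rparr>)"
  obtain k P' where P': "pres R X (free_module R k) P'" using fg_pres[OF X pres_fg[OF X P]] .
  note K = pres_kernel[OF X P']
  obtain m q where q: "pres R ((free_module R k)\<lparr>carrier := a_kernel (free_module R k) X P'\<rparr>) (free_module R m) q"
    using fg_pres[OF K(2) pres_kernel_fg[OF N X P']] .
  have "xt R (free_module R k) (a_kernel (free_module R k) X P') (reg_module R)"
    using xt_indep[OF X P P' reg_lmodule[OF R]] a by blast
  moreover have "evU R n ((free_module R k)\<lparr>carrier := a_kernel (free_module R k) X P'\<rparr>)"
    using ev_srt[OF N _ K(2) q stable_step(2)[OF X X P P' srt_refl[OF X P'] q]] a by (simp add: evU_ev)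
  ultimately show "ev R (Suc n) X" using X P' pres_fg[OF X P] by (auto simp: ev_def)
qed

section \<open>Resolutions and the groups Ext\<close>

lemma resolution_exists:
  fixes R :: "('r, 'e) ring_scheme" and X :: "('r, 'm, 'x) module_scheme"
  assumes N: "noeth R" and X: "lmodule R X" and fg: "fg_module R X"
  shows "\<exists>P d e. is_proj_resolution R X P d e"
proof -
  \<comment> \<open>A state (P, K) is a term of the resolution together with the submodule that the
    next term has to cover. The clause for n = 0 used below pins the first state to the cover of X
    and its kernel, as dependent choice alone would leave the start open.\<close>
  let ?I = "\<lambda>(n::nat) (P :: ('r, nat \<Rightarrow> 'r) module, K). fgproj R P \<and> submod R P K \<and> fg_module R (P\<lparr>carrier := K\<rparr>)"
  let ?Q = "\<lambda>(n::nat) (P :: ('r, nat \<Rightarrow> 'r) module, K) (P' :: ('r, nat \<Rightarrow> 'r) module, K').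
    \<exists>d. lh R P' P d \<and> d ` carrier P' = K \<and> K' = a_kernel P' P d"
  obtain m q where q: "pres R X (free_module R m) q" by (rule fg_pres[OF X fg])
  have "\<exists>s. \<forall>n. ?I n (s n) \<and> ?Q n (s n) (s (Suc n)) \<and> (n = 0 \<longrightarrow> s n = (free_module R m, a_kernel (free_module R m) X q))"
  proof -
    have "\<exists>s. (\<forall>n. (?I n (s n) \<and> (n = 0 \<longrightarrow> s n = (free_module R m, a_kernel (free_module R m) X q))) \<and> ?Q n (s n) (s (Suc n)))"
    proof (rule dependent_nat_choice)
      show "\<exists>x. ?I 0 x \<and> (0 = (0::nat) \<longrightarrow> x = (free_module R m, a_kernel (free_module R m) X q))"
        using q pres_kernel(1)[OF X q] pres_kernel_fg[OF N X q] by (auto simp: pres_def)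
    next
      fix x :: "('r, nat \<Rightarrow> 'r) module \<times> (nat \<Rightarrow> 'r) set" and n :: nat
      assume a: "?I n x \<and> (n = 0 \<longrightarrow> x = (free_module R m, a_kernel (free_module R m) X q))"
      obtain P K where x: "x = (P, K)" by (cases x)
      have P: "fgproj R P" "submod R P K" "fg_module R (P\<lparr>carrier := K\<rparr>)" using a x by auto
      note PK = submod_lmodule[OF fgproj_lmodule[OF P(1)] P(2)]
      obtain k d where d: "pres R (P\<lparr>carrier := K\<rparr>) (free_module R k) d" by (rule fg_pres[OF PK P(3)])
      let ?y = "(free_module R k, a_kernel (free_module R k) (P\<lparr>carrier := K\<rparr>) d)"
      have "?I (Suc n) ?y" using d pres_kernel(1)[OF PK d] pres_kernel_fg[OF N PK d] by (auto simp: pres_def)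
      moreover have "lh R (free_module R k) P d"
        by (rule lh_uncod[OF _ submod_subset[OF P(2)]]) (use d in \<open>simp add: pres_def\<close>)
      then have "?Q n x ?y" unfolding x using d by (auto simp: pres_def a_kernel_def' intro!: exI[of _ d])
      ultimately show "\<exists>y. (?I (Suc n) y \<and> (Suc n = 0 \<longrightarrow> y = (free_module R m, a_kernel (free_module R m) X q))) \<and> ?Q n x y"
        by (intro exI[of _ ?y]) simp
    qed
    then show ?thesis by meson
  qed
  then obtain s where ss: "\<forall>n. ?I n (s n) \<and> ?Q n (s n) (s (Suc n)) \<and> (n = 0 \<longrightarrow> s n = (free_module R m, a_kernel (free_module R m) X q))"
    by (rule exE)
  have s: "?I n (s n)" "?Q n (s n) (s (Suc n))" for n using spec[OF ss, of n] by (simp_all only: simp_thms)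
  have s0: "s 0 = (free_module R m, a_kernel (free_module R m) X q)" using spec[OF ss, of 0] by simp
  define P where "P n = fst (s n)" for n
  have "\<forall>n. \<exists>d. lh R (P (Suc n)) (P n) d \<and> d ` carrier (P (Suc n)) = snd (s n) \<and> snd (s (Suc n)) = a_kernel (P (Suc n)) (P n) d"
    using s(2) by (auto simp: P_def split_beta)
  then obtain d where d: "\<And>n. lh R (P (Suc n)) (P n) (d n)" "\<And>n. d n ` carrier (P (Suc n)) = snd (s n)"
     "\<And>n. snd (s (Suc n)) = a_kernel (P (Suc n)) (P n) (d n)" by metis
  define d' where "d' n = restrict (d n) (carrier (P (Suc n)))" for n
  define e where "e = restrict q (carrier (P 0))"
  have Pn: "fgproj R (P n)" for n using s(1)[of n] by (auto simp: P_def split_beta)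
  have P0: "P 0 = free_module R m" by (simp add: P_def s0)
  have im: "d' n ` carrier (P (Suc n)) = snd (s n)" for n using d(2)[of n] by (simp add: d'_def image_restrict_eq)
  have "is_proj_resolution R X P d' e" unfolding is_proj_resolution_def
  proof (intro conjI allI)
    show "P i \<in> add_modules R" for i using Pn by (simp add: add_modules_iff)
    show "d' i \<in> lhom R (P (Suc i)) (P i)" for i unfolding lhom_iff d'_def
      by (auto intro: lh_cong[OF fgproj_lmodule[OF Pn] fgproj_lmodule[OF Pn] d(1)])
    show "e \<in> lhom R (P 0) X" unfolding lhom_iff e_def
      using lh_cong[OF fgproj_lmodule[OF Pn[of 0]] X, of q e] q by (simp add: P0 pres_def e_def)
    show "e ` carrier (P 0) = carrier X" using q unfolding e_def P0 pres_def by (simp add: image_restrict_eq)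
    show "d' 0 ` carrier (P (Suc 0)) = a_kernel (P 0) X e"
      unfolding im s0 by (auto simp: a_kernel_def' e_def P0)
    show "d' (Suc i) ` carrier (P (Suc (Suc i))) = a_kernel (P (Suc i)) (P i) (d' i)" for i
      unfolding im d(3) by (auto simp: a_kernel_def' d'_def)
  qed
  then show ?thesis by blast
qed

lemma hom_group_comm:
  assumes X: "lmodule R X" and Y: "lmodule R Y" shows "comm_group (hom_group R X Y)"
proof -
  interpret X: lmodule R X by fact
  interpret Y: lmodule R Y by fact
  have res: "restrict f (carrier X) \<in> lhom R X Y" if "lh R X Y f" for f
    using lh_cong[OF X Y that] by (auto simp: lhom_iff)
  have c: "f x \<in> carrier Y" if "f \<in> lhom R X Y" "x \<in> carrier X" for f x
    using that by (auto simp: lhom_iff intro: lh_closed)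
  have eqI: "f = g" if "f \<in> lhom R X Y" "g \<in> lhom R X Y" "\<And>x. x \<in> carrier X \<Longrightarrow> f x = g x" for f g
    using that by (auto simp: lhom_iff intro: extensionalityI)
  show ?thesis
  proof (rule comm_groupI; simp add: hom_group_def)
    show p: "(\<lambda>x\<in>carrier X. f x \<oplus>\<^bsub>Y\<^esub> g x) \<in> lhom R X Y" if "f \<in> lhom R X Y" "g \<in> lhom R X Y" for f g
      using that by (intro res lh_plus[OF X Y]) (auto simp: lhom_iff)
    show z: "(\<lambda>x\<in>carrier X. \<zero>\<^bsub>Y\<^esub>) \<in> lhom R X Y" by (intro res lh_zero_map[OF X Y])
    show "(\<lambda>x\<in>carrier X. (if x \<in> carrier X then f x \<oplus>\<^bsub>Y\<^esub> g x else undefined) \<oplus>\<^bsub>Y\<^esub> h x) =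
      (\<lambda>x\<in>carrier X. f x \<oplus>\<^bsub>Y\<^esub> (if x \<in> carrier X then g x \<oplus>\<^bsub>Y\<^esub> h x else undefined))"
      if "f \<in> lhom R X Y" "g \<in> lhom R X Y" "h \<in> lhom R X Y" for f g h
      using that by (intro restrict_ext) (simp add: c Y.M.a_assoc)
    show "(\<lambda>x\<in>carrier X. f x \<oplus>\<^bsub>Y\<^esub> g x) = (\<lambda>x\<in>carrier X. g x \<oplus>\<^bsub>Y\<^esub> f x)"
      if "f \<in> lhom R X Y" "g \<in> lhom R X Y" for f g
      using that by (intro restrict_ext) (simp add: c Y.M.a_comm)
    show "(\<lambda>x\<in>carrier X. (if x \<in> carrier X then \<zero>\<^bsub>Y\<^esub> else undefined) \<oplus>\<^bsub>Y\<^esub> f x) = f" if f: "f \<in> lhom R X Y" for f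
      using f by (intro extensionalityI[of _ "carrier X"]) (auto simp: c lhom_iff)
    show "\<exists>g\<in>lhom R X Y. (\<lambda>x\<in>carrier X. g x \<oplus>\<^bsub>Y\<^esub> f x) = (\<lambda>x\<in>carrier X. \<zero>\<^bsub>Y\<^esub>)" if f: "f \<in> lhom R X Y" for f
    proof
      show "(\<lambda>x\<in>carrier X. \<ominus>\<^bsub>Y\<^esub> f x) \<in> lhom R X Y"
        using f by (intro res lh_uminus[OF X Y]) (auto simp: lhom_iff)
      show "(\<lambda>x\<in>carrier X. (\<lambda>x\<in>carrier X. \<ominus>\<^bsub>Y\<^esub> f x) x \<oplus>\<^bsub>Y\<^esub> f x) = (\<lambda>x\<in>carrier X. \<zero>\<^bsub>Y\<^esub>)"
        using f by (intro restrict_ext) (simp add: c Y.M.l_neg)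
    qed
  qed
qed

lemma (in comm_group) trivial_factor_iff:
  assumes B: "subgroup B G" shows "trivial_group (G Mod B) \<longleftrightarrow> B = carrier G"
proof
  assume t: "trivial_group (G Mod B)"
  then have "B #> x = B" if "x \<in> carrier G" for x
    using that by (auto simp: trivial_group_def FactGroup_def RCOSETS_def)
  then have "carrier G \<subseteq> B" using coset_join1 B by blast
  then show "B = carrier G" using subgroup.subset[OF B] by blast
next
  assume e: "B = carrier G"
  have "carrier (G Mod B) = {B}"
    using coset_join2[OF _ B] one_closed unfolding FactGroup_def RCOSETS_def by (auto simp: e)
  then show "trivial_group (G Mod B)" using comm_group.axioms(2)[OF abelian_FactGroup[OF B]]
    by (auto simp: trivial_group_def FactGroup_def)
qed

lemma compose_hom:
  assumes X: "lmodule R X" and X': "lmodule R X'" and Y: "lmodule R Y" and d: "lh R X' X d"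
  shows "group_hom (hom_group R X Y) (hom_group R X' Y) (\<lambda>f. compose (carrier X') f d)"
proof -
  have "compose (carrier X') f d \<in> lhom R X' Y" if "f \<in> lhom R X Y" for f
    using that lh_cong[OF X' Y lh_comp[OF d], of f "compose (carrier X') f d"]
    by (auto simp: lhom_iff compose_eq)
  then have "(\<lambda>f. compose (carrier X') f d) \<in> hom (hom_group R X Y) (hom_group R X' Y)"
    using lh_closed[OF d] by (auto simp: hom_def hom_group_def compose_def intro!: restrict_ext)
  then show ?thesis
    by (simp add: group_hom_def group_hom_axioms_def comm_group.axioms(2) hom_group_comm X X' Y)
qed

text \<open>By exactness a cocycle in degree i + 1 is a map on P_(i+1) that vanishes on the kernel
  of d_i, hence a map on the image of d_i; it is a coboundary exactly if that map extends to
  P_i.\<close>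

lemma Ext_trivial_iff:
  fixes Y :: "('r, 'n, 'y) module_scheme"
  assumes Y: "lmodule R Y" and pr: "proj_resolution R X = (P, d)" and res: "is_proj_resolution R X P d e"
  shows "trivial_group (Ext R (Suc i) X Y) \<longleftrightarrow> xt R (P i) (d i ` carrier (P (Suc i))) Y"
proof -
  have PM: "lmodule R (P i)" for i using res by (auto simp: is_proj_resolution_def add_modules_iff fgproj_lmodule)
  have d: "lh R (P (Suc i)) (P i) (d i)" for i using res by (auto simp: is_proj_resolution_def lhom_iff)
  have ex: "d (Suc i) ` carrier (P (Suc (Suc i))) = a_kernel (P (Suc i)) (P i) (d i)" for i
    using res by (auto simp: is_proj_resolution_def)
  let ?\<delta> = "\<lambda>j f. compose (carrier (P (Suc j))) f (d j) :: (nat \<Rightarrow> 'r) \<Rightarrow> 'n"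
  let ?G = "hom_group R (P (Suc i)) Y"
  let ?Z = "kernel ?G (hom_group R (P (Suc (Suc i))) Y) (?\<delta> (Suc i))"
  let ?B = "?\<delta> i ` lhom R (P i) Y"
  interpret G: comm_group ?G by (rule hom_group_comm[OF PM Y])
  interpret h1: group_hom ?G "hom_group R (P (Suc (Suc i))) Y" "?\<delta> (Suc i)" by (rule compose_hom[OF PM PM Y d])
  interpret h0: group_hom "hom_group R (P i) Y" ?G "?\<delta> i" by (rule compose_hom[OF PM PM Y d])
  have Z: "subgroup ?Z ?G" by (rule h1.subgroup_kernel)
  have B: "subgroup ?B ?G" using h0.img_is_subgroup by (simp add: hom_group_def)
  have Z_iff: "f \<in> ?Z \<longleftrightarrow> f \<in> lhom R (P (Suc i)) Y \<and> (\<forall>x\<in>carrier (P (Suc i)). d i x = \<zero>\<^bsub>P i\<^esub> \<longrightarrow> f x = \<zero>\<^bsub>Y\<^esub>)" for f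
  proof -
    have "?\<delta> (Suc i) f = (\<lambda>x\<in>carrier (P (Suc (Suc i))). \<zero>\<^bsub>Y\<^esub>) \<longleftrightarrow> (\<forall>x\<in>d (Suc i) ` carrier (P (Suc (Suc i))). f x = \<zero>\<^bsub>Y\<^esub>)"
      unfolding compose_def restrict_def fun_eq_iff by auto
    then show ?thesis unfolding ex by (auto simp: kernel_def hom_group_def a_kernel_def')
  qed
  have BZ: "?B \<subseteq> ?Z"
  proof
    fix f assume "f \<in> ?B"
    then obtain g where g: "g \<in> lhom R (P i) Y" "f = ?\<delta> i g" by blast
    have "f \<in> lhom R (P (Suc i)) Y" using subgroup.subset[OF B] \<open>f \<in> ?B\<close> by (auto simp: hom_group_def)
    moreover have "g \<zero>\<^bsub>P i\<^esub> = \<zero>\<^bsub>Y\<^esub>" using g(1) lh_zero[OF PM Y, of i g] by (simp add: lhom_iff)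
    ultimately show "f \<in> ?Z" using g(2) unfolding Z_iff by (auto simp: compose_eq)
  qed
  interpret Zg: comm_group "?G\<lparr>carrier := ?Z\<rparr>" 
  proof (rule group.group_comm_groupI[OF G.subgroup_imp_group[OF Z]])
    fix x y assume "x \<in> carrier (?G\<lparr>carrier := ?Z\<rparr>)" "y \<in> carrier (?G\<lparr>carrier := ?Z\<rparr>)"
    then have "x \<in> carrier ?G" "y \<in> carrier ?G" using subgroup.subset[OF Z] by auto
    then show "x \<otimes>\<^bsub>?G\<lparr>carrier := ?Z\<rparr>\<^esub> y = y \<otimes>\<^bsub>?G\<lparr>carrier := ?Z\<rparr>\<^esub> x" using G.m_comm by simp
  qed
  have BZ': "subgroup ?B (?G\<lparr>carrier := ?Z\<rparr>)" by (rule G.subgroup_incl[OF B Z BZ])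
  have "trivial_group (Ext R (Suc i) X Y) \<longleftrightarrow> ?B = ?Z"
    using Zg.trivial_factor_iff[OF BZ'] by (simp add: Ext_def pr)
  also have "\<dots> \<longleftrightarrow> xt R (P i) (d i ` carrier (P (Suc i))) Y"
  proof
    assume e: "?B = ?Z"
    show "xt R (P i) (d i ` carrier (P (Suc i))) Y" unfolding xt_def
    proof (intro allI impI)
      fix f assume f: "lh R ((P i)\<lparr>carrier := d i ` carrier (P (Suc i))\<rparr>) Y f"
      have d': "lh R (P (Suc i)) ((P i)\<lparr>carrier := d i ` carrier (P (Suc i))\<rparr>) (d i)"
        by (rule lh_cod[OF d]) auto
      let ?f = "restrict (\<lambda>x. f (d i x)) (carrier (P (Suc i)))"
      have "f \<zero>\<^bsub>P i\<^esub> = \<zero>\<^bsub>Y\<^esub>"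
        using lh_zero[OF submod_lmodule[OF PM submod_image[OF PM PM d submod_carrier[OF PM]]] Y f] by simp
      moreover have "lh R (P (Suc i)) Y ?f" by (rule lh_cong[OF PM Y lh_comp[OF d' f]]) simp
      ultimately have "?f \<in> ?Z" unfolding Z_iff lhom_iff by auto
      then obtain g where g: "g \<in> lhom R (P i) Y" "?f = ?\<delta> i g" using e by blast
      have "g (d i x) = f (d i x)" if "x \<in> carrier (P (Suc i))" for x
        using fun_cong[OF g(2), of x] that by (simp add: compose_eq)
      then show "\<exists>g. lh R (P i) Y g \<and> (\<forall>x\<in>d i ` carrier (P (Suc i)). g x = f x)"
        using g(1) by (auto simp: lhom_iff)
    qed
  next
    assume x: "xt R (P i) (d i ` carrier (P (Suc i))) Y"
    have "?Z \<subseteq> ?B"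
    proof
      fix f assume "f \<in> ?Z"
      then have f: "lh R (P (Suc i)) Y f" "f \<in> extensional (carrier (P (Suc i)))"
        and k: "\<And>x. x \<in> carrier (P (Suc i)) \<Longrightarrow> d i x = \<zero>\<^bsub>P i\<^esub> \<Longrightarrow> f x = \<zero>\<^bsub>Y\<^esub>" unfolding Z_iff lhom_iff by auto
      let ?D = "(P i)\<lparr>carrier := d i ` carrier (P (Suc i))\<rparr>"
      have D: "lmodule R ?D" by (rule submod_lmodule[OF PM submod_image[OF PM PM d submod_carrier[OF PM]]])
      have d': "lh R (P (Suc i)) ?D (d i)" by (rule lh_cod[OF d]) auto
      \<comment> \<open>The cocycle descends to the image of d_i, where the extension hypothesis
        applies.\<close>
      obtain g where g: "lh R ?D Y g" "\<And>x. x \<in> carrier (P (Suc i)) \<Longrightarrow> g (d i x) = f x"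
        by (rule lh_factor[OF PM Y D d' _ f(1)]) (auto simp: k)
      obtain h where h: "lh R (P i) Y h" "\<And>x. x \<in> d i ` carrier (P (Suc i)) \<Longrightarrow> h x = g x"
        using x g(1) unfolding xt_def by blast
      let ?h = "restrict h (carrier (P i))"
      have "?h \<in> lhom R (P i) Y" unfolding lhom_iff using lh_cong[OF PM Y h(1), of ?h] by simp
      moreover have "f = ?\<delta> i ?h"
        by (rule extensionalityI[OF f(2)]) (auto simp: compose_def g(2) h(2) lh_closed[OF d])
      ultimately show "f \<in> ?B" by blast
    qed
    then show "?B = ?Z" using BZ by blast
  qed
  finally show ?thesis .
qed

text \<open>The chosen resolution is cut into the presentations P_0 -> X and P_(i+1) -> D_i, where
  D_i is the image of d_i. Along these, \<open>ev_Suc\<close> unfolds \<open>ev R n X\<close> into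
  extension conditions on the D_i, which are the vanishing statements of
  \<open>Ext_trivial_iff\<close>.\<close>

lemma perp_iff_ev:
  assumes N: "noeth R" shows "X \<in> perp R \<longleftrightarrow> (\<forall>n. ev R n X)"
proof (cases "lmodule R X \<and> fg_module R X")
  case False then show ?thesis using ev_0[of R X] by (auto simp: perp_def)
next
  case True
  then have X: "lmodule R X" and fg: "fg_module R X" by auto
  have RM: "lmodule R (reg_module R)" by (rule reg_lmodule[OF noeth_ring[OF N]])
  obtain P d where pr: "proj_resolution R X = (P, d)" by (cases "proj_resolution R X")
  \<comment> \<open>The choice made in \<open>proj_resolution\<close> is meaningful only once some
    resolution exists.\<close>
  have "\<exists>Pd. case Pd of (P, d) \<Rightarrow> \<exists>e. is_proj_resolution R X P d e"
    using resolution_exists[OF N X fg] by auto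
  from someI_ex[OF this] have "\<exists>e. is_proj_resolution R X P d e"
    using pr by (simp add: proj_resolution_def)
  then obtain e where res: "is_proj_resolution R X P d e" by blast
  let ?D = "\<lambda>i. d i ` carrier (P (Suc i))"
  have PM: "fgproj R (P i)" "lmodule R (P i)" for i using res
    by (auto simp: is_proj_resolution_def add_modules_iff fgproj_lmodule)
  have d: "lh R (P (Suc i)) (P i) (d i)" for i using res by (auto simp: is_proj_resolution_def lhom_iff)
  have ex: "?D (Suc i) = a_kernel (P (Suc i)) (P i) (d i)" for i
    using res by (auto simp: is_proj_resolution_def)
  have ex0: "?D 0 = a_kernel (P 0) X e" using res by (auto simp: is_proj_resolution_def)
  have p0: "pres R X (P 0) e" using res PM by (auto simp: is_proj_resolution_def pres_def lhom_iff)
  have D: "lmodule R ((P i)\<lparr>carrier := ?D i\<rparr>)" for i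
    by (rule submod_lmodule[OF PM(2) submod_image[OF PM(2) PM(2) d submod_carrier[OF PM(2)]]])
  have p: "pres R ((P i)\<lparr>carrier := ?D i\<rparr>) (P (Suc i)) (d i)" for i
    unfolding pres_def by (auto simp: PM intro: lh_cod[OF d])
  have k: "a_kernel (P (Suc i)) ((P i)\<lparr>carrier := ?D i\<rparr>) (d i) = ?D (Suc i)" for i
    unfolding ex by (simp add: a_kernel_def')
  have S: "ev R (Suc n) ((P i)\<lparr>carrier := ?D i\<rparr>) \<longleftrightarrow> xt R (P (Suc i)) (?D (Suc i)) (reg_module R) \<and>
      ev R n ((P (Suc i))\<lparr>carrier := ?D (Suc i)\<rparr>)" for i n
    using ev_Suc[OF N D p, of n i] unfolding k .
  have S0: "ev R (Suc n) X \<longleftrightarrow> xt R (P 0) (?D 0) (reg_module R) \<and> ev R n ((P 0)\<lparr>carrier := ?D 0\<rparr>)" for n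
    using ev_Suc[OF N X p0, of n] unfolding ex0 .
  have "X \<in> perp R \<longleftrightarrow> (\<forall>i. trivial_group (Ext R (Suc i) X (reg_module R)))"
  proof -
    have "(\<forall>i\<ge>1. trivial_group (Ext R i X (reg_module R))) \<longleftrightarrow> (\<forall>i. trivial_group (Ext R (Suc i) X (reg_module R)))"
      by (metis One_nat_def Suc_le_D le_add1 plus_1_eq_Suc)
    then show ?thesis using True by (simp add: perp_def)
  qed
  also have "\<dots> \<longleftrightarrow> (\<forall>i. xt R (P i) (?D i) (reg_module R))"
    using Ext_trivial_iff[OF RM pr res] by blast
  also have "\<dots> \<longleftrightarrow> (\<forall>n. ev R n X)"
  proof
    assume a: "\<forall>i. xt R (P i) (?D i) (reg_module R)"
    have "ev R n ((P i)\<lparr>carrier := ?D i\<rparr>)" for n i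
    proof (induction n arbitrary: i)
      case 0 show ?case using D pres_fg[OF D p] by (simp add: ev_0)
    next
      case (Suc n) then show ?case using S a by simp
    qed
    then have "ev R (Suc n) X" for n using S0 a by simp
    then show "\<forall>n. ev R n X" using True ev_0 by (metis not0_implies_Suc)
  next
    assume a: "\<forall>n. ev R n X"
    have e: "ev R n ((P i)\<lparr>carrier := ?D i\<rparr>)" for n i
    proof (induction i arbitrary: n)
      case 0 show ?case using a S0 by blast
    next
      case (Suc i) then show ?case using S by blast
    qed
    show "\<forall>i. xt R (P i) (?D i) (reg_module R)"
    proof
      fix i show "xt R (P i) (?D i) (reg_module R)" using a S0 e S by (cases i) blast+
    qed
  qed
  finally show ?thesis .
qed

section \<open>Artin algebras are Noetherian\<close>

lemma submod_in: assumes "submod R X H" shows "submod R (X\<lparr>carrier := H\<rparr>) G \<longleftrightarrow> submod R X G \<and> G \<subseteq> H"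
  using assms by (auto simp: submod_def)

lemma fgE_sub:
  assumes X: "lmodule R X" and H: "submod R X H" and fg: "fg_module R (X\<lparr>carrier := H\<rparr>)"
  obtains S where "finite S" "S \<subseteq> H" "\<And>G. submod R X G \<Longrightarrow> S \<subseteq> G \<Longrightarrow> H \<subseteq> G"
proof -
  obtain S where S: "finite S" "S \<subseteq> carrier (X\<lparr>carrier := H\<rparr>)"
    and g: "\<And>G. submod R (X\<lparr>carrier := H\<rparr>) G \<Longrightarrow> S \<subseteq> G \<Longrightarrow> carrier (X\<lparr>carrier := H\<rparr>) \<subseteq> G"
    by (rule fgE[OF submod_lmodule[OF X H] fg]) (rule that, assumption+)
  show thesis
  proof (rule that)
    show "S \<subseteq> H" using S(2) by simp
    fix G assume G: "submod R X G" "S \<subseteq> G"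
    have "carrier (X\<lparr>carrier := H\<rparr>) \<subseteq> G \<inter> H"
      by (rule g) (use submod_Int[OF G(1) H] submod_in[OF H] G(2) S(2) in auto)
    then show "H \<subseteq> G" by simp
  qed (rule S)
qed

lemma fgI_sub:
  assumes X: "lmodule R X" and H: "submod R X H" and S: "finite S" "S \<subseteq> H"
    and g: "\<And>G. submod R X G \<Longrightarrow> G \<subseteq> H \<Longrightarrow> S \<subseteq> G \<Longrightarrow> H \<subseteq> G"
  shows "fg_module R (X\<lparr>carrier := H\<rparr>)"
proof (rule fgI[OF submod_lmodule[OF X H] S(1)])
  fix G assume G: "submod R (X\<lparr>carrier := H\<rparr>) G" "S \<subseteq> G"
  show "carrier (X\<lparr>carrier := H\<rparr>) \<subseteq> G" using g[of G] G submod_in[OF H] by simp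
qed (use S(2) in simp)

text \<open>Generators of the part of H killed by q, together with preimages of generators of q(H),
  generate H.\<close>

lemma fg_extension:
  assumes X: "lmodule R X" and Y: "lmodule R Y" and q: "lh R X Y q" and H: "submod R X H"
    and k: "fg_module R (X\<lparr>carrier := {h \<in> H. q h = \<zero>\<^bsub>Y\<^esub>}\<rparr>)" and i: "fg_module R (Y\<lparr>carrier := q ` H\<rparr>)"
  shows "fg_module R (X\<lparr>carrier := H\<rparr>)"
proof -
  interpret X: lmodule R X by fact
  interpret Y: lmodule R Y by fact
  have Hc: "\<And>x. x \<in> H \<Longrightarrow> x \<in> carrier X" using submod_subset[OF H] by blast
  let ?N = "{h \<in> H. q h = \<zero>\<^bsub>Y\<^esub>}"
  have N: "submod R X ?N"
    using H lh_zero[OF X Y q] by (auto simp: submod_def lh_add[OF q] lh_smult[OF q] subset_iff)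
  obtain S where S: "finite S" "S \<subseteq> ?N" "\<And>G. submod R X G \<Longrightarrow> S \<subseteq> G \<Longrightarrow> ?N \<subseteq> G"
    by (rule fgE_sub[OF X N k]) (rule that, assumption+)
  obtain T where T: "finite T" "T \<subseteq> q ` H" "\<And>G. submod R Y G \<Longrightarrow> T \<subseteq> G \<Longrightarrow> q ` H \<subseteq> G"
    by (rule fgE_sub[OF Y submod_image[OF X Y q H] i]) (rule that, assumption+)
  obtain U where U: "finite U" "U \<subseteq> H" "T = q ` U" using finite_subset_image[OF T(1,2)] by auto
  show ?thesis
  proof (rule fgI_sub[OF X H, of "S \<union> U"])
    show "finite (S \<union> U)" using S(1) U(1) by simp
    show "S \<union> U \<subseteq> H" using S(2) U(2) by auto
    fix G assume G: "submod R X G" "G \<subseteq> H" and SU: "S \<union> U \<subseteq> G"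
    have N1: "?N \<subseteq> G" by (rule S(3)[OF G(1)]) (use SU in simp)
    have qG: "q ` H \<subseteq> q ` G" by (rule T(3)[OF submod_image[OF X Y q G(1)]]) (use U(3) SU in auto)
    show "H \<subseteq> G"
    proof
      fix h assume h: "h \<in> H"
      then have "q h \<in> q ` G" using qG by auto
      then obtain g where g: "g \<in> G" "q g = q h" by auto
      then have gH: "g \<in> H" using G(2) by auto
      have c: "h \<in> H" "g \<in> carrier X" "h \<in> carrier X" using h gH Hc by auto
      have "h \<ominus>\<^bsub>X\<^esub> g \<in> H" unfolding X.M.minus_eq by (rule submod_add[OF H c(1) X.submod_neg[OF H gH]])
      moreover have "q (h \<ominus>\<^bsub>X\<^esub> g) = \<zero>\<^bsub>Y\<^esub>"
        using lh_minus[OF X Y q c(3,2)] g(2) lh_closed[OF q c(3)] by (simp add: Y.M.minus_eq Y.M.r_neg)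
      ultimately have "h \<ominus>\<^bsub>X\<^esub> g \<in> G" using N1 by blast
      then have "(h \<ominus>\<^bsub>X\<^esub> g) \<oplus>\<^bsub>X\<^esub> g \<in> G" using g(1) submod_add[OF G(1)] by blast
      then show "h \<in> G" using c by (simp add: X.M.minus_eq X.M.a_assoc X.M.l_neg)
    qed
  qed
qed

lemma fg_zero: assumes "lmodule R X" "carrier X = {\<zero>\<^bsub>X\<^esub>}" shows "fg_module R X"
  by (rule fgI[OF assms(1), of "{}"]) (use assms(2) in \<open>auto simp: submod_def\<close>)

text \<open>Forgetting the last coordinate maps H into the free module of smaller rank, and the part
  of H that dies is isomorphic, by its last coordinate, to a left ideal. Both ends are finitely
  generated, so \<open>fg_extension\<close> applies twice.\<close>

lemma free_Suc_fg:
  assumes R: "ring R" and ideals: "\<And>H. submod R (reg_module R) H \<Longrightarrow> fg_module R ((reg_module R)\<lparr>carrier := H\<rparr>)"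
  shows "submod R (free_module R n) H \<Longrightarrow> fg_module R ((free_module R n)\<lparr>carrier := H\<rparr>)"
proof (induction n arbitrary: H)
  case 0
  have "H = {\<zero>\<^bsub>free_module R 0\<^esub>}" using submod_subset[OF 0] submod_zero[OF 0] by (auto simp: restrict_def)
  then show ?case using submod_lmodule[OF free_lmodule[OF R] 0] by (intro fg_zero) auto
next
  case (Suc n)
  let ?F = "free_module R (Suc n)" and ?F' = "free_module R n"
  have F: "lmodule R ?F" and F': "lmodule R ?F'" by (rule free_lmodule[OF R])+
  let ?q = "\<lambda>x. restrict x {..<n}"
  have q: "lh R ?F ?F' ?q" by (rule lhI) (simp add: PiE_iff, simp add: fun_eq_iff, simp add: fun_eq_iff)
  let ?N = "{h \<in> H. ?q h = \<zero>\<^bsub>?F'\<^esub>}"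
  have l: "lh R ?F (reg_module R) (\<lambda>x. x n)" by (intro lhI) auto
  have N: "submod R ?F ?N"
    using submod_Int[OF Suc.prems submod_kernel[OF F F' q]] submod_subset[OF Suc.prems]
    by (auto simp: a_kernel_def' Int_def elim!: back_subst[of "submod R ?F"])
  have "fg_module R (?F\<lparr>carrier := ?N\<rparr>)"
  proof (rule fg_extension[OF F reg_lmodule[OF R] l N])
    show "fg_module R ((reg_module R)\<lparr>carrier := (\<lambda>x. x n) ` ?N\<rparr>)"
      by (rule ideals[OF submod_image[OF F reg_lmodule[OF R] l N]])
    have "h = \<zero>\<^bsub>?F\<^esub>" if h: "h \<in> ?N" "h n = \<zero>\<^bsub>R\<^esub>" for h
    proof
      fix i
      have "h \<in> carrier ?F" using h(1) submod_subset[OF N] by blast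
      moreover have "?q h i = \<zero>\<^bsub>?F'\<^esub> i" using h(1) by simp
      ultimately show "h i = \<zero>\<^bsub>?F\<^esub> i" using h(2) by (cases "i < n"; cases "i = n") (auto simp: PiE_def extensional_def)
    qed
    moreover have "\<zero>\<^bsub>?F\<^esub> \<in> ?N" by (rule submod_zero[OF N])
    ultimately have "{h \<in> ?N. h n = \<zero>\<^bsub>reg_module R\<^esub>} = {\<zero>\<^bsub>?F\<^esub>}" by auto
    then show "fg_module R (?F\<lparr>carrier := {h \<in> ?N. h n = \<zero>\<^bsub>reg_module R\<^esub>}\<rparr>)"
      using submod_lmodule[OF F, of "{\<zero>\<^bsub>?F\<^esub>}"] lmodule.ls_zero[OF F] abelian_monoid.l_zero[OF abelian_group.axioms(1)[OF lmodule_group[OF F]]]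
        abelian_monoid.zero_closed[OF abelian_group.axioms(1)[OF lmodule_group[OF F]]]
      by (intro fg_zero) (simp_all add: submod_def del: free_simps)
  qed
  then show ?case
    by (rule fg_extension[OF F F' q Suc.prems]) (rule Suc.IH[OF submod_image[OF F F' q Suc.prems]])
qed

lemma artinian_min:
  assumes A: "artinian_cring K" and ne: "\<I> \<noteq> {}" and id: "\<And>I. I \<in> \<I> \<Longrightarrow> ideal I K"
  shows "\<exists>I\<in>\<I>. \<forall>J\<in>\<I>. J \<subseteq> I \<longrightarrow> J = I"
proof (rule ccontr)
  assume "\<not> ?thesis"
  then have n: "\<exists>J\<in>\<I>. J \<subset> I" if "I \<in> \<I>" for I using that by blast
  obtain I0 where "I0 \<in> \<I>" using ne by blast
  then have "\<exists>J. \<forall>n. J n \<in> \<I> \<and> J (Suc n) \<subset> J n"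
    using dependent_nat_choice[of "\<lambda>_ I. I \<in> \<I>" "\<lambda>_ I J. J \<subset> I"] n by blast
  then obtain J :: "nat \<Rightarrow> 'a set" where J: "\<And>n. J n \<in> \<I>" "\<And>n. J (Suc n) \<subset> J n" by blast
  then have "\<exists>n. \<forall>m\<ge>n. J m = J n" using A id unfolding artinian_cring_def by blast
  then show False using J(2) by (metis le_Suc_eq less_irrefl order.refl psubset_eq)
qed

lemma submod_ideal: assumes "cring K" "submod K (reg_module K) I" shows "ideal I K"
proof -
  interpret cring K by fact
  interpret X: lmodule K "reg_module K" by (rule reg_lmodule[OF ring_axioms])
  show ?thesis
  proof (rule idealI)
    show "subgroup I (add_monoid K)"
    proof
      show "inv\<^bsub>add_monoid K\<^esub> x \<in> I" if "x \<in> I" for x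
      proof -
        have "x \<in> carrier K" using that assms(2) by (auto simp: submod_def)
        then have "\<ominus>\<^bsub>K\<^esub> x = (\<ominus>\<^bsub>K\<^esub> \<one>\<^bsub>K\<^esub>) \<otimes>\<^bsub>K\<^esub> x" by (simp add: l_minus)
        then show ?thesis using assms(2) that by (simp add: submod_def a_inv_def[symmetric])
      qed
    qed (use assms(2) in \<open>auto simp: submod_def\<close>)
  next
    fix a x assume a: "a \<in> I" "x \<in> carrier K"
    then show "x \<otimes>\<^bsub>K\<^esub> a \<in> I" using assms(2) by (auto simp: submod_def)
    then show "a \<otimes>\<^bsub>K\<^esub> x \<in> I" using a assms(2) m_comm[of a x] by (auto simp: submod_def)
  qed (rule ring_axioms)
qed

lemma submod_adjoin:
  assumes X: "lmodule R X" and H: "submod R X H" and s: "s \<in> carrier X"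
  shows "submod R X {h \<oplus>\<^bsub>X\<^esub> c \<odot>\<^bsub>X\<^esub> s |h c. h \<in> H \<and> c \<in> carrier R}" (is "submod R X ?G")
    and "insert s H \<subseteq> {h \<oplus>\<^bsub>X\<^esub> c \<odot>\<^bsub>X\<^esub> s |h c. h \<in> H \<and> c \<in> carrier R}"
proof -
  interpret X: lmodule R X by fact
  note Hx = subsetD[OF submod_subset[OF H]] and H0 = submod_zero[OF H]
  show "submod R X ?G" unfolding submod_def
  proof (intro conjI ballI)
    show "?G \<subseteq> carrier X" using Hx s by auto
    show "\<zero>\<^bsub>X\<^esub> \<in> ?G" using H0 s by (auto intro!: exI[of _ "\<zero>\<^bsub>X\<^esub>"] exI[of _ "\<zero>\<^bsub>R\<^esub>"])
    show "x \<oplus>\<^bsub>X\<^esub> y \<in> ?G" if x: "x \<in> ?G" and y: "y \<in> ?G" for x y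
    proof -
      obtain h c where x: "x = h \<oplus>\<^bsub>X\<^esub> c \<odot>\<^bsub>X\<^esub> s" "h \<in> H" "c \<in> carrier R" using x by blast
      obtain h' c' where y: "y = h' \<oplus>\<^bsub>X\<^esub> c' \<odot>\<^bsub>X\<^esub> s" "h' \<in> H" "c' \<in> carrier R" using y by blast
      have "x \<oplus>\<^bsub>X\<^esub> y = (h \<oplus>\<^bsub>X\<^esub> h') \<oplus>\<^bsub>X\<^esub> (c \<oplus>\<^bsub>R\<^esub> c') \<odot>\<^bsub>X\<^esub> s"
        using x y s Hx by (simp add: X.lsmult_l_distr X.M.a_ac)
      then show ?thesis using x y submod_add[OF H] by auto
    qed
    show "r \<odot>\<^bsub>X\<^esub> x \<in> ?G" if r: "r \<in> carrier R" and x: "x \<in> ?G" for r x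
    proof -
      obtain h c where x: "x = h \<oplus>\<^bsub>X\<^esub> c \<odot>\<^bsub>X\<^esub> s" "h \<in> H" "c \<in> carrier R" using x by blast
      have "r \<odot>\<^bsub>X\<^esub> x = (r \<odot>\<^bsub>X\<^esub> h) \<oplus>\<^bsub>X\<^esub> (r \<otimes>\<^bsub>R\<^esub> c) \<odot>\<^bsub>X\<^esub> s"
        using x s Hx r by (simp add: X.lsmult_r_distr X.lsmult_assoc)
      then show ?thesis using x r submod_smult[OF H r] by auto
    qed
  qed
  have "s \<in> ?G" using H0 s by (auto intro!: exI[of _ "\<zero>\<^bsub>X\<^esub>"] exI[of _ "\<one>\<^bsub>R\<^esub>"])
  moreover have "x \<in> ?G" if "x \<in> H" for x using that Hx[OF that] s by (auto intro!: exI[of _ x] exI[of _ "\<zero>\<^bsub>R\<^esub>"])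
  ultimately show "insert s H \<subseteq> ?G" by blast
qed

text \<open>An ideal \<open>I\<close> that is minimal among those that are not finitely generated satisfies \<open>x I = I\<close> or
  \<open>x I = 0\<close> for every \<open>x\<close>, so it is a vector space over the field \<open>K/ann(I)\<close> all of whose proper
  subspaces are finitely generated; a complement of a line contradicts this.\<close>

lemma artinian_ideal_fg:
  assumes A: "artinian_cring K" and H: "submod K (reg_module K) H"
  shows "fg_module K ((reg_module K)\<lparr>carrier := H\<rparr>)"
proof (rule ccontr)
  assume nfg: "\<not> ?thesis"
  have C: "cring K" using A by (simp add: artinian_cring_def)
  interpret K: cring K by fact
  let ?R = "reg_module K"
  have R: "lmodule K ?R" by (rule reg_lmodule[OF K.ring_axioms])
  interpret R: lmodule K ?R by fact
  let ?fg = "\<lambda>I. fg_module K (?R\<lparr>carrier := I\<rparr>)"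
  obtain I where I: "submod K ?R I" "\<not> ?fg I" and min: "\<And>J. submod K ?R J \<Longrightarrow> J \<subset> I \<Longrightarrow> ?fg J"
  proof -
    have "\<exists>I\<in>{I. submod K ?R I \<and> \<not> ?fg I}. \<forall>J\<in>{I. submod K ?R I \<and> \<not> ?fg I}. J \<subseteq> I \<longrightarrow> J = I"
      by (rule artinian_min[OF A]) (use H nfg submod_ideal[OF C] in auto)
    then show thesis using that by auto
  qed
  have Ic: "\<And>x. x \<in> I \<Longrightarrow> x \<in> carrier K" using submod_subset[OF I(1)] by auto
  have mult: "lh K ?R ?R (\<lambda>y. x \<otimes>\<^bsub>K\<^esub> y)" if "x \<in> carrier K" for x
    by (rule lhI) (use that in \<open>auto simp: K.r_distr K.m_lcomm\<close>)
  \<comment> \<open>If x I and the annihilator of x in I were both proper in I, both would be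
    finitely generated by minimality of I, and then so would I.\<close>
  have dich: "(\<otimes>\<^bsub>K\<^esub>) x ` I = I \<or> (\<forall>i\<in>I. x \<otimes>\<^bsub>K\<^esub> i = \<zero>\<^bsub>K\<^esub>)" if x: "x \<in> carrier K" for x
  proof (rule ccontr)
    assume c: "\<not> ?thesis"
    let ?N = "{h \<in> I. x \<otimes>\<^bsub>K\<^esub> h = \<zero>\<^bsub>?R\<^esub>}"
    have "submod K ?R ?N"
      using submod_Int[OF I(1) submod_kernel[OF R R mult[OF x]]] Ic
      by (auto simp: a_kernel_def' Int_def elim!: back_subst[of "submod K ?R"])
    then have "?fg ?N" by (rule min) (use c in auto)
    moreover have "(\<otimes>\<^bsub>K\<^esub>) x ` I \<subset> I" using c submod_smult[OF I(1) x] by auto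
    then have "?fg ((\<otimes>\<^bsub>K\<^esub>) x ` I)" by (rule min[OF submod_image[OF R R mult[OF x] I(1)]])
    ultimately show False using I(2) fg_extension[OF R R mult[OF x] I(1)] by blast
  qed
  \<comment> \<open>The chain of ideals generated by the powers of x stops, so x^n = x^(n+1) y for
    some n. As x^n I = I, this y inverts x on I.\<close>
  have invert: "\<exists>y\<in>carrier K. \<forall>i\<in>I. y \<otimes>\<^bsub>K\<^esub> (x \<otimes>\<^bsub>K\<^esub> i) = i" if x: "x \<in> carrier K" and xI: "(\<otimes>\<^bsub>K\<^esub>) x ` I = I" for x
  proof -
    let ?J = "\<lambda>n::nat. (\<otimes>\<^bsub>K\<^esub>) (x [^]\<^bsub>K\<^esub> n) ` carrier K"
    have sJ: "submod K ?R (?J n)" for n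
      using submod_image[OF R R mult[of "x [^]\<^bsub>K\<^esub> n"] submod_carrier[OF R]] x by simp
    have "?J (Suc n) \<subseteq> ?J n" for n using x by (auto simp: K.m_assoc)
    then obtain n where n: "\<forall>m\<ge>n. ?J m = ?J n"
      using A submod_ideal[OF C sJ] unfolding artinian_cring_def by meson
    have "x [^]\<^bsub>K\<^esub> n \<otimes>\<^bsub>K\<^esub> \<one>\<^bsub>K\<^esub> \<in> ?J n" by blast
    moreover have "?J (Suc n) = ?J n" by (rule n[rule_format]) simp
    moreover have "x [^]\<^bsub>K\<^esub> n \<otimes>\<^bsub>K\<^esub> \<one>\<^bsub>K\<^esub> = x [^]\<^bsub>K\<^esub> n" using x by simp
    ultimately have "x [^]\<^bsub>K\<^esub> n \<in> ?J (Suc n)" by metis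
    then obtain y where y: "y \<in> carrier K" "x [^]\<^bsub>K\<^esub> n = x [^]\<^bsub>K\<^esub> Suc n \<otimes>\<^bsub>K\<^esub> y" by blast
    have pI: "(\<otimes>\<^bsub>K\<^esub>) (x [^]\<^bsub>K\<^esub> m) ` I = I" for m :: nat
    proof (induction m)
      case 0 then show ?case using Ic by force
    next
      case (Suc m)
      have "(\<otimes>\<^bsub>K\<^esub>) (x [^]\<^bsub>K\<^esub> Suc m) ` I = (\<otimes>\<^bsub>K\<^esub>) (x [^]\<^bsub>K\<^esub> m) ` ((\<otimes>\<^bsub>K\<^esub>) x ` I)"
        unfolding image_image by (rule image_cong) (use x Ic in \<open>auto simp: K.m_assoc\<close>)
      then show ?case using Suc xI by simp
    qed
    have "y \<otimes>\<^bsub>K\<^esub> (x \<otimes>\<^bsub>K\<^esub> i) = i" if "i \<in> I" for i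
    proof -
      have "i \<in> (\<otimes>\<^bsub>K\<^esub>) (x [^]\<^bsub>K\<^esub> n) ` I" using that unfolding pI .
      then obtain j where j: "j \<in> I" "i = x [^]\<^bsub>K\<^esub> n \<otimes>\<^bsub>K\<^esub> j" by (elim imageE) simp
      have "y \<otimes>\<^bsub>K\<^esub> (x \<otimes>\<^bsub>K\<^esub> i) = (x [^]\<^bsub>K\<^esub> Suc n \<otimes>\<^bsub>K\<^esub> y) \<otimes>\<^bsub>K\<^esub> j"
        using j x y(1) Ic[OF j(1)] by (simp add: K.m_ac)
      also have "\<dots> = i" by (simp only: y(2)[symmetric] j(2)[symmetric])
      finally show ?thesis .
    qed
    then show ?thesis using y(1) by blast
  qed
  have "\<exists>i0\<in>I. i0 \<noteq> \<zero>\<^bsub>K\<^esub>"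
  proof (rule ccontr)
    assume "\<not> ?thesis"
    then have i: "i = \<zero>\<^bsub>K\<^esub>" if "i \<in> I" for i using that by simp
    have "I = {\<zero>\<^bsub>K\<^esub>}"
      by (intro equalityI subsetI) (simp add: i, use submod_zero[OF I(1)] in simp)
    then have "?fg I" by (intro fg_zero[OF submod_lmodule[OF R I(1)]]) simp
    then show False by (rule notE[OF I(2)])
  qed
  then obtain i0 where i0: "i0 \<in> I" "i0 \<noteq> \<zero>\<^bsub>K\<^esub>" by blast
  \<comment> \<open>A submodule of I that is maximal with i0 outside it plays the complement of the
    line through i0.\<close>
  let ?A = "{D. submod K ?R D \<and> D \<subseteq> I \<and> i0 \<notin> D}"
  have "\<exists>D\<in>?A. \<forall>E\<in>?A. D \<subseteq> E \<longrightarrow> E = D"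
  proof (rule subset_Zorn_nonempty)
    have "{\<zero>\<^bsub>K\<^esub>} \<in> ?A" using i0 submod_zero[OF I(1)] by (auto simp: submod_def)
    then show "?A \<noteq> {}" by blast
    fix \<C> assume ne: "\<C> \<noteq> {}" and ch: "subset.chain ?A \<C>"
    have C1: "\<And>D. D \<in> \<C> \<Longrightarrow> D \<in> ?A" and C2: "\<And>D E. D \<in> \<C> \<Longrightarrow> E \<in> \<C> \<Longrightarrow> D \<subseteq> E \<or> E \<subseteq> D"
      using ch by (auto simp: subset_chain_def)
    have C1': "\<And>D. D \<in> \<C> \<Longrightarrow> submod K ?R D" using C1 by simp
    have "submod K ?R (\<Union>\<C>)" unfolding submod_def
    proof (intro conjI ballI)
      show "\<Union>\<C> \<subseteq> carrier ?R" using C1 unfolding submod_def by blast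
      show "\<zero>\<^bsub>?R\<^esub> \<in> \<Union>\<C>" using C1 ne unfolding submod_def by blast
      show "x \<oplus>\<^bsub>?R\<^esub> y \<in> \<Union>\<C>" if xC: "x \<in> \<Union>\<C>" and yC: "y \<in> \<Union>\<C>" for x y
      proof -
        obtain D E where DE: "x \<in> D" "D \<in> \<C>" "y \<in> E" "E \<in> \<C>" using xC yC by (elim UnionE)
        have "\<exists>D'\<in>\<C>. x \<in> D' \<and> y \<in> D'" using C2[OF DE(2,4)]
        proof
          assume "D \<subseteq> E" then show ?thesis using DE by (intro bexI[of _ E]) auto
        next
          assume "E \<subseteq> D" then show ?thesis using DE by (intro bexI[of _ D]) auto
        qed
        then obtain D' where D': "D' \<in> \<C>" "x \<in> D'" "y \<in> D'" by (elim bexE conjE)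
        show ?thesis by (rule UnionI[OF D'(1) submod_add[OF C1'[OF D'(1)] D'(2,3)]])
      qed
      show "r \<odot>\<^bsub>?R\<^esub> x \<in> \<Union>\<C>" if r: "r \<in> carrier K" and x: "x \<in> \<Union>\<C>" for r x
      proof -
        obtain D where D: "D \<in> \<C>" "x \<in> D" using x by (elim UnionE)
        show ?thesis by (rule UnionI[OF D(1) submod_smult[OF C1'[OF D(1)] r D(2)]])
      qed
    qed
    then show "\<Union>\<C> \<in> ?A" using C1 by auto
  qed
  then obtain D where D: "submod K ?R D" "D \<subseteq> I" "i0 \<notin> D"
    and Dmax: "\<And>E. submod K ?R E \<Longrightarrow> E \<subseteq> I \<Longrightarrow> i0 \<notin> E \<Longrightarrow> D \<subseteq> E \<Longrightarrow> E = D" by auto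
  have Dc: "\<And>x. x \<in> D \<Longrightarrow> x \<in> carrier K" using D(2) Ic by blast
  let ?S = "\<lambda>y. {d \<oplus>\<^bsub>K\<^esub> c \<otimes>\<^bsub>K\<^esub> y | d c. d \<in> D \<and> c \<in> carrier K}"
  have sum: "submod K ?R (?S y)" and sub: "insert y D \<subseteq> ?S y" if "y \<in> I" for y
    using submod_adjoin[OF R D(1), of y] Ic[OF that] by simp_all
  have SI: "z \<in> ?S y" if "z = d \<oplus>\<^bsub>K\<^esub> c \<otimes>\<^bsub>K\<^esub> y" "d \<in> D" "c \<in> carrier K" for z d c y using that by blast
  have i0c: "i0 \<in> carrier K" using i0 Ic by blast
  \<comment> \<open>For y outside D maximality gives i0 = d + c y with d in D. Here c y is nonzero,
    so c is invertible on I and y lies in D + K i0.\<close>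
  have spans: "I \<subseteq> ?S i0"
  proof
    fix y assume y: "y \<in> I"
    note yc = Ic[OF y]
    show "y \<in> ?S i0"
    proof (cases "y \<in> D")
      case True then show ?thesis using sub[OF i0(1)] by blast
    next
      case False
      have sI: "?S y \<subseteq> I" using D(2) submod_smult[OF I(1) _ y] submod_add[OF I(1)] by auto
      have "D \<subseteq> ?S y" "y \<in> ?S y" using sub[OF y] unfolding insert_subset by (rule conjunct2, rule conjunct1)
      have "i0 \<in> ?S y"
      proof (rule ccontr)
        assume "i0 \<notin> ?S y"
        then have "?S y = D" by (rule Dmax[OF sum[OF y] sI _ \<open>D \<subseteq> ?S y\<close>])
        with \<open>y \<in> ?S y\<close> False show False by (simp only:)
      qed
      then obtain d c where dc: "i0 = d \<oplus>\<^bsub>K\<^esub> c \<otimes>\<^bsub>K\<^esub> y" "d \<in> D" "c \<in> carrier K" by blast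
      have "c \<otimes>\<^bsub>K\<^esub> y \<noteq> \<zero>\<^bsub>K\<^esub>" using dc D(3) Dc[OF dc(2)] by auto
      then have "(\<otimes>\<^bsub>K\<^esub>) c ` I = I" using dich[OF dc(3)] y by auto
      then obtain b where b: "b \<in> carrier K" "\<forall>i\<in>I. b \<otimes>\<^bsub>K\<^esub> (c \<otimes>\<^bsub>K\<^esub> i) = i" using invert dc(3) by blast
      have "b \<otimes>\<^bsub>K\<^esub> i0 = b \<otimes>\<^bsub>K\<^esub> d \<oplus>\<^bsub>K\<^esub> y"
        using dc b y yc Dc[OF dc(2)] by (simp add: K.r_distr)
      moreover have "b \<otimes>\<^bsub>K\<^esub> d \<in> D" using submod_smult[OF D(1) b(1) dc(2)] by simp
      moreover have "\<ominus>\<^bsub>K\<^esub> (b \<otimes>\<^bsub>K\<^esub> d) \<in> D"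
        using submod_smult[OF D(1) _ calculation(2), of "\<ominus>\<^bsub>K\<^esub> \<one>\<^bsub>K\<^esub>"] b(1) Dc[OF dc(2)] by (simp add: K.l_minus)
      ultimately show ?thesis using yc b(1) Dc[OF dc(2)]
        by (intro SI[of _ "\<ominus>\<^bsub>K\<^esub> (b \<otimes>\<^bsub>K\<^esub> d)" b]) (simp_all add: K.r_neg1)
    qed
  qed
  have "D \<subset> I" using D(2,3) i0(1) by blast
  then have fgD: "?fg D" by (rule min[OF D(1)])
  obtain S where S: "finite S" "S \<subseteq> D" "\<And>G. submod K ?R G \<Longrightarrow> S \<subseteq> G \<Longrightarrow> D \<subseteq> G"
    by (rule fgE_sub[OF R D(1) fgD]) (rule that, assumption+)
  have "?fg I"
  proof (rule fgI_sub[OF R I(1), of "insert i0 S"])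
    fix G assume G: "submod K ?R G" and SG: "insert i0 S \<subseteq> G"
    have "D \<subseteq> G" by (rule S(3)[OF G]) (use SG in simp)
    then have "?S i0 \<subseteq> G" using submod_add[OF G] submod_smult[OF G] SG by auto
    then show "I \<subseteq> G" using spans by (rule subset_trans[rotated])
  qed (use S(1,2) D(2) i0 in auto)
  then show False using I(2) by simp
qed

lemma artinian_noeth: assumes "artinian_cring K" shows "noeth K"
proof -
  have "ring K" using assms by (simp add: artinian_cring_def cring_def)
  then show ?thesis using free_Suc_fg artinian_ideal_fg[OF assms] by (auto simp: noeth_def)
qed

text \<open>Restriction of scalars. The map need not preserve the unit: a module over a corner \<open>eRe\<close> is
  obtained in this way from any \<open>R\<close>-module on which \<open>e\<close> acts as the identity.\<close>

definition res :: "('k \<Rightarrow> 'r) \<Rightarrow> ('r, 'm, 'x) module_scheme \<Rightarrow> ('k, 'm) module" where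
  "res h X = \<lparr>carrier = carrier X, mult = undefined, one = undefined, zero = \<zero>\<^bsub>X\<^esub>, add = add X,
      smult = (\<lambda>c x. h c \<odot>\<^bsub>X\<^esub> x)\<rparr>"

lemma res_simps [simp]: "carrier (res h X) = carrier X" "\<zero>\<^bsub>res h X\<^esub> = \<zero>\<^bsub>X\<^esub>"
  "x \<oplus>\<^bsub>res h X\<^esub> y = x \<oplus>\<^bsub>X\<^esub> y" "c \<odot>\<^bsub>res h X\<^esub> x = h c \<odot>\<^bsub>X\<^esub> x"
  "(res h X)\<lparr>carrier := H\<rparr> = res h (X\<lparr>carrier := H\<rparr>)"
  by (simp_all add: res_def)

lemma lsum_res [simp]: "lsum (res h X) g n = lsum X g n"
  by (induction n) auto

lemma res_lmodule:
  assumes X: "lmodule R X" and K: "ring K"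
    and c: "\<And>a. a \<in> carrier K \<Longrightarrow> h a \<in> carrier R"
    and a: "\<And>a b. a \<in> carrier K \<Longrightarrow> b \<in> carrier K \<Longrightarrow> h (a \<oplus>\<^bsub>K\<^esub> b) = h a \<oplus>\<^bsub>R\<^esub> h b"
    and m: "\<And>a b. a \<in> carrier K \<Longrightarrow> b \<in> carrier K \<Longrightarrow> h (a \<otimes>\<^bsub>K\<^esub> b) = h a \<otimes>\<^bsub>R\<^esub> h b"
    and o: "\<And>x. x \<in> carrier X \<Longrightarrow> h \<one>\<^bsub>K\<^esub> \<odot>\<^bsub>X\<^esub> x = x"
  shows "lmodule K (res h X)"
proof -
  interpret X: lmodule R X by fact
  show ?thesis
  proof (rule lmodule_groupI)
    fix x assume x: "x \<in> carrier (res h X)"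
    show "\<exists>y\<in>carrier (res h X). y \<oplus>\<^bsub>res h X\<^esub> x = \<zero>\<^bsub>res h X\<^esub>"
      by (rule bexI[of _ "\<ominus>\<^bsub>X\<^esub> x"]) (use x in \<open>auto simp: X.M.l_neg\<close>)
  qed (auto simp: K c a m o X.lsmult_l_distr X.lsmult_r_distr X.lsmult_assoc X.M.a_assoc intro: X.M.a_comm)
qed

lemma ring_hom_res_lmodule: "h \<in> ring_hom K R \<Longrightarrow> ring K \<Longrightarrow> lmodule R X \<Longrightarrow> lmodule K (res h X)"
  by (rule res_lmodule) (simp_all add: ring_hom_closed ring_hom_add ring_hom_mult ring_hom_one lmodule.lsmult_one)

lemma res_lh:
  assumes "\<And>a. a \<in> carrier K \<Longrightarrow> h a \<in> carrier R" "lh R X Y f" shows "lh K (res h X) (res h Y) f"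
  using assms by (simp add: lh_def)

lemma res_submod:
  assumes "\<And>a. a \<in> carrier K \<Longrightarrow> h a \<in> carrier R" "submod R X H" shows "submod K (res h X) H"
  using assms by (simp add: submod_def)

text \<open>Every vector is a sum of ring elements placed in single coordinates, so the K-generators
  of R inserted in each coordinate suffice.\<close>

lemma fg_res_free:
  assumes K: "ring K" and R: "ring R" and h: "h \<in> ring_hom K R" and fg: "fg_module K (res h (reg_module R))"
  shows "fg_module K (res h (free_module R n))"
proof -
  interpret R: ring R by fact
  note F = free_lmodule[OF R, of n] and RM = reg_lmodule[OF R]
  note FK = ring_hom_res_lmodule[OF h K F] and RK = ring_hom_res_lmodule[OF h K RM]
  obtain S where S: "finite S" "S \<subseteq> carrier (res h (reg_module R))"
    and g: "\<And>G. submod K (res h (reg_module R)) G \<Longrightarrow> S \<subseteq> G \<Longrightarrow> carrier (res h (reg_module R)) \<subseteq> G"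
    by (rule fgE[OF RK fg]) (rule that, assumption+)
  define ins where "ins j r = r \<odot>\<^bsub>free_module R n\<^esub> unit_vec R n j" for j r
  have ins: "lh R (reg_module R) (free_module R n) (ins j)" for j
    unfolding ins_def using lh_scale[OF F lh_id unit_vec_closed[OF R]] .
  show ?thesis
  proof (rule fgI[OF FK, of "\<Union>j<n. ins j ` S"])
    show "finite (\<Union>j<n. ins j ` S)" using S(1) by simp
    show "(\<Union>j<n. ins j ` S) \<subseteq> carrier (res h (free_module R n))"
    proof (intro UN_least image_subsetI)
      fix j s assume "s \<in> S"
      then show "ins j s \<in> carrier (res h (free_module R n))" using lh_closed[OF ins, of s j] S(2) by (auto simp del: free_simps)
    qed
    fix G assume G: "submod K (res h (free_module R n)) G" and SG: "(\<Union>j<n. ins j ` S) \<subseteq> G"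
    have i: "ins j r \<in> G" if j: "j < n" and r: "r \<in> carrier R" for j r
    proof -
      have "submod K (res h (reg_module R)) {x \<in> carrier (res h (reg_module R)). ins j x \<in> G}"
        by (rule submod_vimage[OF RK FK res_lh[OF ring_hom_closed[OF h] ins] G])
      then have "carrier (res h (reg_module R)) \<subseteq> {x \<in> carrier (res h (reg_module R)). ins j x \<in> G}"
        by (rule g) (use S(2) SG j in auto)
      then show ?thesis using r by auto
    qed
    show "carrier (res h (free_module R n)) \<subseteq> G"
    proof
      fix x assume x: "x \<in> carrier (res h (free_module R n))"
      have "lsum (res h (free_module R n)) (\<lambda>j. ins j (x j)) n \<in> G"
        by (rule submod_lsum[OF G]) (use x i in \<open>auto simp: PiE_iff\<close>)
      then show "x \<in> G" using free_expand[OF R, of x n] x unfolding ins_def by (simp del: free_simps)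
    qed
  qed
qed

text \<open>An R-submodule is a K-submodule, and its finitely many generators over K generate it a
  fortiori over R.\<close>

lemma noeth_over:
  assumes K: "noeth K" and R: "ring R" and h: "h \<in> ring_hom K R" and fg: "fg_module K (res h (reg_module R))"
  shows "noeth R"
  unfolding noeth_def
proof (intro conjI allI impI R)
  fix n H assume H: "submod R (free_module R n) H"
  note F = free_lmodule[OF R, of n]
  note FK = ring_hom_res_lmodule[OF h noeth_ring[OF K] F]
  have r: "submod K (res h (free_module R n)) G" if "submod R (free_module R n) G" for G
    by (rule res_submod[OF ring_hom_closed[OF h] that])
  have fgH: "fg_module K ((res h (free_module R n))\<lparr>carrier := H\<rparr>)"
    by (rule noeth_sub[OF K FK fg_res_free[OF noeth_ring[OF K] R h fg] r[OF H]])
  obtain S where S: "finite S" "S \<subseteq> H" and g: "\<And>G. submod K (res h (free_module R n)) G \<Longrightarrow> S \<subseteq> G \<Longrightarrow> H \<subseteq> G"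
    by (rule fgE_sub[OF FK r[OF H] fgH]) (rule that, assumption+)
  show "fg_module R ((free_module R n)\<lparr>carrier := H\<rparr>)"
    by (rule fgI_sub[OF F H S], rule g, rule r)
qed

section \<open>Opposite rings and Artin algebras\<close>

lemma opp_simps [simp]: "carrier (opp R) = carrier R" "\<zero>\<^bsub>opp R\<^esub> = \<zero>\<^bsub>R\<^esub>" "\<one>\<^bsub>opp R\<^esub> = \<one>\<^bsub>R\<^esub>"
  "x \<oplus>\<^bsub>opp R\<^esub> y = x \<oplus>\<^bsub>R\<^esub> y" "x \<otimes>\<^bsub>opp R\<^esub> y = y \<otimes>\<^bsub>R\<^esub> x"
  by (simp_all add: opp_def)

lemma opp_ring: assumes "ring R" shows "ring (opp R)"
proof -
  interpret R: ring R by fact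
  show ?thesis
  proof (rule ringI)
    show "abelian_group (opp R)"
    proof (rule abelian_groupI)
      fix x assume "x \<in> carrier (opp R)"
      then show "\<exists>y\<in>carrier (opp R). y \<oplus>\<^bsub>opp R\<^esub> x = \<zero>\<^bsub>opp R\<^esub>"
        by (intro bexI[of _ "\<ominus>\<^bsub>R\<^esub> x"]) (auto simp: R.l_neg)
    qed (auto simp: R.a_assoc intro: R.a_comm)
    show "monoid (opp R)" by (rule monoidI) (auto simp: R.m_assoc)
  qed (auto simp: R.l_distr R.r_distr)
qed

text \<open>The image of K is central, so h is also a ring map into \<open>opp R\<close>, and the
  same generators serve on both sides.\<close>

lemma artin_noeth:
  assumes "artin_algebra R" shows "noeth R" "noeth (opp R)"
proof -
  obtain K :: "'a ring" and h where R: "ring R" and K: "artinian_cring K" and h: "h \<in> ring_hom K R"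
    and z: "h ` carrier K \<subseteq> ring_center R" and fg: "fg_module K ((reg_module R)\<lparr>smult := (\<lambda>c x. h c \<otimes>\<^bsub>R\<^esub> x)\<rparr>)"
    using assms by (auto simp: artin_algebra_def)
  interpret K: cring K using K by (simp add: artinian_cring_def)
  note N = artinian_noeth[OF K]
  let ?M = "(reg_module R)\<lparr>smult := (\<lambda>c x. h c \<otimes>\<^bsub>R\<^esub> x)\<rparr>"
  note RK = ring_hom_res_lmodule[OF h K.ring_axioms reg_lmodule[OF R]]
  have comm: "h c \<otimes>\<^bsub>R\<^esub> x = x \<otimes>\<^bsub>R\<^esub> h c" if "c \<in> carrier K" "x \<in> carrier R" for c x
    using z that by (auto simp: ring_center_def)
  have M: "lmodule K ?M" by (rule lmodule_cong[OF RK]) simp_all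
  have "fg_module K (res h (reg_module R))"
    by (rule fg_image[OF M RK fg, of "\<lambda>x. x"]) (auto intro!: lhI)
  then show "noeth R" by (rule noeth_over[OF N R h])
  have h': "h \<in> ring_hom K (opp R)"
  proof (rule ring_hom_memI)
    fix x y assume "x \<in> carrier K" "y \<in> carrier K"
    then show "h (x \<otimes>\<^bsub>K\<^esub> y) = h x \<otimes>\<^bsub>opp R\<^esub> h y"
      using comm[of x "h y"] ring_hom_closed[OF h, of y] ring_hom_mult[OF h, of x y] by simp
  qed (simp_all add: ring_hom_closed[OF h] ring_hom_add[OF h] ring_hom_one[OF h])
  have RK': "lmodule K (res h (reg_module (opp R)))"
    by (rule ring_hom_res_lmodule[OF h' K.ring_axioms reg_lmodule[OF opp_ring[OF R]]])
  have "fg_module K (res h (reg_module (opp R)))"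
  proof (rule fg_image[OF M RK' fg, of "\<lambda>x. x"])
    show "lh K ?M (res h (reg_module (opp R))) (\<lambda>x. x)"
    proof (rule lhI)
      fix c x assume "c \<in> carrier K" "x \<in> carrier ?M"
      then show "c \<odot>\<^bsub>?M\<^esub> x = c \<odot>\<^bsub>res h (reg_module (opp R))\<^esub> x" using comm[of c x] by simp
    qed simp_all
  qed simp
  then show "noeth (opp R)" by (rule noeth_over[OF N opp_ring[OF R] h'])
qed

section \<open>Quotients and transport\<close>

lemma (in abelian_group) neg_zero [simp]: "\<ominus> \<zero> = \<zero>"
  by (rule minus_equality) simp_all

lemma lmodule_image:
  assumes X: "lmodule R X" and s: "carrier Y = q ` carrier X" and z: "\<zero>\<^bsub>Y\<^esub> = q \<zero>\<^bsub>X\<^esub>"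
    and a: "\<And>x y. x \<in> carrier X \<Longrightarrow> y \<in> carrier X \<Longrightarrow> q x \<oplus>\<^bsub>Y\<^esub> q y = q (x \<oplus>\<^bsub>X\<^esub> y)"
    and m: "\<And>r x. r \<in> carrier R \<Longrightarrow> x \<in> carrier X \<Longrightarrow> r \<odot>\<^bsub>Y\<^esub> q x = q (r \<odot>\<^bsub>X\<^esub> x)"
  shows "lmodule R Y" "lh R X Y q"
proof -
  interpret X: lmodule R X by fact
  show "lmodule R Y"
  proof (rule lmodule_groupI)
    show "x \<oplus>\<^bsub>Y\<^esub> y = y \<oplus>\<^bsub>Y\<^esub> x" if "x \<in> carrier Y" "y \<in> carrier Y" for x y
      using that by (auto simp: s a X.M.a_comm)
    show "\<exists>y\<in>carrier Y. y \<oplus>\<^bsub>Y\<^esub> x = \<zero>\<^bsub>Y\<^esub>" if "x \<in> carrier Y" for x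
    proof -
      obtain x' where "x' \<in> carrier X" "x = q x'" using \<open>x \<in> carrier Y\<close> s by auto
      then show ?thesis by (intro bexI[of _ "q (\<ominus>\<^bsub>X\<^esub> x')"]) (auto simp: s a z X.M.l_neg)
    qed
  qed (auto simp: s a m z X.R.ring_axioms X.lsmult_l_distr X.lsmult_r_distr X.lsmult_assoc X.M.a_assoc)
  show "lh R X Y q" by (rule lhI) (auto simp: s a m)
qed

lemma transport:
  fixes X :: "('r, 'm, 'x) module_scheme" and g :: "'m \<Rightarrow> 'n"
  assumes X: "lmodule R X" and g: "inj_on g (carrier X)"
  obtains X' :: "('r, 'n) module" where "lmodule R X'" "lh R X X' g" "lh R X' X (inv_into (carrier X) g)" "carrier X' = g ` carrier X"
proof -
  interpret X: lmodule R X by fact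
  let ?i = "inv_into (carrier X) g"
  define X' :: "('r, 'n) module" where "X' = \<lparr>carrier = g ` carrier X, mult = undefined, one = undefined, zero = g \<zero>\<^bsub>X\<^esub>,
    add = (\<lambda>a b. g (?i a \<oplus>\<^bsub>X\<^esub> ?i b)), smult = (\<lambda>r a. g (r \<odot>\<^bsub>X\<^esub> ?i a))\<rparr>"
  have gi: "?i (g x) = x" if "x \<in> carrier X" for x using that g by simp
  have c: "carrier X' = g ` carrier X" by (simp add: X'_def)
  have "lmodule R X'" "lh R X X' g"
    using lmodule_image[OF X, of X' g] by (simp_all add: X'_def gi)
  moreover have "bij_betw g (carrier X) (carrier X')" using g c by (simp add: bij_betw_def)
  ultimately show thesis using that c lh_inv[OF X, of X' g] by blast
qed

text \<open>A statement about all modules of a class can be made for one carrier type at a time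
  only. Choosing a preimage in a free module for each element puts a copy of any finitely generated
  module on functions from \<open>nat\<close>, which therefore suffice as a test type.\<close>

lemma transport_nat:
  fixes X :: "('r, 'm, 'x) module_scheme" and R :: "('r, 'e) ring_scheme"
  assumes X: "lmodule R X" and fg: "fg_module R X"
  obtains X' :: "('r, nat \<Rightarrow> 'r) module" and a b where "lmodule R X'" "lh R X X' a" "lh R X' X b"
    "\<And>x. x \<in> carrier X \<Longrightarrow> b (a x) = x" "\<And>x. x \<in> carrier X' \<Longrightarrow> a (b x) = x"
proof -
  obtain n q where q: "lh R (free_module R n) X q" "q ` carrier (free_module R n) = carrier X"
    by (rule fg_free_cover[OF X fg])
  let ?g = "inv_into (carrier (free_module R n)) q"
  have g: "inj_on ?g (carrier X)" using q(2) by (metis inj_on_inv_into order_refl)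
  obtain X' :: "('r, nat \<Rightarrow> 'r) module" where X': "lmodule R X'" "lh R X X' ?g"
     "lh R X' X (inv_into (carrier X) ?g)" "carrier X' = ?g ` carrier X"
    by (rule transport[OF X g])
  show thesis
    by (rule that[OF X'(1-3)]) (use g X'(4) in \<open>auto simp: inv_into_f_f f_inv_into_f\<close>)
qed

lemma transport_fgmod:
  fixes X :: "('r, 'm, 'x) module_scheme" and R :: "('r, 'e) ring_scheme"
  assumes X: "lmodule R X" and fg: "fg_module R X"
  obtains X' :: "'r fgmod" and a b where "lmodule R X'" "lh R X X' a" "lh R X' X b"
    "\<And>x. x \<in> carrier X \<Longrightarrow> b (a x) = x" "\<And>x. x \<in> carrier X' \<Longrightarrow> a (b x) = x"
proof -
  obtain Y :: "('r, nat \<Rightarrow> 'r) module" and a b where Y: "lmodule R Y" "lh R X Y a" "lh R Y X b"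
    and ba: "\<And>x. x \<in> carrier X \<Longrightarrow> b (a x) = x" and ab: "\<And>x. x \<in> carrier Y \<Longrightarrow> a (b x) = x"
    by (rule transport_nat[OF X fg]) (rule that, assumption+)
  \<comment> \<open>Singletons, since the elements of an \<open>fgmod\<close> are sets of
    tuples.\<close>
  let ?g = "\<lambda>x :: nat \<Rightarrow> 'r. {x}"
  have g: "inj_on ?g (carrier Y)" by simp
  obtain X' :: "('r, (nat \<Rightarrow> 'r) set) module" where X': "lmodule R X'" "lh R Y X' ?g"
     "lh R X' Y (inv_into (carrier Y) ?g)" "carrier X' = ?g ` carrier Y"
    by (rule transport[OF Y(1) g])
  show thesis
    by (rule that[OF X'(1) lh_comp[OF Y(2) X'(2)] lh_comp[OF X'(3) Y(3)]])
      (use inv_into_f_f[OF g] lh_closed[OF Y(2)] X'(4) in \<open>auto simp: ab ba\<close>)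
qed

text \<open>Each coset is represented by a chosen member, so the quotient stays on the type of X.
  Cokernels of maps into free modules then remain on functions from \<open>nat\<close>, where
  \<open>TL\<close> is stated.\<close>

lemma quotient:
  fixes X :: "('r, 'm, 'x) module_scheme" and R :: "('r, 'e) ring_scheme"
  assumes X: "lmodule R X" and H: "submod R X H"
  obtains Y :: "('r, 'm) module" and q where "lmodule R Y" "lh R X Y q" "q ` carrier X = carrier Y" "a_kernel X Y q = H"
proof -
  interpret X: lmodule R X by fact
  have Hc: "\<And>x. x \<in> H \<Longrightarrow> x \<in> carrier X" using submod_subset[OF H] by blast
  \<comment> \<open>Elements of one coset satisfy the same predicate, so the choice returns the same
    representative for all of them.\<close>
  define q where "q x = (SOME y. y \<in> carrier X \<and> y \<ominus>\<^bsub>X\<^esub> x \<in> H)" for x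
  have q: "q x \<in> carrier X" "q x \<ominus>\<^bsub>X\<^esub> x \<in> H" if "x \<in> carrier X" for x
  proof -
    have "\<exists>y. y \<in> carrier X \<and> y \<ominus>\<^bsub>X\<^esub> x \<in> H"
      using that submod_zero[OF H] by (intro exI[of _ x]) (simp add: X.M.minus_eq X.M.r_neg)
    from someI_ex[OF this] show "q x \<in> carrier X" "q x \<ominus>\<^bsub>X\<^esub> x \<in> H" unfolding q_def by blast+
  qed
  have tr: "a \<ominus>\<^bsub>X\<^esub> c \<in> H" if "a \<ominus>\<^bsub>X\<^esub> b \<in> H" "b \<ominus>\<^bsub>X\<^esub> c \<in> H" "a \<in> carrier X" "b \<in> carrier X" "c \<in> carrier X" for a b c
    using submod_add[OF H that(1,2)] that(3-) by (simp add: X.M.minus_eq X.M.a_ac X.M.r_neg1 X.M.r_neg2)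
  have sy: "b \<ominus>\<^bsub>X\<^esub> a \<in> H" if "a \<ominus>\<^bsub>X\<^esub> b \<in> H" "a \<in> carrier X" "b \<in> carrier X" for a b
    using X.submod_neg[OF H that(1)] that(2-) by (simp add: X.M.minus_eq X.M.a_ac X.M.minus_add)
  have eq: "q x = q y \<longleftrightarrow> x \<ominus>\<^bsub>X\<^esub> y \<in> H" if "x \<in> carrier X" "y \<in> carrier X" for x y
  proof
    assume "q x = q y"
    then show "x \<ominus>\<^bsub>X\<^esub> y \<in> H" using tr[of x "q x" y] sy[of "q x" x] q[OF that(1)] q[OF that(2)] that by simp
  next
    assume h: "x \<ominus>\<^bsub>X\<^esub> y \<in> H"
    have "z \<ominus>\<^bsub>X\<^esub> x \<in> H \<longleftrightarrow> z \<ominus>\<^bsub>X\<^esub> y \<in> H" if z: "z \<in> carrier X" for z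
      using tr[of z x y] tr[of z y x] sy[of x y] h \<open>x \<in> carrier X\<close> \<open>y \<in> carrier X\<close> z by blast
    then show "q x = q y" unfolding q_def by (intro arg_cong[where f = Eps]) blast
  qed
  define Y :: "('r, 'm) module" where "Y = \<lparr>carrier = q ` carrier X, mult = undefined, one = undefined, zero = q \<zero>\<^bsub>X\<^esub>,
    add = (\<lambda>a b. q (a \<oplus>\<^bsub>X\<^esub> b)), smult = (\<lambda>r a. q (r \<odot>\<^bsub>X\<^esub> a))\<rparr>"
  have qa: "q (q x \<oplus>\<^bsub>X\<^esub> q y) = q (x \<oplus>\<^bsub>X\<^esub> y)" if xy: "x \<in> carrier X" "y \<in> carrier X" for x y
  proof -
    have "(q x \<oplus>\<^bsub>X\<^esub> q y) \<ominus>\<^bsub>X\<^esub> (x \<oplus>\<^bsub>X\<^esub> y) = (q x \<ominus>\<^bsub>X\<^esub> x) \<oplus>\<^bsub>X\<^esub> (q y \<ominus>\<^bsub>X\<^esub> y)"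
      using xy q(1) by (simp add: X.M.minus_eq X.M.a_ac X.M.minus_add)
    then show ?thesis using xy q submod_add[OF H q(2)[OF xy(1)] q(2)[OF xy(2)]] by (simp add: eq)
  qed
  have qm: "q (r \<odot>\<^bsub>X\<^esub> q x) = q (r \<odot>\<^bsub>X\<^esub> x)" if xy: "r \<in> carrier R" "x \<in> carrier X" for r x
  proof -
    have "r \<odot>\<^bsub>X\<^esub> q x \<ominus>\<^bsub>X\<^esub> r \<odot>\<^bsub>X\<^esub> x = r \<odot>\<^bsub>X\<^esub> (q x \<ominus>\<^bsub>X\<^esub> x)"
      using xy q(1) by (simp add: X.M.minus_eq X.ls_neg X.lsmult_r_distr)
    then show ?thesis using xy q submod_smult[OF H xy(1) q(2)[OF xy(2)]] by (simp add: eq)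
  qed
  have Y: "lmodule R Y" "lh R X Y q"
    using lmodule_image[OF X, of Y q] by (simp_all add: Y_def qa qm)
  have "a_kernel X Y q = H"
    by (auto simp: a_kernel_def' Y_def eq X.M.minus_eq Hc)
  then show thesis using that Y by (simp add: Y_def)
qed

lemma perp_retract:
  assumes "noeth R" "X \<in> perp R" "lmodule R X'" "lh R X' X a" "lh R X X' b" "\<And>x. x \<in> carrier X' \<Longrightarrow> b (a x) = x"
  shows "X' \<in> perp R"
  using assms(2) ev_retract[OF assms(1) _ assms(3-6)] unfolding perp_iff_ev[OF assms(1)] by simp

lemma lh_free_expand:
  assumes R: "ring R" and Y: "lmodule R Y" and g: "lh R (free_module R n) Y g" and y: "y \<in> carrier (free_module R n)"
  shows "g y = lsum Y (\<lambda>i. y i \<odot>\<^bsub>Y\<^esub> g (unit_vec R n i)) n"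
proof -
  note F = free_lmodule[OF R, of n]
  have yc: "y i \<in> carrier R" if "i < n" for i using y that by (auto simp: PiE_iff)
  have "g y = lsum Y (\<lambda>i. g (y i \<odot>\<^bsub>free_module R n\<^esub> unit_vec R n i)) n"
    by (subst free_expand[OF R y], rule lh_lsum[OF F Y g], rule lmodule.lsmult_closed[OF F yc unit_vec_closed[OF R]])
  also have "\<dots> = lsum Y (\<lambda>i. y i \<odot>\<^bsub>Y\<^esub> g (unit_vec R n i)) n"
    by (rule lsum_cong, rule lh_smult[OF g yc unit_vec_closed[OF R]])
  finally show ?thesis .
qed

section \<open>Weakly Gorenstein rings\<close>

lemma dual_simps [simp]: "carrier (dual R X) = lhom R X (reg_module R)" "\<zero>\<^bsub>dual R X\<^esub> = (\<lambda>x\<in>carrier X. \<zero>\<^bsub>R\<^esub>)"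
  "f \<oplus>\<^bsub>dual R X\<^esub> g = (\<lambda>x\<in>carrier X. f x \<oplus>\<^bsub>R\<^esub> g x)" "r \<odot>\<^bsub>dual R X\<^esub> f = (\<lambda>x\<in>carrier X. f x \<otimes>\<^bsub>R\<^esub> r)"
  by (simp_all add: dual_def)

lemma restrict_lhom: "lmodule R X \<Longrightarrow> lmodule R Y \<Longrightarrow> lh R X Y f \<Longrightarrow> restrict f (carrier X) \<in> lhom R X Y"
  unfolding lhom_iff using lh_cong[of R X Y f "restrict f (carrier X)"] by simp

lemma dual_elem: assumes "f \<in> lhom R X (reg_module R)" shows "lh R X (reg_module R) f" "\<And>x. x \<in> carrier X \<Longrightarrow> f x \<in> carrier R"
  using assms lh_closed[of R X "reg_module R" f] by (auto simp: lhom_iff)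

lemma dual_eqI: "f \<in> lhom R X Y \<Longrightarrow> g \<in> lhom R X Y \<Longrightarrow> (\<And>x. x \<in> carrier X \<Longrightarrow> f x = g x) \<Longrightarrow> f = g"
  by (auto simp: lhom_iff intro: extensionalityI)

lemma lh_rmult:
  assumes "ring R" "lh R X (reg_module R) f" "r \<in> carrier R"
  shows "lh R X (reg_module R) (\<lambda>x. f x \<otimes>\<^bsub>R\<^esub> r)"
  using lh_scale[OF reg_lmodule[OF assms(1)] assms(2), of r] assms(3) by simp

lemma dual_lmodule:
  assumes X: "lmodule R X" shows "lmodule (opp R) (dual R X)"
proof -
  interpret X: lmodule R X by fact
  note R = X.R.ring_axioms
  note RM = reg_lmodule[OF R]
  note c = dual_elem(2)
  show ?thesis
  proof (rule lmodule_groupI)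
    show "ring (opp R)" by (rule opp_ring[OF R])
    fix f assume f: "f \<in> carrier (dual R X)"
    show "\<exists>g\<in>carrier (dual R X). g \<oplus>\<^bsub>dual R X\<^esub> f = \<zero>\<^bsub>dual R X\<^esub>"
    proof (rule bexI)
      show "restrict (\<lambda>x. \<ominus>\<^bsub>reg_module R\<^esub> f x) (carrier X) \<in> carrier (dual R X)"
        using restrict_lhom[OF X RM lh_uminus[OF X RM]] f dual_elem(1) by auto
      have "\<ominus>\<^bsub>reg_module R\<^esub> f x \<oplus>\<^bsub>R\<^esub> f x = \<zero>\<^bsub>R\<^esub>" if "x \<in> carrier X" for x
        using abelian_group.l_neg[OF lmodule_group[OF RM], of "f x"] c[of f R X x] f that by simp
      then show "restrict (\<lambda>x. \<ominus>\<^bsub>reg_module R\<^esub> f x) (carrier X) \<oplus>\<^bsub>dual R X\<^esub> f = \<zero>\<^bsub>dual R X\<^esub>"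
        by (auto intro!: restrict_ext)
    qed
    show "\<zero>\<^bsub>dual R X\<^esub> \<oplus>\<^bsub>dual R X\<^esub> f = f"
      using f c[of f R X] by (intro extensionalityI[of _ "carrier X"]) (auto simp: lhom_iff)
    show "\<one>\<^bsub>opp R\<^esub> \<odot>\<^bsub>dual R X\<^esub> f = f"
      using f c[of f R X] by (intro extensionalityI[of _ "carrier X"]) (auto simp: lhom_iff)
  next
    fix f g assume f: "f \<in> carrier (dual R X)" "g \<in> carrier (dual R X)"
    show "f \<oplus>\<^bsub>dual R X\<^esub> g \<in> carrier (dual R X)"
      using restrict_lhom[OF X RM lh_plus[OF X RM, of f g]] f dual_elem(1)[of f R X] dual_elem(1)[of g R X] by simp
    show "f \<oplus>\<^bsub>dual R X\<^esub> g = g \<oplus>\<^bsub>dual R X\<^esub> f"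
      using f c[of f R X] c[of g R X] by (auto intro!: restrict_ext X.R.a_comm)
    show "r \<odot>\<^bsub>dual R X\<^esub> (f \<oplus>\<^bsub>dual R X\<^esub> g) = r \<odot>\<^bsub>dual R X\<^esub> f \<oplus>\<^bsub>dual R X\<^esub> r \<odot>\<^bsub>dual R X\<^esub> g"
      if "r \<in> carrier (opp R)" for r
      using f c[of f R X] c[of g R X] that by (auto intro!: restrict_ext simp: X.R.l_distr)
    show "(f \<oplus>\<^bsub>dual R X\<^esub> g) \<oplus>\<^bsub>dual R X\<^esub> h = f \<oplus>\<^bsub>dual R X\<^esub> (g \<oplus>\<^bsub>dual R X\<^esub> h)" if "h \<in> carrier (dual R X)" for h
      using f c[of f R X] c[of g R X] c[of h R X] that by (auto intro!: restrict_ext simp: X.R.a_assoc)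
  next
    fix r f assume f: "r \<in> carrier (opp R)" "f \<in> carrier (dual R X)"
    show "r \<odot>\<^bsub>dual R X\<^esub> f \<in> carrier (dual R X)"
      using restrict_lhom[OF X RM lh_rmult[OF R, of X f r]] f dual_elem(1)[of f R X] by simp
    fix s assume s: "s \<in> carrier (opp R)"
    show "(r \<oplus>\<^bsub>opp R\<^esub> s) \<odot>\<^bsub>dual R X\<^esub> f = r \<odot>\<^bsub>dual R X\<^esub> f \<oplus>\<^bsub>dual R X\<^esub> s \<odot>\<^bsub>dual R X\<^esub> f"
      using f c[of f R X] s by (auto intro!: restrict_ext simp: X.R.r_distr)
    show "(r \<otimes>\<^bsub>opp R\<^esub> s) \<odot>\<^bsub>dual R X\<^esub> f = r \<odot>\<^bsub>dual R X\<^esub> (s \<odot>\<^bsub>dual R X\<^esub> f)"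
      using f c[of f R X] s by (auto intro!: restrict_ext simp: X.R.m_assoc)
  next
    show "\<zero>\<^bsub>dual R X\<^esub> \<in> carrier (dual R X)"
      using restrict_lhom[OF X RM lh_zero_map[OF X RM]] by simp
  qed
qed

lemma lsum_reg_opp [simp]: "lsum (reg_module (opp R)) g n = lsum (reg_module R) g n"
  by (induction n) auto

lemma eval_lh: "x \<in> carrier X \<Longrightarrow> lh (opp R) (dual R X) (reg_module (opp R)) (\<lambda>f. f x)"
  by (rule lhI) (auto intro: dual_elem(2))

text \<open>Elementwise form of \<open>torsionless\<close>, with arbitrary linear maps in place of
  the extensional elements of \<open>dual R X\<close>.\<close>

definition tl where
  "tl R X \<longleftrightarrow> (\<forall>x\<in>carrier X. (\<forall>f. lh R X (reg_module R) f \<longrightarrow> f x = \<zero>\<^bsub>R\<^esub>) \<longrightarrow> x = \<zero>\<^bsub>X\<^esub>)"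

lemma torsionless_iff: assumes X: "lmodule R X" shows "torsionless R X \<longleftrightarrow> tl R X"
proof -
  interpret X: lmodule R X by fact
  note RM = reg_lmodule[OF X.R.ring_axioms]
  have eq: "eval_map R X x = eval_map R X y \<longleftrightarrow> (\<forall>f. lh R X (reg_module R) f \<longrightarrow> f x = f y)"
    if xy: "x \<in> carrier X" "y \<in> carrier X" for x y
  proof
    assume e: "eval_map R X x = eval_map R X y"
    show "\<forall>f. lh R X (reg_module R) f \<longrightarrow> f x = f y"
    proof (intro allI impI)
      fix f assume f: "lh R X (reg_module R) f"
      show "f x = f y" using fun_cong[OF e, of "restrict f (carrier X)"] restrict_lhom[OF X RM f] xy
        by (simp add: eval_map_def)
    qed
  next
    assume "\<forall>f. lh R X (reg_module R) f \<longrightarrow> f x = f y"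
    then show "eval_map R X x = eval_map R X y"
      using xy by (auto simp: eval_map_def intro!: restrict_ext dest: dual_elem(1))
  qed
  show ?thesis
  proof
    assume t: "torsionless R X"
    show "tl R X" unfolding tl_def
    proof (intro ballI impI)
      fix x assume x: "x \<in> carrier X" "\<forall>f. lh R X (reg_module R) f \<longrightarrow> f x = \<zero>\<^bsub>R\<^esub>"
      have "f x = f \<zero>\<^bsub>X\<^esub>" if f: "lh R X (reg_module R) f" for f
        using mp[OF spec[OF x(2)] f] lh_zero[OF X RM f] by (simp only: reg_simps)
      then have "eval_map R X x = eval_map R X \<zero>\<^bsub>X\<^esub>" unfolding eq[OF x(1) X.M.zero_closed] by blast
      then show "x = \<zero>\<^bsub>X\<^esub>" using t x(1) by (auto simp: torsionless_def inj_on_def)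
    qed
  next
    assume t: "tl R X"
    show "torsionless R X" unfolding torsionless_def
    proof (rule inj_onI)
      fix x y assume xy: "x \<in> carrier X" "y \<in> carrier X" "eval_map R X x = eval_map R X y"
      have "f (x \<ominus>\<^bsub>X\<^esub> y) = \<zero>\<^bsub>R\<^esub>" if f: "lh R X (reg_module R) f" for f
      proof -
        have "f x = f y" using xy eq f by blast
        then show ?thesis using lh_minus[OF X RM f xy(1,2)] lh_closed[OF f xy(2)]
            abelian_group.r_neg[OF lmodule_group[OF RM]] abelian_group.minus_eq[OF lmodule_group[OF RM]] by simp
      qed
      then have "x \<ominus>\<^bsub>X\<^esub> y = \<zero>\<^bsub>X\<^esub>" using t xy(1,2) by (simp add: tl_def)
      then show "x = y" using xy X.M.minus_eq_zero by blast
    qed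
  qed
qed

lemma tl_embed:
  assumes "lmodule R X" "lmodule R X'" "tl R X" "lh R X' X a" "inj_on a (carrier X')" shows "tl R X'"
  unfolding tl_def
proof (intro ballI impI)
  interpret X': lmodule R X' by fact
  fix x assume x: "x \<in> carrier X'" "\<forall>f. lh R X' (reg_module R) f \<longrightarrow> f x = \<zero>\<^bsub>R\<^esub>"
  have "f (a x) = \<zero>\<^bsub>R\<^esub>" if "lh R X (reg_module R) f" for f using x(2) lh_comp[OF assms(4) that] by blast
  then have "a x = \<zero>\<^bsub>X\<^esub>" using assms(3) lh_closed[OF assms(4) x(1)] by (simp add: tl_def)
  then have "a x = a \<zero>\<^bsub>X'\<^esub>" using lh_zero[OF assms(2,1,4)] by simp
  then show "x = \<zero>\<^bsub>X'\<^esub>" using assms(5) x(1) by (auto dest: inj_onD)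
qed

text \<open>One carrier type represents all; \<open>TL_D\<close> transports the conclusion to any
  module.\<close>

definition TL :: "('r, 'e) ring_scheme \<Rightarrow> bool" where
  "TL R \<longleftrightarrow> (\<forall>X :: ('r, nat \<Rightarrow> 'r) module. X \<in> perp R \<longrightarrow> tl R X)"

lemma perp_lmodule: "X \<in> perp R \<Longrightarrow> lmodule R X" and perp_fg: "X \<in> perp R \<Longrightarrow> fg_module R X"
  by (auto simp: perp_def)

lemma TL_D:
  fixes R :: "('r, 'e) ring_scheme"
  assumes N: "noeth R" and T: "TL R" and X: "X \<in> perp R" shows "tl R X"
proof -
  note XM = perp_lmodule[OF X]
  obtain X' :: "('r, nat \<Rightarrow> 'r) module" and a b where X': "lmodule R X'" "lh R X X' a" "lh R X' X b"
    and ba: "\<And>x. x \<in> carrier X \<Longrightarrow> b (a x) = x" and ab: "\<And>x. x \<in> carrier X' \<Longrightarrow> a (b x) = x"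
    by (rule transport_nat[OF XM perp_fg[OF X]]) (rule that, assumption+)
  have "X' \<in> perp R" by (rule perp_retract[OF N X X'(1,3,2) ab])
  then have "tl R X'" using T by (auto simp: TL_def)
  then show ?thesis by (rule tl_embed[OF X'(1) XM _ X'(2)]) (rule inj_on_inverseI[of _ b], rule ba)
qed

text \<open>A form is determined by its values on n generators, so the dual embeds into a free
  module of rank n over \<open>opp R\<close>, whose submodules are finitely generated.\<close>

lemma fg_dual:
  fixes R :: "('r, 'e) ring_scheme" and X :: "('r, 'm, 'x) module_scheme"
  assumes N: "noeth (opp R)" and X: "lmodule R X" and fg: "fg_module R X"
  shows "fg_module (opp R) (dual R X)"
proof -
  note R = lmodule_ring[OF X]
  note RM = reg_lmodule[OF R] and D = dual_lmodule[OF X]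
  obtain n q where q: "lh R (free_module R n) X q" "q ` carrier (free_module R n) = carrier X"
    by (rule fg_free_cover[OF X fg])
  note F = free_lmodule[OF R, of n]
  let ?F = "free_module (opp R) n"
  note F' = free_lmodule[OF opp_ring[OF R], of n]
  define j :: "('m \<Rightarrow> 'r) \<Rightarrow> nat \<Rightarrow> 'r" where "j f = (\<lambda>i\<in>{..<n}. f (q (unit_vec R n i)))" for f
  have qc: "q (unit_vec R n i) \<in> carrier X" for i using lh_closed[OF q(1) unit_vec_closed[OF R]] .
  have j: "lh (opp R) (dual R X) ?F j"
    by (rule lhI) (auto simp: j_def qc fun_eq_iff intro: dual_elem(2))
  have "inj_on j (carrier (dual R X))"
  proof (rule lh_inj[OF D F' j])
    fix f assume f: "f \<in> carrier (dual R X)" "j f = \<zero>\<^bsub>?F\<^esub>"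
    have fl: "lh R X (reg_module R) f" using f(1) dual_elem(1) by auto
    have z: "f (q (unit_vec R n i)) = \<zero>\<^bsub>R\<^esub>" if "i < n" for i using fun_cong[OF f(2), of i] that by (simp add: j_def)
    have "f x = \<zero>\<^bsub>R\<^esub>" if x: "x \<in> carrier X" for x
    proof -
      obtain y where y: "y \<in> carrier (free_module R n)" "x = q y" using q(2) x by auto
      have c: "y i \<in> carrier R" if "i < n" for i using y(1) that by (auto simp: PiE_iff)
      have "f (q y) = lsum (reg_module R) (\<lambda>i. y i \<odot>\<^bsub>reg_module R\<^esub> f (q (unit_vec R n i))) n"
        by (rule lh_free_expand[OF R RM lh_comp[OF q(1) fl] y(1)])
      also have "\<dots> = \<zero>\<^bsub>reg_module R\<^esub>"
        by (rule abelian_group.lsum_zero[OF lmodule_group[OF RM]]) (use z c ring.ring_simprules[OF R] in simp)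
      finally show ?thesis using y(2) by simp
    qed
    then show "f = \<zero>\<^bsub>dual R X\<^esub>" using f(1)
      by (intro dual_eqI[of f R X "reg_module R"]) (use restrict_lhom[OF X RM lh_zero_map[OF X RM]] in auto)
  qed
  then have b: "bij_betw j (carrier (dual R X)) (j ` carrier (dual R X))" by (simp add: bij_betw_def)
  let ?I = "?F\<lparr>carrier := j ` carrier (dual R X)\<rparr>"
  have I: "submod (opp R) ?F (j ` carrier (dual R X))"
    by (rule submod_image[OF D F' j submod_carrier[OF D]])
  note IM = submod_lmodule[OF F' I]
  have "fg_module (opp R) ?I" using N I unfolding noeth_def by blast
  moreover have j': "lh (opp R) (dual R X) ?I j" by (rule lh_cod[OF j]) auto
  moreover have b': "bij_betw j (carrier (dual R X)) (carrier ?I)" using b by simp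
  moreover have "inv_into (carrier (dual R X)) j ` carrier ?I = carrier (dual R X)"
    using b' by (metis bij_betw_imp_surj_on bij_betw_inv_into)
  ultimately show ?thesis using fg_image[OF IM D _ lh_inv[OF D IM j' b']] by blast
qed

lemma eval_map_lh:
  assumes X: "lmodule R X"
  shows "lh R X (dual (opp R) (dual R X)) (eval_map R X)" "eval_map R X \<in> extensional (carrier X)"
proof -
  note R = lmodule_ring[OF X]
  note D = dual_lmodule[OF X]
  interpret X: lmodule R X by fact
  show "eval_map R X \<in> extensional (carrier X)" by (simp add: eval_map_def)
  have e: "restrict (\<lambda>f. f x) (carrier (dual R X)) \<in> lhom (opp R) (dual R X) (reg_module (opp R))" if "x \<in> carrier X" for x
    by (rule restrict_lhom[OF D reg_lmodule[OF opp_ring[OF R]] eval_lh[OF that]])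
  show "lh R X (dual (opp R) (dual R X)) (eval_map R X)"
  proof (rule lhI)
    show "eval_map R X x \<in> carrier (dual (opp R) (dual R X))" if "x \<in> carrier X" for x
      using e[OF that] that by (simp add: eval_map_def)
  next
    fix x y assume "x \<in> carrier X" "y \<in> carrier X"
    then show "eval_map R X (x \<oplus>\<^bsub>X\<^esub> y) = eval_map R X x \<oplus>\<^bsub>dual (opp R) (dual R X)\<^esub> eval_map R X y"
      by (auto simp: eval_map_def intro!: restrict_ext dest: dual_elem(1) simp: lh_add[OF dual_elem(1)])
  next
    fix r x assume "r \<in> carrier R" "x \<in> carrier X"
    then show "eval_map R X (r \<odot>\<^bsub>X\<^esub> x) = r \<odot>\<^bsub>dual (opp R) (dual R X)\<^esub> eval_map R X x"
      by (auto simp: eval_map_def intro!: restrict_ext simp: lh_smult[OF dual_elem(1)])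
  qed
qed

lemma reflexiveI:
  assumes X: "lmodule R X" and t: "tl R X"
    and s: "\<And>\<xi>. lh (opp R) (dual R X) (reg_module (opp R)) \<xi> \<Longrightarrow> \<exists>x\<in>carrier X. \<forall>f\<in>lhom R X (reg_module R). \<xi> f = f x"
  shows "reflexive R X"
proof -
  note D = dual_lmodule[OF X]
  have "carrier (dual (opp R) (dual R X)) \<subseteq> eval_map R X ` carrier X"
  proof
    fix \<xi> assume x: "\<xi> \<in> carrier (dual (opp R) (dual R X))"
    then obtain x where x: "x \<in> carrier X" "\<forall>f\<in>lhom R X (reg_module R). \<xi> f = f x" "\<xi> \<in> extensional (carrier (dual R X))"
      using s[of \<xi>] by (auto simp: lhom_iff)
    have "\<xi> = eval_map R X x"
      by (rule extensionalityI[OF x(3)]) (use x in \<open>auto simp: eval_map_def\<close>)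
    then show "\<xi> \<in> eval_map R X ` carrier X" using x(1) by blast
  qed
  then have "eval_map R X ` carrier X = carrier (dual (opp R) (dual R X))"
    using lh_closed[OF eval_map_lh(1)[OF X]] by auto
  then show ?thesis unfolding reflexive_def lisos_def using eval_map_lh[OF X] t torsionless_iff[OF X]
    by (simp add: lhom_iff bij_betw_def torsionless_def)
qed

lemma reflexiveD:
  assumes X: "lmodule R X" and r: "reflexive R X" and \<xi>: "lh (opp R) (dual R X) (reg_module (opp R)) \<xi>"
  shows "\<exists>x\<in>carrier X. \<forall>f\<in>lhom R X (reg_module R). \<xi> f = f x"
proof -
  note D = dual_lmodule[OF X]
  have "restrict \<xi> (carrier (dual R X)) \<in> carrier (dual (opp R) (dual R X))"
    using restrict_lhom[OF D reg_lmodule[OF opp_ring[OF lmodule_ring[OF X]]] \<xi>] by simp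
  then obtain x where x: "x \<in> carrier X" "restrict \<xi> (carrier (dual R X)) = eval_map R X x"
    using r by (auto simp: reflexive_def lisos_def bij_betw_def)
  have "\<xi> f = f x" if f: "f \<in> lhom R X (reg_module R)" for f
    using fun_cong[OF x(2), of f] f x(1) by (simp add: eval_map_def)
  then show ?thesis using x(1) by blast
qed

text \<open>Generators \<open>f\<^sub>i\<close> of \<open>X\<^sup>*\<close> give an embedding of \<open>X\<close> into a free module such that every linear form on \<open>X\<close>
  extends; its cokernel is again in \<open>\<^sup>\<bottom>R\<close>, hence torsionless.\<close>

lemma TL_step:
  fixes R :: "('r, 'e) ring_scheme" and X :: "('r, 'm, 'x) module_scheme"
  assumes N: "noeth R" and N': "noeth (opp R)" and T: "TL R" and X: "X \<in> perp R"
  shows "reflexive R X"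
    and "\<exists>Y :: ('r, nat \<Rightarrow> 'r) module. Y \<in> perp R \<and>
      (reflexive R Y \<longrightarrow> (\<forall>n. ev (opp R) n (dual R Y) \<longrightarrow> ev (opp R) (Suc n) (dual R X)))"
proof -
  note XM = perp_lmodule[OF X] and fg = perp_fg[OF X]
  note R = noeth_ring[OF N] and R' = noeth_ring[OF N']
  note RM = reg_lmodule[OF R] and RM' = reg_lmodule[OF R']
  note D = dual_lmodule[OF XM]
  interpret R: ring R by (rule R)
  interpret X: lmodule R X by (rule XM)
  have tX: "tl R X" by (rule TL_D[OF N T X])
  obtain m Q where Q: "lh (opp R) (free_module (opp R) m) (dual R X) Q"
     "Q ` carrier (free_module (opp R) m) = carrier (dual R X)"
    by (rule fg_free_cover[OF D fg_dual[OF N' XM fg]])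
  let ?F = "free_module R m" and ?F' = "free_module (opp R) m"
  have F: "lmodule R ?F" and F': "lmodule (opp R) ?F'" by (rule free_lmodule[OF R], rule free_lmodule[OF R'])
  define f where "f i = Q (unit_vec (opp R) m i)" for i
  have f: "f i \<in> lhom R X (reg_module R)" for i
    using lh_closed[OF Q(1) unit_vec_closed[OF R']] by (simp add: f_def)
  note fl = dual_elem(1)[OF f]
  have fc: "f i x \<in> carrier R" if "x \<in> carrier X" for i x using dual_elem(2)[OF f that] .
  \<comment> \<open>A pairing of vectors y with coefficient vectors c: each c in the free module
    over \<open>opp R\<close> gives a linear form \<phi> c on the free module over R, and
    \<open>Qx\<close> below says that Q c is \<phi> c after \<iota>.\<close>
  define \<phi> where "\<phi> c y = lsum (reg_module R) (\<lambda>i. y i \<odot>\<^bsub>reg_module R\<^esub> c i) m" for c y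
  have \<phi>: "lh R ?F (reg_module R) (\<phi> c)" if "c \<in> carrier ?F'" for c
    unfolding \<phi>_def by (rule combination_lh[OF RM]) (use that in \<open>auto simp: PiE_iff\<close>)
  define \<iota> where "\<iota> x = (\<lambda>i\<in>{..<m}. f i x)" for x
  have \<iota>: "lh R X ?F \<iota>"
    by (rule lhI) (auto simp: \<iota>_def fc lh_add[OF fl] lh_smult[OF fl] fun_eq_iff)
  have Qx: "Q c x = \<phi> c (\<iota> x)" if c: "c \<in> carrier ?F'" and x: "x \<in> carrier X" for c x
  proof -
    have e: "lh (opp R) ?F' (reg_module (opp R)) (\<lambda>c. Q c x)" by (rule lh_comp[OF Q(1) eval_lh[OF x]])
    have "Q c x = lsum (reg_module (opp R)) (\<lambda>i. c i \<odot>\<^bsub>reg_module (opp R)\<^esub> f i x) m"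
      unfolding f_def by (rule lh_free_expand[OF R' RM' e c])
    also have "\<dots> = lsum (reg_module (opp R)) (\<lambda>i. \<iota> x i \<odot>\<^bsub>reg_module R\<^esub> c i) m"
      by (rule lsum_cong) (simp add: \<iota>_def)
    finally show ?thesis by (simp only: \<phi>_def lsum_reg_opp)
  qed
  have ext: "\<exists>c\<in>carrier ?F'. \<forall>x\<in>carrier X. h x = \<phi> c (\<iota> x)" if h: "lh R X (reg_module R) h" for h
  proof -
    have "restrict h (carrier X) \<in> Q ` carrier ?F'" unfolding Q(2) using restrict_lhom[OF XM RM h] by simp
    then obtain c where c: "restrict h (carrier X) = Q c" "c \<in> carrier ?F'" by (rule imageE)
    have "h x = \<phi> c (\<iota> x)" if "x \<in> carrier X" for x using Qx[OF c(2) that] fun_cong[OF c(1), of x] that by simp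
    then show ?thesis using c(2) by blast
  qed
  have inj: "inj_on \<iota> (carrier X)"
  proof (rule lh_inj[OF XM F \<iota>])
    fix x assume x: "x \<in> carrier X" "\<iota> x = \<zero>\<^bsub>?F\<^esub>"
    have "h x = \<zero>\<^bsub>R\<^esub>" if h: "lh R X (reg_module R) h" for h
    proof -
      obtain c where c: "c \<in> carrier ?F'" "h x = \<phi> c (\<iota> x)" using ext[OF h] x(1) by blast
      show ?thesis unfolding c(2) x(2) lh_zero[OF F RM \<phi>[OF c(1)]] by simp
    qed
    then show "x = \<zero>\<^bsub>X\<^esub>" using tX x(1) by (simp add: tl_def)
  qed
  let ?I = "\<iota> ` carrier X"
  have I: "submod R ?F ?I" by (rule submod_image[OF XM F \<iota> submod_carrier[OF XM]])
  note IM = submod_lmodule[OF F I]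
  have \<iota>': "lh R X (?F\<lparr>carrier := ?I\<rparr>) \<iota>" by (rule lh_cod[OF \<iota>]) auto
  have bij: "bij_betw \<iota> (carrier X) (carrier (?F\<lparr>carrier := ?I\<rparr>))" using inj by (simp add: bij_betw_def)
  note inv = lh_inv[OF XM IM \<iota>' bij]
  obtain Y :: "('r, nat \<Rightarrow> 'r) module" and q where Y: "lmodule R Y" "lh R ?F Y q" "q ` carrier ?F = carrier Y" "a_kernel ?F Y q = ?I"
    by (rule quotient[OF F I])
  have pY: "pres R Y ?F q" using Y free_fgproj[OF R] by (auto simp: pres_def)
  \<comment> \<open>The kernel of the presentation of Y is a copy of X, hence in
    \<open>perp R\<close>, and forms extend from it to the free module because the f i generate the
    dual of X. So \<open>ev_Suc\<close> gives Ext^i(Y, R) = 0 in all positive degrees.\<close>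
  have "?F\<lparr>carrier := ?I\<rparr> \<in> perp R"
    by (rule perp_retract[OF N X IM inv \<iota>']) (rule bij_betw_inv_into_right[OF bij])
  moreover have "xt R ?F ?I (reg_module R)" unfolding xt_def
  proof (intro allI impI)
    fix h assume h: "lh R (?F\<lparr>carrier := ?I\<rparr>) (reg_module R) h"
    obtain c where "c \<in> carrier ?F'" "\<forall>x\<in>carrier X. h (\<iota> x) = \<phi> c (\<iota> x)" using ext[OF lh_comp[OF \<iota>' h]] by blast
    then show "\<exists>g. lh R ?F (reg_module R) g \<and> (\<forall>x\<in>?I. g x = h x)" using \<phi> by (intro exI[of _ "\<phi> c"]) auto
  qed
  ultimately have evY: "ev R (Suc n) Y" for n using ev_Suc[OF N Y(1) pY, of n] Y(4) by (simp add: perp_iff_ev[OF N])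
  have Yp: "Y \<in> perp R" unfolding perp_iff_ev[OF N]
  proof
    fix n show "ev R n Y" using evY pres_fg[OF Y(1) pY] Y(1) by (cases n) (auto simp: ev_0)
  qed
  then have tY: "tl R Y" using T by (simp add: TL_def)
  have qz: "q (\<iota> x) = \<zero>\<^bsub>Y\<^esub>" if "x \<in> carrier X" for x using Y(4) that by (auto simp: a_kernel_def')
  \<comment> \<open>\<open>cf\<close> takes a form on Y to its coefficient vector on the free
    module. It will identify the dual of Y with the kernel of Q, that is, with the first syzygy of
    the dual of X.\<close>
  define cf where "cf g = (\<lambda>i\<in>{..<m}. g (q (unit_vec R m i)))" for g :: "(nat \<Rightarrow> 'r) \<Rightarrow> 'r"
  have quc: "q (unit_vec R m i) \<in> carrier Y" for i by (rule lh_closed[OF Y(2) unit_vec_closed[OF R]])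
  have cf: "cf g \<in> carrier ?F'" if "lh R Y (reg_module R) g" for g
    using lh_closed[OF that quc] by (simp add: cf_def)
  have \<phi>cf: "\<phi> (cf g) y = g (q y)" if g: "lh R Y (reg_module R) g" and y: "y \<in> carrier ?F" for g y
  proof -
    have "g (q y) = lsum (reg_module R) (\<lambda>i. y i \<odot>\<^bsub>reg_module R\<^esub> g (q (unit_vec R m i))) m"
      by (rule lh_free_expand[OF R RM lh_comp[OF Y(2) g] y])
    also have "\<dots> = \<phi> (cf g) y" unfolding \<phi>_def by (rule lsum_cong) (simp add: cf_def)
    finally show ?thesis by simp
  qed
  have Qcf: "Q (cf g) = \<zero>\<^bsub>dual R X\<^esub>" if g: "lh R Y (reg_module R) g" for g
  proof (rule dual_eqI[of _ R X "reg_module R"])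
    show "Q (cf g) \<in> lhom R X (reg_module R)" using lh_closed[OF Q(1) cf[OF g]] by simp
    show "\<zero>\<^bsub>dual R X\<^esub> \<in> lhom R X (reg_module R)" using restrict_lhom[OF XM RM lh_zero_map[OF XM RM]] by simp
    show "Q (cf g) x = \<zero>\<^bsub>dual R X\<^esub> x" if x: "x \<in> carrier X" for x
      using Qx[OF cf[OF g] x] \<phi>cf[OF g lh_closed[OF \<iota> x]] qz[OF x] lh_zero[OF Y(1) RM g] x by simp
  qed
  show "reflexive R X"
  proof (rule reflexiveI[OF XM tX])
    fix \<xi> assume \<xi>: "lh (opp R) (dual R X) (reg_module (opp R)) \<xi>"
    have \<xi>c: "\<xi> (f i) \<in> carrier R" for i using lh_closed[OF \<xi>, of "f i"] f by simp
    \<comment> \<open>p is the vector at which \<xi> evaluates. Forms on Y vanish at q p, because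
      their coefficient vectors are killed by Q; as Y is torsionless, q p = 0 and p comes from
      X.\<close>
    define p where "p = (\<lambda>i\<in>{..<m}. \<xi> (f i))"
    have p: "p \<in> carrier ?F" using \<xi>c by (simp add: p_def)
    have \<xi>Q: "\<xi> (Q c) = \<phi> c p" if c: "c \<in> carrier ?F'" for c
    proof -
      have "\<xi> (Q c) = lsum (reg_module (opp R)) (\<lambda>i. c i \<odot>\<^bsub>reg_module (opp R)\<^esub> \<xi> (f i)) m"
        unfolding f_def by (rule lh_free_expand[OF R' RM' lh_comp[OF Q(1) \<xi>] c])
      also have "\<dots> = lsum (reg_module (opp R)) (\<lambda>i. p i \<odot>\<^bsub>reg_module R\<^esub> c i) m"
        by (rule lsum_cong) (simp add: p_def)
      finally show ?thesis by (simp only: \<phi>_def lsum_reg_opp)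
    qed
    have "g (q p) = \<zero>\<^bsub>R\<^esub>" if g: "lh R Y (reg_module R) g" for g
      using \<phi>cf[OF g p] \<xi>Q[OF cf[OF g]] lh_zero[OF D RM' \<xi>] unfolding Qcf[OF g] by simp
    then have "q p = \<zero>\<^bsub>Y\<^esub>" using tY lh_closed[OF Y(2) p] by (simp add: tl_def)
    then have "p \<in> ?I" using Y(4) p by (auto simp: a_kernel_def')
    then obtain x where x: "x \<in> carrier X" "p = \<iota> x" by auto
    have "\<xi> h = h x" if h: "h \<in> lhom R X (reg_module R)" for h
    proof -
      have "h \<in> Q ` carrier ?F'" unfolding Q(2) using h by simp
      then obtain c where c: "h = Q c" "c \<in> carrier ?F'" by (rule imageE)
      then show ?thesis using \<xi>Q[OF c(2)] Qx[OF c(2) x(1)] x(2) by simp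
    qed
    then show "\<exists>x\<in>carrier X. \<forall>f\<in>lhom R X (reg_module R). \<xi> f = f x" using x(1) by blast
  qed
  have pX: "pres (opp R) (dual R X) ?F' Q" using Q free_fgproj[OF R'] by (auto simp: pres_def)
  let ?K = "a_kernel ?F' (dual R X) Q"
  note KM = pres_kernel[OF D pX]
  have cfl: "lh (opp R) (dual R Y) (?F'\<lparr>carrier := ?K\<rparr>) cf"
  proof (rule lh_cod)
    show "lh (opp R) (dual R Y) ?F' cf"
      by (rule lhI) (use lh_closed[OF dual_elem(1) quc] quc in \<open>auto simp: cf_def fun_eq_iff\<close>)
    show "cf g \<in> ?K" if "g \<in> carrier (dual R Y)" for g
      using cf[OF dual_elem(1)] Qcf[OF dual_elem(1)] that by (auto simp: a_kernel_def')
  qed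
  \<comment> \<open>For c in the kernel of Q the form \<phi> c vanishes on the image of X, hence
    descends to Y.\<close>
  have \<phi>q: "\<exists>g. g \<in> lhom R Y (reg_module R) \<and> cf g = c \<and> (\<forall>y\<in>carrier ?F. g (q y) = \<phi> c y)" if c: "c \<in> ?K" for c
  proof -
    have cF: "c \<in> carrier ?F'" and Qc: "Q c = \<zero>\<^bsub>dual R X\<^esub>" using c by (auto simp: a_kernel_def')
    have k: "\<phi> c y = \<zero>\<^bsub>reg_module R\<^esub>" if "y \<in> carrier ?F" "q y = \<zero>\<^bsub>Y\<^esub>" for y
    proof -
      have "y \<in> ?I" using Y(4) that by (auto simp: a_kernel_def')
      then obtain x where x: "x \<in> carrier X" "y = \<iota> x" by auto
      show ?thesis using Qx[OF cF x(1)] Qc x by simp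
    qed
    obtain g where g: "lh R Y (reg_module R) g" "\<And>y. y \<in> carrier ?F \<Longrightarrow> g (q y) = \<phi> c y"
      by (rule lh_factor[OF F RM Y(1,2,3) \<phi>[OF cF] k]) (assumption | rule that)+
    let ?g = "restrict g (carrier Y)"
    have "cf ?g = c"
    proof
      fix i show "cf ?g i = c i"
      proof (cases "i < m")
        case True
        have "g (q (unit_vec R m i)) = \<phi> c (unit_vec R m i)" by (rule g(2)[OF unit_vec_closed[OF R]])
        also have "\<dots> = c i" unfolding \<phi>_def
          by (rule combination_unit_vec[OF RM _ True]) (use cF in \<open>auto simp: PiE_iff\<close>)
        finally show ?thesis using True quc by (simp add: cf_def)
      next
        case False
        then show ?thesis using cF by (auto simp: cf_def PiE_iff extensional_def)
      qed
    qed
    then show ?thesis using restrict_lhom[OF Y(1) RM g(1)] g(2) lh_closed[OF Y(2)]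
      by (intro exI[of _ ?g]) simp
  qed
  have "ev (opp R) (Suc n) (dual R X)" if rY: "reflexive R Y" and evn: "ev (opp R) n (dual R Y)" for n
  proof -
    have inj: "inj_on cf (carrier (dual R Y))"
    proof (rule lh_inj[OF dual_lmodule[OF Y(1)] KM(2) cfl])
      fix g assume g: "g \<in> carrier (dual R Y)" and z: "cf g = \<zero>\<^bsub>?F'\<lparr>carrier := ?K\<rparr>\<^esub>"
      have gl: "lh R Y (reg_module R) g" using g dual_elem(1) by auto
      have "g y = \<zero>\<^bsub>R\<^esub>" if y: "y \<in> carrier Y" for y
      proof -
        obtain y' where y': "y = q y'" "y' \<in> carrier ?F" by (rule imageE[OF y[folded Y(3)]])
        have "\<phi> (cf g) y' = \<zero>\<^bsub>reg_module R\<^esub>" unfolding \<phi>_def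
          by (rule abelian_group.lsum_zero[OF lmodule_group[OF RM]]) (use y' in \<open>auto simp: z PiE_iff\<close>)
        then show ?thesis using \<phi>cf[OF gl y'(2)] y'(1) by simp
      qed
      then show "g = \<zero>\<^bsub>dual R Y\<^esub>" using g restrict_lhom[OF Y(1) RM lh_zero_map[OF Y(1) RM]]
        by (intro dual_eqI[of g R Y "reg_module R"]) auto
    qed
    moreover have "cf ` carrier (dual R Y) = ?K"
    proof (intro equalityI subsetI)
      fix c assume "c \<in> ?K" then show "c \<in> cf ` carrier (dual R Y)" using \<phi>q[of c] by auto
    next
      fix c assume "c \<in> cf ` carrier (dual R Y)" then show "c \<in> ?K" using lh_closed[OF cfl] by auto
    qed
    ultimately have b: "bij_betw cf (carrier (dual R Y)) (carrier (?F'\<lparr>carrier := ?K\<rparr>))" by (simp add: bij_betw_def)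
    have "ev (opp R) n (?F'\<lparr>carrier := ?K\<rparr>)"
      by (rule ev_retract[OF N' evn KM(2) lh_inv[OF dual_lmodule[OF Y(1)] KM(2) cfl b] cfl])
        (rule bij_betw_inv_into_right[OF b])
    \<comment> \<open>A form on the kernel of Q is a form on the dual of Y, so by reflexivity it
      evaluates at some y = q p; evaluation at p extends it to the free module.\<close>
    moreover have "xt (opp R) ?F' ?K (reg_module (opp R))" unfolding xt_def
    proof (intro allI impI)
      fix h assume h: "lh (opp R) (?F'\<lparr>carrier := ?K\<rparr>) (reg_module (opp R)) h"
      obtain y where y: "y \<in> carrier Y" "\<forall>g\<in>lhom R Y (reg_module R). h (cf g) = g y"
        using reflexiveD[OF Y(1) rY lh_comp[OF cfl h]] by blast
      obtain p where p: "y = q p" "p \<in> carrier ?F" by (rule imageE[OF y(1)[folded Y(3)]])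
      let ?e = "\<lambda>c. lsum (reg_module (opp R)) (\<lambda>i. c i \<odot>\<^bsub>reg_module (opp R)\<^esub> p i) m"
      have "lh (opp R) ?F' (reg_module (opp R)) ?e"
        by (rule combination_lh[OF RM']) (use p in \<open>auto simp: PiE_iff\<close>)
      moreover have "?e c = h c" if cK: "c \<in> ?K" for c
      proof -
        obtain g where g: "g \<in> lhom R Y (reg_module R)" "cf g = c" "\<forall>y\<in>carrier ?F. g (q y) = \<phi> c y" using \<phi>q[OF cK] by blast
        have "h c = \<phi> c p" using g y(2) p by auto
        then show ?thesis by (simp add: \<phi>_def)
      qed
      ultimately show "\<exists>g. lh (opp R) ?F' (reg_module (opp R)) g \<and> (\<forall>x\<in>?K. g x = h x)" by blast
    qed
    ultimately show ?thesis using ev_Suc[OF N' D pX] by blast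
  qed
  then show "\<exists>Y :: ('r, nat \<Rightarrow> 'r) module. Y \<in> perp R \<and>
      (reflexive R Y \<longrightarrow> (\<forall>n. ev (opp R) n (dual R Y) \<longrightarrow> ev (opp R) (Suc n) (dual R X)))"
    using Yp by blast
qed

text \<open>\<open>TL_step\<close> trades one degree for the dual of X against one degree less for
  the dual of the cokernel Y, which belongs to the class again and is reflexive. Hence an induction
  on the degree, over all modules of the class at once.\<close>

lemma TL_gp:
  fixes R :: "('r, 'e) ring_scheme"
  assumes N: "noeth R" and N': "noeth (opp R)" and T: "TL R" and X: "X \<in> perp R"
  shows "X \<in> gp R"
proof -
  have 0: "ev (opp R) 0 (dual R Z)" if "Z \<in> perp R" for Z :: "('r, 'z, 'w) module_scheme"
    using dual_lmodule[OF perp_lmodule[OF that]] fg_dual[OF N' perp_lmodule[OF that] perp_fg[OF that]] by (simp add: ev_0)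
  have U: "ev (opp R) n (dual R Y)" if "Y \<in> perp R" for n and Y :: "('r, nat \<Rightarrow> 'r) module"
    using that
  proof (induction n arbitrary: Y)
    case 0
    show ?case using dual_lmodule[OF perp_lmodule[OF 0]] fg_dual[OF N' perp_lmodule[OF 0] perp_fg[OF 0]] by (simp add: ev_0)
  next
    case (Suc n)
    obtain Z :: "('r, nat \<Rightarrow> 'r) module" where Z: "Z \<in> perp R"
      "reflexive R Z \<longrightarrow> (\<forall>n. ev (opp R) n (dual R Z) \<longrightarrow> ev (opp R) (Suc n) (dual R Y))"
      using TL_step(2)[OF N N' T Suc.prems] by blast
    then show ?case using TL_step(1)[OF N N' T Z(1)] Suc.IH[OF Z(1)] by blast
  qed
  have "ev (opp R) n (dual R X)" for n
  proof (cases n)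
    case 0
    then show ?thesis using dual_lmodule[OF perp_lmodule[OF X]] fg_dual[OF N' perp_lmodule[OF X] perp_fg[OF X]] by (simp add: ev_0)
  next
    case (Suc k)
    obtain Z :: "('r, nat \<Rightarrow> 'r) module" where Z: "Z \<in> perp R"
      "reflexive R Z \<longrightarrow> (\<forall>n. ev (opp R) n (dual R Z) \<longrightarrow> ev (opp R) (Suc n) (dual R X))"
      using TL_step(2)[OF N N' T X] by blast
    then show ?thesis using TL_step(1)[OF N N' T Z(1)] U[OF Z(1)] Suc by blast
  qed
  then show ?thesis using X TL_step(1)[OF N N' T X] by (simp add: gp_def perp_iff_ev[OF N'])
qed

text \<open>One direction holds because reflexive modules are torsionless, the other is
  \<open>TL_gp\<close>. The two sides speak about different carrier types, hence the
  transport.\<close>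

lemma weakly_Gorenstein_iff:
  fixes R :: "('r, 'e) ring_scheme"
  assumes N: "noeth R" and N': "noeth (opp R)"
  shows "weakly_Gorenstein R \<longleftrightarrow> TL R"
proof
  assume "TL R"
  then show "weakly_Gorenstein R" unfolding weakly_Gorenstein_def using TL_gp[OF N N'] by (auto simp: gp_def)
next
  assume w: "weakly_Gorenstein R"
  show "TL R" unfolding TL_def
  proof (intro allI impI)
    fix X :: "('r, nat \<Rightarrow> 'r) module" assume X: "X \<in> perp R"
    note XM = perp_lmodule[OF X]
    obtain X' :: "'r fgmod" and a b where X': "lmodule R X'" "lh R X X' a" "lh R X' X b"
      and ba: "\<And>x. x \<in> carrier X \<Longrightarrow> b (a x) = x" and ab: "\<And>x. x \<in> carrier X' \<Longrightarrow> a (b x) = x"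
      by (rule transport_fgmod[OF XM perp_fg[OF X]]) (rule that, assumption+)
    have "X' \<in> perp R" by (rule perp_retract[OF N X X'(1,3,2)]) (rule ab)
    then have "X' \<in> gp R" using w by (simp add: weakly_Gorenstein_def)
    then have "torsionless R X'" by (simp add: gp_def reflexive_def torsionless_def lisos_def bij_betw_def)
    then have "tl R X'" using torsionless_iff[OF X'(1)] by simp
    then show "tl R X" by (rule tl_embed[OF X'(1) XM _ X'(2)]) (rule inj_on_inverseI[of _ b], rule ba)
  qed
qed

section \<open>Vanishing of first extensions of semi-Gorenstein-projective modules\<close>

lemma lsum_append:
  assumes "abelian_group X" "\<And>i. i < n + m \<Longrightarrow> h i \<in> carrier X"
  shows "lsum X h (n + m) = lsum X h n \<oplus>\<^bsub>X\<^esub> lsum X (\<lambda>j. h (n + j)) m"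
proof -
  interpret X: abelian_group X by fact
  show ?thesis using assms(2)
  proof (induction m)
    case 0 then show ?case by (simp add: X.lsum_closed)
  next
    case (Suc m) then show ?case by (simp add: X.lsum_closed X.a_assoc)
  qed
qed

text \<open>The substantial inclusion in perp = add, on one carrier type; \<open>fgproj_perp\<close>
  and \<open>perp_eq_add_iff\<close> supply the rest.\<close>

definition PA :: "('r, 'e) ring_scheme \<Rightarrow> bool" where
  "PA R \<longleftrightarrow> (\<forall>X :: ('r, nat \<Rightarrow> 'r) module. X \<in> perp R \<longrightarrow> fgproj R X)"

lemma PA_D:
  fixes R :: "('r, 'e) ring_scheme"
  assumes N: "noeth R" and T: "PA R" and X: "X \<in> perp R" shows "fgproj R X"
proof -
  note XM = perp_lmodule[OF X]
  obtain X' :: "('r, nat \<Rightarrow> 'r) module" and a b where X': "lmodule R X'" "lh R X X' a" "lh R X' X b"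
    and ba: "\<And>x. x \<in> carrier X \<Longrightarrow> b (a x) = x" and ab: "\<And>x. x \<in> carrier X' \<Longrightarrow> a (b x) = x"
    by (rule transport_nat[OF XM perp_fg[OF X]]) (rule that, assumption+)
  have "X' \<in> perp R" by (rule perp_retract[OF N X X'(1,3,2)]) (rule ab)
  then have "fgproj R X'" using T by (auto simp: PA_def)
  then show ?thesis by (rule fgproj_retract[OF _ XM X'(2,3)]) (rule ba)
qed

lemma zero_submod: assumes "lmodule R X" shows "submod R X {\<zero>\<^bsub>X\<^esub>}"
proof -
  interpret X: lmodule R X by fact
  show ?thesis by (simp add: submod_def)
qed

lemma zero_fgproj: assumes X: "lmodule R X" "carrier X = {\<zero>\<^bsub>X\<^esub>}" shows "fgproj R X"
  unfolding fgproj_def dbasis_def using X by (intro conjI exI[of _ "0::nat"]) auto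

text \<open>The identity is a presentation with kernel zero, and the zero module is projective
  again.\<close>

lemma fgproj_perp: assumes N: "noeth R" and P: "fgproj R P" shows "P \<in> perp R"
  unfolding perp_iff_ev[OF N]
proof
  fix n show "ev R n P" using P
  proof (induction n arbitrary: P)
    case 0 then show ?case by (simp add: ev_0 fgproj_lmodule fgproj_fg)
  next
    case (Suc n)
    note PM = fgproj_lmodule[OF Suc.prems]
    have p: "pres R P P (\<lambda>x. x)" using Suc.prems by (simp add: pres_def lh_id)
    interpret P: lmodule R P by (rule PM)
    have k: "a_kernel P P (\<lambda>x. x) = {\<zero>\<^bsub>P\<^esub>}" by (auto simp: a_kernel_def')
    note Z = submod_lmodule[OF PM zero_submod[OF PM]]
    have "ev R n (P\<lparr>carrier := {\<zero>\<^bsub>P\<^esub>}\<rparr>)" by (rule Suc.IH[OF zero_fgproj[OF Z]]) simp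
    moreover have "xt R P {\<zero>\<^bsub>P\<^esub>} (reg_module R)" unfolding xt_def
    proof (intro allI impI)
      note RM = reg_lmodule[OF noeth_ring[OF N]]
      fix f assume f: "lh R (P\<lparr>carrier := {\<zero>\<^bsub>P\<^esub>}\<rparr>) (reg_module R) f"
      show "\<exists>g. lh R P (reg_module R) g \<and> (\<forall>x\<in>{\<zero>\<^bsub>P\<^esub>}. g x = f x)"
        using lh_zero[OF Z RM f] lh_zero_map[OF PM RM] by auto
    qed
    ultimately show ?case using ev_Suc[OF N PM p, of n] k by simp
  qed
qed

lemma perp_eq_add_iff:
  fixes R :: "('r, 'e) ring_scheme"
  assumes N: "noeth R" shows "(perp R :: 'r fgmod set) = add_modules R \<longleftrightarrow> PA R"
proof
  assume "PA R" then show "(perp R :: 'r fgmod set) = add_modules R"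
    using PA_D[OF N] fgproj_perp[OF N] by (auto simp: add_modules_iff)
next
  assume e: "(perp R :: 'r fgmod set) = add_modules R"
  show "PA R" unfolding PA_def
  proof (intro allI impI)
    fix X :: "('r, nat \<Rightarrow> 'r) module" assume X: "X \<in> perp R"
    note XM = perp_lmodule[OF X]
    obtain X' :: "'r fgmod" and a b where X': "lmodule R X'" "lh R X X' a" "lh R X' X b"
      and ba: "\<And>x. x \<in> carrier X \<Longrightarrow> b (a x) = x" and ab: "\<And>x. x \<in> carrier X' \<Longrightarrow> a (b x) = x"
      by (rule transport_fgmod[OF XM perp_fg[OF X]]) (rule that, assumption+)
    have "X' \<in> perp R" by (rule perp_retract[OF N X X'(1,3,2)]) (rule ab)
    then have "fgproj R X'" using e by (simp add: add_modules_iff)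
    then show "fgproj R X" by (rule fgproj_retract[OF _ XM X'(2,3)]) (rule ba)
  qed
qed

lemma perp_kernel:
  assumes N: "noeth R" and X: "X \<in> perp R" and P: "pres R X P p"
  shows "xt R P (a_kernel P X p) (reg_module R)" "P\<lparr>carrier := a_kernel P X p\<rparr> \<in> perp R"
  using ev_Suc[OF N perp_lmodule[OF X] P] X by (auto simp: perp_iff_ev[OF N])

text \<open>\<open>Ext\<^sup>1(Z, N) = 0\<close> for all \<open>Z \<in> \<^sup>\<bottom>R\<close>\<close>

definition vz :: "('r, 'e) ring_scheme \<Rightarrow> ('r, 'n, 'x) module_scheme \<Rightarrow> bool" where
  "vz R N \<longleftrightarrow> lmodule R N \<and> (\<forall>(Z :: ('r, nat \<Rightarrow> 'r) module) (P :: ('r, nat \<Rightarrow> 'r) module) p.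
     Z \<in> perp R \<longrightarrow> pres R Z P p \<longrightarrow> xt R P (a_kernel P Z p) N)"

text \<open>X is a retract, hence a stable summand, of its copy on functions from
  \<open>nat\<close>.\<close>

lemma vz_D:
  fixes R :: "('r, 'e) ring_scheme"
  assumes N: "noeth R" and v: "vz R M" and X: "X \<in> perp R" and P: "pres R X P p"
  shows "xt R P (a_kernel P X p) M"
proof -
  note XM = perp_lmodule[OF X]
  obtain X' :: "('r, nat \<Rightarrow> 'r) module" and a b where X': "lmodule R X'" "lh R X X' a" "lh R X' X b"
    and ba: "\<And>x. x \<in> carrier X \<Longrightarrow> b (a x) = x" and ab: "\<And>x. x \<in> carrier X' \<Longrightarrow> a (b x) = x"
    by (rule transport_nat[OF XM perp_fg[OF X]]) (rule that, assumption+)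
  have Xp: "X' \<in> perp R" by (rule perp_retract[OF N X X'(1,3,2)]) (rule ab)
  obtain k q where q: "pres R X' (free_module R k) q" by (rule fg_pres[OF X'(1) perp_fg[OF Xp]])
  have "xt R (free_module R k) (a_kernel (free_module R k) X' q) M" using v Xp q by (auto simp: vz_def)
  moreover have "srt R X X' P p" by (rule retract_srt[OF XM P X'(2,3)]) (rule ba)
  ultimately show ?thesis using stable_step(1)[OF X'(1) XM q P] v by (auto simp: vz_def)
qed

text \<open>A dual basis reduces a map into M to n maps into R, each of which extends; the elements
  m_i recombine the extensions.\<close>

lemma vz_fgproj: assumes N: "noeth R" and M: "fgproj R M" shows "vz R M"
  unfolding vz_def
proof (intro conjI allI impI)
  show MM: "lmodule R M" by (rule fgproj_lmodule[OF M])
  interpret M: lmodule R M by (rule MM)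
  fix Z P :: "('a, nat \<Rightarrow> 'a) module" and p assume Z: "Z \<in> perp R" and P: "pres R Z P p"
  let ?K = "a_kernel P Z p"
  note K = pres_kernel[OF perp_lmodule[OF Z] P]
  have PM: "lmodule R P" using P by (simp add: pres_def fgproj_lmodule)
  obtain n l m where d: "dbasis R M n l m" using M by (auto simp: fgproj_def)
  show "xt R P ?K M" unfolding xt_def
  proof (intro allI impI)
    fix f assume f: "lh R (P\<lparr>carrier := ?K\<rparr>) M f"
    have "\<forall>i. \<exists>g. i < n \<longrightarrow> lh R P (reg_module R) g \<and> (\<forall>x\<in>?K. g x = l i (f x))"
    proof
      fix i show "\<exists>g. i < n \<longrightarrow> lh R P (reg_module R) g \<and> (\<forall>x\<in>?K. g x = l i (f x))"
      proof (cases "i < n")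
        case True
        then have "lh R (P\<lparr>carrier := ?K\<rparr>) (reg_module R) (\<lambda>x. l i (f x))"
          using d by (intro lh_comp[OF f]) (simp add: dbasis_def)
        then show ?thesis using perp_kernel(1)[OF N Z P] unfolding xt_def by blast
      qed simp
    qed
    then obtain g where g: "\<And>i. i < n \<Longrightarrow> lh R P (reg_module R) (g i)" "\<And>i x. i < n \<Longrightarrow> x \<in> ?K \<Longrightarrow> g i x = l i (f x)"
      by metis
    let ?g = "\<lambda>x. lsum M (\<lambda>i. g i x \<odot>\<^bsub>M\<^esub> m i) n"
    have "lh R P M ?g"
      by (rule lsum_lh[OF PM MM], rule lh_scale[OF MM g(1)]) (use d in \<open>auto simp: dbasis_def\<close>)
    moreover have "?g x = f x" if x: "x \<in> ?K" for x
    proof -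
      have "?g x = lsum M (\<lambda>i. l i (f x) \<odot>\<^bsub>M\<^esub> m i) n" by (rule lsum_cong) (simp add: g(2) x)
      also have "\<dots> = f x" using d lh_closed[OF f, of x] x by (simp add: dbasis_def)
      finally show ?thesis .
    qed
    ultimately show "\<exists>g. lh R P M g \<and> (\<forall>x\<in>?K. g x = f x)" by blast
  qed
qed

text \<open>Ext^1(X, ker q) = 0 makes Hom(X, M0) -> Hom(X, M) surjective. On a free cover of X a
  lift h exists; it maps the kernel of the cover into ker q, this restriction extends to some h'
  with values in ker q, and h - h' descends to X.\<close>

lemma vz_lift:
  assumes N: "noeth R" and M: "lmodule R M" and M0: "lmodule R M0" and q: "lh R M0 M q" "q ` carrier M0 = carrier M"
    and v: "vz R (M0\<lparr>carrier := a_kernel M0 M q\<rparr>)" and X: "X \<in> perp R" and g: "lh R X M g"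
  obtains h where "lh R X M0 h" "\<And>x. x \<in> carrier X \<Longrightarrow> q (h x) = g x"
proof -
  note XM = perp_lmodule[OF X]
  interpret M0: lmodule R M0 by fact
  interpret M: lmodule R M by fact
  obtain k p where p: "pres R X (free_module R k) p" by (rule fg_pres[OF XM perp_fg[OF X]])
  let ?F = "free_module R k" and ?H = "a_kernel M0 M q"
  let ?K = "a_kernel ?F X p"
  have F: "lmodule R ?F" by (rule free_lmodule[OF noeth_ring[OF N]])
  have p': "lh R ?F X p" "p ` carrier ?F = carrier X" using p by (auto simp: pres_def)
  have H: "submod R M0 ?H" by (rule submod_kernel[OF M0 M q(1)])
  have gp: "lh R ?F M (\<lambda>x. g (p x))" by (rule lh_comp[OF p'(1) g])
  obtain h where h: "lh R ?F M0 h" "\<And>x. x \<in> carrier ?F \<Longrightarrow> q (h x) = g (p x)"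
    by (rule fgproj_lift[OF free_fgproj[OF noeth_ring[OF N]] M0 M q(1) gp])
      (assumption | rule that | simp only: q(2) lh_closed[OF gp])+
  have "lh R (?F\<lparr>carrier := ?K\<rparr>) (M0\<lparr>carrier := ?H\<rparr>) h"
  proof (rule lh_cod[OF lh_dom[OF h(1)]])
    show "?K \<subseteq> carrier ?F" by (auto simp: a_kernel_def')
    fix x assume "x \<in> carrier (?F\<lparr>carrier := ?K\<rparr>)"
    then have x: "x \<in> carrier ?F" "p x = \<zero>\<^bsub>X\<^esub>" by (auto simp: a_kernel_def')
    have "q (h x) = \<zero>\<^bsub>M\<^esub>" unfolding h(2)[OF x(1)] x(2) by (rule lh_zero[OF XM M g])
    then show "h x \<in> ?H" using lh_closed[OF h(1) x(1)] by (simp add: a_kernel_def')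
  qed
  then obtain h' where h': "lh R ?F (M0\<lparr>carrier := ?H\<rparr>) h'" "\<forall>x\<in>?K. h' x = h x"
    using vz_D[OF N v X p] unfolding xt_def by blast
  have h'0: "lh R ?F M0 h'" by (rule lh_uncod[OF h'(1) submod_subset[OF H]])
  have qh': "q (h' x) = \<zero>\<^bsub>M\<^esub>" if "x \<in> carrier ?F" for x using lh_closed[OF h'(1) that] by (simp add: a_kernel_def')
  have d: "lh R ?F M0 (\<lambda>x. h x \<ominus>\<^bsub>M0\<^esub> h' x)" by (rule lh_diff[OF F M0 h(1) h'0])
  have "h x \<ominus>\<^bsub>M0\<^esub> h' x = \<zero>\<^bsub>M0\<^esub>" if "x \<in> carrier ?F" "p x = \<zero>\<^bsub>X\<^esub>" for x
  proof -
    have "x \<in> ?K" using that by (simp add: a_kernel_def')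
    then show ?thesis using h'(2) lh_closed[OF h(1) that(1)] by (simp add: M0.M.minus_eq M0.M.r_neg)
  qed
  then obtain t where t: "lh R X M0 t" "\<And>x. x \<in> carrier ?F \<Longrightarrow> t (p x) = h x \<ominus>\<^bsub>M0\<^esub> h' x"
    by (rule lh_factor[OF F M0 XM p' d]) (assumption | rule that)+
  have "q (t x) = g x" if x: "x \<in> carrier X" for x
  proof -
    obtain y where y: "x = p y" "y \<in> carrier ?F" by (rule imageE[OF x[folded p'(2)]])
    show ?thesis unfolding y(1) t(2)[OF y(2)]
      using lh_minus[OF M0 M q(1) lh_closed[OF h(1) y(2)] lh_closed[OF h'0 y(2)]] lh_closed[OF gp y(2)]
      by (simp only: qh'[OF y(2)] h(2)[OF y(2)]) (simp add: M.M.minus_eq)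
  qed
  then show thesis using that t(1) by blast
qed

text \<open>In the long exact sequence Ext^1(Z, M) sits between Ext^1(Z, M0) and Ext^2(Z, ker q),
  and the latter is Ext^1 of a syzygy of Z, which is in \<open>perp R\<close> again. In terms of
  maps: lift from the syzygy to M0, extend there, compose with q.\<close>

lemma vz_step:
  assumes N: "noeth R" and M: "lmodule R M" and q: "lh R M0 M q" "q ` carrier M0 = carrier M"
    and v0: "vz R M0" and v: "vz R (M0\<lparr>carrier := a_kernel M0 M q\<rparr>)"
  shows "vz R M"
  unfolding vz_def
proof (intro conjI allI impI)
  show "lmodule R M" by (rule M)
  have M0: "lmodule R M0" using v0 by (simp add: vz_def)
  fix Z P :: "('a, nat \<Rightarrow> 'a) module" and p assume Z: "Z \<in> perp R" and P: "pres R Z P p"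
  let ?K = "a_kernel P Z p"
  show "xt R P ?K M" unfolding xt_def
  proof (intro allI impI)
    fix f assume f: "lh R (P\<lparr>carrier := ?K\<rparr>) M f"
    obtain h where h: "lh R (P\<lparr>carrier := ?K\<rparr>) M0 h" "\<And>x. x \<in> carrier (P\<lparr>carrier := ?K\<rparr>) \<Longrightarrow> q (h x) = f x"
      by (rule vz_lift[OF N M M0 q v perp_kernel(2)[OF N Z P] f]) (rule that, assumption+)
    then have qh: "\<And>x. x \<in> ?K \<Longrightarrow> q (h x) = f x" by simp
    obtain g where g: "lh R P M0 g" "\<forall>x\<in>?K. g x = h x" using v0 Z P h(1) unfolding vz_def xt_def by blast
    show "\<exists>g. lh R P M g \<and> (\<forall>x\<in>?K. g x = f x)"
      by (intro exI[of _ "\<lambda>x. q (g x)"] conjI lh_comp[OF g(1) q(1)]) (simp add: g(2) qh)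
  qed
qed

lemma vz_zero: assumes M: "lmodule R M" and z: "carrier M = {\<zero>\<^bsub>M\<^esub>}" shows "vz R M"
  unfolding vz_def xt_def
proof (intro conjI allI impI)
  fix Z P :: "('a, nat \<Rightarrow> 'a) module" and p f assume Z: "Z \<in> perp R" and P: "pres R Z P p"
    and f: "lh R (P\<lparr>carrier := a_kernel P Z p\<rparr>) M f"
  have PM: "lmodule R P" using P by (simp add: pres_def fgproj_lmodule)
  show "\<exists>g. lh R P M g \<and> (\<forall>x\<in>a_kernel P Z p. g x = f x)"
    by (intro exI[of _ "\<lambda>_. \<zero>\<^bsub>M\<^esub>"] conjI lh_zero_map[OF PM M] ballI) (use lh_closed[OF f] z in simp)
qed (rule M)

text \<open>\<alpha> splits \<rho> linearly over L, so A is a direct summand of L as an L-module,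
  and forms with values in A become forms with values in L.\<close>

lemma fgproj_res:
  assumes L: "ring L" and \<rho>: "\<rho> \<in> ring_hom L A" and \<alpha>: "lh L (res \<rho> (reg_module A)) (reg_module L) \<alpha>"
    and \<rho>\<alpha>: "\<And>a. a \<in> carrier A \<Longrightarrow> \<rho> (\<alpha> a) = a" and P: "fgproj A P"
  shows "fgproj L (res \<rho> P)"
proof -
  note PM = fgproj_lmodule[OF P]
  obtain n l p where d: "dbasis A P n l p" using P by (auto simp: fgproj_def)
  have lc: "l i x \<in> carrier A" if "i < n" "x \<in> carrier P" for i x
    using d that lh_closed[of A P "reg_module A" "l i" x] by (auto simp: dbasis_def)
  have "dbasis L (res \<rho> P) n (\<lambda>i x. \<alpha> (l i x)) p" unfolding dbasis_def
  proof (intro conjI allI impI ballI)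
    fix i assume i: "i < n"
    then have "lh A P (reg_module A) (l i)" using d by (simp add: dbasis_def)
    from lh_comp[OF res_lh[OF ring_hom_closed[OF \<rho>] this] \<alpha>]
    show "lh L (res \<rho> P) (reg_module L) (\<lambda>x. \<alpha> (l i x))" .
    show "p i \<in> carrier (res \<rho> P)" using d i by (simp add: dbasis_def)
  next
    fix x assume x: "x \<in> carrier (res \<rho> P)"
    have "lsum P (\<lambda>i. \<rho> (\<alpha> (l i x)) \<odot>\<^bsub>P\<^esub> p i) n = lsum P (\<lambda>i. l i x \<odot>\<^bsub>P\<^esub> p i) n"
      by (rule lsum_cong) (use lc x in \<open>simp add: \<rho>\<alpha>\<close>)
    then show "x = lsum (res \<rho> P) (\<lambda>i. \<alpha> (l i x) \<odot>\<^bsub>res \<rho> P\<^esub> p i) n" using d x by (simp add: dbasis_def)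
  qed
  then show ?thesis using ring_hom_res_lmodule[OF \<rho> L PM] unfolding fgproj_def by blast
qed

lemma proj_dim_finite:
  assumes "proj_dim R X < \<infinity>"
  obtains n P d e where "is_proj_resolution R X P d e" "\<And>i. i > n \<Longrightarrow> carrier (P i) = {\<zero>\<^bsub>P i\<^esub>}"
proof -
  have "{enat n | n. \<exists>P d e. is_proj_resolution R X P d e \<and> (\<forall>i > n. carrier (P i) = {\<zero>\<^bsub>P i\<^esub>})} \<noteq> {}"
    (is "?S \<noteq> {}")
  proof
    assume "?S = {}"
    then have "proj_dim R X = Inf {}" unfolding proj_dim_def by (rule arg_cong)
    then show False using assms by (simp add: top_enat_def)
  qed
  then show thesis using that by blast
qed

text \<open>Descent along a finite resolution with \<open>vz_step\<close>. The resolution is taken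
  over A and viewed over L through \<rho>, where its terms stay projective; with \<rho> the identity
  this covers the case L = A.\<close>

lemma vz_res_proj_dim:
  fixes A :: "('a, 'e) ring_scheme" and X :: "('a, 'm, 'x) module_scheme"
  assumes N: "noeth L" and \<rho>: "\<rho> \<in> ring_hom L A" and \<alpha>: "lh L (res \<rho> (reg_module A)) (reg_module L) \<alpha>"
    and \<rho>\<alpha>: "\<And>a. a \<in> carrier A \<Longrightarrow> \<rho> (\<alpha> a) = a" and X: "lmodule A X" and pd: "proj_dim A X < \<infinity>"
  shows "vz L (res \<rho> X)"
proof -
  note L = noeth_ring[OF N]
  obtain n P d e where r: "is_proj_resolution A X P d e" and z: "\<And>i. i > n \<Longrightarrow> carrier (P i) = {\<zero>\<^bsub>P i\<^esub>}"
    by (rule proj_dim_finite[OF pd]) (rule that, assumption+)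
  let ?D = "\<lambda>i. d i ` carrier (P (Suc i))"
  have PM: "fgproj A (P i)" "lmodule A (P i)" for i using r
    by (auto simp: is_proj_resolution_def add_modules_iff fgproj_lmodule)
  have d: "lh A (P (Suc i)) (P i) (d i)" for i using r by (auto simp: is_proj_resolution_def lhom_iff)
  have D: "submod A (P i) (?D i)" for i by (rule submod_image[OF PM(2) PM(2) d submod_carrier[OF PM(2)]])
  note DM = submod_lmodule[OF PM(2) D]
  have resM: "lmodule L (res \<rho> Y)" if "lmodule A Y" for Y :: "('a, 'y, 'z) module_scheme"
    by (rule ring_hom_res_lmodule[OF \<rho> L that])
  have vP: "vz L (res \<rho> (P i))" for i by (rule vz_fgproj[OF N fgproj_res[OF L \<rho> \<alpha> \<rho>\<alpha> PM(1)]])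
  have step: "vz L (res \<rho> ((P i)\<lparr>carrier := ?D i\<rparr>))" if v: "vz L (res \<rho> ((P (Suc i))\<lparr>carrier := ?D (Suc i)\<rparr>))" for i
  proof (rule vz_step[OF N ring_hom_res_lmodule[OF \<rho> L DM] _ _ vP, of _ _ "d i"])
    show "lh L (res \<rho> (P (Suc i))) (res \<rho> ((P i)\<lparr>carrier := ?D i\<rparr>)) (d i)"
      by (rule res_lh[OF ring_hom_closed[OF \<rho>] lh_cod[OF d]]) auto
    show "d i ` carrier (res \<rho> (P (Suc i))) = carrier (res \<rho> (P i\<lparr>carrier := ?D i\<rparr>))" by simp
    have "?D (Suc i) = a_kernel (res \<rho> (P (Suc i))) (res \<rho> ((P i)\<lparr>carrier := ?D i\<rparr>)) (d i)"
      using r by (simp add: is_proj_resolution_def a_kernel_def')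
    then show "vz L (res \<rho> (P (Suc i))\<lparr>carrier := a_kernel (res \<rho> (P (Suc i))) (res \<rho> ((P i)\<lparr>carrier := ?D i\<rparr>)) (d i)\<rparr>)"
      using v by simp
  qed
  \<comment> \<open>Downward induction on i, with k bounding n - i. It starts at i = n, where the
    image of d_n is zero because P_(n+1) is.\<close>
  have "vz L (res \<rho> ((P i)\<lparr>carrier := ?D i\<rparr>))" if "i \<ge> n - k" "i \<le> n" for i k
    using that
  proof (induction k arbitrary: i)
    case 0
    then have i: "i = n" by simp
    have "d n \<zero>\<^bsub>P (Suc n)\<^esub> = \<zero>\<^bsub>P n\<^esub>" by (rule lh_zero[OF PM(2) PM(2) d])
    then have "?D n = {\<zero>\<^bsub>P n\<^esub>}" using z[of "Suc n"] by simp
    then show ?case unfolding i by (intro vz_zero ring_hom_res_lmodule[OF \<rho> L DM]) simp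
  next
    case (Suc k)
    show ?case
    proof (cases "i = n")
      case True then show ?thesis using Suc.IH[of n] by simp
    next
      case False
      then have "n - k \<le> Suc i" "Suc i \<le> n" using Suc.prems by auto
      then show ?thesis by (rule step[OF Suc.IH])
    qed
  qed
  from this[of n 0] have v0: "vz L (res \<rho> ((P 0)\<lparr>carrier := ?D 0\<rparr>))" by simp
  have e: "lh A (P 0) X e" "e ` carrier (P 0) = carrier X" using r by (auto simp: is_proj_resolution_def lhom_iff)
  show ?thesis
  proof (rule vz_step[OF N ring_hom_res_lmodule[OF \<rho> L X] res_lh[OF ring_hom_closed[OF \<rho>] e(1)] _ vP])
    have "?D 0 = a_kernel (res \<rho> (P 0)) (res \<rho> X) e" using r by (simp add: is_proj_resolution_def a_kernel_def')
    then show "vz L (res \<rho> (P 0)\<lparr>carrier := a_kernel (res \<rho> (P 0)) (res \<rho> X) e\<rparr>)" using v0 by simp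
  qed (use e(2) in simp_all)
qed

section \<open>Triangular rings\<close>

text \<open>\<open>A\<close> and \<open>B\<close> are the corners \<open>eLe\<close> and \<open>fLf\<close> for the idempotents \<open>e = \<alpha> 1\<close> and \<open>f = \<beta> 1\<close>, which satisfy
  \<open>e + f = 1\<close> and \<open>fLe = 0\<close>; hence the compressions \<open>\<rho>\<close> and \<open>\<sigma>\<close> are ring homomorphisms. The \<open>A\<close>-\<open>B\<close>-bimodule is
  \<open>eLf\<close>.\<close>

locale triangular =
  fixes L :: "('l, 'e1) ring_scheme" and A :: "('a, 'e2) ring_scheme" and B :: "('b, 'e3) ring_scheme"
    and \<alpha> :: "'a \<Rightarrow> 'l" and \<rho> :: "'l \<Rightarrow> 'a" and \<beta> :: "'b \<Rightarrow> 'l" and \<sigma> :: "'l \<Rightarrow> 'b"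
  assumes NL: "noeth L" and NA: "noeth A" and NB: "noeth B"
    and \<rho>: "\<rho> \<in> ring_hom L A" and \<sigma>: "\<sigma> \<in> ring_hom L B"
    and \<alpha>_closed: "\<And>a. a \<in> carrier A \<Longrightarrow> \<alpha> a \<in> carrier L"
    and \<alpha>_add: "\<And>a a'. a \<in> carrier A \<Longrightarrow> a' \<in> carrier A \<Longrightarrow> \<alpha> (a \<oplus>\<^bsub>A\<^esub> a') = \<alpha> a \<oplus>\<^bsub>L\<^esub> \<alpha> a'"
    and \<alpha>_mult: "\<And>a a'. a \<in> carrier A \<Longrightarrow> a' \<in> carrier A \<Longrightarrow> \<alpha> (a \<otimes>\<^bsub>A\<^esub> a') = \<alpha> a \<otimes>\<^bsub>L\<^esub> \<alpha> a'"
    and \<beta>_closed: "\<And>b. b \<in> carrier B \<Longrightarrow> \<beta> b \<in> carrier L"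
    and \<beta>_add: "\<And>b b'. b \<in> carrier B \<Longrightarrow> b' \<in> carrier B \<Longrightarrow> \<beta> (b \<oplus>\<^bsub>B\<^esub> b') = \<beta> b \<oplus>\<^bsub>L\<^esub> \<beta> b'"
    and \<beta>_mult: "\<And>b b'. b \<in> carrier B \<Longrightarrow> b' \<in> carrier B \<Longrightarrow> \<beta> (b \<otimes>\<^bsub>B\<^esub> b') = \<beta> b \<otimes>\<^bsub>L\<^esub> \<beta> b'"
    and \<rho>\<alpha>: "\<And>a. a \<in> carrier A \<Longrightarrow> \<rho> (\<alpha> a) = a"
    and \<sigma>\<beta>: "\<And>b. b \<in> carrier B \<Longrightarrow> \<sigma> (\<beta> b) = b"
    and \<alpha>\<rho>: "\<And>x. x \<in> carrier L \<Longrightarrow> \<alpha> (\<rho> x) = \<alpha> \<one>\<^bsub>A\<^esub> \<otimes>\<^bsub>L\<^esub> x \<otimes>\<^bsub>L\<^esub> \<alpha> \<one>\<^bsub>A\<^esub>"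
    and \<beta>\<sigma>: "\<And>x. x \<in> carrier L \<Longrightarrow> \<beta> (\<sigma> x) = \<beta> \<one>\<^bsub>B\<^esub> \<otimes>\<^bsub>L\<^esub> x \<otimes>\<^bsub>L\<^esub> \<beta> \<one>\<^bsub>B\<^esub>"
    and sum_one: "\<alpha> \<one>\<^bsub>A\<^esub> \<oplus>\<^bsub>L\<^esub> \<beta> \<one>\<^bsub>B\<^esub> = \<one>\<^bsub>L\<^esub>"
    and lower_zero: "\<And>x. x \<in> carrier L \<Longrightarrow> \<beta> \<one>\<^bsub>B\<^esub> \<otimes>\<^bsub>L\<^esub> x \<otimes>\<^bsub>L\<^esub> \<alpha> \<one>\<^bsub>A\<^esub> = \<zero>\<^bsub>L\<^esub>"
begin

section \<open>Calculus with the idempotents e and f\<close>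

abbreviation "e \<equiv> \<alpha> \<one>\<^bsub>A\<^esub>"
abbreviation "f \<equiv> \<beta> \<one>\<^bsub>B\<^esub>"

sublocale L: ring L by (rule noeth_ring[OF NL])
sublocale A: ring A by (rule noeth_ring[OF NA])
sublocale B: ring B by (rule noeth_ring[OF NB])

lemmas \<rho>c [simp] = ring_hom_closed[OF \<rho>] and \<sigma>c [simp] = ring_hom_closed[OF \<sigma>]
lemmas cl [simp] = \<alpha>_closed \<beta>_closed

lemma ef [simp]: "e \<in> carrier L" "f \<in> carrier L" by simp_all

lemma ee [simp]: "e \<otimes>\<^bsub>L\<^esub> e = e" "f \<otimes>\<^bsub>L\<^esub> f = f"
  using \<alpha>_mult[of "\<one>\<^bsub>A\<^esub>" "\<one>\<^bsub>A\<^esub>"] \<beta>_mult[of "\<one>\<^bsub>B\<^esub>" "\<one>\<^bsub>B\<^esub>"] by simp_all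

lemma fe [simp]: "f \<otimes>\<^bsub>L\<^esub> e = \<zero>\<^bsub>L\<^esub>" using lower_zero[of "\<one>\<^bsub>L\<^esub>"] by simp

lemma split: assumes "x \<in> carrier L" shows "x = e \<otimes>\<^bsub>L\<^esub> x \<oplus>\<^bsub>L\<^esub> f \<otimes>\<^bsub>L\<^esub> x" "x = x \<otimes>\<^bsub>L\<^esub> e \<oplus>\<^bsub>L\<^esub> x \<otimes>\<^bsub>L\<^esub> f"
  using assms sum_one L.l_distr[of e f x] L.r_distr[of e f x] by simp_all

text \<open>From 1 = e + f and fLe = 0 one gets Le = eLe, and in \<open>fx\<close> likewise fL =
  fLf. Compression to a corner thus becomes multiplication on one side, as recorded in
  \<open>\<alpha>\<rho>'\<close> and \<open>\<beta>\<sigma>'\<close>.\<close>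

lemma xe: assumes "x \<in> carrier L" shows "x \<otimes>\<^bsub>L\<^esub> e = e \<otimes>\<^bsub>L\<^esub> x \<otimes>\<^bsub>L\<^esub> e"
proof -
  have "x \<otimes>\<^bsub>L\<^esub> e = e \<otimes>\<^bsub>L\<^esub> (x \<otimes>\<^bsub>L\<^esub> e) \<oplus>\<^bsub>L\<^esub> f \<otimes>\<^bsub>L\<^esub> (x \<otimes>\<^bsub>L\<^esub> e)" by (rule split(1)) (simp add: assms)
  then show ?thesis using assms lower_zero[OF assms] by (simp add: L.m_assoc[symmetric])
qed

lemma fx: assumes "x \<in> carrier L" shows "f \<otimes>\<^bsub>L\<^esub> x = f \<otimes>\<^bsub>L\<^esub> x \<otimes>\<^bsub>L\<^esub> f"
proof -
  have "f \<otimes>\<^bsub>L\<^esub> x = f \<otimes>\<^bsub>L\<^esub> x \<otimes>\<^bsub>L\<^esub> e \<oplus>\<^bsub>L\<^esub> f \<otimes>\<^bsub>L\<^esub> x \<otimes>\<^bsub>L\<^esub> f" by (rule split(2)) (simp add: assms)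
  then show ?thesis using assms lower_zero[OF assms] by simp
qed

lemma \<alpha>\<rho>': "x \<in> carrier L \<Longrightarrow> \<alpha> (\<rho> x) = x \<otimes>\<^bsub>L\<^esub> e" using \<alpha>\<rho> xe by simp
lemma \<beta>\<sigma>': "x \<in> carrier L \<Longrightarrow> \<beta> (\<sigma> x) = f \<otimes>\<^bsub>L\<^esub> x" using \<beta>\<sigma> fx by simp

lemma \<alpha>_e: assumes "a \<in> carrier A" shows "e \<otimes>\<^bsub>L\<^esub> \<alpha> a = \<alpha> a" "\<alpha> a \<otimes>\<^bsub>L\<^esub> e = \<alpha> a"
  using \<alpha>_mult[OF A.one_closed assms] \<alpha>_mult[OF assms A.one_closed] assms by simp_all
lemma \<beta>_f: assumes "b \<in> carrier B" shows "f \<otimes>\<^bsub>L\<^esub> \<beta> b = \<beta> b" "\<beta> b \<otimes>\<^bsub>L\<^esub> f = \<beta> b"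
  using \<beta>_mult[OF B.one_closed assms] \<beta>_mult[OF assms B.one_closed] assms by simp_all

lemma \<alpha>0 [simp]: "\<alpha> \<zero>\<^bsub>A\<^esub> = \<zero>\<^bsub>L\<^esub>"
  using \<alpha>_add[of "\<zero>\<^bsub>A\<^esub>" "\<zero>\<^bsub>A\<^esub>"] by (simp add: L.add.l_cancel_one')

lemma \<rho>f: "\<rho> f = \<zero>\<^bsub>A\<^esub>"
proof -
  have "\<alpha> (\<rho> f) = \<alpha> \<zero>\<^bsub>A\<^esub>" by (simp add: \<alpha>\<rho>')
  then have "\<rho> (\<alpha> (\<rho> f)) = \<rho> (\<alpha> \<zero>\<^bsub>A\<^esub>)" by (rule arg_cong)
  then show ?thesis by (simp only: \<rho>\<alpha> \<rho>c ef A.zero_closed)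
qed

lemma \<rho>e: "\<rho> e = \<one>\<^bsub>A\<^esub>" by (simp add: \<rho>\<alpha>)

text \<open>Inflated along \<rho>, the ring A becomes the left ideal Le = eLe of L. This makes it
  projective over L, which \<open>fgproj_inflate\<close> uses.\<close>

lemma \<alpha>_lh: "lh L (res \<rho> (reg_module A)) (reg_module L) \<alpha>"
proof (rule lhI)
  fix r x assume a: "r \<in> carrier L" "x \<in> carrier (res \<rho> (reg_module A))"
  then have "\<alpha> (\<rho> r \<otimes>\<^bsub>A\<^esub> x) = r \<otimes>\<^bsub>L\<^esub> (e \<otimes>\<^bsub>L\<^esub> \<alpha> x)" by (simp add: \<alpha>_mult \<alpha>\<rho>' L.m_assoc)
  then show "\<alpha> (r \<odot>\<^bsub>res \<rho> (reg_module A)\<^esub> x) = r \<odot>\<^bsub>reg_module L\<^esub> \<alpha> x" using a by (simp add: \<alpha>_e)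
qed (simp_all add: \<alpha>_add)

section \<open>A-modules as L-modules killed by f\<close>

lemma fgproj_inflate: "fgproj A P \<Longrightarrow> fgproj L (res \<rho> P)"
  by (rule fgproj_res[OF L.ring_axioms \<rho> \<alpha>_lh \<rho>\<alpha>])

lemma inflate_lmodule: "lmodule A X \<Longrightarrow> lmodule L (res \<rho> X)"
  by (rule ring_hom_res_lmodule[OF \<rho> L.ring_axioms])

lemma inflate_lh: "lh A X Y g \<Longrightarrow> lh L (res \<rho> X) (res \<rho> Y) g"
  by (rule res_lh[OF \<rho>c])

lemma f_inflate: assumes "lmodule A X" "x \<in> carrier X" shows "f \<odot>\<^bsub>res \<rho> X\<^esub> x = \<zero>\<^bsub>X\<^esub>"
proof -
  interpret X: lmodule A X by fact
  show ?thesis using assms(2) by (simp add: \<rho>f)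
qed

text \<open>Such L-modules are the same thing as A-modules: \<open>res \<alpha>\<close> and
  \<open>res \<rho>\<close> are mutually inverse on them, as far as elements of the carriers are
  concerned.\<close>

definition killed where "killed X \<longleftrightarrow> lmodule L X \<and> (\<forall>x\<in>carrier X. f \<odot>\<^bsub>X\<^esub> x = \<zero>\<^bsub>X\<^esub>)"

lemma killed_inflate: "lmodule A X \<Longrightarrow> killed (res \<rho> X)"
  unfolding killed_def using inflate_lmodule f_inflate[of X] by (auto simp del: res_simps(4))

lemma killed_e: assumes "killed X" "x \<in> carrier X" shows "e \<odot>\<^bsub>X\<^esub> x = x"
proof -
  interpret X: lmodule L X using assms by (simp add: killed_def)
  have "x = (e \<oplus>\<^bsub>L\<^esub> f) \<odot>\<^bsub>X\<^esub> x" using assms by (simp add: sum_one)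
  also have "\<dots> = e \<odot>\<^bsub>X\<^esub> x \<oplus>\<^bsub>X\<^esub> f \<odot>\<^bsub>X\<^esub> x" using assms by (intro X.lsmult_l_distr) simp_all
  also have "\<dots> = e \<odot>\<^bsub>X\<^esub> x" using assms by (simp add: killed_def)
  finally show ?thesis by simp
qed

lemma killed_smult: assumes "killed X" "x \<in> carrier X" "r \<in> carrier L" shows "\<alpha> (\<rho> r) \<odot>\<^bsub>X\<^esub> x = r \<odot>\<^bsub>X\<^esub> x"
proof -
  interpret X: lmodule L X using assms by (simp add: killed_def)
  show ?thesis using assms X.lsmult_assoc[of r e x] by (simp add: \<alpha>\<rho>' killed_e)
qed

lemma killed_lmodule: assumes "killed X" shows "lmodule A (res \<alpha> X)"
  by (rule res_lmodule[OF _ A.ring_axioms, of L])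
    (use assms in \<open>simp_all add: killed_def killed_e[OF assms] \<alpha>_add \<alpha>_mult\<close>)

lemma killed_hom:
  assumes k: "killed X" and f: "lh A (res \<alpha> X) Y g" shows "lh L X (res \<rho> Y) g"
proof (rule lhI)
  fix r x assume a: "r \<in> carrier L" "x \<in> carrier X"
  have "g (r \<odot>\<^bsub>X\<^esub> x) = g (\<rho> r \<odot>\<^bsub>res \<alpha> X\<^esub> x)" using killed_smult[OF k a(2,1)] by simp
  also have "\<dots> = \<rho> r \<odot>\<^bsub>Y\<^esub> g x" using a by (intro lh_smult[OF f]) simp_all
  finally show "g (r \<odot>\<^bsub>X\<^esub> x) = r \<odot>\<^bsub>res \<rho> Y\<^esub> g x" by simp
qed (use lh_closed[OF f] lh_add[OF f] in simp_all)

lemma killed_hom':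
  assumes k: "killed X" and f: "lh A Y (res \<alpha> X) g" shows "lh L (res \<rho> Y) X g"
proof (rule lhI)
  fix r x assume a: "r \<in> carrier L" "x \<in> carrier (res \<rho> Y)"
  have "g (\<rho> r \<odot>\<^bsub>Y\<^esub> x) = \<alpha> (\<rho> r) \<odot>\<^bsub>X\<^esub> g x" using lh_smult[OF f, of "\<rho> r" x] a by simp
  then show "g (r \<odot>\<^bsub>res \<rho> Y\<^esub> x) = r \<odot>\<^bsub>X\<^esub> g x" using killed_smult[OF k, of "g x" r] a lh_closed[OF f, of x] by simp
qed (use lh_closed[OF f] lh_add[OF f] in simp_all)

lemma inflate_hom_L:
  assumes Y: "lmodule A Y" and h: "lh L (res \<rho> Y) (reg_module L) h" and y: "y \<in> carrier Y"
  shows "e \<otimes>\<^bsub>L\<^esub> h y = h y"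
proof -
  interpret Y: lmodule A Y by fact
  have "e \<otimes>\<^bsub>L\<^esub> h y = h (\<rho> e \<odot>\<^bsub>Y\<^esub> y)" using lh_smult[OF h, of e y] y by simp
  then show ?thesis using y by (simp only: \<rho>e Y.lsmult_one)
qed

lemma inflate_hom_A:
  assumes Y: "lmodule A Y" and h: "lh L (res \<rho> Y) (reg_module L) h" shows "lh A Y (reg_module A) (\<lambda>y. \<rho> (h y))"
proof (rule lhI)
  fix r x assume a: "r \<in> carrier A" "x \<in> carrier Y"
  have "h (r \<odot>\<^bsub>Y\<^esub> x) = \<alpha> r \<otimes>\<^bsub>L\<^esub> h x" using lh_smult[OF h, of "\<alpha> r" x] a by (simp add: \<rho>\<alpha>)
  then show "\<rho> (h (r \<odot>\<^bsub>Y\<^esub> x)) = r \<odot>\<^bsub>reg_module A\<^esub> \<rho> (h x)"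
    using a lh_closed[OF h, of x] by (simp add: ring_hom_mult[OF \<rho>] \<rho>\<alpha>)
next
  fix x x' assume "x \<in> carrier Y" "x' \<in> carrier Y"
  then show "\<rho> (h (x \<oplus>\<^bsub>Y\<^esub> x')) = \<rho> (h x) \<oplus>\<^bsub>reg_module A\<^esub> \<rho> (h x')"
    using lh_add[OF h, of x x'] lh_closed[OF h, of x] lh_closed[OF h, of x'] by (simp add: ring_hom_add[OF \<rho>])
qed (use lh_closed[OF h] in simp)

lemma ev_res_id: assumes "lmodule A Y" "ev A n (res \<alpha> (res \<rho> Y))" shows "ev A n Y"
  by (rule ev_retract[OF NA assms(2,1), of "\<lambda>x. x" "\<lambda>x. x"]) (auto intro!: lhI simp: \<rho>\<alpha>)

text \<open>An A-presentation of X is also an L-presentation, because inflated free modules are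
  projective over L. A form on its kernel with values in A becomes one with values in L through
  \<alpha>, extends there, and returns through \<rho>.\<close>

lemma killed_ev_step:
  fixes X :: "('l, 'm, 'x) module_scheme"
  assumes k: "killed X" and X: "ev L (Suc n) X"
    and IH: "\<And>Y :: ('l, nat \<Rightarrow> 'a) module. killed Y \<Longrightarrow> ev L n Y \<Longrightarrow> ev A n (res \<alpha> Y)"
    and fg: "fg_module A (res \<alpha> X)"
  shows "ev A (Suc n) (res \<alpha> X)"
proof -
  note XM = killed_lmodule[OF k]
  have XL: "lmodule L X" using k by (simp add: killed_def)
  obtain m p where p: "pres A (res \<alpha> X) (free_module A m) p" by (rule fg_pres[OF XM fg])
  let ?F = "free_module A m"
  let ?K = "a_kernel ?F (res \<alpha> X) p"
  note K = pres_kernel[OF XM p]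
  have F: "lmodule A ?F" by (rule free_lmodule[OF A.ring_axioms])
  have p': "lh A ?F (res \<alpha> X) p" "p ` carrier ?F = carrier X" using p by (auto simp: pres_def)
  have pL: "pres L X (res \<rho> ?F) p"
    unfolding pres_def using killed_hom'[OF k p'(1)] p'(2) fgproj_inflate[OF free_fgproj[OF A.ring_axioms]] by simp
  have ker: "a_kernel (res \<rho> ?F) X p = ?K" by (simp add: a_kernel_def')
  have e: "xt L (res \<rho> ?F) ?K (reg_module L)" "ev L n (res \<rho> (?F\<lparr>carrier := ?K\<rparr>))"
    using ev_Suc[OF NL XL pL, of n] X unfolding ker by simp_all
  have "ev A n (?F\<lparr>carrier := ?K\<rparr>)"
    by (rule ev_res_id[OF K(2) IH[OF killed_inflate[OF K(2)] e(2)]])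
  moreover have "xt A ?F ?K (reg_module A)" unfolding xt_def
  proof (intro allI impI)
    fix h assume h: "lh A (?F\<lparr>carrier := ?K\<rparr>) (reg_module A) h"
    have "lh L ((res \<rho> ?F)\<lparr>carrier := ?K\<rparr>) (reg_module L) (\<lambda>x. \<alpha> (h x))"
      using lh_comp[OF inflate_lh[OF h] \<alpha>_lh] by simp
    then obtain H where H: "lh L (res \<rho> ?F) (reg_module L) H" "\<forall>x\<in>?K. H x = \<alpha> (h x)"
      using e(1) unfolding xt_def by blast
    have "\<rho> (H x) = h x" if "x \<in> ?K" for x using H(2) that lh_closed[OF h, of x] by (simp add: \<rho>\<alpha>)
    then show "\<exists>g. lh A ?F (reg_module A) g \<and> (\<forall>x\<in>?K. g x = h x)"
      using inflate_hom_A[OF F H(1)] by blast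
  qed
  ultimately show ?thesis using ev_Suc[OF NA XM p] by blast
qed

lemma killed_fg:
  assumes k: "killed X" and fg: "fg_module L X" shows "fg_module A (res \<alpha> X)"
proof -
  have X: "lmodule L X" using k by (simp add: killed_def)
  obtain S where S: "finite S" "S \<subseteq> carrier X" "\<And>H. submod L X H \<Longrightarrow> S \<subseteq> H \<Longrightarrow> carrier X \<subseteq> H"
    by (rule fgE[OF X fg]) (rule that, assumption+)
  have c: "x \<in> carrier X" if "submod A (res \<alpha> X) H" "x \<in> H" for x H using that by (auto simp: submod_def)
  have "submod L X H" if H: "submod A (res \<alpha> X) H" for H
    unfolding submod_def
  proof (intro conjI ballI)
    fix r x assume a: "r \<in> carrier L" "x \<in> H"
    have "\<rho> r \<odot>\<^bsub>res \<alpha> X\<^esub> x \<in> H" by (rule submod_smult[OF H]) (use a in simp_all)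
    then show "r \<odot>\<^bsub>X\<^esub> x \<in> H" using killed_smult[OF k c[OF H a(2)] a(1)] by simp
  qed (use H in \<open>auto simp: submod_def\<close>)
  then show ?thesis by (intro fgI[OF killed_lmodule[OF k] S(1)] ) (use S(2) in simp, simp add: S(3))
qed

text \<open>\<open>killed_ev_step\<close> leads from the type of X to functions from
  \<open>nat\<close>, so the induction runs on that type (fact \<open>U\<close>) and the first step
  is applied separately.\<close>

lemma killed_ev:
  assumes k: "killed X" and X: "ev L n X" shows "ev A n (res \<alpha> X)"
proof -
  have 0: "ev A 0 (res \<alpha> Y)" if "killed Y" "ev L m Y" for Y :: "('l, 'y, 'z) module_scheme" and m
    using that killed_lmodule killed_fg[OF that(1) ev_fg[OF that(2)]] by (simp add: ev_0)
  have U: "ev A n (res \<alpha> Y)" if "killed Y" "ev L n Y" for Y :: "('l, nat \<Rightarrow> 'a) module" and n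
    using that
  proof (induction n arbitrary: Y)
    case 0 then show ?case using killed_lmodule killed_fg[OF 0(1) ev_fg[OF 0(2)]] by (simp add: ev_0)
  next
    case (Suc n) show ?case by (rule killed_ev_step[OF Suc.prems Suc.IH killed_fg[OF Suc.prems(1) ev_fg[OF Suc.prems(2)]]])
  qed
  show ?thesis
  proof (cases n)
    case 0 then show ?thesis using killed_lmodule[OF k] killed_fg[OF k ev_fg[OF X]] by (simp add: ev_0)
  next
    case (Suc m)
    show ?thesis unfolding Suc by (rule killed_ev_step[OF k X[unfolded Suc] U killed_fg[OF k ev_fg[OF X]]])
  qed
qed

lemma killed_perp: assumes k: "killed X" and X: "X \<in> perp L" shows "res \<alpha> X \<in> perp A"
  using killed_ev[OF k] X by (simp add: perp_iff_ev[OF NL] perp_iff_ev[OF NA])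

section \<open>The bimodule eLf and inflation of semi-Gorenstein-projective modules\<close>

definition bimS where "bimS = {x \<in> carrier L. e \<otimes>\<^bsub>L\<^esub> x = x \<and> x \<otimes>\<^bsub>L\<^esub> f = x}"

definition bim where "bim = (reg_module L)\<lparr>carrier := bimS\<rparr>"

lemma bim_simps [simp]: "carrier bim = bimS" "\<zero>\<^bsub>bim\<^esub> = \<zero>\<^bsub>L\<^esub>" "x \<oplus>\<^bsub>bim\<^esub> y = x \<oplus>\<^bsub>L\<^esub> y" "r \<odot>\<^bsub>bim\<^esub> x = r \<otimes>\<^bsub>L\<^esub> x"
  by (simp_all add: bim_def)

lemma bimS_D: assumes "x \<in> bimS" shows "x \<in> carrier L" "e \<otimes>\<^bsub>L\<^esub> x = x" "x \<otimes>\<^bsub>L\<^esub> f = x" "f \<otimes>\<^bsub>L\<^esub> x = \<zero>\<^bsub>L\<^esub>"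
proof -
  show "x \<in> carrier L" "e \<otimes>\<^bsub>L\<^esub> x = x" "x \<otimes>\<^bsub>L\<^esub> f = x" using assms by (auto simp: bimS_def)
  then show "f \<otimes>\<^bsub>L\<^esub> x = \<zero>\<^bsub>L\<^esub>" using L.m_assoc[of f e x] by simp
qed

lemma bimS_I: assumes "x \<in> carrier L" "f \<otimes>\<^bsub>L\<^esub> x = \<zero>\<^bsub>L\<^esub>" "x \<otimes>\<^bsub>L\<^esub> f = x" shows "x \<in> bimS"
  using assms split(1)[OF assms(1)] by (simp add: bimS_def)

lemma bimS_submod: "submod L (reg_module L) bimS"
  unfolding submod_def
proof (intro conjI ballI)
  show "bimS \<subseteq> carrier (reg_module L)" using bimS_D by auto
  show "\<zero>\<^bsub>reg_module L\<^esub> \<in> bimS" by (simp add: bimS_def)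
  show "x \<oplus>\<^bsub>reg_module L\<^esub> y \<in> bimS" if "x \<in> bimS" "y \<in> bimS" for x y
    using bimS_D[OF that(1)] bimS_D[OF that(2)] by (simp add: bimS_def L.r_distr L.l_distr)
  show "r \<odot>\<^bsub>reg_module L\<^esub> x \<in> bimS" if "r \<in> carrier L" "x \<in> bimS" for r x
  proof (rule bimS_I)
    note x = bimS_D[OF that(2)]
    show "r \<odot>\<^bsub>reg_module L\<^esub> x \<in> carrier L" using that x by simp
    have "f \<otimes>\<^bsub>L\<^esub> (r \<otimes>\<^bsub>L\<^esub> x) = f \<otimes>\<^bsub>L\<^esub> r \<otimes>\<^bsub>L\<^esub> f \<otimes>\<^bsub>L\<^esub> x"
      using x that L.m_assoc[of f r x] fx[OF that(1)] by simp
    then show "f \<otimes>\<^bsub>L\<^esub> (r \<odot>\<^bsub>reg_module L\<^esub> x) = \<zero>\<^bsub>L\<^esub>" using x that L.m_assoc[of "f \<otimes>\<^bsub>L\<^esub> r" f x] by simp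
    show "(r \<odot>\<^bsub>reg_module L\<^esub> x) \<otimes>\<^bsub>L\<^esub> f = r \<odot>\<^bsub>reg_module L\<^esub> x" using x that by (simp add: L.m_assoc)
  qed
qed

lemma bim_lmodule: "lmodule L bim"
  unfolding bim_def by (rule submod_lmodule[OF reg_lmodule[OF L.ring_axioms] bimS_submod])

lemma bim_killed: "killed bim"
  unfolding killed_def using bim_lmodule bimS_D(4) by simp

text \<open>A form h on an inflated module has values in eL and splits as h e + h f. The part h e is
  a form over A and extends because X is in \<open>perp A\<close>; the part h f takes values in eLf
  and extends by the hypothesis on \<open>bim\<close>.\<close>

lemma inflate_ev_step:
  assumes v: "vz A (res \<alpha> bim)" and X: "X \<in> perp A" and p: "pres A X P p"
    and K: "ev L n (res \<rho> (P\<lparr>carrier := a_kernel P X p\<rparr>))"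
  shows "ev L (Suc n) (res \<rho> X)"
proof -
  note XM = perp_lmodule[OF X]
  let ?K = "a_kernel P X p"
  have P: "fgproj A P" and PM: "lmodule A P" using p by (auto simp: pres_def fgproj_lmodule)
  note KM = pres_kernel[OF XM p]
  note Kc = submod_subset[OF KM(1)]
  have pL: "pres L (res \<rho> X) (res \<rho> P) p"
    using p inflate_lh fgproj_inflate[OF P] by (auto simp: pres_def)
  have ker: "a_kernel (res \<rho> P) (res \<rho> X) p = ?K" by (simp add: a_kernel_def')
  have "xt L (res \<rho> P) ?K (reg_module L)" unfolding xt_def
  proof (intro allI impI)
    fix h assume "lh L ((res \<rho> P)\<lparr>carrier := ?K\<rparr>) (reg_module L) h"
    then have h: "lh L (res \<rho> (P\<lparr>carrier := ?K\<rparr>)) (reg_module L) h" by simp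
    have hc: "h x \<in> carrier L" if "x \<in> ?K" for x using lh_closed[OF h] that by simp
    have eh: "e \<otimes>\<^bsub>L\<^esub> h x = h x" if "x \<in> ?K" for x using inflate_hom_L[OF KM(2) h] that by simp
    obtain H1 where H1: "lh A P (reg_module A) H1" "\<forall>x\<in>?K. H1 x = \<rho> (h x)"
      using perp_kernel(1)[OF NA X p] inflate_hom_A[OF KM(2) h] unfolding xt_def by blast
    have "lh A (P\<lparr>carrier := ?K\<rparr>) (res \<alpha> bim) (\<lambda>x. h x \<otimes>\<^bsub>L\<^esub> f)"
    proof (rule lhI)
      fix x assume "x \<in> carrier (P\<lparr>carrier := ?K\<rparr>)"
      then have x: "x \<in> ?K" by simp
      show "h x \<otimes>\<^bsub>L\<^esub> f \<in> carrier (res \<alpha> bim)"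
        using hc[OF x] eh[OF x] L.m_assoc[of e "h x" f] L.m_assoc[of "h x" f f] by (simp add: bimS_def)
      fix r assume r: "r \<in> carrier A"
      have "h (r \<odot>\<^bsub>P\<^esub> x) = \<alpha> r \<otimes>\<^bsub>L\<^esub> h x" using lh_smult[OF h, of "\<alpha> r" x] x r by (simp add: \<rho>\<alpha>)
      then show "h (r \<odot>\<^bsub>P\<lparr>carrier := ?K\<rparr>\<^esub> x) \<otimes>\<^bsub>L\<^esub> f = r \<odot>\<^bsub>res \<alpha> bim\<^esub> (h x \<otimes>\<^bsub>L\<^esub> f)"
        using hc[OF x] r by (simp add: L.m_assoc)
    next
      fix x y assume "x \<in> carrier (P\<lparr>carrier := ?K\<rparr>)" "y \<in> carrier (P\<lparr>carrier := ?K\<rparr>)"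
      then show "h (x \<oplus>\<^bsub>P\<lparr>carrier := ?K\<rparr>\<^esub> y) \<otimes>\<^bsub>L\<^esub> f = (h x \<otimes>\<^bsub>L\<^esub> f) \<oplus>\<^bsub>res \<alpha> bim\<^esub> (h y \<otimes>\<^bsub>L\<^esub> f)"
        using lh_add[OF h, of x y] hc[of x] hc[of y] by (simp add: L.l_distr)
    qed
    then obtain H2 where H2: "lh A P (res \<alpha> bim) H2" "\<forall>x\<in>?K. H2 x = h x \<otimes>\<^bsub>L\<^esub> f"
      using vz_D[OF NA v X p] unfolding xt_def by blast
    have a: "lh L (res \<rho> P) (reg_module L) (\<lambda>x. \<alpha> (H1 x))" by (rule lh_comp[OF inflate_lh[OF H1(1)] \<alpha>_lh])
    have b: "lh L (res \<rho> P) (reg_module L) H2"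
    proof -
      have "lh L (res \<rho> P) bim H2" by (rule killed_hom'[OF bim_killed H2(1)])
      then show ?thesis unfolding bim_def by (rule lh_uncod) (use bimS_D in auto)
    qed
    \<comment> \<open>On the kernel the first summand is \<alpha> (\<rho> (h x)), which is h x times
      e, and the second is h x times f.\<close>
    have "lh L (res \<rho> P) (reg_module L) (\<lambda>x. \<alpha> (H1 x) \<oplus>\<^bsub>reg_module L\<^esub> H2 x)"
      by (rule lh_plus[OF inflate_lmodule[OF PM] reg_lmodule[OF L.ring_axioms] a b])
    moreover have "\<alpha> (H1 x) \<oplus>\<^bsub>reg_module L\<^esub> H2 x = h x" if x: "x \<in> ?K" for x
      using H1(2) H2(2) x hc[OF x] split(2)[OF hc[OF x]] by (simp add: \<alpha>\<rho>')
    ultimately show "\<exists>g. lh L (res \<rho> P) (reg_module L) g \<and> (\<forall>x\<in>?K. g x = h x)" by blast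
  qed
  then show ?thesis using ev_Suc[OF NL inflate_lmodule[OF XM] pL, of n] K unfolding ker by simp
qed

lemma inflate_fg: assumes X: "lmodule A X" and "fg_module A X" shows "fg_module L (res \<rho> X)"
proof -
  obtain m p where p: "pres A X (free_module A m) p" using fg_pres[OF assms] .
  have "pres L (res \<rho> X) (res \<rho> (free_module A m)) p"
    using p inflate_lh fgproj_inflate[OF free_fgproj[OF A.ring_axioms]] by (auto simp: pres_def)
  then show ?thesis by (rule pres_fg[OF inflate_lmodule[OF X]])
qed

lemma inflate_perp:
  assumes v: "vz A (res \<alpha> bim)" and X: "X \<in> perp A" shows "res \<rho> X \<in> perp L"
  unfolding perp_iff_ev[OF NL]
proof
  have U: "ev L n (res \<rho> Y)" if "Y \<in> perp A" for Y :: "('a, nat \<Rightarrow> 'a) module" and n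
    using that
  proof (induction n arbitrary: Y)
    case 0 show ?case using inflate_lmodule[OF perp_lmodule[OF 0]] inflate_fg[OF perp_lmodule[OF 0] perp_fg[OF 0]] by (simp add: ev_0)
  next
    case (Suc n)
    obtain m p where p: "pres A Y (free_module A m) p" by (rule fg_pres[OF perp_lmodule[OF Suc.prems] perp_fg[OF Suc.prems]])
    show ?case by (rule inflate_ev_step[OF v Suc.prems p Suc.IH[OF perp_kernel(2)[OF NA Suc.prems p]]])
  qed
  fix n show "ev L n (res \<rho> X)"
  proof (cases n)
    case 0 then show ?thesis using inflate_lmodule[OF perp_lmodule[OF X]] inflate_fg[OF perp_lmodule[OF X] perp_fg[OF X]] by (simp add: ev_0)
  next
    case (Suc k)
    obtain m p where p: "pres A X (free_module A m) p" by (rule fg_pres[OF perp_lmodule[OF X] perp_fg[OF X]])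
    show ?thesis unfolding Suc by (rule inflate_ev_step[OF v X p U[OF perp_kernel(2)[OF NA X p]]])
  qed
qed

end

section \<open>The corner B and splitting off a projective summand\<close>

context triangular begin

text \<open>This is fX: the image of an idempotent is its set of fixed points.\<close>

definition fix_f where "fix_f X = {x \<in> carrier X. f \<odot>\<^bsub>X\<^esub> x = x}"

definition corner_B where "corner_B X = res \<beta> (X\<lparr>carrier := fix_f X\<rparr>)"

lemma corner_B_simps [simp]: "carrier (corner_B X) = fix_f X" "\<zero>\<^bsub>corner_B X\<^esub> = \<zero>\<^bsub>X\<^esub>"
  "x \<oplus>\<^bsub>corner_B X\<^esub> y = x \<oplus>\<^bsub>X\<^esub> y" "b \<odot>\<^bsub>corner_B X\<^esub> x = \<beta> b \<odot>\<^bsub>X\<^esub> x" "lsum (corner_B X) g n = lsum X g n"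
  by (simp_all add: corner_B_def lsum_carrier)

lemma fix_f_D: "x \<in> fix_f X \<Longrightarrow> x \<in> carrier X" "x \<in> fix_f X \<Longrightarrow> f \<odot>\<^bsub>X\<^esub> x = x"
  by (auto simp: fix_f_def)

lemma fix_f_smult: assumes "lmodule L X" "x \<in> carrier X" shows "f \<odot>\<^bsub>X\<^esub> x \<in> fix_f X"
proof -
  interpret X: lmodule L X by fact
  show ?thesis using assms(2) X.lsmult_assoc[of f f x] by (simp add: fix_f_def)
qed

lemma corner_B_lmodule: assumes X: "lmodule L X" shows "lmodule B (corner_B X)"
proof -
  interpret X: lmodule L X by fact
  have sm: "\<beta> b \<odot>\<^bsub>X\<^esub> x \<in> fix_f X" if "b \<in> carrier B" "x \<in> fix_f X" for b x
    using that fix_f_D(1)[OF that(2)] X.lsmult_assoc[of f "\<beta> b" x] by (simp add: fix_f_def \<beta>_f)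
  show ?thesis
  proof (rule lmodule_groupI)
    fix x assume "x \<in> carrier (corner_B X)"
    then have x: "x \<in> fix_f X" by simp
    show "\<exists>y\<in>carrier (corner_B X). y \<oplus>\<^bsub>corner_B X\<^esub> x = \<zero>\<^bsub>corner_B X\<^esub>"
    proof (rule bexI)
      show "\<ominus>\<^bsub>X\<^esub> x \<in> carrier (corner_B X)" using fix_f_D[OF x] by (simp add: fix_f_def X.ls_neg)
      show "\<ominus>\<^bsub>X\<^esub> x \<oplus>\<^bsub>corner_B X\<^esub> x = \<zero>\<^bsub>corner_B X\<^esub>" using fix_f_D[OF x] by (simp add: X.M.l_neg)
    qed
    show "\<one>\<^bsub>B\<^esub> \<odot>\<^bsub>corner_B X\<^esub> x = x" using fix_f_D[OF x] by simp
    show "b \<odot>\<^bsub>corner_B X\<^esub> x \<in> carrier (corner_B X)" if "b \<in> carrier B" for b using sm[OF that x] by simp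
    show "(b \<oplus>\<^bsub>B\<^esub> c) \<odot>\<^bsub>corner_B X\<^esub> x = b \<odot>\<^bsub>corner_B X\<^esub> x \<oplus>\<^bsub>corner_B X\<^esub> c \<odot>\<^bsub>corner_B X\<^esub> x"
      if "b \<in> carrier B" "c \<in> carrier B" for b c using that fix_f_D[OF x] by (simp add: \<beta>_add X.lsmult_l_distr)
    show "(b \<otimes>\<^bsub>B\<^esub> c) \<odot>\<^bsub>corner_B X\<^esub> x = b \<odot>\<^bsub>corner_B X\<^esub> (c \<odot>\<^bsub>corner_B X\<^esub> x)"
      if "b \<in> carrier B" "c \<in> carrier B" for b c using that fix_f_D[OF x] by (simp add: \<beta>_mult X.lsmult_assoc)
    fix y assume "y \<in> carrier (corner_B X)"
    then have y: "y \<in> fix_f X" by simp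
    show "x \<oplus>\<^bsub>corner_B X\<^esub> y \<in> carrier (corner_B X)"
      using fix_f_D[OF x] fix_f_D[OF y] by (simp add: fix_f_def X.lsmult_r_distr)
    show "x \<oplus>\<^bsub>corner_B X\<^esub> y = y \<oplus>\<^bsub>corner_B X\<^esub> x" using fix_f_D[OF x] fix_f_D[OF y] by (simp add: X.M.a_comm)
    show "b \<odot>\<^bsub>corner_B X\<^esub> (x \<oplus>\<^bsub>corner_B X\<^esub> y) = b \<odot>\<^bsub>corner_B X\<^esub> x \<oplus>\<^bsub>corner_B X\<^esub> b \<odot>\<^bsub>corner_B X\<^esub> y"
      if "b \<in> carrier B" for b using that fix_f_D[OF x] fix_f_D[OF y] by (simp add: X.lsmult_r_distr)
  qed (auto simp: B.ring_axioms X.M.a_assoc fix_f_D, simp add: fix_f_def)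
qed

lemma corner_B_lh: assumes X: "lmodule L X" and g: "lh L X Y g" shows "lh B (corner_B X) (corner_B Y) g"
proof (rule lhI)
  fix x assume "x \<in> carrier (corner_B X)"
  then have x: "x \<in> carrier X" "f \<odot>\<^bsub>X\<^esub> x = x" by (simp_all add: fix_f_def)
  have "f \<odot>\<^bsub>Y\<^esub> g x = g x" using lh_smult[OF g ef(2) x(1)] unfolding x(2) by (rule sym)
  then show "g x \<in> carrier (corner_B Y)" using lh_closed[OF g x(1)] by (simp add: fix_f_def)
qed (simp_all add: lh_add[OF g] lh_smult[OF g] fix_f_D(1))

text \<open>Since fL = fLf, compression loses nothing: for x in fP the coefficient l_i(x) lies in
  fL, hence in fLf, so the elements f p_i generate fP with the compressed forms as
  coefficients.\<close>

lemma corner_B_fgproj: assumes P: "fgproj L P" shows "fgproj B (corner_B P)"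
proof -
  note PM = fgproj_lmodule[OF P]
  interpret P: lmodule L P by (rule PM)
  obtain n l p where d: "dbasis L P n l p" using P by (auto simp: fgproj_def)
  have l: "lh L P (reg_module L) (l i)" if "i < n" for i using d that by (simp add: dbasis_def)
  have pc: "p i \<in> carrier P" if "i < n" for i using d that by (simp add: dbasis_def)
  have lc: "l i x \<in> carrier L" if "i < n" "x \<in> carrier P" for i x using lh_closed[OF l[OF that(1)] that(2)] by simp
  have fl: "f \<otimes>\<^bsub>L\<^esub> l i x = l i x" if "i < n" "x \<in> fix_f P" for i x
    using lh_smult[OF l[OF that(1)] ef(2) fix_f_D(1)[OF that(2)]] unfolding fix_f_D(2)[OF that(2)] by simp
  have "dbasis B (corner_B P) n (\<lambda>i x. \<sigma> (l i x)) (\<lambda>i. f \<odot>\<^bsub>P\<^esub> p i)" unfolding dbasis_def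
  proof (intro conjI allI impI ballI)
    fix i assume i: "i < n"
    show "f \<odot>\<^bsub>P\<^esub> p i \<in> carrier (corner_B P)" using fix_f_smult[OF PM pc[OF i]] by simp
    show "lh B (corner_B P) (reg_module B) (\<lambda>x. \<sigma> (l i x))"
    proof (rule lhI)
      show "\<sigma> (l i (x \<oplus>\<^bsub>corner_B P\<^esub> y)) = \<sigma> (l i x) \<oplus>\<^bsub>reg_module B\<^esub> \<sigma> (l i y)"
        if "x \<in> carrier (corner_B P)" "y \<in> carrier (corner_B P)" for x y
        using that by (simp add: lh_add[OF l[OF i]] lc[OF i] ring_hom_add[OF \<sigma>] fix_f_D(1))
      show "\<sigma> (l i (b \<odot>\<^bsub>corner_B P\<^esub> x)) = b \<odot>\<^bsub>reg_module B\<^esub> \<sigma> (l i x)"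
        if "b \<in> carrier B" "x \<in> carrier (corner_B P)" for b x
        using that by (simp add: lh_smult[OF l[OF i]] lc[OF i] ring_hom_mult[OF \<sigma>] \<sigma>\<beta> fix_f_D(1))
    qed (simp add: lc[OF i] fix_f_D(1))
  next
    fix x assume "x \<in> carrier (corner_B P)"
    then have x: "x \<in> fix_f P" by simp
    have "x = lsum P (\<lambda>i. l i x \<odot>\<^bsub>P\<^esub> p i) n" using d fix_f_D(1)[OF x] by (simp add: dbasis_def)
    also have "\<dots> = lsum P (\<lambda>i. \<beta> (\<sigma> (l i x)) \<odot>\<^bsub>P\<^esub> (f \<odot>\<^bsub>P\<^esub> p i)) n"
    proof (rule lsum_cong)
      fix i assume i: "i < n"
      note xi = lc[OF i fix_f_D(1)[OF x]]
      have "\<beta> (\<sigma> (l i x)) \<odot>\<^bsub>P\<^esub> (f \<odot>\<^bsub>P\<^esub> p i) = (f \<otimes>\<^bsub>L\<^esub> l i x \<otimes>\<^bsub>L\<^esub> f) \<odot>\<^bsub>P\<^esub> p i"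
        using xi pc[OF i] P.lsmult_assoc[of "f \<otimes>\<^bsub>L\<^esub> l i x" f "p i"] by (simp add: \<beta>\<sigma>')
      also have "\<dots> = l i x \<odot>\<^bsub>P\<^esub> p i" using fx[OF xi] fl[OF i x] by simp
      finally show "l i x \<odot>\<^bsub>P\<^esub> p i = \<beta> (\<sigma> (l i x)) \<odot>\<^bsub>P\<^esub> (f \<odot>\<^bsub>P\<^esub> p i)" by simp
    qed
    finally show "x = lsum (corner_B P) (\<lambda>i. \<sigma> (l i x) \<odot>\<^bsub>corner_B P\<^esub> (f \<odot>\<^bsub>P\<^esub> p i)) n" by simp
  qed
  then show ?thesis using corner_B_lmodule[OF PM] unfolding fgproj_def by blast
qed

text \<open>The exact sequence \<open>0 \<rightarrow> eLf \<rightarrow> Lf \<rightarrow> fLf \<rightarrow> 0\<close> of left \<open>L\<close>-modules.\<close>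

definition Lf where "Lf = (reg_module L)\<lparr>carrier := {x \<in> carrier L. x \<otimes>\<^bsub>L\<^esub> f = x}\<rparr>"

definition NB where "NB = res \<sigma> (reg_module B)"

lemma Lf_simps [simp]: "carrier Lf = {x \<in> carrier L. x \<otimes>\<^bsub>L\<^esub> f = x}" "\<zero>\<^bsub>Lf\<^esub> = \<zero>\<^bsub>L\<^esub>" "x \<oplus>\<^bsub>Lf\<^esub> y = x \<oplus>\<^bsub>L\<^esub> y"
  "r \<odot>\<^bsub>Lf\<^esub> x = r \<otimes>\<^bsub>L\<^esub> x"
  by (simp_all add: Lf_def)

lemma NB_simps [simp]: "carrier NB = carrier B" "\<zero>\<^bsub>NB\<^esub> = \<zero>\<^bsub>B\<^esub>" "x \<oplus>\<^bsub>NB\<^esub> y = x \<oplus>\<^bsub>B\<^esub> y" "r \<odot>\<^bsub>NB\<^esub> x = \<sigma> r \<otimes>\<^bsub>B\<^esub> x"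
  by (simp_all add: NB_def)

lemma NB_lmodule: "lmodule L NB"
  unfolding NB_def by (rule ring_hom_res_lmodule[OF \<sigma> L.ring_axioms reg_lmodule[OF B.ring_axioms]])

lemma Lf_fgproj: "fgproj L Lf"
proof -
  have s: "submod L (reg_module L) {x \<in> carrier L. x \<otimes>\<^bsub>L\<^esub> f = x}"
    by (auto simp: submod_def L.l_distr L.m_assoc)
  have M: "lmodule L Lf" unfolding Lf_def by (rule submod_lmodule[OF reg_lmodule[OF L.ring_axioms] s])
  have "lh L Lf (reg_module L) (\<lambda>x. x)" by (rule lhI) auto
  moreover have "dbasis L (reg_module L) 1 (\<lambda>_ x. x) (\<lambda>_. \<one>\<^bsub>L\<^esub>)" by (auto simp: dbasis_def lh_id)
  then have "fgproj L (reg_module L)" using reg_lmodule[OF L.ring_axioms] unfolding fgproj_def by blast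
  moreover have "lh L (reg_module L) Lf (\<lambda>x. x \<otimes>\<^bsub>L\<^esub> f)" by (rule lhI) (auto simp: L.l_distr L.m_assoc)
  ultimately show ?thesis by (intro fgproj_retract[OF _ M, of "reg_module L" "\<lambda>x. x" "\<lambda>x. x \<otimes>\<^bsub>L\<^esub> f"]) auto
qed

lemma \<sigma>_lh: "lh L Lf NB \<sigma>" "\<sigma> ` carrier Lf = carrier NB" "a_kernel Lf NB \<sigma> = bimS"
proof -
  show "lh L Lf NB \<sigma>" by (rule lhI) (auto simp: ring_hom_add[OF \<sigma>] ring_hom_mult[OF \<sigma>])
  show "\<sigma> ` carrier Lf = carrier NB"
  proof (intro equalityI subsetI)
    fix b assume "b \<in> carrier NB"
    then show "b \<in> \<sigma> ` carrier Lf" by (intro image_eqI[of _ _ "\<beta> b"]) (auto simp: \<sigma>\<beta> \<beta>_f)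
  qed auto
  have "\<sigma> x = \<zero>\<^bsub>B\<^esub> \<longleftrightarrow> f \<otimes>\<^bsub>L\<^esub> x = \<zero>\<^bsub>L\<^esub>" if x: "x \<in> carrier L" for x
  proof
    have b0: "\<beta> \<zero>\<^bsub>B\<^esub> = \<zero>\<^bsub>L\<^esub>" using \<beta>_add[of "\<zero>\<^bsub>B\<^esub>" "\<zero>\<^bsub>B\<^esub>"] by (simp add: L.add.l_cancel_one')
    show "f \<otimes>\<^bsub>L\<^esub> x = \<zero>\<^bsub>L\<^esub>" if "\<sigma> x = \<zero>\<^bsub>B\<^esub>" using \<beta>\<sigma>'[OF x] that b0 by simp
    assume "f \<otimes>\<^bsub>L\<^esub> x = \<zero>\<^bsub>L\<^esub>"
    then have "\<sigma> (\<beta> (\<sigma> x)) = \<sigma> (\<beta> \<zero>\<^bsub>B\<^esub>)" using \<beta>\<sigma>'[OF x] b0 by simp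
    then show "\<sigma> x = \<zero>\<^bsub>B\<^esub>" using x by (simp only: \<sigma>\<beta> \<sigma>c B.zero_closed)
  qed
  then show "a_kernel Lf NB \<sigma> = bimS" using bimS_D bimS_I by (auto simp: a_kernel_def')
qed

lemma Lf_kernel: "Lf\<lparr>carrier := a_kernel Lf NB \<sigma>\<rparr> = bim"
  unfolding \<sigma>_lh(3) by (simp add: Lf_def bim_def)

lemma vz_NB: assumes "vz L bim" shows "vz L NB"
  by (rule vz_step[OF NL NB_lmodule \<sigma>_lh(1,2) vz_fgproj[OF NL Lf_fgproj]]) (simp add: Lf_kernel assms)

text \<open>With its converse \<open>NB_hom_corner_B\<close> this is the adjunction Hom_B(fX, B) =
  Hom_L(X, NB), which turns extension problems over B into extension problems over L. Linearity
  rests on fL = fLf.\<close>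

lemma corner_B_hom_NB:
  assumes X: "lmodule L X" and g: "lh B (corner_B X) (reg_module B) g" shows "lh L X NB (\<lambda>x. g (f \<odot>\<^bsub>X\<^esub> x))"
proof -
  interpret X: lmodule L X by fact
  note c = fix_f_smult[OF X]
  show ?thesis
  proof (rule lhI)
    show "g (f \<odot>\<^bsub>X\<^esub> x) \<in> carrier NB" if "x \<in> carrier X" for x using lh_closed[OF g, of "f \<odot>\<^bsub>X\<^esub> x"] c[OF that] by simp
    show "g (f \<odot>\<^bsub>X\<^esub> (x \<oplus>\<^bsub>X\<^esub> y)) = g (f \<odot>\<^bsub>X\<^esub> x) \<oplus>\<^bsub>NB\<^esub> g (f \<odot>\<^bsub>X\<^esub> y)" if "x \<in> carrier X" "y \<in> carrier X" for x y
      using lh_add[OF g, of "f \<odot>\<^bsub>X\<^esub> x" "f \<odot>\<^bsub>X\<^esub> y"] c that by (simp add: X.lsmult_r_distr)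
    fix r x assume a: "r \<in> carrier L" "x \<in> carrier X"
    have "f \<odot>\<^bsub>X\<^esub> (r \<odot>\<^bsub>X\<^esub> x) = (f \<otimes>\<^bsub>L\<^esub> r \<otimes>\<^bsub>L\<^esub> f) \<odot>\<^bsub>X\<^esub> x" using a X.lsmult_assoc[of f r x] fx[OF a(1)] by simp
    also have "\<dots> = \<beta> (\<sigma> r) \<odot>\<^bsub>X\<^esub> (f \<odot>\<^bsub>X\<^esub> x)" using a X.lsmult_assoc[of "f \<otimes>\<^bsub>L\<^esub> r" f x] by (simp add: \<beta>\<sigma>')
    finally show "g (f \<odot>\<^bsub>X\<^esub> (r \<odot>\<^bsub>X\<^esub> x)) = r \<odot>\<^bsub>NB\<^esub> g (f \<odot>\<^bsub>X\<^esub> x)"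
      using lh_smult[OF g, of "\<sigma> r" "f \<odot>\<^bsub>X\<^esub> x"] a c by simp
  qed
qed

lemma NB_hom_corner_B:
  assumes g: "lh L X NB g" shows "lh B (corner_B X) (reg_module B) g"
proof (rule lhI)
  show "g (b \<odot>\<^bsub>corner_B X\<^esub> x) = b \<odot>\<^bsub>reg_module B\<^esub> g x" if "b \<in> carrier B" "x \<in> carrier (corner_B X)" for b x
    using lh_smult[OF g, of "\<beta> b" x] that fix_f_D(1)[of x X] by (simp add: \<sigma>\<beta>)
qed (simp_all add: lh_closed[OF g, simplified] lh_add[OF g] fix_f_D(1))

text \<open>Passing from Z to fZ is exact and sends free modules to projective ones, so it carries a
  presentation of Z to one of fZ. A form on the new kernel is a map from the old kernel to
  \<open>NB\<close>, and it extends because Ext^1(Z, NB) = 0.\<close>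

lemma corner_B_ev:
  fixes Z :: "('l, nat \<Rightarrow> 'l) module"
  assumes v: "vz L bim" and Z: "Z \<in> perp L" shows "ev B n (corner_B Z)"
  using Z
proof (induction n arbitrary: Z)
  fix n and Z :: "('l, nat \<Rightarrow> 'l) module" assume Z: "Z \<in> perp L"
  note ZM = perp_lmodule[OF Z]
  obtain k p where p: "pres L Z (free_module L k) p" by (rule fg_pres[OF ZM perp_fg[OF Z]])
  let ?F = "free_module L k"
  let ?K = "a_kernel ?F Z p"
  have F: "lmodule L ?F" by (rule free_lmodule[OF L.ring_axioms])
  have p': "lh L ?F Z p" "p ` carrier ?F = carrier Z" using p by (auto simp: pres_def)
  note K = pres_kernel[OF ZM p]
  have pB: "pres B (corner_B Z) (corner_B ?F) p" unfolding pres_def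
  proof (intro conjI corner_B_fgproj free_fgproj L.ring_axioms corner_B_lh[OF F p'(1)])
    show "p ` carrier (corner_B ?F) = carrier (corner_B Z)"
    proof (intro equalityI subsetI)
      fix z assume "z \<in> carrier (corner_B Z)"
      then have z: "z \<in> carrier Z" "f \<odot>\<^bsub>Z\<^esub> z = z" by (auto simp: fix_f_def)
      obtain y where y: "z = p y" "y \<in> carrier ?F" by (rule imageE[OF z(1)[folded p'(2)]])
      have "p (f \<odot>\<^bsub>?F\<^esub> y) = z" using lh_smult[OF p'(1) ef(2) y(2)] unfolding y(1)[symmetric] z(2) .
      then show "z \<in> p ` carrier (corner_B ?F)" using fix_f_smult[OF F y(2)] by (intro image_eqI[of _ _ "f \<odot>\<^bsub>?F\<^esub> y"]) simp_all
    next
      fix z assume "z \<in> p ` carrier (corner_B ?F)"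
      then show "z \<in> carrier (corner_B Z)" using lh_closed[OF corner_B_lh[OF F p'(1)]] by auto
    qed
  qed
  have ker: "a_kernel (corner_B ?F) (corner_B Z) p = fix_f (?F\<lparr>carrier := ?K\<rparr>)"
    by (auto simp: a_kernel_def' fix_f_def)
  have kerM: "corner_B ?F\<lparr>carrier := fix_f (?F\<lparr>carrier := ?K\<rparr>)\<rparr> = corner_B (?F\<lparr>carrier := ?K\<rparr>)"
    by (simp add: corner_B_def)
  have xt: "xt B (corner_B ?F) (fix_f (?F\<lparr>carrier := ?K\<rparr>)) (reg_module B)" unfolding xt_def kerM
  proof (intro allI impI)
    fix g assume g: "lh B (corner_B (?F\<lparr>carrier := ?K\<rparr>)) (reg_module B) g"
    obtain h where h: "lh L ?F NB h" "\<forall>x\<in>?K. h x = g (f \<odot>\<^bsub>?F\<^esub> x)"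
      using vz_D[OF NL vz_NB[OF v] Z p] corner_B_hom_NB[OF K(2) g] unfolding xt_def by auto
    have "h x = g x" if "x \<in> fix_f (?F\<lparr>carrier := ?K\<rparr>)" for x
    proof -
      have "x \<in> ?K" "f \<odot>\<^bsub>?F\<^esub> x = x" using that by (simp_all add: fix_f_def)
      then show ?thesis using h(2) by metis
    qed
    then show "\<exists>h. lh B (corner_B ?F) (reg_module B) h \<and> (\<forall>x\<in>fix_f (?F\<lparr>carrier := ?K\<rparr>). h x = g x)"
      using NB_hom_corner_B[OF h(1)] by blast
  qed
  note BZ = corner_B_lmodule[OF ZM]
  show "ev B 0 (corner_B Z)" using BZ pres_fg[OF BZ pB] by (simp add: ev_0)
  assume IH: "\<And>Z :: ('l, nat \<Rightarrow> 'l) module. Z \<in> perp L \<Longrightarrow> ev B n (corner_B Z)"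
  have "ev B n (corner_B (?F\<lparr>carrier := ?K\<rparr>))" by (rule IH[OF perp_kernel(2)[OF NL Z p]])
  then show "ev B (Suc n) (corner_B Z)" using ev_Suc[OF NB BZ pB, of n] xt unfolding ker kerM by blast
qed

text \<open>The \<mu> i form a map from Z to (Lf)^n, and the p i a map back, since Hom_L(Lf, Z) =
  fZ. The last clause says that the composite is the identity on fZ.\<close>

definition proj_part where
  "proj_part Z n \<mu> p \<longleftrightarrow> (\<forall>i<n. lh L Z (reg_module L) (\<mu> i) \<and> (\<forall>z\<in>carrier Z. \<mu> i z \<otimes>\<^bsub>L\<^esub> f = \<mu> i z) \<and> p i \<in> fix_f Z) \<and>
     (\<forall>z\<in>fix_f Z. z = lsum Z (\<lambda>i. \<mu> i z \<odot>\<^bsub>Z\<^esub> p i) n)"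

text \<open>A dual basis of the projective \<open>B\<close>-module \<open>fZ\<close> extends to linear forms on \<open>Z\<close>, because the obstruction lies in
  \<open>Ext\<^sup>1(Z, eLf) = 0\<close>.\<close>

lemma proj_part_exists:
  fixes Z :: "('l, nat \<Rightarrow> 'l) module"
  assumes v: "vz L bim" and PB: "PA B" and Z: "Z \<in> perp L"
  obtains n \<mu> p where "proj_part Z n \<mu> p"
proof -
  note ZM = perp_lmodule[OF Z]
  interpret Z: lmodule L Z by (rule ZM)
  have "corner_B Z \<in> perp B" unfolding perp_iff_ev[OF NB] using corner_B_ev[OF v Z] by blast
  then have "fgproj B (corner_B Z)" by (rule PA_D[OF NB PB])
  then obtain n l p where d: "dbasis B (corner_B Z) n l p" by (auto simp: fgproj_def)
  have l: "lh B (corner_B Z) (reg_module B) (l i)" if "i < n" for i using d that by (simp add: dbasis_def)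
  have pc: "p i \<in> fix_f Z" if "i < n" for i using d that by (simp add: dbasis_def)
  \<comment> \<open>The form l i on fZ corresponds to a map Z -> \<open>NB\<close>, which is lifted
    along the surjection \<sigma> from Lf with kernel eLf.\<close>
  have "\<forall>i. \<exists>\<mu>. i < n \<longrightarrow> lh L Z Lf \<mu> \<and> (\<forall>z\<in>carrier Z. \<sigma> (\<mu> z) = l i (f \<odot>\<^bsub>Z\<^esub> z))"
  proof
    fix i show "\<exists>\<mu>. i < n \<longrightarrow> lh L Z Lf \<mu> \<and> (\<forall>z\<in>carrier Z. \<sigma> (\<mu> z) = l i (f \<odot>\<^bsub>Z\<^esub> z))"
    proof (cases "i < n")
      case True
      obtain \<mu> where \<mu>: "lh L Z Lf \<mu>" "\<And>z. z \<in> carrier Z \<Longrightarrow> \<sigma> (\<mu> z) = l i (f \<odot>\<^bsub>Z\<^esub> z)"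
      proof (rule vz_lift[OF NL NB_lmodule fgproj_lmodule[OF Lf_fgproj] \<sigma>_lh(1,2) _ Z corner_B_hom_NB[OF ZM l[OF True]]])
        show "vz L (Lf\<lparr>carrier := a_kernel Lf NB \<sigma>\<rparr>)" by (simp add: Lf_kernel v)
      qed (rule that, assumption+)
      then show ?thesis by blast
    qed simp
  qed
  then obtain \<mu> where \<mu>: "\<And>i. i < n \<Longrightarrow> lh L Z Lf (\<mu> i)" "\<And>i z. i < n \<Longrightarrow> z \<in> carrier Z \<Longrightarrow> \<sigma> (\<mu> i z) = l i (f \<odot>\<^bsub>Z\<^esub> z)"
    by metis
  have "proj_part Z n \<mu> p" unfolding proj_part_def
  proof (intro conjI allI impI ballI)
    fix i assume i: "i < n"
    show "lh L Z (reg_module L) (\<mu> i)" using \<mu>(1)[OF i] unfolding Lf_def by (rule lh_uncod) auto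
    show "\<mu> i z \<otimes>\<^bsub>L\<^esub> f = \<mu> i z" if "z \<in> carrier Z" for z using lh_closed[OF \<mu>(1)[OF i] that] by simp
    show "p i \<in> fix_f Z" by (rule pc[OF i])
  next
    fix z assume z: "z \<in> fix_f Z"
    note z' = fix_f_D[OF z]
    have "z = lsum Z (\<lambda>i. \<beta> (l i z) \<odot>\<^bsub>Z\<^esub> p i) n" using d z by (simp add: dbasis_def)
    also have "\<dots> = lsum Z (\<lambda>i. \<mu> i z \<odot>\<^bsub>Z\<^esub> p i) n"
    proof (rule lsum_cong)
      fix i assume i: "i < n"
      have c: "\<mu> i z \<in> carrier L" using lh_closed[OF \<mu>(1)[OF i] z'(1)] by simp
      \<comment> \<open>For z = f z the value \<mu> i z lies in fL, so passing through \<sigma> and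
        back through \<beta> does not change it.\<close>
      have "\<beta> (l i z) = \<beta> (\<sigma> (\<mu> i z))" using \<mu>(2)[OF i z'(1)] z'(2) by simp
      also have "\<dots> = f \<otimes>\<^bsub>L\<^esub> \<mu> i z" by (rule \<beta>\<sigma>'[OF c])
      also have "\<dots> = \<mu> i z" using lh_smult[OF \<mu>(1)[OF i] ef(2) z'(1)] unfolding z'(2) by simp
      finally show "\<beta> (l i z) \<odot>\<^bsub>Z\<^esub> p i = \<mu> i z \<odot>\<^bsub>Z\<^esub> p i" by simp
    qed
    finally show "z = lsum Z (\<lambda>i. \<mu> i z \<odot>\<^bsub>Z\<^esub> p i) n" .
  qed
  then show thesis by (rule that)
qed

definition proj_map where "proj_map Z n \<mu> p z = lsum Z (\<lambda>i. \<mu> i z \<odot>\<^bsub>Z\<^esub> p i) n"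

context
  fixes Z :: "('l, 'z, 'w) module_scheme" and n \<mu> p
  assumes Z: "lmodule L Z" and pp: "proj_part Z n \<mu> p"
begin

interpretation Z: lmodule L Z by (rule Z)

abbreviation "\<pi> \<equiv> proj_map Z n \<mu> p"

lemma pp_D: "i < n \<Longrightarrow> lh L Z (reg_module L) (\<mu> i)" "i < n \<Longrightarrow> z \<in> carrier Z \<Longrightarrow> \<mu> i z \<in> carrier L"
  "i < n \<Longrightarrow> z \<in> carrier Z \<Longrightarrow> \<mu> i z \<otimes>\<^bsub>L\<^esub> f = \<mu> i z" "i < n \<Longrightarrow> p i \<in> fix_f Z" "i < n \<Longrightarrow> p i \<in> carrier Z"
  "z \<in> fix_f Z \<Longrightarrow> \<pi> z = z"
  using pp lh_closed[of L Z "reg_module L" "\<mu> i" z] fix_f_D(1)[of "p i" Z] by (auto simp: proj_part_def proj_map_def)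

lemma \<pi>_lh: "lh L Z Z \<pi>"
  unfolding proj_map_def by (rule lsum_lh[OF Z Z], rule lh_scale[OF Z pp_D(1) pp_D(5)])

text \<open>\<pi> is the identity on fZ, which contains the p i, so it fixes every combination of
  them.\<close>

lemma \<pi>_idem: assumes z: "z \<in> carrier Z" shows "\<pi> (\<pi> z) = \<pi> z"
proof -
  have "\<pi> (\<pi> z) = lsum Z (\<lambda>i. \<pi> (\<mu> i z \<odot>\<^bsub>Z\<^esub> p i)) n"
    by (subst (2) proj_map_def, rule lh_lsum[OF Z Z \<pi>_lh]) (simp add: pp_D z)
  also have "\<dots> = \<pi> z" unfolding proj_map_def[of Z n \<mu> p z]
    by (rule lsum_cong) (simp add: lh_smult[OF \<pi>_lh] pp_D z)
  finally show ?thesis .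
qed

lemma \<pi>_zero: assumes z: "z \<in> carrier Z" and m: "\<And>i. i < n \<Longrightarrow> \<mu> i z = \<zero>\<^bsub>L\<^esub>" shows "\<pi> z = \<zero>\<^bsub>Z\<^esub>"
  unfolding proj_map_def by (rule Z.M.lsum_zero) (simp add: m pp_D)

definition rest where "rest = Z\<lparr>carrier := a_kernel Z Z \<pi>\<rparr>"

lemma rest_simps [simp]: "carrier rest = {z \<in> carrier Z. \<pi> z = \<zero>\<^bsub>Z\<^esub>}" "\<zero>\<^bsub>rest\<^esub> = \<zero>\<^bsub>Z\<^esub>" "x \<oplus>\<^bsub>rest\<^esub> y = x \<oplus>\<^bsub>Z\<^esub> y"
  "r \<odot>\<^bsub>rest\<^esub> x = r \<odot>\<^bsub>Z\<^esub> x"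
  by (simp_all add: rest_def a_kernel_def')

lemma rest_lmodule: "lmodule L rest"
  unfolding rest_def by (rule submod_lmodule[OF Z submod_kernel[OF Z Z \<pi>_lh]])

lemma rest_killed: "killed rest"
  unfolding killed_def
proof (intro conjI ballI rest_lmodule)
  fix x assume x: "x \<in> carrier rest"
  then have "f \<odot>\<^bsub>Z\<^esub> x = \<pi> (f \<odot>\<^bsub>Z\<^esub> x)" using pp_D(6)[OF fix_f_smult[OF Z, of x]] by simp
  also have "\<dots> = \<zero>\<^bsub>Z\<^esub>" using x by (simp add: lh_smult[OF \<pi>_lh])
  finally show "f \<odot>\<^bsub>rest\<^esub> x = \<zero>\<^bsub>rest\<^esub>" by simp
qed

lemma rest_proj: "lh L Z rest (\<lambda>z. z \<ominus>\<^bsub>Z\<^esub> \<pi> z)"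
proof -
  have d: "lh L Z Z (\<lambda>z. z \<ominus>\<^bsub>Z\<^esub> \<pi> z)" by (rule lh_diff[OF Z Z lh_id \<pi>_lh])
  show ?thesis unfolding rest_def
  proof (rule lh_cod[OF d])
    fix z assume z: "z \<in> carrier Z"
    note c = lh_closed[OF \<pi>_lh z]
    have "\<pi> (z \<ominus>\<^bsub>Z\<^esub> \<pi> z) = \<zero>\<^bsub>Z\<^esub>"
      using lh_minus[OF Z Z \<pi>_lh z c] c by (simp add: \<pi>_idem[OF z] Z.M.minus_eq Z.M.r_neg)
    then show "z \<ominus>\<^bsub>Z\<^esub> \<pi> z \<in> a_kernel Z Z \<pi>" using z c by (simp add: a_kernel_def')
  qed
qed

lemma rest_decomp: assumes z: "z \<in> carrier Z" shows "z = \<pi> z \<oplus>\<^bsub>Z\<^esub> (z \<ominus>\<^bsub>Z\<^esub> \<pi> z)"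
  using z lh_closed[OF \<pi>_lh z] by (simp add: Z.M.minus_eq Z.M.a_ac Z.M.r_neg1 Z.M.r_neg2 Z.M.r_neg)

lemma rest_id: assumes "z \<in> carrier rest" shows "z \<ominus>\<^bsub>Z\<^esub> \<pi> z = z"
  using assms by (simp add: Z.M.minus_eq)

lemma rest_perp: assumes "Z \<in> perp L" shows "rest \<in> perp L"
proof -
  have i: "lh L rest Z (\<lambda>z. z)" by (rule lhI) auto
  show ?thesis by (rule perp_retract[OF NL assms rest_lmodule i rest_proj]) (rule rest_id)
qed

text \<open>Z is the direct sum of the image of \<pi> and \<open>rest\<close>. The dual bases of the
  two are concatenated, the second one pulled back along z - \<pi> z.\<close>

lemma rest_fgproj: assumes g: "fgproj A (res \<alpha> rest)" shows "fgproj L Z"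
proof -
  obtain m l q where d: "dbasis A (res \<alpha> rest) m l q" using g by (auto simp: fgproj_def)
  have l: "lh A (res \<alpha> rest) (reg_module A) (l j)" if "j < m" for j using d that by (simp add: dbasis_def)
  have qc: "q j \<in> carrier rest" if "j < m" for j using d that by (simp add: dbasis_def)
  have ll: "lh L Z (reg_module L) (\<lambda>z. \<alpha> (l j (z \<ominus>\<^bsub>Z\<^esub> \<pi> z)))" if "j < m" for j
    by (rule lh_comp[OF rest_proj lh_comp[OF killed_hom[OF rest_killed l[OF that]] \<alpha>_lh]])
  let ?M = "\<lambda>i. if i < n then \<mu> i else (\<lambda>z. \<alpha> (l (i - n) (z \<ominus>\<^bsub>Z\<^esub> \<pi> z)))"
  let ?p = "\<lambda>i. if i < n then p i else q (i - n)"
  have M: "lh L Z (reg_module L) (?M i)" if "i < n + m" for i using that pp_D(1)[of i] ll[of "i - n"] by auto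
  have p: "?p i \<in> carrier Z" if "i < n + m" for i using that pp_D(5)[of i] qc[of "i - n"] by auto
  have "z = lsum Z (\<lambda>i. ?M i z \<odot>\<^bsub>Z\<^esub> ?p i) (n + m)" if z: "z \<in> carrier Z" for z
  proof -
    have zr: "z \<ominus>\<^bsub>Z\<^esub> \<pi> z \<in> carrier rest" by (rule lh_closed[OF rest_proj z])
    have "lsum Z (\<lambda>i. ?M i z \<odot>\<^bsub>Z\<^esub> ?p i) (n + m)
      = lsum Z (\<lambda>i. ?M i z \<odot>\<^bsub>Z\<^esub> ?p i) n \<oplus>\<^bsub>Z\<^esub> lsum Z (\<lambda>j. ?M (n + j) z \<odot>\<^bsub>Z\<^esub> ?p (n + j)) m"
      by (rule lsum_append[OF Z.M.abelian_group_axioms]) (use lh_closed[OF M z] p in \<open>simp del: if_split_asm\<close>)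
    also have "lsum Z (\<lambda>i. ?M i z \<odot>\<^bsub>Z\<^esub> ?p i) n = \<pi> z" unfolding proj_map_def by (rule lsum_cong) simp
    also have "lsum Z (\<lambda>j. ?M (n + j) z \<odot>\<^bsub>Z\<^esub> ?p (n + j)) m = lsum (res \<alpha> rest) (\<lambda>j. l j (z \<ominus>\<^bsub>Z\<^esub> \<pi> z) \<odot>\<^bsub>res \<alpha> rest\<^esub> q j) m"
      by (simp add: rest_def lsum_carrier)
    also have "\<dots> = z \<ominus>\<^bsub>Z\<^esub> \<pi> z" using d zr by (simp add: dbasis_def)
    finally show ?thesis using rest_decomp[OF z] by simp
  qed
  then have "dbasis L Z (n + m) ?M ?p" using M p unfolding dbasis_def by blast
  then show ?thesis using Z unfolding fgproj_def by blast
qed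

text \<open>An element killed by all forms is killed by the \<mu> i, so \<pi> kills it and it lies
  in \<open>rest\<close>. There the forms over A detect it, once they are extended to Z along z -
  \<pi> z.\<close>

lemma rest_tl: assumes t: "tl A (res \<alpha> rest)" shows "tl L Z"
  unfolding tl_def
proof (intro ballI impI)
  fix z assume z: "z \<in> carrier Z" "\<forall>g. lh L Z (reg_module L) g \<longrightarrow> g z = \<zero>\<^bsub>L\<^esub>"
  have "\<mu> i z = \<zero>\<^bsub>L\<^esub>" if "i < n" for i using z(2) pp_D(1)[OF that] by blast
  then have \<pi>0: "\<pi> z = \<zero>\<^bsub>Z\<^esub>" using \<pi>_zero[OF z(1)] by blast
  then have zr: "z \<in> carrier rest" using z(1) by simp
  have "g z = \<zero>\<^bsub>A\<^esub>" if g: "lh A (res \<alpha> rest) (reg_module A) g" for g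
  proof -
    have "lh L Z (reg_module L) (\<lambda>z. \<alpha> (g (z \<ominus>\<^bsub>Z\<^esub> \<pi> z)))"
      by (rule lh_comp[OF rest_proj lh_comp[OF killed_hom[OF rest_killed g] \<alpha>_lh]])
    then have "\<alpha> (g (z \<ominus>\<^bsub>Z\<^esub> \<pi> z)) = \<zero>\<^bsub>L\<^esub>" using z(2) by blast
    then have "\<alpha> (g z) = \<alpha> \<zero>\<^bsub>A\<^esub>" using rest_id[OF zr] by simp
    then have "\<rho> (\<alpha> (g z)) = \<rho> (\<alpha> \<zero>\<^bsub>A\<^esub>)" by (rule arg_cong)
    then show ?thesis using lh_closed[OF g, of z] zr by (simp only: \<rho>\<alpha> A.zero_closed res_simps reg_simps)
  qed
  then show "z = \<zero>\<^bsub>Z\<^esub>" using t zr by (simp add: tl_def)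
qed

end

text \<open>A form h on the inflated module vanishes at x as soon as h e and h f do: the first is a
  form over A, and the second has values in eLf, which is torsionless over A.\<close>

lemma inflate_tl:
  assumes t: "tl A (res \<alpha> bim)" and X: "lmodule A X" and tX: "tl L (res \<rho> X)" shows "tl A X"
  unfolding tl_def
proof (intro ballI impI)
  fix x assume x: "x \<in> carrier X" "\<forall>g. lh A X (reg_module A) g \<longrightarrow> g x = \<zero>\<^bsub>A\<^esub>"
  have "h x = \<zero>\<^bsub>L\<^esub>" if h: "lh L (res \<rho> X) (reg_module L) h" for h
  proof -
    have hc: "h y \<in> carrier L" if "y \<in> carrier X" for y using lh_closed[OF h, of y] that by simp
    have "\<rho> (h x) = \<zero>\<^bsub>A\<^esub>" using x(2) inflate_hom_A[OF X h] by blast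
    then have 1: "h x \<otimes>\<^bsub>L\<^esub> e = \<zero>\<^bsub>L\<^esub>" using \<alpha>\<rho>'[OF hc[OF x(1)]] by simp
    have m: "h y \<otimes>\<^bsub>L\<^esub> f \<in> bimS" if "y \<in> carrier X" for y
      using hc[OF that] inflate_hom_L[OF X h that] L.m_assoc[of e "h y" f] L.m_assoc[of "h y" f f] by (simp add: bimS_def)
    have hf: "lh A X (res \<alpha> bim) (\<lambda>y. h y \<otimes>\<^bsub>L\<^esub> f)"
    proof (rule lhI)
      fix r y assume a: "r \<in> carrier A" "y \<in> carrier X"
      have "h (r \<odot>\<^bsub>X\<^esub> y) = \<alpha> r \<otimes>\<^bsub>L\<^esub> h y" using lh_smult[OF h, of "\<alpha> r" y] a by (simp add: \<rho>\<alpha>)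
      then show "h (r \<odot>\<^bsub>X\<^esub> y) \<otimes>\<^bsub>L\<^esub> f = r \<odot>\<^bsub>res \<alpha> bim\<^esub> (h y \<otimes>\<^bsub>L\<^esub> f)" using a hc by (simp add: L.m_assoc)
    next
      fix y y' assume "y \<in> carrier X" "y' \<in> carrier X"
      then show "h (y \<oplus>\<^bsub>X\<^esub> y') \<otimes>\<^bsub>L\<^esub> f = (h y \<otimes>\<^bsub>L\<^esub> f) \<oplus>\<^bsub>res \<alpha> bim\<^esub> (h y' \<otimes>\<^bsub>L\<^esub> f)"
        using lh_add[OF h, of y y'] hc by (simp add: L.l_distr)
    qed (use m in simp)
    have "k (h x \<otimes>\<^bsub>L\<^esub> f) = \<zero>\<^bsub>A\<^esub>" if "lh A (res \<alpha> bim) (reg_module A) k" for k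
      using x(2) lh_comp[OF hf that] by blast
    then have "h x \<otimes>\<^bsub>L\<^esub> f = \<zero>\<^bsub>L\<^esub>" using t m[OF x(1)] by (simp add: tl_def)
    then show ?thesis using 1 split(2)[OF hc[OF x(1)]] by simp
  qed
  then show "x = \<zero>\<^bsub>X\<^esub>" using tX x(1) by (simp add: tl_def)
qed

lemma inflate_fgprojD: assumes X: "lmodule A X" and P: "fgproj L (res \<rho> X)" shows "fgproj A X"
proof -
  interpret X: lmodule A X by fact
  obtain n l p where d: "dbasis L (res \<rho> X) n l p" using P by (auto simp: fgproj_def)
  have l: "lh L (res \<rho> X) (reg_module L) (l i)" if "i < n" for i using d that by (simp add: dbasis_def)
  have "dbasis A X n (\<lambda>i x. \<rho> (l i x)) p" unfolding dbasis_def
  proof (intro conjI allI impI ballI inflate_hom_A[OF X l])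
    show "p i \<in> carrier X" if "i < n" for i using d that by (simp add: dbasis_def)
    show "x = lsum X (\<lambda>i. \<rho> (l i x) \<odot>\<^bsub>X\<^esub> p i) n" if "x \<in> carrier X" for x using d that by (simp add: dbasis_def)
  qed
  then show ?thesis using X unfolding fgproj_def by blast
qed

lemma PA_iff: assumes vL: "vz L bim" and vA: "vz A (res \<alpha> bim)" and PB: "PA B" shows "PA L \<longleftrightarrow> PA A"
proof
  assume P: "PA L"
  show "PA A" unfolding PA_def
  proof (intro allI impI)
    fix X :: "('a, nat \<Rightarrow> 'a) module" assume X: "X \<in> perp A"
    show "fgproj A X" by (rule inflate_fgprojD[OF perp_lmodule[OF X] PA_D[OF NL P inflate_perp[OF vA X]]])
  qed
next
  assume P: "PA A"
  show "PA L" unfolding PA_def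
  proof (intro allI impI)
    fix Z :: "('l, nat \<Rightarrow> 'l) module" assume Z: "Z \<in> perp L"
    obtain n \<mu> p where pp: "proj_part Z n \<mu> p" by (rule proj_part_exists[OF vL PB Z])
    note ZM = perp_lmodule[OF Z]
    show "fgproj L Z"
      by (rule rest_fgproj[OF ZM pp PA_D[OF NA P killed_perp[OF rest_killed[OF ZM pp] rest_perp[OF ZM pp Z]]]])
  qed
qed

text \<open>Kept apart from \<open>PA_iff\<close> for the passage from all vertices of a quiver to
  one of them, where the complementary corner is not yet known to satisfy \<open>PA\<close>.\<close>

lemma PA_down: assumes vA: "vz A (res \<alpha> bim)" and P: "PA L" shows "PA A"
  unfolding PA_def
proof (intro allI impI)
  fix X :: "('a, nat \<Rightarrow> 'a) module" assume X: "X \<in> perp A"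
  show "fgproj A X" by (rule inflate_fgprojD[OF perp_lmodule[OF X] PA_D[OF NL P inflate_perp[OF vA X]]])
qed

lemma TL_iff: assumes vL: "vz L bim" and vA: "vz A (res \<alpha> bim)" and PB: "PA B" and t: "tl A (res \<alpha> bim)"
  shows "TL L \<longleftrightarrow> TL A"
proof
  assume T: "TL L"
  show "TL A" unfolding TL_def
  proof (intro allI impI)
    fix X :: "('a, nat \<Rightarrow> 'a) module" assume X: "X \<in> perp A"
    show "tl A X" by (rule inflate_tl[OF t perp_lmodule[OF X] TL_D[OF NL T inflate_perp[OF vA X]]])
  qed
next
  assume T: "TL A"
  show "TL L" unfolding TL_def
  proof (intro allI impI)
    fix Z :: "('l, nat \<Rightarrow> 'l) module" assume Z: "Z \<in> perp L"
    obtain n \<mu> p where pp: "proj_part Z n \<mu> p" by (rule proj_part_exists[OF vL PB Z])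
    note ZM = perp_lmodule[OF Z]
    show "tl L Z"
      by (rule rest_tl[OF ZM pp TL_D[OF NA T killed_perp[OF rest_killed[OF ZM pp] rest_perp[OF ZM pp Z]]]])
  qed
qed

end

section \<open>Tensor products\<close>

text \<open>X stands for any structure whose additive part is the tensor group, so that the results
  serve both \<open>tensor_module\<close> and \<open>tensor_algebra\<close>.\<close>

locale tensor =
  fixes B :: "('b, 'e) ring_scheme" and N :: "('b, 'm, 'x) module_scheme" and Y :: "('b, 'y, 'z) module_scheme"
    and X :: "(('m \<times> 'y \<Rightarrow>\<^sub>0 int) set, 'w) ring_scheme"
  assumes N: "lmodule (opp B) N" and Y: "lmodule B Y"
    and X_carrier: "carrier X = carrier (tensor_group B N Y)"
    and X_add: "add X = monoid.mult (tensor_group B N Y)"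
    and X_zero: "\<zero>\<^bsub>X\<^esub> = \<one>\<^bsub>tensor_group B N Y\<^esub>"
begin

sublocale N: lmodule "opp B" N by (rule N)
sublocale Y: lmodule B Y by (rule Y)

abbreviation "rel \<equiv> tensor_rel B N Y"
abbreviation "cls \<equiv> tensor_class B N Y"
abbreviation "tt m y \<equiv> cls (frag_of (m, y))"
abbreviation "S \<equiv> carrier N \<times> carrier Y"

definition gens where
  "gens = {frag_of (m \<oplus>\<^bsub>N\<^esub> m', y) - frag_of (m, y) - frag_of (m', y) | m m' y.
         m \<in> carrier N \<and> m' \<in> carrier N \<and> y \<in> carrier Y} \<union>
      {frag_of (m, y \<oplus>\<^bsub>Y\<^esub> y') - frag_of (m, y) - frag_of (m, y') | m y y'.
         m \<in> carrier N \<and> y \<in> carrier Y \<and> y' \<in> carrier Y} \<union>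
      {frag_of (b \<odot>\<^bsub>N\<^esub> m, y) - frag_of (m, b \<odot>\<^bsub>Y\<^esub> y) | m b y.
         m \<in> carrier N \<and> b \<in> carrier B \<and> y \<in> carrier Y}"

lemma keys_diff3: "Poly_Mapping.keys (a - b - c) \<subseteq> Poly_Mapping.keys a \<union> Poly_Mapping.keys b \<union> Poly_Mapping.keys c"
  for a b c :: "'q \<Rightarrow>\<^sub>0 int"
  using keys_diff[of "a - b" c] keys_diff[of a b] by auto

lemma gens_carrier: "t \<in> gens \<Longrightarrow> Poly_Mapping.keys t \<subseteq> S"
  unfolding gens_def
  by (elim UnE CollectE exE conjE; hypsubst; rule order_trans[OF keys_diff3] order_trans[OF keys_diff])
    (auto simp: N.lsmult_closed)

lemma rel_eq: "rel = generate (free_Abelian_group S) gens"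
  by (simp add: tensor_rel_def tensor_free_def gens_def)

lemma rel_carrier: "t \<in> rel \<Longrightarrow> Poly_Mapping.keys t \<subseteq> S"
  using group.generate_incl[OF group_free_Abelian_group, of gens S] gens_carrier unfolding rel_eq by fastforce

text \<open>Closure under differences covers sums and inverses alike; the inverse of the free
  abelian group is negation only for elements supported in S, which the generators are.\<close>

lemma rel_least:
  assumes "0 \<in> H" "\<And>a b. a \<in> H \<Longrightarrow> b \<in> H \<Longrightarrow> a - b \<in> H" "gens \<subseteq> H" shows "rel \<subseteq> H"
proof
  fix t assume "t \<in> rel"
  then have "t \<in> generate (free_Abelian_group S) gens" by (simp only: rel_eq)
  then show "t \<in> H"
  proof (induction rule: generate.induct)
    case one then show ?case using assms(1) by simp
  next
    case (incl h) then show ?case using assms(3) by auto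
  next
    case (inv h)
    have "0 - h \<in> H" using assms inv by blast
    then show ?case using gens_carrier[OF inv] by simp
  next
    case (eng h k)
    have "h - (0 - k) \<in> H" using assms eng by blast
    then show ?case by simp
  qed
qed

lemma rel_subgroup: "subgroup rel (free_Abelian_group S)"
  unfolding rel_eq using gens_carrier by (intro group.generate_is_subgroup) auto

lemma rel_zero: "0 \<in> rel" and rel_diff: "a \<in> rel \<Longrightarrow> b \<in> rel \<Longrightarrow> a - b \<in> rel"
proof -
  show "0 \<in> rel" using subgroup.one_closed[OF rel_subgroup] by simp
  assume "a \<in> rel" "b \<in> rel"
  then show "a - b \<in> rel"
    using subgroup.m_closed[OF rel_subgroup, of a "-b"] subgroup.m_inv_closed[OF rel_subgroup, of b] rel_carrier[of b] by simp
qed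

lemma rel_add: assumes "a \<in> rel" "b \<in> rel" shows "a + b \<in> rel"
  using rel_diff[OF assms(1) rel_diff[OF rel_zero assms(2)]] by simp

lemma rel_gens: "t \<in> gens \<Longrightarrow> t \<in> rel"
  unfolding rel_eq by (rule generate.incl)

lemma cls_alt: "cls t = (\<lambda>h. h + t) ` rel"
  by (auto simp: tensor_class_def r_coset_def tensor_free_def)

lemma cls_mem: "s \<in> cls t \<longleftrightarrow> s - t \<in> rel"
  unfolding cls_alt by (auto simp: image_iff) (metis diff_add_cancel)

lemma cls_eq: "cls s = cls t \<longleftrightarrow> s - t \<in> rel"
proof
  assume "cls s = cls t"
  moreover have "s \<in> cls s" using rel_zero by (simp add: cls_mem)
  ultimately show "s - t \<in> rel" by (simp add: cls_mem)
next
  assume st: "s - t \<in> rel"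
  show "cls s = cls t"
  proof (intro Set.set_eqI)
    fix x
    show "x \<in> cls s \<longleftrightarrow> x \<in> cls t"
      unfolding cls_mem using rel_add[OF _ st, of "x - s"] rel_diff[OF _ st, of "x - t"] by auto
  qed
qed

lemma carrier_alt: "carrier X = cls ` {t. Poly_Mapping.keys t \<subseteq> S}"
  by (auto simp: X_carrier tensor_group_def FactGroup_def RCOSETS_def tensor_class_def tensor_free_def)

lemma cls_closed: "Poly_Mapping.keys t \<subseteq> S \<Longrightarrow> cls t \<in> carrier X"
  unfolding carrier_alt by blast

lemma add_cls: "cls s \<oplus>\<^bsub>X\<^esub> cls t = cls (s + t)"
proof -
  have "cls s \<oplus>\<^bsub>X\<^esub> cls t = (\<Union>a\<in>cls s. \<Union>b\<in>cls t. {a + b})"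
    by (simp add: X_add tensor_group_def FactGroup_def set_mult_def tensor_free_def)
  also have "\<dots> = cls (s + t)"
  proof (intro Set.set_eqI iffI)
    fix x assume "x \<in> (\<Union>a\<in>cls s. \<Union>b\<in>cls t. {a + b})"
    then obtain a b where ab: "a - s \<in> rel" "b - t \<in> rel" "x = a + b" by (auto simp: cls_mem)
    then show "x \<in> cls (s + t)" using rel_add[OF ab(1,2)] by (simp add: cls_mem algebra_simps)
  next
    fix x assume "x \<in> cls (s + t)"
    then have "x - t \<in> cls s" by (simp add: cls_mem algebra_simps)
    moreover have "t \<in> cls t" using rel_zero by (simp add: cls_mem)
    ultimately show "x \<in> (\<Union>a\<in>cls s. \<Union>b\<in>cls t. {a + b})" by (intro UN_I[of "x - t"] UN_I[of t]) auto
  qed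
  finally show ?thesis .
qed

lemma zero_cls: "\<zero>\<^bsub>X\<^esub> = cls 0"
  by (simp add: X_zero tensor_group_def FactGroup_def cls_alt)

lemma X_group: "abelian_group X"
proof (rule abelian_groupI)
  show "x \<oplus>\<^bsub>X\<^esub> y \<in> carrier X" if "x \<in> carrier X" "y \<in> carrier X" for x y
    using that keys_add unfolding carrier_alt by (force simp: add_cls)
  show "\<zero>\<^bsub>X\<^esub> \<in> carrier X" by (simp add: zero_cls cls_closed)
  show "x \<oplus>\<^bsub>X\<^esub> y \<oplus>\<^bsub>X\<^esub> z = x \<oplus>\<^bsub>X\<^esub> (y \<oplus>\<^bsub>X\<^esub> z)" if "x \<in> carrier X" "y \<in> carrier X" "z \<in> carrier X" for x y z
    using that unfolding carrier_alt by (auto simp: add_cls add.assoc)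
  show "x \<oplus>\<^bsub>X\<^esub> y = y \<oplus>\<^bsub>X\<^esub> x" if "x \<in> carrier X" "y \<in> carrier X" for x y
    using that unfolding carrier_alt by (auto simp: add_cls add.commute)
  show "\<zero>\<^bsub>X\<^esub> \<oplus>\<^bsub>X\<^esub> x = x" if "x \<in> carrier X" for x
    using that unfolding carrier_alt by (auto simp: add_cls zero_cls)
  show "\<exists>y\<in>carrier X. y \<oplus>\<^bsub>X\<^esub> x = \<zero>\<^bsub>X\<^esub>" if xX: "x \<in> carrier X" for x
  proof -
    obtain t where "x = cls t" "Poly_Mapping.keys t \<subseteq> S" using xX unfolding carrier_alt by blast
    then show ?thesis by (intro bexI[of _ "cls (- t)"]) (simp_all add: add_cls zero_cls cls_closed)
  qed
qed

sublocale X: abelian_group X by (rule X_group)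

lemma tt_closed [simp]: "m \<in> carrier N \<Longrightarrow> y \<in> carrier Y \<Longrightarrow> tt m y \<in> carrier X"
  by (rule cls_closed) simp

lemma tt_add1: "m \<in> carrier N \<Longrightarrow> m' \<in> carrier N \<Longrightarrow> y \<in> carrier Y \<Longrightarrow> tt (m \<oplus>\<^bsub>N\<^esub> m') y = tt m y \<oplus>\<^bsub>X\<^esub> tt m' y"
  and tt_add2: "m \<in> carrier N \<Longrightarrow> y \<in> carrier Y \<Longrightarrow> y' \<in> carrier Y \<Longrightarrow> tt m (y \<oplus>\<^bsub>Y\<^esub> y') = tt m y \<oplus>\<^bsub>X\<^esub> tt m y'"
  and tt_bal: "m \<in> carrier N \<Longrightarrow> b \<in> carrier B \<Longrightarrow> y \<in> carrier Y \<Longrightarrow> tt (b \<odot>\<^bsub>N\<^esub> m) y = tt m (b \<odot>\<^bsub>Y\<^esub> y)"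
  unfolding add_cls cls_eq by (rule rel_gens, unfold gens_def diff_diff_add[symmetric], blast)+

lemma tt_zero1: assumes "y \<in> carrier Y" shows "tt \<zero>\<^bsub>N\<^esub> y = \<zero>\<^bsub>X\<^esub>"
  using tt_add1[of "\<zero>\<^bsub>N\<^esub>" "\<zero>\<^bsub>N\<^esub>" y] assms by (simp add: X.add.l_cancel_one')
lemma tt_zero2: assumes "m \<in> carrier N" shows "tt m \<zero>\<^bsub>Y\<^esub> = \<zero>\<^bsub>X\<^esub>"
  using tt_add2[of m "\<zero>\<^bsub>Y\<^esub>" "\<zero>\<^bsub>Y\<^esub>"] assms by (simp add: X.add.l_cancel_one')

text \<open>A sign can be absorbed into the first tensor factor, so pure tensors generate under
  addition alone.\<close>

lemma tensor_induct [consumes 1, case_names tt add]: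
  assumes x: "x \<in> carrier X" and t: "\<And>m y. m \<in> carrier N \<Longrightarrow> y \<in> carrier Y \<Longrightarrow> P (tt m y)"
    and a: "\<And>x y. x \<in> carrier X \<Longrightarrow> y \<in> carrier X \<Longrightarrow> P x \<Longrightarrow> P y \<Longrightarrow> P (x \<oplus>\<^bsub>X\<^esub> y)"
  shows "P x"
proof -
  \<comment> \<open>Induction on the free abelian group runs through differences; the statement for
    -s is carried along to turn them into sums.\<close>
  have "Poly_Mapping.keys s \<subseteq> S \<and> P (cls s) \<and> P (cls (- s))" if "Poly_Mapping.keys s \<subseteq> S" for s
    using that
  proof (induction s rule: frag_induction)
    case zero
    have "P (tt \<zero>\<^bsub>N\<^esub> \<zero>\<^bsub>Y\<^esub>)" by (rule t) simp_all
    then show ?case by (simp add: tt_zero1 zero_cls)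
  next
    case (diff s s')
    then show ?case using a[of "cls s" "cls (- s')"] a[of "cls s'" "cls (- s)"] keys_diff[of s s']
      by (auto simp: add_cls cls_closed)
  next
    case (one p)
    obtain m y where p: "p = (m, y)" "m \<in> carrier N" "y \<in> carrier Y" using one by auto
    have "tt (\<ominus>\<^bsub>N\<^esub> m) y \<oplus>\<^bsub>X\<^esub> tt m y = \<zero>\<^bsub>X\<^esub>"
      using tt_add1[of "\<ominus>\<^bsub>N\<^esub> m" m y] p by (simp add: N.M.l_neg tt_zero1)
    moreover have "cls (- frag_of p) \<oplus>\<^bsub>X\<^esub> tt m y = \<zero>\<^bsub>X\<^esub>" using p by (simp add: add_cls zero_cls)
    ultimately have "cls (- frag_of p) = tt (\<ominus>\<^bsub>N\<^esub> m) y"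
      using X.minus_equality[of "cls (- frag_of p)" "tt m y"] X.minus_equality[of "tt (\<ominus>\<^bsub>N\<^esub> m) y" "tt m y"] p
      by (simp add: cls_closed)
    then show ?case using t[of m y] t[of "\<ominus>\<^bsub>N\<^esub> m" y] p by simp
  qed
  then show ?thesis using x unfolding carrier_alt by blast
qed

lemma tensor_lift:
  fixes H :: "('h, 'v) ring_scheme" and \<psi> :: "'m \<Rightarrow> 'y \<Rightarrow> 'h"
  assumes H: "abelian_group H" and c: "\<And>m y. m \<in> carrier N \<Longrightarrow> y \<in> carrier Y \<Longrightarrow> \<psi> m y \<in> carrier H"
    and a1: "\<And>m m' y. m \<in> carrier N \<Longrightarrow> m' \<in> carrier N \<Longrightarrow> y \<in> carrier Y \<Longrightarrow> \<psi> (m \<oplus>\<^bsub>N\<^esub> m') y = \<psi> m y \<oplus>\<^bsub>H\<^esub> \<psi> m' y"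
    and a2: "\<And>m y y'. m \<in> carrier N \<Longrightarrow> y \<in> carrier Y \<Longrightarrow> y' \<in> carrier Y \<Longrightarrow> \<psi> m (y \<oplus>\<^bsub>Y\<^esub> y') = \<psi> m y \<oplus>\<^bsub>H\<^esub> \<psi> m y'"
    and b: "\<And>m b y. m \<in> carrier N \<Longrightarrow> b \<in> carrier B \<Longrightarrow> y \<in> carrier Y \<Longrightarrow> \<psi> (b \<odot>\<^bsub>N\<^esub> m) y = \<psi> m (b \<odot>\<^bsub>Y\<^esub> y)"
  obtains \<tau> where "\<And>x. x \<in> carrier X \<Longrightarrow> \<tau> x \<in> carrier H"
    "\<And>x y. x \<in> carrier X \<Longrightarrow> y \<in> carrier X \<Longrightarrow> \<tau> (x \<oplus>\<^bsub>X\<^esub> y) = \<tau> x \<oplus>\<^bsub>H\<^esub> \<tau> y"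
    "\<And>m y. m \<in> carrier N \<Longrightarrow> y \<in> carrier Y \<Longrightarrow> \<tau> (tt m y) = \<psi> m y"
proof -
  interpret H: abelian_group H by (rule H)
  have im: "(\<lambda>(m, y). \<psi> m y) ` S \<subseteq> carrier (add_monoid H)" using c by auto
  obtain h where h: "h \<in> hom (free_Abelian_group S) (add_monoid H)" and hf: "\<And>x. x \<in> S \<Longrightarrow> h (frag_of x) = (\<lambda>(m, y). \<psi> m y) x"
    by (rule comm_group.free_Abelian_group_universal[OF H.a_comm_group im]) (rule that, assumption+)
  have hc: "h s \<in> carrier H" if "Poly_Mapping.keys s \<subseteq> S" for s using h that by (auto simp: hom_def Pi_iff)
  have ha: "h (s + t) = h s \<oplus>\<^bsub>H\<^esub> h t" if "Poly_Mapping.keys s \<subseteq> S" "Poly_Mapping.keys t \<subseteq> S" for s t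
    using h that by (auto simp: hom_def)
  have hd: "h (s - t) \<oplus>\<^bsub>H\<^esub> h t = h s" if "Poly_Mapping.keys s \<subseteq> S" "Poly_Mapping.keys t \<subseteq> S" for s t
  proof -
    have "Poly_Mapping.keys (s - t) \<subseteq> S" using that keys_diff[of s t] by blast
    from ha[OF this that(2)] show ?thesis by simp
  qed
  have h0: "h 0 = \<zero>\<^bsub>H\<^esub>" using hd[of 0 0] hc[of 0] by (simp add: H.add.l_cancel_one)
  have hf': "h (frag_of (m, y)) = \<psi> m y" if "m \<in> carrier N" "y \<in> carrier Y" for m y using hf[of "(m, y)"] that by simp
  have eq0: "h (s - t) = \<zero>\<^bsub>H\<^esub>" if "Poly_Mapping.keys s \<subseteq> S" "Poly_Mapping.keys t \<subseteq> S" "h s = h t" for s t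
  proof -
    have k: "Poly_Mapping.keys (s - t) \<subseteq> S" using that(1,2) keys_diff[of s t] by blast
    show ?thesis using hd[OF that(1,2)] hc[OF that(2)] hc[OF k] that(3) by (simp add: H.add.r_cancel_one)
  qed
  \<comment> \<open>The assumptions on \<psi> say that h vanishes on the generating relations; so it
    vanishes on all relations and is constant on classes.\<close>
  have "rel \<subseteq> {t. Poly_Mapping.keys t \<subseteq> S \<and> h t = \<zero>\<^bsub>H\<^esub>}"
  proof (rule rel_least)
    show "0 \<in> {t. Poly_Mapping.keys t \<subseteq> S \<and> h t = \<zero>\<^bsub>H\<^esub>}" using h0 by simp
    show "s - t \<in> {t. Poly_Mapping.keys t \<subseteq> S \<and> h t = \<zero>\<^bsub>H\<^esub>}"
      if "s \<in> {t. Poly_Mapping.keys t \<subseteq> S \<and> h t = \<zero>\<^bsub>H\<^esub>}" "t \<in> {t. Poly_Mapping.keys t \<subseteq> S \<and> h t = \<zero>\<^bsub>H\<^esub>}" for s t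
      using eq0[of s t] that keys_diff[of s t] by auto
    show "gens \<subseteq> {t. Poly_Mapping.keys t \<subseteq> S \<and> h t = \<zero>\<^bsub>H\<^esub>}"
    proof
      fix t assume t: "t \<in> gens"
      have k: "Poly_Mapping.keys (frag_of p + frag_of q) \<subseteq> S" if "p \<in> S" "q \<in> S" for p q :: "'m \<times> 'y"
        using keys_add[of "frag_of p" "frag_of q"] that by auto
      have "h t = \<zero>\<^bsub>H\<^esub>" using t unfolding gens_def
      proof (elim UnE CollectE exE conjE)
        fix m m' y assume t: "t = frag_of (m \<oplus>\<^bsub>N\<^esub> m', y) - frag_of (m, y) - frag_of (m', y)"
          and m: "m \<in> carrier N" "m' \<in> carrier N" "y \<in> carrier Y"
        show ?thesis unfolding t diff_diff_add
          by (rule eq0) (use m k[of "(m, y)" "(m', y)"] in \<open>simp_all add: ha hf' a1\<close>)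
      next
        fix m y y' assume t: "t = frag_of (m, y \<oplus>\<^bsub>Y\<^esub> y') - frag_of (m, y) - frag_of (m, y')"
          and m: "m \<in> carrier N" "y \<in> carrier Y" "y' \<in> carrier Y"
        show ?thesis unfolding t diff_diff_add
          by (rule eq0) (use m k[of "(m, y)" "(m, y')"] in \<open>simp_all add: ha hf' a2\<close>)
      next
        fix m bb y assume t: "t = frag_of (bb \<odot>\<^bsub>N\<^esub> m, y) - frag_of (m, bb \<odot>\<^bsub>Y\<^esub> y)"
          and m: "m \<in> carrier N" "bb \<in> carrier B" "y \<in> carrier Y"
        show ?thesis unfolding t
          by (rule eq0) (use m N.lsmult_closed[of bb m] in \<open>simp_all add: hf' b\<close>)
      qed
      then show "t \<in> {t. Poly_Mapping.keys t \<subseteq> S \<and> h t = \<zero>\<^bsub>H\<^esub>}" using gens_carrier[OF t] by simp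
    qed
  qed
  then have kill: "h t = \<zero>\<^bsub>H\<^esub>" if "t \<in> rel" for t using that by auto
  define \<tau> where "\<tau> x = h (SOME t. t \<in> x \<and> Poly_Mapping.keys t \<subseteq> S)" for x
  have \<tau>: "\<tau> (cls s) = h s" if s: "Poly_Mapping.keys s \<subseteq> S" for s
  proof -
    have "\<exists>t. t \<in> cls s \<and> Poly_Mapping.keys t \<subseteq> S" using s rel_zero by (intro exI[of _ s]) (simp add: cls_mem)
    from someI_ex[OF this] have t: "(SOME t. t \<in> cls s \<and> Poly_Mapping.keys t \<subseteq> S) - s \<in> rel"
       "Poly_Mapping.keys (SOME t. t \<in> cls s \<and> Poly_Mapping.keys t \<subseteq> S) \<subseteq> S" by (simp_all add: cls_mem)
    show ?thesis using hd[OF t(2) s] kill[OF t(1)] hc[OF s] by (simp add: \<tau>_def)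
  qed
  show thesis
  proof (rule that[of \<tau>])
    show "\<tau> x \<in> carrier H" if "x \<in> carrier X" for x using that unfolding carrier_alt by (auto simp: \<tau> hc)
    show "\<tau> (tt m y) = \<psi> m y" if "m \<in> carrier N" "y \<in> carrier Y" for m y using that by (simp add: \<tau> hf')
    fix x y assume "x \<in> carrier X" "y \<in> carrier X"
    then obtain s t where st: "x = cls s" "y = cls t" "Poly_Mapping.keys s \<subseteq> S" "Poly_Mapping.keys t \<subseteq> S"
      unfolding carrier_alt by blast
    have "Poly_Mapping.keys (s + t) \<subseteq> S" using keys_add[of s t] st(3,4) by blast
    then show "\<tau> (x \<oplus>\<^bsub>X\<^esub> y) = \<tau> x \<oplus>\<^bsub>H\<^esub> \<tau> y" unfolding st(1,2) add_cls using st(3,4) by (simp add: \<tau> ha)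
  qed
qed

lemma tt_lsum:
  assumes "m \<in> carrier N" "\<And>i. i < n \<Longrightarrow> g i \<in> carrier Y"
  shows "lsum X (\<lambda>i. tt m (g i)) n = tt m (lsum Y g n)"
  using assms(2) by (induction n) (simp_all add: assms(1) tt_zero2 tt_add2 Y.M.lsum_closed)

text \<open>\<kappa> i is the map 1 \<otimes> l i from N \<otimes> Y to N; the dual basis identity
  of Y is pushed through the tensor product.\<close>

lemma tensor_dual_basis:
  assumes d: "dbasis B Y n l p"
  obtains \<kappa> where "\<And>i x. i < n \<Longrightarrow> x \<in> carrier X \<Longrightarrow> \<kappa> i x \<in> carrier N"
    "\<And>i x y. i < n \<Longrightarrow> x \<in> carrier X \<Longrightarrow> y \<in> carrier X \<Longrightarrow> \<kappa> i (x \<oplus>\<^bsub>X\<^esub> y) = \<kappa> i x \<oplus>\<^bsub>N\<^esub> \<kappa> i y"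
    "\<And>i m y. i < n \<Longrightarrow> m \<in> carrier N \<Longrightarrow> y \<in> carrier Y \<Longrightarrow> \<kappa> i (tt m y) = l i y \<odot>\<^bsub>N\<^esub> m"
    "\<And>x. x \<in> carrier X \<Longrightarrow> lsum X (\<lambda>i. tt (\<kappa> i x) (p i)) n = x"
proof -
  have l: "lh B Y (reg_module B) (l i)" "p i \<in> carrier Y" if "i < n" for i using d that by (auto simp: dbasis_def)
  have lc: "l i y \<in> carrier B" if "i < n" "y \<in> carrier Y" for i y using lh_closed[OF l(1)[OF that(1)] that(2)] by simp
  \<comment> \<open>The three properties are packaged for the axiom of choice; the bound i < n sits
    inside so that the predicate is satisfiable for every i.\<close>
  define Pr where "Pr i \<kappa> \<longleftrightarrow> i < n \<longrightarrow> (\<forall>x\<in>carrier X. \<kappa> x \<in> carrier N) \<and>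
    (\<forall>x\<in>carrier X. \<forall>y\<in>carrier X. \<kappa> (x \<oplus>\<^bsub>X\<^esub> y) = \<kappa> x \<oplus>\<^bsub>N\<^esub> \<kappa> y) \<and>
    (\<forall>m\<in>carrier N. \<forall>y\<in>carrier Y. \<kappa> (tt m y) = l i y \<odot>\<^bsub>N\<^esub> m)" for i \<kappa>
  have "\<exists>\<kappa>. Pr i \<kappa>" for i
  proof (cases "i < n")
    case True
    obtain \<kappa> where "\<And>x. x \<in> carrier X \<Longrightarrow> \<kappa> x \<in> carrier N"
       "\<And>x y. x \<in> carrier X \<Longrightarrow> y \<in> carrier X \<Longrightarrow> \<kappa> (x \<oplus>\<^bsub>X\<^esub> y) = \<kappa> x \<oplus>\<^bsub>N\<^esub> \<kappa> y"
       "\<And>m y. m \<in> carrier N \<Longrightarrow> y \<in> carrier Y \<Longrightarrow> \<kappa> (tt m y) = l i y \<odot>\<^bsub>N\<^esub> m"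
      by (rule tensor_lift[OF N.M.abelian_group_axioms, of "\<lambda>m y. l i y \<odot>\<^bsub>N\<^esub> m"]; ((rule that; assumption) |
        simp add: N.lsmult_closed N.lsmult_l_distr[simplified] N.lsmult_r_distr N.lsmult_assoc[simplified]
          lc[OF True] lh_add[OF l(1)[OF True]] lh_smult[OF l(1)[OF True]]))
    then show ?thesis unfolding Pr_def by (intro exI[of _ \<kappa>]) simp
  qed (simp add: Pr_def)
  then obtain \<kappa> where "\<forall>i. Pr i (\<kappa> i)" using choice[of Pr] by blast
  then have \<kappa>: "i < n \<Longrightarrow> x \<in> carrier X \<Longrightarrow> \<kappa> i x \<in> carrier N"
    "i < n \<Longrightarrow> x \<in> carrier X \<Longrightarrow> y \<in> carrier X \<Longrightarrow> \<kappa> i (x \<oplus>\<^bsub>X\<^esub> y) = \<kappa> i x \<oplus>\<^bsub>N\<^esub> \<kappa> i y"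
    "i < n \<Longrightarrow> m \<in> carrier N \<Longrightarrow> z \<in> carrier Y \<Longrightarrow> \<kappa> i (tt m z) = l i z \<odot>\<^bsub>N\<^esub> m" for i x y m z
    unfolding Pr_def by simp_all
  have "lsum X (\<lambda>i. tt (\<kappa> i x) (p i)) n = x" if x: "x \<in> carrier X" for x
    using x
  proof (induction x rule: tensor_induct)
    case (tt m y)
    have "lsum X (\<lambda>i. tt (\<kappa> i (tt m y)) (p i)) n = lsum X (\<lambda>i. tt m (l i y \<odot>\<^bsub>Y\<^esub> p i)) n"
      by (rule lsum_cong) (use tt l lc in \<open>simp add: \<kappa>(3) tt_bal\<close>)
    also have "\<dots> = tt m (lsum Y (\<lambda>i. l i y \<odot>\<^bsub>Y\<^esub> p i) n)"
      by (rule tt_lsum) (use tt l lc in \<open>simp_all add: Y.lsmult_closed\<close>)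
    also have "lsum Y (\<lambda>i. l i y \<odot>\<^bsub>Y\<^esub> p i) n = y" using d tt by (simp add: dbasis_def)
    finally show ?case .
  next
    case (add x y)
    have "lsum X (\<lambda>i. tt (\<kappa> i (x \<oplus>\<^bsub>X\<^esub> y)) (p i)) n = lsum X (\<lambda>i. tt (\<kappa> i x) (p i) \<oplus>\<^bsub>X\<^esub> tt (\<kappa> i y) (p i)) n"
      by (rule lsum_cong) (use add.hyps l in \<open>simp add: \<kappa>(1,2) tt_add1\<close>)
    also have "\<dots> = x \<oplus>\<^bsub>X\<^esub> y" using add l by (subst X.lsum_add) (simp_all add: \<kappa>(1))
    finally show ?case .
  qed
  then show thesis using that[of \<kappa>] \<kappa> by blast
qed

text \<open>Operations on tensor classes are defined as unions over all representatives. An additive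
  map that respects the generating relations contributes one and the same class each time.\<close>

lemma union_cls:
  assumes E: "\<And>s t. E (s - t) = E s - (E t :: ('m \<times> 'y \<Rightarrow>\<^sub>0 int))" and r: "\<And>t. t \<in> gens \<Longrightarrow> E t \<in> rel"
  shows "\<And>t. t \<in> rel \<Longrightarrow> E t \<in> rel"
    and "\<And>t. (\<Union>s\<in>cls t. cls (E s)) = cls (E t)"
proof -
  have E0: "E 0 = 0" using E[of 0 0] by simp
  have "rel \<subseteq> {t. E t \<in> rel}"
    by (rule rel_least) (auto simp: E0 E rel_zero rel_diff r)
  then have 1: "E t \<in> rel" if "t \<in> rel" for t using that by auto
  then show "\<And>t. t \<in> rel \<Longrightarrow> E t \<in> rel" .
  fix t
  have "cls (E s) = cls (E t)" if "s \<in> cls t" for s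
    using 1[of "s - t"] that by (simp add: cls_mem cls_eq E)
  moreover have "t \<in> cls t" using rel_zero by (simp add: cls_mem)
  ultimately show "(\<Union>s\<in>cls t. cls (E s)) = cls (E t)" by blast
qed

end

lemma right_module_simps [simp]: "carrier (right_module M) = carrier M" "\<zero>\<^bsub>right_module M\<^esub> = \<zero>\<^bsub>M\<^esub>"
  "x \<oplus>\<^bsub>right_module M\<^esub> y = x \<oplus>\<^bsub>M\<^esub> y" "b \<odot>\<^bsub>right_module M\<^esub> x = rsmult M x b"
  by (simp_all add: right_module_def)

lemma tensor_module_tensor:
  assumes "bimodule A B M" "lmodule B Y" shows "tensor B (right_module M) Y (tensor_module M B Y)"
  using assms by (simp add: tensor_def tensor_module_def bimodule_def)

lemma tensor_module_lmodule:
  fixes M :: "('a, 'b, 'm, 'x) bimodule_scheme" and Y :: "('b, 'y, 'z) module_scheme"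
  assumes M: "bimodule A B M" and Y: "lmodule B Y"
  shows "lmodule A (tensor_module M B Y)"
    and "\<And>a m y. a \<in> carrier A \<Longrightarrow> m \<in> carrier M \<Longrightarrow> y \<in> carrier Y \<Longrightarrow>
      a \<odot>\<^bsub>tensor_module M B Y\<^esub> tensor_class B (right_module M) Y (frag_of (m, y)) = tensor_class B (right_module M) Y (frag_of (a \<odot>\<^bsub>M\<^esub> m, y))"
proof -
  interpret M: bimodule A B M by (rule M)
  interpret T: tensor B "right_module M" Y "tensor_module M B Y" by (rule tensor_module_tensor[OF M Y])
  let ?T = "tensor_module M B Y"
  define E :: "'a \<Rightarrow> ('m \<times> 'y \<Rightarrow>\<^sub>0 int) \<Rightarrow> ('m \<times> 'y \<Rightarrow>\<^sub>0 int)"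
    where "E a = frag_extend (\<lambda>(m, y). frag_of (a \<odot>\<^bsub>M\<^esub> m, y))" for a
  have Ed: "E a (s - t) = E a s - E a t" for a and s t :: "'m \<times> 'y \<Rightarrow>\<^sub>0 int" by (simp add: E_def frag_extend_diff)
  have Ea: "E a (s + t) = E a s + E a t" for a and s t :: "'m \<times> 'y \<Rightarrow>\<^sub>0 int" by (simp add: E_def frag_extend_add)
  have Ef: "E a (frag_of (m, y)) = frag_of (a \<odot>\<^bsub>M\<^esub> m, y)" for a m and y :: 'y by (simp add: E_def)
  \<comment> \<open>Multiplying the first factor by a sends each generating relation to one of the
    same kind; for the balancing relations this is the bimodule law.\<close>
  have Eg: "E a t \<in> T.rel" if a: "a \<in> carrier A" and t: "t \<in> T.gens" for a t
  proof (rule T.rel_gens)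
    show "E a t \<in> T.gens" using t
      apply (subst (asm) T.gens_def) apply (elim UnE CollectE exE conjE)
      subgoal for m m' y
        unfolding T.gens_def apply (rule UnI1, rule UnI1, rule CollectI)
        apply (rule exI[of _ "a \<odot>\<^bsub>M\<^esub> m"], rule exI[of _ "a \<odot>\<^bsub>M\<^esub> m'"], rule exI[of _ y])
        using a by (simp add: Ed Ef M.L.lsmult_r_distr M.L.lsmult_closed)
      subgoal for m y y'
        unfolding T.gens_def apply (rule UnI1, rule UnI2, rule CollectI)
        apply (rule exI[of _ "a \<odot>\<^bsub>M\<^esub> m"], rule exI[of _ y], rule exI[of _ y'])
        using a by (simp add: Ed Ef M.L.lsmult_closed)
      subgoal for m b y
        unfolding T.gens_def apply (rule UnI2, rule CollectI)
        apply (rule exI[of _ "a \<odot>\<^bsub>M\<^esub> m"], rule exI[of _ b], rule exI[of _ y])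
        using a by (simp add: Ed Ef M.bimod_assoc M.L.lsmult_closed)
      done
  qed
  have sm: "a \<odot>\<^bsub>?T\<^esub> T.cls t = T.cls (E a t)" if "a \<in> carrier A" for a t
  proof -
    have "a \<odot>\<^bsub>?T\<^esub> T.cls t = (\<Union>s\<in>T.cls t. T.cls (E a s))" by (simp add: tensor_module_def E_def)
    then show ?thesis using T.union_cls(2)[of "E a", OF Ed Eg[OF that]] by simp
  qed
  show tt: "a \<odot>\<^bsub>?T\<^esub> T.tt m y = T.tt (a \<odot>\<^bsub>M\<^esub> m) y" if "a \<in> carrier A" for a m y using sm[OF that] by (simp add: Ef)
  have sa: "a \<odot>\<^bsub>?T\<^esub> (x \<oplus>\<^bsub>?T\<^esub> y) = a \<odot>\<^bsub>?T\<^esub> x \<oplus>\<^bsub>?T\<^esub> a \<odot>\<^bsub>?T\<^esub> y"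
    if "a \<in> carrier A" "x \<in> carrier ?T" "y \<in> carrier ?T" for a x y
    using that(2,3) unfolding T.carrier_alt by (auto simp: T.add_cls sm[OF that(1)] Ea)
  have sc: "a \<odot>\<^bsub>?T\<^esub> x \<in> carrier ?T" if "a \<in> carrier A" "x \<in> carrier ?T" for a x
    using that(2) by (induction x rule: T.tensor_induct) (use that(1) in \<open>simp_all add: tt sa M.L.lsmult_closed\<close>)
  show "lmodule A ?T"
  proof (rule lmodule_groupI)
    show "\<exists>y\<in>carrier ?T. y \<oplus>\<^bsub>?T\<^esub> x = \<zero>\<^bsub>?T\<^esub>" if "x \<in> carrier ?T" for x
      using that by (intro bexI[of _ "\<ominus>\<^bsub>?T\<^esub> x"]) (auto simp: T.X.l_neg)
    show "(a \<oplus>\<^bsub>A\<^esub> a') \<odot>\<^bsub>?T\<^esub> x = a \<odot>\<^bsub>?T\<^esub> x \<oplus>\<^bsub>?T\<^esub> a' \<odot>\<^bsub>?T\<^esub> x"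
      if a: "a \<in> carrier A" "a' \<in> carrier A" and x: "x \<in> carrier ?T" for a a' x
      using x
    proof (induction x rule: T.tensor_induct)
      case (tt m y)
      then show ?case using a by (simp add: \<open>\<And>a m y. a \<in> carrier A \<Longrightarrow> a \<odot>\<^bsub>?T\<^esub> T.tt m y = T.tt (a \<odot>\<^bsub>M\<^esub> m) y\<close>
         M.L.lsmult_l_distr M.L.lsmult_closed T.tt_add1[simplified])
    next
      case (add x y)
      then show ?case using a by (simp add: sa sc T.X.a_ac)
    qed
    show "(a \<otimes>\<^bsub>A\<^esub> a') \<odot>\<^bsub>?T\<^esub> x = a \<odot>\<^bsub>?T\<^esub> (a' \<odot>\<^bsub>?T\<^esub> x)"
      if a: "a \<in> carrier A" "a' \<in> carrier A" and x: "x \<in> carrier ?T" for a a' x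
      using x
    proof (induction x rule: T.tensor_induct)
      case (tt m y)
      then show ?case using a by (simp add: \<open>\<And>a m y. a \<in> carrier A \<Longrightarrow> a \<odot>\<^bsub>?T\<^esub> T.tt m y = T.tt (a \<odot>\<^bsub>M\<^esub> m) y\<close>
         M.L.lsmult_assoc M.L.lsmult_closed)
    next
      case (add x y)
      then show ?case using a by (simp add: sa sc)
    qed
    show "\<one>\<^bsub>A\<^esub> \<odot>\<^bsub>?T\<^esub> x = x" if x: "x \<in> carrier ?T" for x
      using x
    proof (induction x rule: T.tensor_induct)
      case (tt m y)
      then show ?case by (simp add: \<open>\<And>a m y. a \<in> carrier A \<Longrightarrow> a \<odot>\<^bsub>?T\<^esub> T.tt m y = T.tt (a \<odot>\<^bsub>M\<^esub> m) y\<close>)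
    next
      case (add x y)
      then show ?case by (simp add: sa)
    qed
    show "x \<oplus>\<^bsub>?T\<^esub> y = y \<oplus>\<^bsub>?T\<^esub> x" if "x \<in> carrier ?T" "y \<in> carrier ?T" for x y
      using that by (rule T.X.a_comm)
  qed (simp_all add: M.L.R.ring_axioms sa sc T.X.a_assoc)
qed

section \<open>Retracts and direct sums\<close>

lemma vz_retract:
  assumes v: "vz R X" and Y: "lmodule R Y" and a: "lh R X Y a" and b: "lh R Y X b" and ab: "\<And>y. y \<in> carrier Y \<Longrightarrow> a (b y) = y"
  shows "vz R Y"
  unfolding vz_def xt_def
proof (intro conjI allI impI Y)
  fix Z P :: "('a, nat \<Rightarrow> 'a) module" and p g assume Z: "Z \<in> perp R" and P: "pres R Z P p"
    and g: "lh R (P\<lparr>carrier := a_kernel P Z p\<rparr>) Y g"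
  obtain h where h: "lh R P X h" "\<forall>x\<in>a_kernel P Z p. h x = b (g x)"
    using v Z P lh_comp[OF g b] unfolding vz_def xt_def by blast
  show "\<exists>h. lh R P Y h \<and> (\<forall>x\<in>a_kernel P Z p. h x = g x)"
  proof (intro exI[of _ "\<lambda>x. a (h x)"] conjI lh_comp[OF h(1) a] ballI)
    fix x assume x: "x \<in> a_kernel P Z p"
    then show "a (h x) = g x" using h(2) ab[of "g x"] lh_closed[OF g, of x] by simp
  qed
qed

lemma fst_lsum_direct_sum: "(\<And>x y x' y'. (x, y) \<oplus>\<^bsub>D\<^esub> (x', y') = (x \<oplus>\<^bsub>X\<^esub> x', y \<oplus>\<^bsub>Y\<^esub> y')) \<Longrightarrow> \<zero>\<^bsub>D\<^esub> = (\<zero>\<^bsub>X\<^esub>, \<zero>\<^bsub>Y\<^esub>) \<Longrightarrow>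
  lsum D (\<lambda>i. (g i, h i)) n = (lsum X g n, lsum Y h n)"
  by (induction n) auto

lemma fgproj_direct_sum:
  assumes P: "fgproj R P" and Q: "fgproj R Q" shows "fgproj R (direct_sum P Q)"
proof -
  obtain n l p where d: "dbasis R P n l p" using P by (auto simp: fgproj_def)
  obtain m k q where d': "dbasis R Q m k q" using Q by (auto simp: fgproj_def)
  note PM = fgproj_lmodule[OF P] and QM = fgproj_lmodule[OF Q]
  interpret P: lmodule R P by (rule PM)
  interpret Q: lmodule R Q by (rule QM)
  let ?D = "direct_sum P Q"
  note DM = direct_sum_lmodule[OF PM QM]
  have f: "lh R ?D P fst" and s: "lh R ?D Q snd" by (rule lhI; auto)+
  let ?l = "\<lambda>i. if i < n then (\<lambda>x. l i (fst x)) else (\<lambda>x. k (i - n) (snd x))"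
  let ?p = "\<lambda>i. if i < n then (p i, \<zero>\<^bsub>Q\<^esub>) else (\<zero>\<^bsub>P\<^esub>, q (i - n))"
  have l: "lh R P (reg_module R) (l i)" "p i \<in> carrier P" if "i < n" for i using d that by (auto simp: dbasis_def)
  have k: "lh R Q (reg_module R) (k i)" "q i \<in> carrier Q" if "i < m" for i using d' that by (auto simp: dbasis_def)
  have L: "lh R ?D (reg_module R) (?l i)" if "i < n + m" for i
    using that lh_comp[OF f l(1)[of i]] lh_comp[OF s k(1)[of "i - n"]] by auto
  have Pc: "?p i \<in> carrier ?D" if "i < n + m" for i using that l(2)[of i] k(2)[of "i - n"] by auto
  have lc: "l i x \<in> carrier R" if "i < n" "x \<in> carrier P" for i x using lh_closed[OF l(1)[OF that(1)] that(2)] by simp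
  have kc: "k i x \<in> carrier R" if "i < m" "x \<in> carrier Q" for i x using lh_closed[OF k(1)[OF that(1)] that(2)] by simp
  have "x = lsum ?D (\<lambda>i. ?l i x \<odot>\<^bsub>?D\<^esub> ?p i) (n + m)" if x: "x \<in> carrier ?D" for x
  proof -
    obtain y z where yz: "x = (y, z)" "y \<in> carrier P" "z \<in> carrier Q" using x by auto
    have "lsum ?D (\<lambda>i. ?l i x \<odot>\<^bsub>?D\<^esub> ?p i) (n + m)
      = lsum ?D (\<lambda>i. ?l i x \<odot>\<^bsub>?D\<^esub> ?p i) n \<oplus>\<^bsub>?D\<^esub> lsum ?D (\<lambda>j. ?l (n + j) x \<odot>\<^bsub>?D\<^esub> ?p (n + j)) m"
      by (rule lsum_append[OF lmodule_group[OF DM]], rule lmodule.lsmult_closed[OF DM])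
        (use lh_closed[OF L x] Pc in \<open>simp_all only: reg_simps\<close>)
    also have "lsum ?D (\<lambda>i. ?l i x \<odot>\<^bsub>?D\<^esub> ?p i) n = lsum ?D (\<lambda>i. (l i y \<odot>\<^bsub>P\<^esub> p i, \<zero>\<^bsub>Q\<^esub>)) n"
      by (rule lsum_cong) (use yz lc in simp)
    also have "\<dots> = (y, \<zero>\<^bsub>Q\<^esub>)"
      using d yz by (subst fst_lsum_direct_sum[of ?D P Q]) (simp_all add: dbasis_def Q.M.lsum_zero)
    also have "lsum ?D (\<lambda>j. ?l (n + j) x \<odot>\<^bsub>?D\<^esub> ?p (n + j)) m = lsum ?D (\<lambda>j. (\<zero>\<^bsub>P\<^esub>, k j z \<odot>\<^bsub>Q\<^esub> q j)) m"
      by (rule lsum_cong) (use yz kc in simp)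
    also have "\<dots> = (\<zero>\<^bsub>P\<^esub>, z)"
      using d' yz by (subst fst_lsum_direct_sum[of ?D P Q]) (simp_all add: dbasis_def P.M.lsum_zero)
    finally show ?thesis using yz by simp
  qed
  then have "dbasis R ?D (n + m) ?l ?p" using L Pc unfolding dbasis_def by blast
  then show ?thesis using DM unfolding fgproj_def by blast
qed

text \<open>The direct sum and X differ by a projective summand only: the P-component factors
  through the chosen cover of the sum, so \<open>ev_srt\<close> applies.\<close>

lemma perp_direct_sum:
  assumes N: "noeth R" and P: "fgproj R P" and X: "X \<in> perp R"
  shows "direct_sum P X \<in> perp R"
proof -
  note PM = fgproj_lmodule[OF P] and XM = perp_lmodule[OF X]
  note DM = direct_sum_lmodule[OF PM XM]
  interpret P: lmodule R P by (rule PM)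
  interpret X: lmodule R X by (rule XM)
  obtain m q where q: "pres R X (free_module R m) q" by (rule fg_pres[OF XM perp_fg[OF X]])
  let ?F = "free_module R m"
  have F: "lmodule R ?F" by (rule free_lmodule[OF noeth_ring[OF N]])
  have q': "lh R ?F X q" "q ` carrier ?F = carrier X" using q by (auto simp: pres_def)
  let ?Q = "\<lambda>(x, y). (x, q y)"
  have pD: "pres R (direct_sum P X) (direct_sum P ?F) ?Q" unfolding pres_def
  proof (intro conjI fgproj_direct_sum P free_fgproj noeth_ring[OF N])
    show "lh R (direct_sum P ?F) (direct_sum P X) ?Q"
      by (rule lhI) (auto simp: lh_closed[OF q'(1)] lh_add[OF q'(1)] lh_smult[OF q'(1)] simp del: free_simps)
    show "?Q ` carrier (direct_sum P ?F) = carrier (direct_sum P X)"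
      unfolding direct_sum_simps q'(2)[symmetric] by force
  qed
  have "srt R (direct_sum P X) X (direct_sum P ?F) ?Q"
    unfolding srt_def
  proof (intro exI conjI ballI)
    show "lh R (direct_sum P X) X snd" by (rule lhI) auto
    show "lh R X (direct_sum P X) (\<lambda>x. (\<zero>\<^bsub>P\<^esub>, x))" by (rule lhI) auto
    interpret F: lmodule R ?F by (rule F)
    show "lh R (direct_sum P X) (direct_sum P ?F) (\<lambda>x. (fst x, \<zero>\<^bsub>?F\<^esub>))"
      by (rule lhI) (auto simp del: free_simps)
    show "x = (\<zero>\<^bsub>P\<^esub>, snd x) \<oplus>\<^bsub>direct_sum P X\<^esub> ?Q (fst x, \<zero>\<^bsub>?F\<^esub>)" if "x \<in> carrier (direct_sum P X)" for x
      using that lh_zero[OF F XM q'(1)] by (auto simp del: free_simps)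
  qed
  then show ?thesis using ev_srt[OF N _ DM pD] X unfolding perp_iff_ev[OF N] by blast
qed

section \<open>Triangular matrix rings\<close>

lemma triangular_ring_simps [simp]:
  "carrier (triangular_ring A M B) = carrier A \<times> carrier M \<times> carrier B"
  "(a, m, b) \<otimes>\<^bsub>triangular_ring A M B\<^esub> (a', m', b') = (a \<otimes>\<^bsub>A\<^esub> a', a \<odot>\<^bsub>M\<^esub> m' \<oplus>\<^bsub>M\<^esub> rsmult M m b', b \<otimes>\<^bsub>B\<^esub> b')"
  "\<one>\<^bsub>triangular_ring A M B\<^esub> = (\<one>\<^bsub>A\<^esub>, \<zero>\<^bsub>M\<^esub>, \<one>\<^bsub>B\<^esub>)" "\<zero>\<^bsub>triangular_ring A M B\<^esub> = (\<zero>\<^bsub>A\<^esub>, \<zero>\<^bsub>M\<^esub>, \<zero>\<^bsub>B\<^esub>)"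
  "(a, m, b) \<oplus>\<^bsub>triangular_ring A M B\<^esub> (a', m', b') = (a \<oplus>\<^bsub>A\<^esub> a', m \<oplus>\<^bsub>M\<^esub> m', b \<oplus>\<^bsub>B\<^esub> b')"
  by (simp_all add: triangular_ring_def)

lemma triple_module_simps [simp]: "carrier (triple_module M B X Y \<phi>) = carrier X \<times> carrier Y"
  "\<zero>\<^bsub>triple_module M B X Y \<phi>\<^esub> = (\<zero>\<^bsub>X\<^esub>, \<zero>\<^bsub>Y\<^esub>)"
  "(x, y) \<oplus>\<^bsub>triple_module M B X Y \<phi>\<^esub> (x', y') = (x \<oplus>\<^bsub>X\<^esub> x', y \<oplus>\<^bsub>Y\<^esub> y')"
  "(a, m, b) \<odot>\<^bsub>triple_module M B X Y \<phi>\<^esub> (x, y) =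
     (a \<odot>\<^bsub>X\<^esub> x \<oplus>\<^bsub>X\<^esub> \<phi> (tensor_class B (right_module M) Y (frag_of (m, y))), b \<odot>\<^bsub>Y\<^esub> y)"
  by (simp_all add: triple_module_def)

lemma zero_module_simps [simp]: "carrier zero_module = {()}"
  by (simp add: zero_module_def)

locale tri_ring =
  fixes A :: "('a, 'e1) ring_scheme" and B :: "('b, 'e2) ring_scheme" and M :: "('a, 'b, 'm, 'x) bimodule_scheme"
  assumes artA: "artin_algebra A" and artB: "artin_algebra B" and bim: "bimodule A B M"
    and artL: "artin_algebra (triangular_ring A M B)"
begin

abbreviation "\<Lambda> \<equiv> triangular_ring A M B"

sublocale Bi: bimodule A B M by (rule bim)

lemma rs [simp]: "m \<in> carrier M \<Longrightarrow> b \<in> carrier B \<Longrightarrow> rsmult M m b \<in> carrier M"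
  "m \<in> carrier M \<Longrightarrow> rsmult M m \<one>\<^bsub>B\<^esub> = m" "b \<in> carrier B \<Longrightarrow> rsmult M \<zero>\<^bsub>M\<^esub> b = \<zero>\<^bsub>M\<^esub>" "m \<in> carrier M \<Longrightarrow> rsmult M m \<zero>\<^bsub>B\<^esub> = \<zero>\<^bsub>M\<^esub>"
  using Bi.Rt.lsmult_closed[of b m] Bi.Rt.lsmult_one[of m] Bi.Rt.ls_zero[of b] Bi.Rt.ls_lzero[of m] by simp_all

sublocale triangular \<Lambda> A B "\<lambda>a. (a, \<zero>\<^bsub>M\<^esub>, \<zero>\<^bsub>B\<^esub>)" fst "\<lambda>b. (\<zero>\<^bsub>A\<^esub>, \<zero>\<^bsub>M\<^esub>, b)" "\<lambda>x. snd (snd x)"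
proof -
  interpret A: ring A by (rule noeth_ring[OF artin_noeth(1)[OF artA]])
  interpret B: ring B by (rule noeth_ring[OF artin_noeth(1)[OF artB]])
  show "triangular \<Lambda> A B (\<lambda>a. (a, \<zero>\<^bsub>M\<^esub>, \<zero>\<^bsub>B\<^esub>)) fst (\<lambda>b. (\<zero>\<^bsub>A\<^esub>, \<zero>\<^bsub>M\<^esub>, b)) (\<lambda>x. snd (snd x))"
    apply (unfold_locales)
    using artin_noeth(1)[OF artA] artin_noeth(1)[OF artB] artin_noeth(1)[OF artL]
    apply (simp_all add: ring_hom_def Pi_iff split: prod.splits)
    by auto
qed

lemma bimS_iff: "x \<in> bimS \<longleftrightarrow> (\<exists>m\<in>carrier M. x = (\<zero>\<^bsub>A\<^esub>, m, \<zero>\<^bsub>B\<^esub>))"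
  unfolding bimS_def by (cases x) auto

text \<open>The bimodule eLf of the abstract setting is M itself, over A as well as, inflated, over
  \<Lambda>.\<close>

lemma bim_iso: "lh A M (res (\<lambda>a. (a, \<zero>\<^bsub>M\<^esub>, \<zero>\<^bsub>B\<^esub>)) bim) (\<lambda>m. (\<zero>\<^bsub>A\<^esub>, m, \<zero>\<^bsub>B\<^esub>))"
  "lh A (res (\<lambda>a. (a, \<zero>\<^bsub>M\<^esub>, \<zero>\<^bsub>B\<^esub>)) bim) M (\<lambda>x. fst (snd x))"
  "lh \<Lambda> (res fst M) bim (\<lambda>m. (\<zero>\<^bsub>A\<^esub>, m, \<zero>\<^bsub>B\<^esub>))" "lh \<Lambda> bim (res fst M) (\<lambda>x. fst (snd x))"
  by (rule lhI; auto simp: bimS_iff Bi.L.lsmult_closed)+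

end

context tri_ring begin

abbreviation "inA a \<equiv> (a, \<zero>\<^bsub>M\<^esub>, \<zero>\<^bsub>B\<^esub>)"
abbreviation "inB b \<equiv> (\<zero>\<^bsub>A\<^esub>, \<zero>\<^bsub>M\<^esub>, b)"
abbreviation "inM m \<equiv> (\<zero>\<^bsub>A\<^esub>, m, \<zero>\<^bsub>B\<^esub>)"

lemma bimA_lmodule: "lmodule A (res inA bim)"
  by (rule killed_lmodule[OF bim_killed])

lemma vz_bim:
  assumes pd: "proj_dim A M < \<infinity>"
  shows "vz \<Lambda> bim" "vz A (res inA bim)"
proof -
  have M: "lmodule A M" by (rule Bi.L.lmodule_axioms)
  have "vz \<Lambda> (res fst M)" by (rule vz_res_proj_dim[OF NL \<rho> \<alpha>_lh \<rho>\<alpha> M pd])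
  then show "vz \<Lambda> bim" by (rule vz_retract[OF _ bim_lmodule bim_iso(3,4)]) (auto simp: bimS_iff)
  \<comment> \<open>The same descent with L = A, where \<rho> and \<alpha> are the identity.\<close>
  have "vz A (res (\<lambda>a. a) M)"
    by (rule vz_res_proj_dim[OF NA _ _ _ M pd, of _ "\<lambda>a. a"]) (auto simp: ring_hom_def intro!: lhI)
  then show "vz A (res inA bim)"
    by (rule vz_retract[OF _ bimA_lmodule, where a = "\<lambda>m. inM m" and b = "\<lambda>x. fst (snd x)"])
      (use bim_iso(1,2) in \<open>auto simp: bimS_iff lh_def\<close>)
qed

lemma tl_bim: assumes "torsionless A M" shows "tl A (res inA bim)"
proof -
  have "tl A M" using assms torsionless_iff[OF Bi.L.lmodule_axioms] by simp
  then show ?thesis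
    by (rule tl_embed[OF Bi.L.lmodule_axioms bimA_lmodule _ bim_iso(2)]) (auto simp: inj_on_def bimS_iff)
qed

section \<open>Modules over the matrix ring as triples\<close>

abbreviation "TP P \<equiv> triple_module M B (tensor_module M B P) P (\<lambda>t. t)"
abbreviation "TG G \<equiv> triple_module M B G (zero_module :: ('b, unit) module) (\<lambda>_. \<zero>\<^bsub>G\<^esub>)"

lemma TP_lmodule: assumes P: "lmodule B P" shows "lmodule \<Lambda> (TP P)"
proof -
  interpret P: lmodule B P by fact
  interpret T: tensor B "right_module M" P "tensor_module M B P" by (rule tensor_module_tensor[OF bim P])
  note TM = tensor_module_lmodule[OF bim P]
  interpret TM: lmodule A "tensor_module M B P" by (rule TM(1))
  note tt = T.tt_closed[simplified] T.tt_add1[simplified] T.tt_add2[simplified] TM(2) T.tt_zero1[simplified]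
    T.tt_bal[simplified]
  show ?thesis
  proof (rule lmodule_groupI)
    show "ring \<Lambda>" by (rule L.ring_axioms)
    fix x assume x: "x \<in> carrier (TP P)"
    show "\<exists>y\<in>carrier (TP P). y \<oplus>\<^bsub>TP P\<^esub> x = \<zero>\<^bsub>TP P\<^esub>"
      using x by (intro bexI[of _ "(\<ominus>\<^bsub>tensor_module M B P\<^esub> fst x, \<ominus>\<^bsub>P\<^esub> snd x)"]) (auto simp: T.X.l_neg P.M.l_neg)
    show "\<one>\<^bsub>\<Lambda>\<^esub> \<odot>\<^bsub>TP P\<^esub> x = x" using x by (auto simp: tt)
    fix r assume r: "r \<in> carrier \<Lambda>"
    show "r \<odot>\<^bsub>TP P\<^esub> x \<in> carrier (TP P)" using x r by (auto simp: tt)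
    fix s assume s: "s \<in> carrier \<Lambda>"
    show "(r \<oplus>\<^bsub>\<Lambda>\<^esub> s) \<odot>\<^bsub>TP P\<^esub> x = r \<odot>\<^bsub>TP P\<^esub> x \<oplus>\<^bsub>TP P\<^esub> s \<odot>\<^bsub>TP P\<^esub> x"
      using x r s by (auto simp: tt TM.lsmult_l_distr P.lsmult_l_distr T.X.a_ac)
    show "(r \<otimes>\<^bsub>\<Lambda>\<^esub> s) \<odot>\<^bsub>TP P\<^esub> x = r \<odot>\<^bsub>TP P\<^esub> (s \<odot>\<^bsub>TP P\<^esub> x)"
      using x r s by (auto simp: tt TM.lsmult_assoc P.lsmult_assoc TM.lsmult_r_distr T.X.a_ac Bi.L.lsmult_closed)
  next
    fix r x y assume "r \<in> carrier \<Lambda>" "x \<in> carrier (TP P)" "y \<in> carrier (TP P)"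
    then show "r \<odot>\<^bsub>TP P\<^esub> (x \<oplus>\<^bsub>TP P\<^esub> y) = r \<odot>\<^bsub>TP P\<^esub> x \<oplus>\<^bsub>TP P\<^esub> r \<odot>\<^bsub>TP P\<^esub> y"
      by (auto simp: tt TM.lsmult_r_distr P.lsmult_r_distr T.X.a_ac)
  next
    fix x y assume "x \<in> carrier (TP P)" "y \<in> carrier (TP P)"
    then show "x \<oplus>\<^bsub>TP P\<^esub> y = y \<oplus>\<^bsub>TP P\<^esub> x" by (cases x; cases y) (simp add: T.X.a_comm P.M.a_comm)
  qed (auto simp: T.X.a_assoc P.M.a_assoc)
qed

lemma TG_lmodule: assumes G: "lmodule A G" shows "lmodule \<Lambda> (TG G)"
  and "lh \<Lambda> (TG G) (res fst G) fst" "lh \<Lambda> (res fst G) (TG G) (\<lambda>x. (x, ()))"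
proof -
  interpret G: lmodule A G by fact
  show i: "lh \<Lambda> (res fst G) (TG G) (\<lambda>x. (x, ()))" by (rule lhI) auto
  have "carrier (TG G) = (\<lambda>x. (x, ())) ` carrier (res fst G)" by auto
  then show "lmodule \<Lambda> (TG G)"
    by (rule lmodule_image(1)[OF inflate_lmodule[OF G]]) auto
  show "lh \<Lambda> (TG G) (res fst G) fst" by (rule lhI) auto
qed

text \<open>This triple is the tensor product of \<Lambda>f with P over B, so a dual basis (l i, p
  i) of P induces one: the i-th coefficient of a pair (t, y) is the element of \<Lambda>f with
  M-component \<kappa> i t and B-component l i y.\<close>

lemma TP_fgproj: assumes P: "fgproj B P" shows "fgproj \<Lambda> (TP P)"
proof -
  note PM = fgproj_lmodule[OF P]
  interpret P: lmodule B P by (rule PM)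
  interpret T: tensor B "right_module M" P "tensor_module M B P" by (rule tensor_module_tensor[OF bim PM])
  note TM = tensor_module_lmodule[OF bim PM]
  interpret TM: lmodule A "tensor_module M B P" by (rule TM(1))
  let ?T = "tensor_module M B P"
  obtain n l p where d: "dbasis B P n l p" using P by (auto simp: fgproj_def)
  have l: "lh B P (reg_module B) (l i)" "p i \<in> carrier P" if "i < n" for i using d that by (auto simp: dbasis_def)
  have lc: "l i y \<in> carrier B" if "i < n" "y \<in> carrier P" for i y using lh_closed[OF l(1)[OF that(1)] that(2)] by simp
  obtain \<kappa> where \<kappa>: "\<And>i x. i < n \<Longrightarrow> x \<in> carrier ?T \<Longrightarrow> \<kappa> i x \<in> carrier M"
     "\<And>i x y. i < n \<Longrightarrow> x \<in> carrier ?T \<Longrightarrow> y \<in> carrier ?T \<Longrightarrow> \<kappa> i (x \<oplus>\<^bsub>?T\<^esub> y) = \<kappa> i x \<oplus>\<^bsub>M\<^esub> \<kappa> i y"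
     "\<And>i m y. i < n \<Longrightarrow> m \<in> carrier M \<Longrightarrow> y \<in> carrier P \<Longrightarrow> \<kappa> i (T.tt m y) = rsmult M m (l i y)"
     and dec: "\<And>x. x \<in> carrier ?T \<Longrightarrow> lsum ?T (\<lambda>i. T.tt (\<kappa> i x) (p i)) n = x"
    by (rule T.tensor_dual_basis[OF d, simplified]) (rule that, assumption+)
  have \<kappa>s: "\<kappa> i (a \<odot>\<^bsub>?T\<^esub> x) = a \<odot>\<^bsub>M\<^esub> \<kappa> i x" if i: "i < n" and a: "a \<in> carrier A" and x: "x \<in> carrier ?T" for i a x
    using x
  proof (induction x rule: T.tensor_induct)
    case (tt m y) then show ?case using i a by (simp add: TM(2) \<kappa>(3) Bi.bimod_assoc lc)
  next
    case (add x y) then show ?case using i a by (simp add: TM.lsmult_r_distr \<kappa>(1,2) Bi.L.lsmult_r_distr)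
  qed
  have "dbasis \<Lambda> (TP P) n (\<lambda>i x. (\<zero>\<^bsub>A\<^esub>, \<kappa> i (fst x), l i (snd x))) (\<lambda>i. (\<zero>\<^bsub>?T\<^esub>, p i))"
    unfolding dbasis_def
  proof (intro conjI allI impI ballI)
    fix i assume i: "i < n"
    show "(\<zero>\<^bsub>?T\<^esub>, p i) \<in> carrier (TP P)" using l(2)[OF i] by simp
    show "lh \<Lambda> (TP P) (reg_module \<Lambda>) (\<lambda>x. (\<zero>\<^bsub>A\<^esub>, \<kappa> i (fst x), l i (snd x)))"
      by (rule lhI) (auto simp: \<kappa>[OF i] \<kappa>s[OF i] lc[OF i] lh_add[OF l(1)[OF i]] lh_smult[OF l(1)[OF i]] TM.lsmult_closed)
  next
    fix x assume x: "x \<in> carrier (TP P)"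
    have "lsum (TP P) (\<lambda>i. (\<zero>\<^bsub>A\<^esub>, \<kappa> i (fst x), l i (snd x)) \<odot>\<^bsub>TP P\<^esub> (\<zero>\<^bsub>?T\<^esub>, p i)) n
      = lsum (TP P) (\<lambda>i. (T.tt (\<kappa> i (fst x)) (p i), l i (snd x) \<odot>\<^bsub>P\<^esub> p i)) n"
      by (rule lsum_cong) (use x l in \<open>auto simp: \<kappa>(1)\<close>)
    also have "\<dots> = (lsum ?T (\<lambda>i. T.tt (\<kappa> i (fst x)) (p i)) n, lsum P (\<lambda>i. l i (snd x) \<odot>\<^bsub>P\<^esub> p i) n)"
      by (rule fst_lsum_direct_sum) simp_all
    also have "\<dots> = x" using x d dec[of "fst x"] by (cases x) (simp add: dbasis_def)
    finally show "x = lsum (TP P) (\<lambda>i. (\<zero>\<^bsub>A\<^esub>, \<kappa> i (fst x), l i (snd x)) \<odot>\<^bsub>TP P\<^esub> (\<zero>\<^bsub>?T\<^esub>, p i)) n" by simp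
  qed
  then show ?thesis using TP_lmodule[OF PM] unfolding fgproj_def by blast
qed

lemma TP_TG_perp:
  assumes vA: "vz A (res inA bim)" and P: "fgproj B P" and G: "G \<in> perp A"
  shows "direct_sum (TP P) (TG G) \<in> perp \<Lambda>"
proof (rule perp_direct_sum[OF NL TP_fgproj[OF P]])
  note GM = perp_lmodule[OF G]
  show "TG G \<in> perp \<Lambda>"
    by (rule perp_retract[OF NL inflate_perp[OF vA G] TG_lmodule(1,2,3)[OF GM]]) auto
qed

text \<open>The image of \<pi> is the tensor product of \<Lambda>f with fZ, that is, the triple of a
  copy P of fZ. Its complement \<open>rest\<close> is an A-module, and G is a copy of it. The
  isomorphism and its inverse are written down explicitly.\<close>

lemma perp_decomposition:
  fixes Z :: "('a \<times> 'm \<times> 'b, nat \<Rightarrow> 'a \<times> 'm \<times> 'b) module"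
  assumes vL: "vz \<Lambda> bim" and PB: "PA B" and Z: "Z \<in> perp \<Lambda>"
  shows "\<exists>P \<in> (add_modules B :: 'b fgmod set). \<exists>G \<in> (perp A :: 'a fgmod set).
    lisomorphic \<Lambda> (direct_sum (TP P) (TG G)) Z"
proof -
  note ZM = perp_lmodule[OF Z]
  interpret Z: lmodule \<Lambda> Z by (rule ZM)
  obtain n \<mu> p where pp: "proj_part Z n \<mu> p" by (rule proj_part_exists[OF vL PB Z])
  define \<pi> where "\<pi> = proj_map Z n \<mu> p"
  let ?R = "rest Z n \<mu> p"
  note pp_D = pp_D[OF ZM pp, folded \<pi>_def] and \<pi>l = \<pi>_lh[OF ZM pp, folded \<pi>_def] and idem = \<pi>_idem[OF ZM pp, folded \<pi>_def]
    and decomp = rest_decomp[OF ZM pp, folded \<pi>_def] and rproj = rest_proj[OF ZM pp, folded \<pi>_def]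
    and rid = rest_id[OF ZM pp, folded \<pi>_def] and killed = rest_killed[OF ZM pp]
  note rs = rest_simps[OF ZM pp, folded \<pi>_def]
  have pB: "corner_B Z \<in> perp B" unfolding perp_iff_ev[OF NB] using corner_B_ev[OF vL Z] by blast
  note BM = corner_B_lmodule[OF ZM]
  obtain P :: "'b fgmod" and a b where PM: "lmodule B P" and a: "lh B (corner_B Z) P a" and b: "lh B P (corner_B Z) b"
    and ba: "\<And>x. x \<in> carrier (corner_B Z) \<Longrightarrow> b (a x) = x" and ab: "\<And>x. x \<in> carrier P \<Longrightarrow> a (b x) = x"
    by (rule transport_fgmod[OF BM perp_fg[OF pB]]) (rule that, assumption+)
  have "fgproj B P" by (rule fgproj_retract[OF PA_D[OF NB PB pB] PM b a]) (rule ab)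
  then have P: "P \<in> add_modules B" by (simp add: add_modules_iff)
  have pA: "res inA ?R \<in> perp A" by (rule killed_perp[OF killed rest_perp[OF ZM pp Z]])
  obtain G :: "'a fgmod" and c d where GM: "lmodule A G" and c: "lh A (res inA ?R) G c" and d: "lh A G (res inA ?R) d"
    and dc: "\<And>x. x \<in> carrier (res inA ?R) \<Longrightarrow> d (c x) = x" and cd: "\<And>x. x \<in> carrier G \<Longrightarrow> c (d x) = x"
    by (rule transport_fgmod[OF perp_lmodule[OF pA] perp_fg[OF pA]]) (rule that, assumption+)
  have G: "G \<in> perp A" by (rule perp_retract[OF NA pA GM d c]) (rule cd)
  interpret P: lmodule B P by (rule PM)
  interpret G: lmodule A G by (rule GM)
  interpret T: tensor B "right_module M" P "tensor_module M B P" by (rule tensor_module_tensor[OF bim PM])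
  note TM = tensor_module_lmodule[OF bim PM]
  interpret TM: lmodule A "tensor_module M B P" by (rule TM(1))
  let ?T = "tensor_module M B P"
  have inM: "inM m \<in> carrier \<Lambda>" if "m \<in> carrier M" for m using that by simp
  have bc: "b y \<in> carrier Z" "e2 \<odot>\<^bsub>Z\<^esub> b y = b y" if "y \<in> carrier P" "e2 = inB \<one>\<^bsub>B\<^esub>" for y e2
    using lh_closed[OF b that(1)] fix_f_D[of "b y" Z] that(2) by simp_all
  have bsm: "b (r \<odot>\<^bsub>P\<^esub> y) = inB r \<odot>\<^bsub>Z\<^esub> b y" if "r \<in> carrier B" "y \<in> carrier P" for r y
    using lh_smult[OF b that] by simp
  have badd: "b (y \<oplus>\<^bsub>P\<^esub> y') = b y \<oplus>\<^bsub>Z\<^esub> b y'" if "y \<in> carrier P" "y' \<in> carrier P" for y y'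
    using lh_add[OF b that] by simp
  \<comment> \<open>\<tau> is the multiplication map from M \<otimes> P to Z; by
    \<open>\<tau>e2\<close> below it lands in eZ.\<close>
  obtain \<tau> where \<tau>c: "\<And>x. x \<in> carrier ?T \<Longrightarrow> \<tau> x \<in> carrier Z"
    and \<tau>a: "\<And>x y. x \<in> carrier ?T \<Longrightarrow> y \<in> carrier ?T \<Longrightarrow> \<tau> (x \<oplus>\<^bsub>?T\<^esub> y) = \<tau> x \<oplus>\<^bsub>Z\<^esub> \<tau> y"
    and \<tau>t: "\<And>m y. m \<in> carrier (right_module M) \<Longrightarrow> y \<in> carrier P \<Longrightarrow> \<tau> (T.tt m y) = inM m \<odot>\<^bsub>Z\<^esub> b y"
  proof (rule T.tensor_lift[OF Z.M.abelian_group_axioms, of "\<lambda>m y. inM m \<odot>\<^bsub>Z\<^esub> b y"])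
    fix m y assume m: "m \<in> carrier (right_module M)" and y: "y \<in> carrier P"
    note bcy = bc[OF y refl]
    show "inM m \<odot>\<^bsub>Z\<^esub> b y \<in> carrier Z" using m bcy by simp
    show "inM (m \<oplus>\<^bsub>right_module M\<^esub> m') \<odot>\<^bsub>Z\<^esub> b y = inM m \<odot>\<^bsub>Z\<^esub> b y \<oplus>\<^bsub>Z\<^esub> inM m' \<odot>\<^bsub>Z\<^esub> b y"
      if "m' \<in> carrier (right_module M)" for m'
      using m bcy that Z.lsmult_l_distr[of "inM m" "inM m'" "b y"] by simp
    show "inM m \<odot>\<^bsub>Z\<^esub> b (y \<oplus>\<^bsub>P\<^esub> y') = inM m \<odot>\<^bsub>Z\<^esub> b y \<oplus>\<^bsub>Z\<^esub> inM m \<odot>\<^bsub>Z\<^esub> b y'" if "y' \<in> carrier P" for y'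
      using m y bcy that by (simp add: badd Z.lsmult_r_distr bc(1)[OF that refl])
    show "inM (r \<odot>\<^bsub>right_module M\<^esub> m) \<odot>\<^bsub>Z\<^esub> b y = inM m \<odot>\<^bsub>Z\<^esub> b (r \<odot>\<^bsub>P\<^esub> y)" if "r \<in> carrier B" for r
      using m y bcy that Z.lsmult_assoc[of "inM m" "inB r" "b y"] by (simp add: bsm)
  qed (rule that, assumption+)
  have \<tau>t': "\<tau> (T.tt m y) = inM m \<odot>\<^bsub>Z\<^esub> b y" if "m \<in> carrier M" "y \<in> carrier P" for m y using \<tau>t that by simp
  define e1 where "e1 = inA \<one>\<^bsub>A\<^esub>"
  define e2 where "e2 = inB \<one>\<^bsub>B\<^esub>"
  have e12: "e1 \<in> carrier \<Lambda>" "e2 \<in> carrier \<Lambda>" by (simp_all add: e1_def e2_def)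
  note bc = bc[OF _ e2_def]
  have fixc: "z \<in> fix_f Z \<longleftrightarrow> z \<in> carrier Z \<and> e2 \<odot>\<^bsub>Z\<^esub> z = z" for z by (simp add: fix_f_def e2_def)
  have esplit: "e1 \<odot>\<^bsub>Z\<^esub> z \<oplus>\<^bsub>Z\<^esub> e2 \<odot>\<^bsub>Z\<^esub> z = z" if "z \<in> carrier Z" for z
    using Z.lsmult_l_distr[OF e12 that] Z.lsmult_one[OF that] by (simp add: e1_def e2_def)
  have \<tau>s: "\<tau> (aa \<odot>\<^bsub>?T\<^esub> x) = (aa, m, bb) \<odot>\<^bsub>Z\<^esub> \<tau> x"
    if r: "aa \<in> carrier A" "m \<in> carrier M" "bb \<in> carrier B" and x: "x \<in> carrier ?T" for aa m bb x
    using x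
  proof (induction x rule: T.tensor_induct)
    case (tt m' y)
    then show ?case using r Z.lsmult_assoc[of "(aa, m, bb)" "inM m'" "b y"] bc
      by (simp add: TM(2) \<tau>t' Bi.L.lsmult_closed)
  next
    case (add x y) then show ?case using r by (simp add: TM.lsmult_r_distr \<tau>a \<tau>c Z.lsmult_r_distr)
  qed
  have \<tau>e2: "e2 \<odot>\<^bsub>Z\<^esub> \<tau> x = \<zero>\<^bsub>Z\<^esub>" if x: "x \<in> carrier ?T" for x
  proof -
    have "e2 \<odot>\<^bsub>Z\<^esub> \<tau> x = \<tau> (\<zero>\<^bsub>A\<^esub> \<odot>\<^bsub>?T\<^esub> x)" using \<tau>s[of "\<zero>\<^bsub>A\<^esub>" "\<zero>\<^bsub>M\<^esub>" "\<one>\<^bsub>B\<^esub>" x] x by (simp add: e2_def)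
    also have "\<dots> = \<tau> \<zero>\<^bsub>?T\<^esub>" using x by simp
    also have "\<dots> = \<zero>\<^bsub>Z\<^esub>" using \<tau>a[of "\<zero>\<^bsub>?T\<^esub>" "\<zero>\<^bsub>?T\<^esub>"] \<tau>c[of "\<zero>\<^bsub>?T\<^esub>"] by (simp add: Z.M.add.l_cancel_one')
    finally show ?thesis .
  qed
  have \<pi>b: "\<pi> (b y) = b y" if "y \<in> carrier P" for y using pp_D(6)[of "b y"] bc[OF that] by (simp add: fixc)
  have \<pi>\<tau>: "\<pi> (\<tau> x) = \<tau> x" if x: "x \<in> carrier ?T" for x
    using x
  proof (induction x rule: T.tensor_induct)
    case (tt m y)
    then show ?case using bc by (simp add: \<tau>t' lh_smult[OF \<pi>l inM] \<pi>b)
  next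
    case (add x y) then show ?case by (simp add: \<tau>a \<tau>c lh_add[OF \<pi>l])
  qed
  \<comment> \<open>The values of \<mu> i lie in \<Lambda>f, so they have the form (0, m, b).
    \<Theta> collects their M-parts as tensors with the copies of the p i, and will be a left
    inverse of \<tau>.\<close>
  define mp where "mp i z = fst (snd (\<mu> i z))" for i z
  define \<Theta> where "\<Theta> z = lsum ?T (\<lambda>i. T.tt (mp i z) (a (p i))) n" for z
  have pc: "p i \<in> fix_f Z" "p i \<in> carrier Z" "a (p i) \<in> carrier P" "b (a (p i)) = p i" if "i < n" for i
    using pp_D(4,5)[OF that] lh_closed[OF a, of "p i"] ba[of "p i"] by simp_all
  have \<mu>f: "\<exists>m\<in>carrier M. \<exists>bb\<in>carrier B. \<mu> i z = (\<zero>\<^bsub>A\<^esub>, m, bb)" if "i < n" "z \<in> carrier Z" for i z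
  proof -
    obtain x1 x2 x3 where x: "\<mu> i z = (x1, x2, x3)" by (cases "\<mu> i z")
    show ?thesis using pp_D(2,3)[OF that] unfolding x by auto
  qed
  have mpc: "mp i z \<in> carrier M" if "i < n" "z \<in> carrier Z" for i z using \<mu>f[OF that] by (auto simp: mp_def)
  have mpa: "mp i (z \<oplus>\<^bsub>Z\<^esub> z') = mp i z \<oplus>\<^bsub>M\<^esub> mp i z'" if "i < n" "z \<in> carrier Z" "z' \<in> carrier Z" for i z z'
    using \<mu>f[OF that(1,2)] \<mu>f[OF that(1,3)] lh_add[OF pp_D(1)[OF that(1)] that(2,3)] by (auto simp: mp_def)
  have \<Theta>c: "\<Theta> z \<in> carrier ?T" if "z \<in> carrier Z" for z
    unfolding \<Theta>_def by (rule T.X.lsum_closed) (use mpc pc that in simp)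
  have \<Theta>a: "\<Theta> (z \<oplus>\<^bsub>Z\<^esub> z') = \<Theta> z \<oplus>\<^bsub>?T\<^esub> \<Theta> z'" if "z \<in> carrier Z" "z' \<in> carrier Z" for z z'
  proof -
    have "\<Theta> (z \<oplus>\<^bsub>Z\<^esub> z') = lsum ?T (\<lambda>i. T.tt (mp i z) (a (p i)) \<oplus>\<^bsub>?T\<^esub> T.tt (mp i z') (a (p i))) n"
      unfolding \<Theta>_def by (rule lsum_cong) (use mpc pc that in \<open>simp add: mpa T.tt_add1[simplified]\<close>)
    also have "\<dots> = \<Theta> z \<oplus>\<^bsub>?T\<^esub> \<Theta> z'" unfolding \<Theta>_def by (rule T.X.lsum_add) (use mpc pc that in simp_all)
    finally show ?thesis .
  qed
  \<comment> \<open>For z in fZ the value \<mu> i z lies in f\<Lambda>f, so its M-part vanishes;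
    hence \<Theta> kills the copy of P in Z.\<close>
  have \<mu>b: "\<exists>bb\<in>carrier B. \<mu> i z = inB bb" if h: "i < n" "z \<in> carrier Z" "e2 \<odot>\<^bsub>Z\<^esub> z = z" for i z
  proof -
    obtain m bb where m: "m \<in> carrier M" "bb \<in> carrier B" "\<mu> i z = (\<zero>\<^bsub>A\<^esub>, m, bb)" using \<mu>f[OF h(1,2)] by blast
    have "\<mu> i z = e2 \<otimes>\<^bsub>\<Lambda>\<^esub> \<mu> i z" using lh_smult[OF pp_D(1)[OF h(1)] e12(2) h(2)] unfolding h(3) by simp
    then show ?thesis using m by (auto simp: e2_def)
  qed
  have \<Theta>b: "\<Theta> (b y) = \<zero>\<^bsub>?T\<^esub>" if y: "y \<in> carrier P" for y
    unfolding \<Theta>_def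
  proof (rule T.X.lsum_zero)
    fix i assume i: "i < n"
    have "mp i (b y) = \<zero>\<^bsub>M\<^esub>" using \<mu>b[OF i bc[OF y]] by (auto simp: mp_def)
    then show "T.tt (mp i (b y)) (a (p i)) = \<zero>\<^bsub>?T\<^esub>" using T.tt_zero1[OF pc(3)[OF i]] by simp
  qed
  \<comment> \<open>Balancing moves the B-coefficients to the second factor, where they recombine to
    y by the dual basis identity on fZ.\<close>
  have \<Theta>\<tau>: "\<Theta> (\<tau> x) = x" if x: "x \<in> carrier ?T" for x
    using x
  proof (induction x rule: T.tensor_induct)
    case (tt m y)
    then have m: "m \<in> carrier M" and y: "y \<in> carrier P" by simp_all
    define bb where "bb i = snd (snd (\<mu> i (b y)))" for i
    have \<mu>bb: "\<mu> i (b y) = inB (bb i)" "bb i \<in> carrier B" if "i < n" for i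
      using \<mu>b[OF that bc[OF y]] by (auto simp: bb_def)
    have "\<Theta> (\<tau> (T.tt m y)) = lsum ?T (\<lambda>i. T.tt m (bb i \<odot>\<^bsub>P\<^esub> a (p i))) n" unfolding \<Theta>_def
    proof (rule lsum_cong)
      fix i assume i: "i < n"
      have "\<mu> i (\<tau> (T.tt m y)) = inM m \<otimes>\<^bsub>\<Lambda>\<^esub> inB (bb i)"
        using lh_smult[OF pp_D(1)[OF i] inM[OF m] bc(1)[OF y]] by (simp add: \<tau>t' m y \<mu>bb[OF i])
      then have "mp i (\<tau> (T.tt m y)) = rsmult M m (bb i)" using m \<mu>bb[OF i] by (simp add: mp_def)
      then show "T.tt (mp i (\<tau> (T.tt m y))) (a (p i)) = T.tt m (bb i \<odot>\<^bsub>P\<^esub> a (p i))"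
        using m \<mu>bb[OF i] pc(3)[OF i] T.tt_bal[of m "bb i" "a (p i)"] by simp
    qed
    also have "\<dots> = T.tt m (lsum P (\<lambda>i. bb i \<odot>\<^bsub>P\<^esub> a (p i)) n)"
      by (rule T.tt_lsum) (use m \<mu>bb(2) pc(3) in simp_all)
    also have "lsum P (\<lambda>i. bb i \<odot>\<^bsub>P\<^esub> a (p i)) n = a (lsum (corner_B Z) (\<lambda>i. bb i \<odot>\<^bsub>corner_B Z\<^esub> p i) n)"
    proof -
      have "a (lsum (corner_B Z) (\<lambda>i. bb i \<odot>\<^bsub>corner_B Z\<^esub> p i) n) = lsum P (\<lambda>i. a (bb i \<odot>\<^bsub>corner_B Z\<^esub> p i)) n"
        by (rule lh_lsum[OF BM PM a], rule lmodule.lsmult_closed[OF BM]) (use \<mu>bb pc in simp_all)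
      also have "\<dots> = lsum P (\<lambda>i. bb i \<odot>\<^bsub>P\<^esub> a (p i)) n"
        by (rule lsum_cong, rule lh_smult[OF a]) (use \<mu>bb pc in simp_all)
      finally show ?thesis by simp
    qed
    also have "lsum (corner_B Z) (\<lambda>i. bb i \<odot>\<^bsub>corner_B Z\<^esub> p i) n = lsum Z (\<lambda>i. \<mu> i (b y) \<odot>\<^bsub>Z\<^esub> p i) n"
      unfolding corner_B_simps by (rule lsum_cong) (simp add: \<mu>bb)
    also have "\<dots> = b y" using \<pi>b[OF y] by (simp add: \<pi>_def proj_map_def)
    also have "a (b y) = y" by (rule ab[OF y])
    finally show ?case .
  next
    case (add x y) then show ?case by (simp add: \<tau>a \<Theta>a \<tau>c)
  qed
  \<comment> \<open>The M-part of a coefficient is what multiplication by e from the left leaves of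
    it, so \<tau> \<Theta> w is the e-component of \<pi> w.\<close>
  have \<tau>\<Theta>: "\<tau> (\<Theta> w) = e1 \<odot>\<^bsub>Z\<^esub> \<pi> w" if w: "w \<in> carrier Z" for w
  proof -
    have "k \<le> n \<Longrightarrow> \<tau> (lsum ?T (\<lambda>i. T.tt (mp i w) (a (p i))) k) = lsum Z (\<lambda>i. e1 \<odot>\<^bsub>Z\<^esub> (\<mu> i w \<odot>\<^bsub>Z\<^esub> p i)) k" for k
    proof (induction k)
      case 0
      have "\<tau> \<zero>\<^bsub>?T\<^esub> = \<zero>\<^bsub>Z\<^esub>" using \<tau>a[of "\<zero>\<^bsub>?T\<^esub>" "\<zero>\<^bsub>?T\<^esub>"] \<tau>c[of "\<zero>\<^bsub>?T\<^esub>"] by (simp add: Z.M.add.l_cancel_one')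
      then show ?case by simp
    next
      case (Suc k)
      then have k: "k < n" by simp
      obtain m bb where m: "m \<in> carrier M" "bb \<in> carrier B" "\<mu> k w = (\<zero>\<^bsub>A\<^esub>, m, bb)" using \<mu>f[OF k w] by blast
      have "e1 \<odot>\<^bsub>Z\<^esub> (\<mu> k w \<odot>\<^bsub>Z\<^esub> p k) = inM m \<odot>\<^bsub>Z\<^esub> p k"
        using m pc(2)[OF k] Z.lsmult_assoc[of e1 "\<mu> k w" "p k", symmetric] by (simp add: e1_def)
      moreover have "\<tau> (T.tt (mp k w) (a (p k))) = inM m \<odot>\<^bsub>Z\<^esub> p k"
        using m pc[OF k] by (simp add: mp_def \<tau>t')
      ultimately show ?case using Suc mpc[OF _ w] pc by (simp add: \<tau>a T.X.lsum_closed)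
    qed
    from this[of n] have "\<tau> (\<Theta> w) = lsum Z (\<lambda>i. e1 \<odot>\<^bsub>Z\<^esub> (\<mu> i w \<odot>\<^bsub>Z\<^esub> p i)) n" by (simp add: \<Theta>_def)
    also have "\<dots> = e1 \<odot>\<^bsub>Z\<^esub> lsum Z (\<lambda>i. \<mu> i w \<odot>\<^bsub>Z\<^esub> p i) n"
      by (rule Z.smult_lsum[OF e12(1), symmetric], rule Z.lsmult_closed) (use pp_D w in simp_all)
    finally show ?thesis by (simp add: \<pi>_def proj_map_def)
  qed
  have dcl: "d g \<in> carrier Z" "\<pi> (d g) = \<zero>\<^bsub>Z\<^esub>" "e2 \<odot>\<^bsub>Z\<^esub> d g = \<zero>\<^bsub>Z\<^esub>" if "g \<in> carrier G" for g
    using lh_closed[OF d that] killed unfolding killed_def e2_def by (simp_all add: rs)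
  have ds: "d (aa \<odot>\<^bsub>G\<^esub> g) = (aa, m, bb) \<odot>\<^bsub>Z\<^esub> d g"
    if "aa \<in> carrier A" "m \<in> carrier M" "bb \<in> carrier B" "g \<in> carrier G" for aa m bb g
    using lh_smult[OF d that(1,4)] killed_smult[OF killed, of "d g" "(aa, m, bb)"] that lh_closed[OF d that(4)] by (simp add: rs)
  have da: "d (g \<oplus>\<^bsub>G\<^esub> g') = d g \<oplus>\<^bsub>Z\<^esub> d g'" if "g \<in> carrier G" "g' \<in> carrier G" for g g'
    using lh_add[OF d that] by (simp add: rs)
  let ?D = "direct_sum (TP P) (TG G)"
  let ?\<Phi> = "\<lambda>((t, y), (g, u)). (\<tau> t \<oplus>\<^bsub>Z\<^esub> b y) \<oplus>\<^bsub>Z\<^esub> d g"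
  \<comment> \<open>The three components are the e-part of \<pi> z, its f-part, and the remainder z
    - \<pi> z; the middle one is written with z because f z = f \<pi> z.\<close>
  let ?\<Psi> = "\<lambda>z. ((\<Theta> (\<pi> z), a (e2 \<odot>\<^bsub>Z\<^esub> z)), (c (z \<ominus>\<^bsub>Z\<^esub> \<pi> z), ()))"
  have \<Phi>: "lh \<Lambda> ?D Z ?\<Phi>"
  proof (rule lhI)
    show "?\<Phi> x \<in> carrier Z" if "x \<in> carrier ?D" for x using that bc dcl \<tau>c by auto
    show "?\<Phi> (x \<oplus>\<^bsub>?D\<^esub> x') = ?\<Phi> x \<oplus>\<^bsub>Z\<^esub> ?\<Phi> x'" if "x \<in> carrier ?D" "x' \<in> carrier ?D" for x x'
      using that by (auto simp: bc dcl \<tau>c \<tau>a badd da Z.M.a_ac)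
    fix r x assume "r \<in> carrier \<Lambda>" "x \<in> carrier ?D"
    then obtain aa m bb t y g where r: "r = (aa, m, bb)" "aa \<in> carrier A" "m \<in> carrier M" "bb \<in> carrier B"
      and x: "x = ((t, y), (g, ()))" "t \<in> carrier ?T" "y \<in> carrier P" "g \<in> carrier G" by auto
    have "(aa, m, bb) \<odot>\<^bsub>Z\<^esub> b y = ((aa, m, bb) \<otimes>\<^bsub>\<Lambda>\<^esub> e2) \<odot>\<^bsub>Z\<^esub> b y"
      using Z.lsmult_assoc[of "(aa, m, bb)" e2 "b y"] r e12 bc[OF x(3)] by simp
    also have "\<dots> = (inM m \<oplus>\<^bsub>\<Lambda>\<^esub> inB bb) \<odot>\<^bsub>Z\<^esub> b y" using r by (simp add: e2_def)
    also have "\<dots> = \<tau> (T.tt m y) \<oplus>\<^bsub>Z\<^esub> b (bb \<odot>\<^bsub>P\<^esub> y)"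
      using r x bc[OF x(3)] by (subst Z.lsmult_l_distr) (simp_all add: \<tau>t' bsm)
    finally have by': "(aa, m, bb) \<odot>\<^bsub>Z\<^esub> b y = \<tau> (T.tt m y) \<oplus>\<^bsub>Z\<^esub> b (bb \<odot>\<^bsub>P\<^esub> y)" .
    have "?\<Phi> (r \<odot>\<^bsub>?D\<^esub> x) = (\<tau> (aa \<odot>\<^bsub>?T\<^esub> t) \<oplus>\<^bsub>Z\<^esub> \<tau> (T.tt m y) \<oplus>\<^bsub>Z\<^esub> b (bb \<odot>\<^bsub>P\<^esub> y)) \<oplus>\<^bsub>Z\<^esub> d (aa \<odot>\<^bsub>G\<^esub> g)"
      using r x by (simp add: \<tau>a)
    also have "\<dots> = (r \<odot>\<^bsub>Z\<^esub> \<tau> t \<oplus>\<^bsub>Z\<^esub> r \<odot>\<^bsub>Z\<^esub> b y) \<oplus>\<^bsub>Z\<^esub> r \<odot>\<^bsub>Z\<^esub> d g"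
      unfolding r(1) by' \<tau>s[OF r(2-4) x(2)] ds[OF r(2-4) x(4)]
      using r x \<tau>c[OF x(2)] \<tau>c[of "T.tt m y"] bc[of "bb \<odot>\<^bsub>P\<^esub> y"] dcl[OF x(4)] by (simp add: Z.M.a_assoc)
    also have "\<dots> = r \<odot>\<^bsub>Z\<^esub> ?\<Phi> x"
      using r x \<tau>c[OF x(2)] bc[OF x(3)] dcl[OF x(4)] by (simp add: Z.lsmult_r_distr)
    finally show "?\<Phi> (r \<odot>\<^bsub>?D\<^esub> x) = r \<odot>\<^bsub>Z\<^esub> ?\<Phi> x" .
  qed
  have "bij_betw ?\<Phi> (carrier ?D) (carrier Z)"
  proof (rule bij_betw_inverseI[where g = ?\<Psi>])
    show "?\<Phi> x \<in> carrier Z" if "x \<in> carrier ?D" for x by (rule lh_closed[OF \<Phi> that])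
    show "?\<Psi> z \<in> carrier ?D" if z: "z \<in> carrier Z" for z
      using \<Theta>c[OF lh_closed[OF \<pi>l z]] lh_closed[OF a, of "e2 \<odot>\<^bsub>Z\<^esub> z"] fix_f_smult[OF ZM z]
        lh_closed[OF c, of "z \<ominus>\<^bsub>Z\<^esub> \<pi> z"] lh_closed[OF rproj z] by (simp add: e2_def)
    show "?\<Phi> (?\<Psi> z) = z" if z: "z \<in> carrier Z" for z
    proof -
      note \<pi>z = lh_closed[OF \<pi>l z]
      have 1: "\<tau> (\<Theta> (\<pi> z)) = e1 \<odot>\<^bsub>Z\<^esub> \<pi> z" using \<tau>\<Theta>[OF \<pi>z] idem[OF z] by simp
      have fz: "e2 \<odot>\<^bsub>Z\<^esub> z \<in> fix_f Z" using fix_f_smult[OF ZM z] by (simp add: e2_def)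
      have 2: "b (a (e2 \<odot>\<^bsub>Z\<^esub> z)) = e2 \<odot>\<^bsub>Z\<^esub> \<pi> z"
        using ba[of "e2 \<odot>\<^bsub>Z\<^esub> z"] fz pp_D(6)[OF fz] lh_smult[OF \<pi>l e12(2) z] by simp
      have 3: "d (c (z \<ominus>\<^bsub>Z\<^esub> \<pi> z)) = z \<ominus>\<^bsub>Z\<^esub> \<pi> z" using dc lh_closed[OF rproj z] by simp
      show ?thesis using decomp[OF z] by (simp add: 1 2 3 esplit[OF \<pi>z])
    qed
    show "?\<Psi> (?\<Phi> x) = x" if x: "x \<in> carrier ?D" for x
    proof -
      obtain t y g where x: "x = ((t, y), (g, ()))" "t \<in> carrier ?T" "y \<in> carrier P" "g \<in> carrier G" using x by auto
      define z where "z = ?\<Phi> x"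
      have z: "z = (\<tau> t \<oplus>\<^bsub>Z\<^esub> b y) \<oplus>\<^bsub>Z\<^esub> d g" using x by (simp add: z_def)
      note cl = \<tau>c[OF x(2)] bc[OF x(3)] dcl[OF x(4)]
      have 1: "e2 \<odot>\<^bsub>Z\<^esub> z = b y" unfolding z using cl e12 \<tau>e2[OF x(2)] by (simp add: Z.lsmult_r_distr)
      have 2: "\<pi> z = \<tau> t \<oplus>\<^bsub>Z\<^esub> b y" unfolding z using cl by (simp add: lh_add[OF \<pi>l] \<pi>\<tau>[OF x(2)] \<pi>b[OF x(3)])
      have 3: "\<Theta> (\<pi> z) = t" unfolding 2 using cl x by (simp add: \<Theta>a \<Theta>\<tau> \<Theta>b)
      have "(w \<oplus>\<^bsub>Z\<^esub> u) \<ominus>\<^bsub>Z\<^esub> w = u" if "w \<in> carrier Z" "u \<in> carrier Z" for u w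
        using that by (simp add: Z.M.minus_eq Z.M.a_comm[of w u] Z.M.a_assoc Z.M.r_neg)
      then have 4: "z \<ominus>\<^bsub>Z\<^esub> \<pi> z = d g" unfolding 2 unfolding z using cl by simp
      show ?thesis unfolding z_def[symmetric] 1 3 4 using x by (simp add: ab cd)
    qed
  qed
  then have "lisomorphic \<Lambda> ?D Z"
    by (rule lisomorphicI[OF direct_sum_lmodule[OF TP_lmodule[OF PM] TG_lmodule(1)[OF GM]] \<Phi>])
  then show ?thesis using P G by blast
qed

end

context tri_ring begin

lemma perp_shape:
  fixes Z :: "('a \<times> 'm \<times> 'b) fgmod"
  assumes v: "vz \<Lambda> bim" "vz A (res inA bim)" and PB: "PA B"
  shows "Z \<in> perp \<Lambda> \<longleftrightarrow> lmodule \<Lambda> Z \<and> (\<exists>P \<in> (add_modules B :: 'b fgmod set). \<exists>G \<in> (perp A :: 'a fgmod set).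
    lisomorphic \<Lambda> Z (direct_sum (TP P) (TG G)))"
proof (intro iffI conjI)
  assume Z: "Z \<in> perp \<Lambda>"
  note ZM = perp_lmodule[OF Z]
  show "lmodule \<Lambda> Z" by (rule ZM)
  obtain Z' :: "('a \<times> 'm \<times> 'b, nat \<Rightarrow> 'a \<times> 'm \<times> 'b) module" and a b where Z': "lmodule \<Lambda> Z'" and a: "lh \<Lambda> Z Z' a"
    and b: "lh \<Lambda> Z' Z b" and ba: "\<And>x. x \<in> carrier Z \<Longrightarrow> b (a x) = x" and ab: "\<And>x. x \<in> carrier Z' \<Longrightarrow> a (b x) = x"
    by (rule transport_nat[OF ZM perp_fg[OF Z]]) (rule that, assumption+)
  have "Z' \<in> perp \<Lambda>" by (rule perp_retract[OF NL Z Z' b a ab])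
  from perp_decomposition[OF v(1) PB this] obtain P :: "'b fgmod" and G :: "'a fgmod"
    where PG: "P \<in> add_modules B" "G \<in> perp A" and iso: "lisomorphic \<Lambda> (direct_sum (TP P) (TG G)) Z'" by blast
  have "lmodule B P" using PG(1) by (simp add: add_modules_def)
  then have D: "lmodule \<Lambda> (direct_sum (TP P) (TG G))"
    by (rule direct_sum_lmodule[OF TP_lmodule TG_lmodule(1)[OF perp_lmodule[OF PG(2)]]])
  obtain f g where f: "lh \<Lambda> (direct_sum (TP P) (TG G)) Z' f" and g: "lh \<Lambda> Z' (direct_sum (TP P) (TG G)) g"
    and gf: "\<And>x. x \<in> carrier (direct_sum (TP P) (TG G)) \<Longrightarrow> g (f x) = x" and fg: "\<And>x. x \<in> carrier Z' \<Longrightarrow> f (g x) = x"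
    by (rule lisomorphicE2[OF iso D Z']) (rule that, assumption+)
  have "bij_betw (\<lambda>x. g (a x)) (carrier Z) (carrier (direct_sum (TP P) (TG G)))"
    by (rule bij_betw_inverseI[where g = "\<lambda>y. b (f y)"])
      (simp_all only: lh_closed[OF a] lh_closed[OF b] lh_closed[OF f] lh_closed[OF g] ba ab gf fg)
  then have "lisomorphic \<Lambda> Z (direct_sum (TP P) (TG G))" by (rule lisomorphicI[OF ZM lh_comp[OF a g]])
  then show "\<exists>P \<in> (add_modules B :: 'b fgmod set). \<exists>G \<in> (perp A :: 'a fgmod set).
    lisomorphic \<Lambda> Z (direct_sum (TP P) (TG G))" using PG by blast
next
  assume "lmodule \<Lambda> Z \<and> (\<exists>P \<in> (add_modules B :: 'b fgmod set). \<exists>G \<in> (perp A :: 'a fgmod set).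
    lisomorphic \<Lambda> Z (direct_sum (TP P) (TG G)))"
  then obtain P :: "'b fgmod" and G :: "'a fgmod" where ZM: "lmodule \<Lambda> Z" and PG: "P \<in> add_modules B" "G \<in> perp A"
    and iso: "lisomorphic \<Lambda> Z (direct_sum (TP P) (TG G))" by blast
  have D: "direct_sum (TP P) (TG G) \<in> perp \<Lambda>"
    by (rule TP_TG_perp[OF v(2) _ PG(2)]) (use PG(1) in \<open>simp add: add_modules_iff\<close>)
  obtain f g where f: "lh \<Lambda> Z (direct_sum (TP P) (TG G)) f" and g: "lh \<Lambda> (direct_sum (TP P) (TG G)) Z g"
    and gf: "\<And>x. x \<in> carrier Z \<Longrightarrow> g (f x) = x"
    by (rule lisomorphicE2[OF iso ZM perp_lmodule[OF D]]) (rule that, assumption+)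
  show "Z \<in> perp \<Lambda>" by (rule perp_retract[OF NL D ZM f g gf])
qed

end

lemma triangular_ring_perp:
  fixes A :: "'a ring" and B :: "'b ring" and M :: "('a, 'b, 'm) bimodule"
  defines "R \<equiv> triangular_ring A M B"
  assumes A: "artin_algebra A" and B: "artin_algebra B" and M: "bimodule A B M" and L: "artin_algebra R"
    and PB: "(perp B :: 'b fgmod set) = add_modules B" and T: "torsionless A M" "proj_dim A M < \<infinity>"
  shows "weakly_Gorenstein R \<longleftrightarrow> weakly_Gorenstein A"
    and "weakly_Gorenstein A \<Longrightarrow> (perp R :: ('a \<times> 'm \<times> 'b) fgmod set) = gp R"
    and "weakly_Gorenstein A \<Longrightarrow> (gp R :: ('a \<times> 'm \<times> 'b) fgmod set) = {Z. lmodule R Z \<and>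
      (\<exists>P \<in> (add_modules B :: 'b fgmod set). \<exists>G \<in> (perp A :: 'a fgmod set). lisomorphic R Z
        (direct_sum (triple_module M B (tensor_module M B P) P (\<lambda>t. t))
          (triple_module M B G (zero_module :: ('b, unit) module) (\<lambda>_. \<zero>\<^bsub>G\<^esub>))))}"
    and "(perp R :: ('a \<times> 'm \<times> 'b) fgmod set) = add_modules R \<longleftrightarrow> (perp A :: 'a fgmod set) = add_modules A"
proof -
  interpret tri_ring A B M by (rule tri_ring.intro) (use A B M L in \<open>simp_all add: R_def\<close>)
  have "PA B" using PB perp_eq_add_iff[OF NB] by simp
  note PB = this and v = vz_bim[OF T(2)]
  show W: "weakly_Gorenstein R \<longleftrightarrow> weakly_Gorenstein A"
    unfolding R_def weakly_Gorenstein_iff[OF artin_noeth[OF artL]] weakly_Gorenstein_iff[OF artin_noeth[OF artA]]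
    by (rule TL_iff[OF v PB tl_bim[OF T(1)]])
  show "(perp R :: ('a \<times> 'm \<times> 'b) fgmod set) = add_modules R \<longleftrightarrow> (perp A :: 'a fgmod set) = add_modules A"
    unfolding R_def perp_eq_add_iff[OF NL] perp_eq_add_iff[OF NA] by (rule PA_iff[OF v PB])
  assume "weakly_Gorenstein A"
  then show g: "(perp R :: ('a \<times> 'm \<times> 'b) fgmod set) = gp R" using W by (simp only: weakly_Gorenstein_def)
  show "(gp R :: ('a \<times> 'm \<times> 'b) fgmod set) = {Z. lmodule R Z \<and>
      (\<exists>P \<in> (add_modules B :: 'b fgmod set). \<exists>G \<in> (perp A :: 'a fgmod set). lisomorphic R Z
        (direct_sum (TP P) (TG G)))}"
    unfolding g[symmetric] unfolding R_def by (rule Set.set_eqI) (simp only: mem_Collect_eq perp_shape[OF v PB])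
qed

section \<open>Tensor products of algebras\<close>

text \<open>A basis is built by adding generators one at a time: s either lies in the span H of the
  previous ones or is independent of it, and in the second case X = H \<oplus> K s.\<close>

lemma field_generated_fgproj:
  fixes K :: "('k, 'e) ring_scheme" and X :: "('k, 'm, 'x) module_scheme"
  assumes K: "field K" and S: "finite S" and X: "lmodule K X" "S \<subseteq> carrier X"
    and g: "\<And>H. submod K X H \<Longrightarrow> S \<subseteq> H \<Longrightarrow> carrier X \<subseteq> H"
  shows "fgproj K X"
  using S X g
proof (induction S arbitrary: X)
  case (empty X)
  interpret X: lmodule K X by fact
  have "carrier X = {\<zero>\<^bsub>X\<^esub>}" using empty(3)[OF zero_submod[OF empty(1)]] by auto
  then show ?case by (rule zero_fgproj[OF empty(1)])
next
  case (insert s S X)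
  interpret K: field K by (rule K)
  interpret X: lmodule K X by fact
  have sc: "s \<in> carrier X" using insert.prems by simp
  define H where "H = \<Inter>{H. submod K X H \<and> S \<subseteq> H}"
  have 0: "submod K X (carrier X)" by (rule submod_carrier[OF insert.prems(1)])
  have Hc: "H \<subseteq> carrier X" using 0 insert.prems unfolding H_def by auto
  have H: "submod K X H" using Hc unfolding submod_def H_def by auto
  note Hm = submod_lmodule[OF insert.prems(1) H]
  have Hf: "fgproj K (X\<lparr>carrier := H\<rparr>)"
  proof (rule insert.IH[OF Hm])
    show "S \<subseteq> carrier (X\<lparr>carrier := H\<rparr>)" by (auto simp: H_def)
    fix G assume G: "submod K (X\<lparr>carrier := H\<rparr>) G" "S \<subseteq> G"
    have "submod K X G" using G(1) submod_in[OF H] by blast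
    then show "carrier (X\<lparr>carrier := H\<rparr>) \<subseteq> G" using G(2) by (auto simp: H_def)
  qed
  show ?case
  proof (cases "s \<in> H")
    case True
    have "carrier X \<subseteq> H" using True by (intro insert.prems(3)[OF H]) (auto simp: H_def)
    then have "X\<lparr>carrier := H\<rparr> = X" using Hc by (simp add: subset_antisym)
    then show ?thesis using Hf by simp
  next
    case False
    have Hx: "x \<in> carrier X" if "x \<in> H" for x using Hc that by blast
    have Ha: "x \<oplus>\<^bsub>X\<^esub> y \<in> H" and Hs: "k \<odot>\<^bsub>X\<^esub> x \<in> H" if "x \<in> H" "y \<in> H" "k \<in> carrier K" for x y k
      using H that by (auto simp: submod_def)
    have Hn: "\<ominus>\<^bsub>X\<^esub> x \<in> H" if "x \<in> H" for x by (rule X.submod_neg[OF H that])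
    have H0: "\<zero>\<^bsub>X\<^esub> \<in> H" using H by (simp add: submod_def)
    let ?G = "{h \<oplus>\<^bsub>X\<^esub> k \<odot>\<^bsub>X\<^esub> s |h k. h \<in> H \<and> k \<in> carrier K}"
    have swap: "(h \<oplus>\<^bsub>X\<^esub> k \<odot>\<^bsub>X\<^esub> s) \<oplus>\<^bsub>X\<^esub> (h' \<oplus>\<^bsub>X\<^esub> k' \<odot>\<^bsub>X\<^esub> s) = (h \<oplus>\<^bsub>X\<^esub> h') \<oplus>\<^bsub>X\<^esub> (k \<oplus>\<^bsub>K\<^esub> k') \<odot>\<^bsub>X\<^esub> s"
      if "h \<in> H" "h' \<in> H" "k \<in> carrier K" "k' \<in> carrier K" for h h' k k'
      using that sc Hx by (simp add: X.lsmult_l_distr X.M.a_ac)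
    have sm: "r \<odot>\<^bsub>X\<^esub> (h \<oplus>\<^bsub>X\<^esub> k \<odot>\<^bsub>X\<^esub> s) = r \<odot>\<^bsub>X\<^esub> h \<oplus>\<^bsub>X\<^esub> (r \<otimes>\<^bsub>K\<^esub> k) \<odot>\<^bsub>X\<^esub> s"
      if "h \<in> H" "k \<in> carrier K" "r \<in> carrier K" for h k r
      using that sc Hx by (simp add: X.lsmult_r_distr X.lsmult_assoc)
    have "S \<subseteq> H" by (auto simp: H_def)
    then have "insert s S \<subseteq> ?G" using submod_adjoin(2)[OF insert.prems(1) H sc] by blast
    then have "carrier X \<subseteq> ?G" by (rule insert.prems(3)[OF submod_adjoin(1)[OF insert.prems(1) H sc]])
    then have ex: "\<forall>x. \<exists>p. x \<in> carrier X \<longrightarrow> fst p \<in> H \<and> snd p \<in> carrier K \<and> x = fst p \<oplus>\<^bsub>X\<^esub> snd p \<odot>\<^bsub>X\<^esub> s" by fastforce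
    \<comment> \<open>q x holds the H-component of x and its coefficient at s.\<close>
    from choice[OF ex] obtain q where q: "\<forall>x. x \<in> carrier X \<longrightarrow> fst (q x) \<in> H \<and> snd (q x) \<in> carrier K \<and> x = fst (q x) \<oplus>\<^bsub>X\<^esub> snd (q x) \<odot>\<^bsub>X\<^esub> s" by (rule exE)
    have qc: "fst (q x) \<in> H" "snd (q x) \<in> carrier K" "fst (q x) \<oplus>\<^bsub>X\<^esub> snd (q x) \<odot>\<^bsub>X\<^esub> s = x" if "x \<in> carrier X" for x
      using q that by (blast, blast, metis)
    \<comment> \<open>Here nonzero scalars are inverted: k s in H with k nonzero would put s into
      H.\<close>
    have k0: "k = \<zero>\<^bsub>K\<^esub>" if "k \<in> carrier K" "k \<odot>\<^bsub>X\<^esub> s \<in> H" for k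
    proof (rule ccontr)
      assume "k \<noteq> \<zero>\<^bsub>K\<^esub>"
      then have k: "k \<in> Units K" using that by (simp add: K.field_Units)
      have "inv\<^bsub>K\<^esub> k \<odot>\<^bsub>X\<^esub> (k \<odot>\<^bsub>X\<^esub> s) = s" using k sc that by (simp flip: X.lsmult_assoc)
      then show False using Hs[OF that(2) that(2), of "inv\<^bsub>K\<^esub> k"] k False by simp
    qed
    have uniq: "q (h \<oplus>\<^bsub>X\<^esub> k \<odot>\<^bsub>X\<^esub> s) = (h, k)" if h: "h \<in> H" "k \<in> carrier K" for h k
    proof -
      let ?x = "h \<oplus>\<^bsub>X\<^esub> k \<odot>\<^bsub>X\<^esub> s"
      obtain h' k' where q': "q ?x = (h', k')" by (cases "q ?x")
      have x: "?x \<in> carrier X" using h Hx sc by simp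
      have h': "h' \<in> H" "k' \<in> carrier K" "h' \<oplus>\<^bsub>X\<^esub> k' \<odot>\<^bsub>X\<^esub> s = ?x" using qc[OF x] unfolding q' by simp_all
      have c: "h \<in> carrier X" "h' \<in> carrier X" "k \<odot>\<^bsub>X\<^esub> s \<in> carrier X" "k' \<odot>\<^bsub>X\<^esub> s \<in> carrier X" using h h' Hx sc by simp_all
      have "(k \<ominus>\<^bsub>K\<^esub> k') \<odot>\<^bsub>X\<^esub> s = k \<odot>\<^bsub>X\<^esub> s \<oplus>\<^bsub>X\<^esub> \<ominus>\<^bsub>X\<^esub> (k' \<odot>\<^bsub>X\<^esub> s)"
        using h h' sc by (simp add: K.minus_eq X.lsmult_l_distr X.ls_lneg)
      also have "\<dots> = \<ominus>\<^bsub>X\<^esub> h \<oplus>\<^bsub>X\<^esub> ((h \<oplus>\<^bsub>X\<^esub> k \<odot>\<^bsub>X\<^esub> s) \<oplus>\<^bsub>X\<^esub> \<ominus>\<^bsub>X\<^esub> (k' \<odot>\<^bsub>X\<^esub> s))" using c by (simp add: X.M.a_assoc X.M.r_neg1)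
      also have "\<dots> = \<ominus>\<^bsub>X\<^esub> h \<oplus>\<^bsub>X\<^esub> h'" unfolding h'(3)[symmetric] using c by (simp add: X.M.a_assoc X.M.r_neg)
      finally have "(k \<ominus>\<^bsub>K\<^esub> k') \<odot>\<^bsub>X\<^esub> s \<in> H" using Ha Hn h h' by simp
      then have "k \<ominus>\<^bsub>K\<^esub> k' = \<zero>\<^bsub>K\<^esub>" using h h' by (intro k0) simp_all
      then have kk: "k = k'" using K.minus_equality[of k "\<ominus>\<^bsub>K\<^esub> k'"] h h' by (simp add: K.minus_eq)
      have "h = h'" using h'(3) c unfolding kk by simp
      with kk q' show ?thesis by simp
    qed
    have qa: "q (x \<oplus>\<^bsub>X\<^esub> y) = (fst (q x) \<oplus>\<^bsub>X\<^esub> fst (q y), snd (q x) \<oplus>\<^bsub>K\<^esub> snd (q y))" if "x \<in> carrier X" "y \<in> carrier X" for x y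
      using uniq[of "fst (q x) \<oplus>\<^bsub>X\<^esub> fst (q y)" "snd (q x) \<oplus>\<^bsub>K\<^esub> snd (q y)"]
        swap[of "fst (q x)" "fst (q y)" "snd (q x)" "snd (q y)"] qc[OF that(1)] qc[OF that(2)] Ha by simp
    have qs: "q (r \<odot>\<^bsub>X\<^esub> x) = (r \<odot>\<^bsub>X\<^esub> fst (q x), r \<otimes>\<^bsub>K\<^esub> snd (q x))" if "r \<in> carrier K" "x \<in> carrier X" for r x
      using uniq[of "r \<odot>\<^bsub>X\<^esub> fst (q x)" "r \<otimes>\<^bsub>K\<^esub> snd (q x)"] sm[of "fst (q x)" "snd (q x)" r] qc[OF that(2)] Hs that(1) by simp
    obtain n l p where d: "dbasis K (X\<lparr>carrier := H\<rparr>) n l p" using Hf by (auto simp: fgproj_def)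
    have l: "lh K (X\<lparr>carrier := H\<rparr>) (reg_module K) (l i)" "p i \<in> H" if "i < n" for i using d that by (auto simp: dbasis_def)
    have "dbasis K X (Suc n) (\<lambda>i x. if i < n then l i (fst (q x)) else snd (q x)) (\<lambda>i. if i < n then p i else s)"
      unfolding dbasis_def
    proof (intro conjI allI impI ballI)
      fix i show "(if i < n then p i else s) \<in> carrier X" using l(2) Hx sc by simp
      show "lh K X (reg_module K) (\<lambda>x. if i < n then l i (fst (q x)) else snd (q x))"
      proof (cases "i < n")
        case True
        show ?thesis using lh_closed[OF l(1)[OF True]] lh_add[OF l(1)[OF True]] lh_smult[OF l(1)[OF True]] qc qa qs True
          by (intro lhI) simp_all
      next
        case False then show ?thesis using qc qa qs by (intro lhI) simp_all
      qed
    next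
      fix x assume x: "x \<in> carrier X"
      have "lsum X (\<lambda>i. (if i < n then l i (fst (q x)) else snd (q x)) \<odot>\<^bsub>X\<^esub> (if i < n then p i else s)) n
        = lsum X (\<lambda>i. l i (fst (q x)) \<odot>\<^bsub>X\<^esub> p i) n" by (rule lsum_cong) simp
      also have "\<dots> = fst (q x)" using d qc(1)[OF x] by (simp add: dbasis_def lsum_carrier)
      finally show "x = lsum X (\<lambda>i. (if i < n then l i (fst (q x)) else snd (q x)) \<odot>\<^bsub>X\<^esub> (if i < n then p i else s)) (Suc n)"
        using qc(3)[OF x] by simp
    qed
    then show ?thesis using insert.prems(1) unfolding fgproj_def by blast
  qed
qed

lemma field_fgproj:
  assumes "field K" "lmodule K X" "fg_module K X" shows "fgproj K X"
proof -
  obtain S where "finite S" "S \<subseteq> carrier X" "\<And>H. submod K X H \<Longrightarrow> S \<subseteq> H \<Longrightarrow> carrier X \<subseteq> H"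
    by (rule fgE[OF assms(2,3)]) (rule that, assumption+)
  then show ?thesis by (rule field_generated_fgproj[OF assms(1) _ assms(2)])
qed

section \<open>The ring structure on a tensor product of algebras\<close>

lemma frag_extend_add2: "frag_extend (\<lambda>x. f x + g x) s = frag_extend f s + frag_extend g s"
  by (simp add: frag_extend_def frag_cmul_distrib2 sum.distrib)

lemma frag_extend_diff2: "frag_extend (\<lambda>x. f x - g x) s = frag_extend f s - frag_extend g s"
  using frag_extend_add2[of "\<lambda>x. f x - g x" g s] by simp

lemma assoc_algebra_lmodule:
  assumes "assoc_algebra K C" shows "lmodule K C" "lmodule (opp K) C"
proof -
  interpret C: assoc_algebra K C by fact
  show "lmodule K C"
    by (unfold_locales) (simp_all add: C.smult_l_distr C.smult_r_distr C.smult_assoc1)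
  have "ring (opp K)" by (rule opp_ring[OF C.R.ring_axioms])
  then interpret O: ring "opp K" .
  show "lmodule (opp K) C"
    by (unfold_locales) (simp_all add: C.smult_l_distr C.smult_r_distr C.smult_assoc1 C.R.m_comm)
qed

locale algebra_tensor =
  fixes K :: "('k, 'e) ring_scheme" and C :: "('k, 'c, 'x) module_scheme" and D :: "('k, 'd, 'y) module_scheme"
  assumes C: "assoc_algebra K C" and D: "assoc_algebra K D"
begin

abbreviation "\<Gamma> \<equiv> tensor_algebra K C D"

sublocale C: assoc_algebra K C by (rule C)
sublocale D: assoc_algebra K D by (rule D)
sublocale tensor K C D \<Gamma>
  by (rule tensor.intro) (simp_all add: assoc_algebra_lmodule[OF C] assoc_algebra_lmodule[OF D] tensor_algebra_def)

definition E :: "('c \<times> 'd \<Rightarrow>\<^sub>0 int) \<Rightarrow> ('c \<times> 'd \<Rightarrow>\<^sub>0 int) \<Rightarrow> ('c \<times> 'd \<Rightarrow>\<^sub>0 int)" where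
  "E s t = frag_extend (\<lambda>(a, c). frag_extend (\<lambda>(a', c'). frag_of (a \<otimes>\<^bsub>C\<^esub> a', c \<otimes>\<^bsub>D\<^esub> c')) t) s"

lemma E_diff: "E (s - s') t = E s t - E s' t" "E s (t - t') = E s t - E s t'"
  by (simp_all add: E_def frag_extend_diff frag_extend_diff2 case_prod_unfold)

lemma E_add: "E (s + s') t = E s t + E s' t" "E s (t + t') = E s t + E s t'"
  by (simp_all add: E_def frag_extend_add frag_extend_add2 case_prod_unfold)

lemma E_of: "E (frag_of (a, c)) (frag_of (a', c')) = frag_of (a \<otimes>\<^bsub>C\<^esub> a', c \<otimes>\<^bsub>D\<^esub> c')"
  by (simp add: E_def)

lemma E_zero: "E 0 t = 0" "E s 0 = 0"
  using E_diff(1)[of 0 0 t] E_diff(2)[of s 0 0] by simp_all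

lemma gensI:
  "m \<in> carrier C \<Longrightarrow> m' \<in> carrier C \<Longrightarrow> y \<in> carrier D \<Longrightarrow> frag_of (m \<oplus>\<^bsub>C\<^esub> m', y) - frag_of (m, y) - frag_of (m', y) \<in> gens"
  "m \<in> carrier C \<Longrightarrow> y \<in> carrier D \<Longrightarrow> y' \<in> carrier D \<Longrightarrow> frag_of (m, y \<oplus>\<^bsub>D\<^esub> y') - frag_of (m, y) - frag_of (m, y') \<in> gens"
  "m \<in> carrier C \<Longrightarrow> b \<in> carrier K \<Longrightarrow> y \<in> carrier D \<Longrightarrow> frag_of (b \<odot>\<^bsub>C\<^esub> m, y) - frag_of (m, b \<odot>\<^bsub>D\<^esub> y) \<in> gens"
  unfolding gens_def by blast+

text \<open>Multiplying a relation by a fixed formal sum gives a relation again, on either side;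
  this makes the product of classes independent of representatives.\<close>

lemma E_gens:
  assumes g: "g \<in> gens" and s: "Poly_Mapping.keys s \<subseteq> S"
  shows "E s g \<in> rel" "E g s \<in> rel"
proof -
  have "E (frag_of p) g \<in> rel \<and> E g (frag_of p) \<in> rel" if "p \<in> S" for p
  proof -
    obtain a c where p: "p = (a, c)" "a \<in> carrier C" "c \<in> carrier D" using \<open>p \<in> S\<close> by auto
    show ?thesis using g
      apply (subst (asm) gens_def) apply (elim UnE CollectE exE conjE)
      subgoal for m m' y
        using p gensI(1)[of "a \<otimes>\<^bsub>C\<^esub> m" "a \<otimes>\<^bsub>C\<^esub> m'" "c \<otimes>\<^bsub>D\<^esub> y"] gensI(1)[of "m \<otimes>\<^bsub>C\<^esub> a" "m' \<otimes>\<^bsub>C\<^esub> a" "y \<otimes>\<^bsub>D\<^esub> c"]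
        by (simp add: E_diff E_of C.r_distr C.l_distr rel_gens)
      subgoal for m y y'
        using p gensI(2)[of "a \<otimes>\<^bsub>C\<^esub> m" "c \<otimes>\<^bsub>D\<^esub> y" "c \<otimes>\<^bsub>D\<^esub> y'"] gensI(2)[of "m \<otimes>\<^bsub>C\<^esub> a" "y \<otimes>\<^bsub>D\<^esub> c" "y' \<otimes>\<^bsub>D\<^esub> c"]
        by (simp add: E_diff E_of D.r_distr D.l_distr rel_gens)
      subgoal for m b y
        using p gensI(3)[of "a \<otimes>\<^bsub>C\<^esub> m" b "c \<otimes>\<^bsub>D\<^esub> y"] gensI(3)[of "m \<otimes>\<^bsub>C\<^esub> a" b "y \<otimes>\<^bsub>D\<^esub> c"]
        by (simp add: E_diff E_of C.smult_mult_left C.smult_mult_right D.smult_mult_left D.smult_mult_right rel_gens)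
      done
  qed
  then have 1: "p \<in> S \<Longrightarrow> E (frag_of p) g \<in> rel" "p \<in> S \<Longrightarrow> E g (frag_of p) \<in> rel" for p by blast+
  have "E s g \<in> rel \<and> E g s \<in> rel" using s
    by (induction s rule: frag_induction) (simp_all add: 1 E_zero rel_zero E_diff rel_diff)
  then show "E s g \<in> rel" "E g s \<in> rel" by simp_all
qed

lemma mult_cls:
  assumes s: "Poly_Mapping.keys s \<subseteq> S" and t: "Poly_Mapping.keys t \<subseteq> S"
  shows "cls s \<otimes>\<^bsub>\<Gamma>\<^esub> cls t = cls (E s t)"
proof -
  have k: "Poly_Mapping.keys a \<subseteq> S" if "a \<in> cls s" for a
  proof -
    have "Poly_Mapping.keys (a - s) \<subseteq> S" using that rel_carrier[of "a - s"] by (simp add: cls_mem)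
    then show ?thesis using keys_add[of "a - s" s] s by auto
  qed
  have "cls s \<otimes>\<^bsub>\<Gamma>\<^esub> cls t = (\<Union>a\<in>cls s. \<Union>b\<in>cls t. cls (E a b))" by (simp add: tensor_algebra_def E_def)
  also have "\<dots> = (\<Union>a\<in>cls s. cls (E a t))"
    by (rule SUP_cong[OF refl], rule union_cls(2)) (use k E_gens in \<open>simp_all add: E_diff\<close>)
  also have "\<dots> = cls (E s t)"
    by (rule union_cls(2)) (use t E_gens in \<open>simp_all add: E_diff\<close>)
  finally show ?thesis .
qed

lemma tt_mult: "a \<in> carrier C \<Longrightarrow> c \<in> carrier D \<Longrightarrow> a' \<in> carrier C \<Longrightarrow> c' \<in> carrier D \<Longrightarrow>
    tt a c \<otimes>\<^bsub>\<Gamma>\<^esub> tt a' c' = tt (a \<otimes>\<^bsub>C\<^esub> a') (c \<otimes>\<^bsub>D\<^esub> c')"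
  by (simp add: mult_cls E_of)

lemma tmult_distr:
  assumes "x \<in> carrier \<Gamma>" "y \<in> carrier \<Gamma>" "z \<in> carrier \<Gamma>"
  shows "(x \<oplus>\<^bsub>\<Gamma>\<^esub> y) \<otimes>\<^bsub>\<Gamma>\<^esub> z = x \<otimes>\<^bsub>\<Gamma>\<^esub> z \<oplus>\<^bsub>\<Gamma>\<^esub> y \<otimes>\<^bsub>\<Gamma>\<^esub> z" "z \<otimes>\<^bsub>\<Gamma>\<^esub> (x \<oplus>\<^bsub>\<Gamma>\<^esub> y) = z \<otimes>\<^bsub>\<Gamma>\<^esub> x \<oplus>\<^bsub>\<Gamma>\<^esub> z \<otimes>\<^bsub>\<Gamma>\<^esub> y"
proof -
  obtain s t u where st: "x = cls s" "y = cls t" "z = cls u" "Poly_Mapping.keys s \<subseteq> S" "Poly_Mapping.keys t \<subseteq> S" "Poly_Mapping.keys u \<subseteq> S"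
    using assms unfolding carrier_alt by blast
  have k: "Poly_Mapping.keys (s + t) \<subseteq> S" using keys_add[of s t] st by blast
  show "(x \<oplus>\<^bsub>\<Gamma>\<^esub> y) \<otimes>\<^bsub>\<Gamma>\<^esub> z = x \<otimes>\<^bsub>\<Gamma>\<^esub> z \<oplus>\<^bsub>\<Gamma>\<^esub> y \<otimes>\<^bsub>\<Gamma>\<^esub> z" "z \<otimes>\<^bsub>\<Gamma>\<^esub> (x \<oplus>\<^bsub>\<Gamma>\<^esub> y) = z \<otimes>\<^bsub>\<Gamma>\<^esub> x \<oplus>\<^bsub>\<Gamma>\<^esub> z \<otimes>\<^bsub>\<Gamma>\<^esub> y"
    using st k by (simp_all add: mult_cls add_cls E_add)
qed

lemma one_tt: "\<one>\<^bsub>\<Gamma>\<^esub> = tt \<one>\<^bsub>C\<^esub> \<one>\<^bsub>D\<^esub>"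
  by (simp add: tensor_algebra_def)

lemma tmult_closed: "x \<in> carrier \<Gamma> \<Longrightarrow> y \<in> carrier \<Gamma> \<Longrightarrow> x \<otimes>\<^bsub>\<Gamma>\<^esub> y \<in> carrier \<Gamma>"
proof (induction x rule: tensor_induct)
  case (tt m d)
  from \<open>y \<in> carrier \<Gamma>\<close> show ?case
    by (induction y rule: tensor_induct) (use tt in \<open>simp_all add: tt_mult tmult_distr\<close>)
qed (simp add: tmult_distr)

lemma tensor_algebra_ring: "ring \<Gamma>"
proof (rule ringI)
  show "abelian_group \<Gamma>" by (rule X_group)
  have assoc3: "tt a d \<otimes>\<^bsub>\<Gamma>\<^esub> tt a' d' \<otimes>\<^bsub>\<Gamma>\<^esub> z = tt a d \<otimes>\<^bsub>\<Gamma>\<^esub> (tt a' d' \<otimes>\<^bsub>\<Gamma>\<^esub> z)"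
    if h: "a \<in> carrier C" "d \<in> carrier D" "a' \<in> carrier C" "d' \<in> carrier D" and z: "z \<in> carrier \<Gamma>" for a d a' d' z
    using z by (induction z rule: tensor_induct)
      (use h in \<open>simp_all add: tt_mult C.m_assoc D.m_assoc tmult_distr tmult_closed\<close>)
  have assoc2: "tt a d \<otimes>\<^bsub>\<Gamma>\<^esub> y \<otimes>\<^bsub>\<Gamma>\<^esub> z = tt a d \<otimes>\<^bsub>\<Gamma>\<^esub> (y \<otimes>\<^bsub>\<Gamma>\<^esub> z)"
    if h: "a \<in> carrier C" "d \<in> carrier D" and z: "z \<in> carrier \<Gamma>" and y: "y \<in> carrier \<Gamma>" for a d y z
    using y by (induction y rule: tensor_induct)
      (use h z in \<open>simp_all add: assoc3 tmult_distr tmult_closed\<close>)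
  show "monoid \<Gamma>"
  proof (rule monoidI)
    fix x y z assume x: "x \<in> carrier \<Gamma>" and yz: "y \<in> carrier \<Gamma>" "z \<in> carrier \<Gamma>"
    show "x \<otimes>\<^bsub>\<Gamma>\<^esub> y \<otimes>\<^bsub>\<Gamma>\<^esub> z = x \<otimes>\<^bsub>\<Gamma>\<^esub> (y \<otimes>\<^bsub>\<Gamma>\<^esub> z)"
      using x by (induction x rule: tensor_induct) (use yz in \<open>simp_all add: assoc2 tmult_distr tmult_closed\<close>)
  next
    fix x assume x: "x \<in> carrier \<Gamma>"
    show "\<one>\<^bsub>\<Gamma>\<^esub> \<otimes>\<^bsub>\<Gamma>\<^esub> x = x" using x by (induction x rule: tensor_induct) (simp_all add: one_tt tt_mult tmult_distr)
    show "x \<otimes>\<^bsub>\<Gamma>\<^esub> \<one>\<^bsub>\<Gamma>\<^esub> = x" using x by (induction x rule: tensor_induct) (simp_all add: one_tt tt_mult tmult_distr)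
  qed (simp_all add: tmult_closed one_tt)
qed (simp_all add: tmult_distr)

sublocale \<Gamma>: ring \<Gamma> by (rule tensor_algebra_ring)

end

context triangular begin

text \<open>The left ideal eLf is killed by f, so over L it is the inflation of an A-module, and
  inflation keeps projectivity.\<close>

lemma fgproj_bim_vz:
  assumes "fgproj A (res \<alpha> bim)" shows "vz L bim" "vz A (res \<alpha> bim)"
proof -
  show "vz A (res \<alpha> bim)" by (rule vz_fgproj[OF NA assms])
  have "lh L (res \<rho> (res \<alpha> bim)) bim (\<lambda>x. x)" by (rule killed_hom'[OF bim_killed lh_id])
  moreover have "lh L bim (res \<rho> (res \<alpha> bim)) (\<lambda>x. x)" by (rule killed_hom[OF bim_killed lh_id])
  ultimately have "fgproj L bim" by (intro fgproj_retract[OF fgproj_inflate[OF assms] bim_lmodule]) simp_all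
  then show "vz L bim" by (rule vz_fgproj[OF NL])
qed

end

section \<open>Noetherian algebras and corners\<close>

lemma field_noeth: assumes "field K" shows "noeth K"
proof (rule artinian_noeth, unfold artinian_cring_def, intro conjI allI impI)
  interpret field K by fact
  show "cring K" by (rule is_cring)
  fix J :: "nat \<Rightarrow> 'a set" assume J: "\<forall>n. ideal (J n) K \<and> J (Suc n) \<subseteq> J n"
  then have J2: "J n = {\<zero>\<^bsub>K\<^esub>} \<or> J n = carrier K" for n using all_ideals by auto
  have J3: "m \<le> n \<Longrightarrow> J n \<subseteq> J m" for m n by (rule lift_Suc_antimono_le[of J]) (use J in auto)
  show "\<exists>n. \<forall>m\<ge>n. J m = J n"
  proof (cases "\<exists>n. J n = {\<zero>\<^bsub>K\<^esub>}")
    case True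
    then obtain n where n: "J n = {\<zero>\<^bsub>K\<^esub>}" by blast
    have "J m = {\<zero>\<^bsub>K\<^esub>}" if "m \<ge> n" for m using J2[of m] J3[OF that] n zero_closed by auto
    then show ?thesis using n by (intro exI[of _ n]) simp
  next
    case False then show ?thesis using J2 by simp
  qed
qed

lemma assoc_algebra_noeth:
  assumes K: "noeth K" and C: "assoc_algebra K C" "fg_module K C" shows "noeth C"
proof -
  interpret C: assoc_algebra K C by fact
  note CM = assoc_algebra_lmodule(1)[OF C(1)]
  let ?h = "\<lambda>k. k \<odot>\<^bsub>C\<^esub> \<one>\<^bsub>C\<^esub>"
  have h: "?h \<in> ring_hom K C"
    by (rule ring_hom_memI) (simp_all add: C.smult_l_distr C.smult_assoc1 C.smult_mult_left)
  have l: "lh K C (res ?h (reg_module C)) (\<lambda>x. x)" by (rule lhI) (simp_all add: C.smult_mult_left)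
  have "lmodule K (res ?h (reg_module C))" by (rule ring_hom_res_lmodule[OF h C.R.ring_axioms reg_lmodule[OF C.ring_axioms]])
  then have "fg_module K (res ?h (reg_module C))" by (rule fg_image[OF CM _ C(2) l]) simp
  then show ?thesis by (rule noeth_over[OF K C.ring_axioms h])
qed

text \<open>eRe keeps the type and the operations of R and only changes the carrier and the unit, so
  inclusions between corners are given by the identity function.\<close>

definition corner :: "('r, 'e) ring_scheme \<Rightarrow> 'r \<Rightarrow> ('r, 'e) ring_scheme" where
  "corner R e = R\<lparr>carrier := {x \<in> carrier R. e \<otimes>\<^bsub>R\<^esub> x \<otimes>\<^bsub>R\<^esub> e = x}, one := e\<rparr>"

lemma corner_simps [simp]: "carrier (corner R e) = {x \<in> carrier R. e \<otimes>\<^bsub>R\<^esub> x \<otimes>\<^bsub>R\<^esub> e = x}" "\<one>\<^bsub>corner R e\<^esub> = e"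
  "\<zero>\<^bsub>corner R e\<^esub> = \<zero>\<^bsub>R\<^esub>" "x \<oplus>\<^bsub>corner R e\<^esub> y = x \<oplus>\<^bsub>R\<^esub> y" "x \<otimes>\<^bsub>corner R e\<^esub> y = x \<otimes>\<^bsub>R\<^esub> y"
  by (simp_all add: corner_def)

lemma (in ring) idem_fix:
  assumes "e \<in> carrier R" "f \<in> carrier R" "e \<otimes> e = e" "f \<otimes> f = f" "x \<in> carrier R"
  shows "e \<otimes> x \<otimes> f = x \<longleftrightarrow> e \<otimes> x = x \<and> x \<otimes> f = x"
proof
  assume h: "e \<otimes> x \<otimes> f = x"
  have "e \<otimes> (e \<otimes> x \<otimes> f) = e \<otimes> x \<otimes> f" "e \<otimes> x \<otimes> f \<otimes> f = e \<otimes> x \<otimes> f"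
    using assms by (simp_all add: m_assoc flip: m_assoc[of e e])
  then show "e \<otimes> x = x \<and> x \<otimes> f = x" using h by simp
qed simp

lemma (in ring) corner_ring:
  assumes e: "e \<in> carrier R" "e \<otimes> e = e" shows "ring (corner R e)"
proof -
  note i = idem_fix[OF e(1,1) e(2,2)]
  have c: "x \<in> carrier (corner R e) \<longleftrightarrow> x \<in> carrier R \<and> e \<otimes> x = x \<and> x \<otimes> e = x" for x
    using i by auto
  show ?thesis
  proof (rule ringI)
    show "abelian_group (corner R e)"
    proof (rule abelian_groupI; (unfold c)?)
      fix x assume "x \<in> carrier R \<and> e \<otimes> x = x \<and> x \<otimes> e = x"
      then show "\<exists>y\<in>carrier (corner R e). y \<oplus>\<^bsub>corner R e\<^esub> x = \<zero>\<^bsub>corner R e\<^esub>"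
        using e by (intro bexI[of _ "\<ominus> x"]) (auto simp: l_neg l_minus r_minus)
    qed (use e in \<open>auto simp: r_distr l_distr a_assoc intro: a_comm\<close>)
    show "monoid (corner R e)"
      by (rule monoidI; (unfold c)?) (use e in \<open>auto simp: m_assoc simp flip: m_assoc[of e]\<close>)
  qed (auto simp: l_distr r_distr)
qed

text \<open>\<open>D\<close> plays the role of \<open>KQ/I\<close>: \<open>\<epsilon> U\<close> is the sum of the trivial paths at the vertices in \<open>U\<close>, and \<open>\<chi> v\<close> is the
  coefficient of the trivial path at \<open>v\<close>.\<close>

locale directed_tensor = algebra_tensor K C D
  for K :: "('k, 'e) ring_scheme" and C :: "('k, 'c, 'x) module_scheme" and D :: "('k, 'd, 'y) module_scheme" +
  fixes V :: "'v set" and \<epsilon> :: "'v set \<Rightarrow> 'd" and \<chi> :: "'v \<Rightarrow> 'd \<Rightarrow> 'k"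
  assumes field: "field K" and fgC: "fg_module K C" and fgD: "fg_module K D"
    and finV: "finite V"
    and \<epsilon>_closed [simp]: "\<And>U. \<epsilon> U \<in> carrier D"
    and \<epsilon>_mult: "\<And>U W. \<epsilon> U \<otimes>\<^bsub>D\<^esub> \<epsilon> W = \<epsilon> (U \<inter> W)"
    and \<epsilon>_union: "\<And>U W. U \<inter> W = {} \<Longrightarrow> \<epsilon> (U \<union> W) = \<epsilon> U \<oplus>\<^bsub>D\<^esub> \<epsilon> W"
    and \<epsilon>_empty: "\<epsilon> {} = \<zero>\<^bsub>D\<^esub>" and \<epsilon>_V: "\<epsilon> V = \<one>\<^bsub>D\<^esub>"
    and \<chi>_lh: "\<And>v. v \<in> V \<Longrightarrow> lh K D (reg_module K) (\<chi> v)"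
    and \<chi>_one: "\<And>v. v \<in> V \<Longrightarrow> \<chi> v (\<epsilon> {v}) = \<one>\<^bsub>K\<^esub>"
    and \<epsilon>_\<chi>: "\<And>v d. v \<in> V \<Longrightarrow> d \<in> carrier D \<Longrightarrow> \<epsilon> {v} \<otimes>\<^bsub>D\<^esub> d \<otimes>\<^bsub>D\<^esub> \<epsilon> {v} = \<chi> v d \<odot>\<^bsub>D\<^esub> \<epsilon> {v}"
    and sink: "\<And>U. U \<subseteq> V \<Longrightarrow> U \<noteq> {} \<Longrightarrow> \<exists>v\<in>U. \<forall>d\<in>carrier D. \<epsilon> (U - {v}) \<otimes>\<^bsub>D\<^esub> d \<otimes>\<^bsub>D\<^esub> \<epsilon> {v} = \<zero>\<^bsub>D\<^esub>"
begin

definition \<eta> where "\<eta> U = tt \<one>\<^bsub>C\<^esub> (\<epsilon> U)"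

lemma \<eta>_closed [simp]: "\<eta> U \<in> carrier \<Gamma>" by (simp add: \<eta>_def)
lemma \<eta>_mult [simp]: "\<eta> U \<otimes>\<^bsub>\<Gamma>\<^esub> \<eta> W = \<eta> (U \<inter> W)" by (simp add: \<eta>_def tt_mult \<epsilon>_mult)
lemma \<eta>_union: "U \<inter> W = {} \<Longrightarrow> \<eta> (U \<union> W) = \<eta> U \<oplus>\<^bsub>\<Gamma>\<^esub> \<eta> W" by (simp add: \<eta>_def tt_add2 \<epsilon>_union)
lemma \<eta>_empty: "\<eta> {} = \<zero>\<^bsub>\<Gamma>\<^esub>" by (simp add: \<eta>_def tt_zero2 \<epsilon>_empty)
lemma \<eta>_V: "\<eta> V = \<one>\<^bsub>\<Gamma>\<^esub>" by (simp add: \<eta>_def one_tt \<epsilon>_V)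

lemma \<eta>_mult2: "x \<in> carrier \<Gamma> \<Longrightarrow> \<eta> U \<otimes>\<^bsub>\<Gamma>\<^esub> (\<eta> W \<otimes>\<^bsub>\<Gamma>\<^esub> x) = \<eta> (U \<inter> W) \<otimes>\<^bsub>\<Gamma>\<^esub> x"
  by (simp flip: \<Gamma>.m_assoc)

definition j where "j c = tt c \<one>\<^bsub>D\<^esub>"

lemma j_hom: "j \<in> ring_hom C \<Gamma>"
  by (rule ring_hom_memI) (simp_all add: j_def tt_mult tt_add1 one_tt)

lemma j_closed [simp]: "c \<in> carrier C \<Longrightarrow> j c \<in> carrier \<Gamma>" by (simp add: j_def)

lemma j_\<eta>: "c \<in> carrier C \<Longrightarrow> j c \<otimes>\<^bsub>\<Gamma>\<^esub> \<eta> U = tt c (\<epsilon> U)" "c \<in> carrier C \<Longrightarrow> \<eta> U \<otimes>\<^bsub>\<Gamma>\<^esub> j c = tt c (\<epsilon> U)"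
  by (simp_all add: j_def \<eta>_def tt_mult)

text \<open>\<tau> is 1 \<otimes> l, read as a map from the tensor product to C.\<close>

lemma lift_functional:
  assumes l: "lh K D (reg_module K) l"
  obtains \<tau> where "\<And>x. x \<in> carrier \<Gamma> \<Longrightarrow> \<tau> x \<in> carrier C"
    "\<And>x y. x \<in> carrier \<Gamma> \<Longrightarrow> y \<in> carrier \<Gamma> \<Longrightarrow> \<tau> (x \<oplus>\<^bsub>\<Gamma>\<^esub> y) = \<tau> x \<oplus>\<^bsub>C\<^esub> \<tau> y"
    "\<And>m y. m \<in> carrier C \<Longrightarrow> y \<in> carrier D \<Longrightarrow> \<tau> (tt m y) = l y \<odot>\<^bsub>C\<^esub> m"
proof -
  have lc: "l y \<in> carrier K" if "y \<in> carrier D" for y using lh_closed[OF l that] by simp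
  show thesis
    by (rule tensor_lift[OF C.M.abelian_group_axioms, of "\<lambda>m y. l y \<odot>\<^bsub>C\<^esub> m"]; ((rule that; assumption) |
      simp add: lc C.smult_r_distr C.smult_l_distr C.smult_assoc1 lh_add[OF l] lh_smult[OF l] C.R.m_comm flip: C.smult_assoc1))
qed

abbreviation "\<Gamma>C \<equiv> res j (reg_module \<Gamma>)"

lemma \<Gamma>C_lmodule: "lmodule C \<Gamma>C"
  by (rule ring_hom_res_lmodule[OF j_hom C.ring_axioms reg_lmodule[OF \<Gamma>.ring_axioms]])

text \<open>D is finitely generated over the field K and so has a dual basis; tensoring with C turns
  it into one of \<Gamma> over C.\<close>

lemma \<Gamma>C_fgproj: "fgproj C \<Gamma>C"
proof -
  note DM = assoc_algebra_lmodule(1)[OF D]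
  obtain n l p where d: "dbasis K D n l p" using field_fgproj[OF field DM fgD] by (auto simp: fgproj_def)
  have l: "lh K D (reg_module K) (l i)" "p i \<in> carrier D" if "i < n" for i using d that by (auto simp: dbasis_def)
  have lc: "l i y \<in> carrier K" if "i < n" "y \<in> carrier D" for i y using lh_closed[OF l(1)[OF that(1)] that(2)] by simp
  obtain \<tau> where \<tau>: "\<And>i x. i < n \<Longrightarrow> x \<in> carrier \<Gamma> \<Longrightarrow> \<tau> i x \<in> carrier C"
    "\<And>i x y. i < n \<Longrightarrow> x \<in> carrier \<Gamma> \<Longrightarrow> y \<in> carrier \<Gamma> \<Longrightarrow> \<tau> i (x \<oplus>\<^bsub>\<Gamma>\<^esub> y) = \<tau> i x \<oplus>\<^bsub>C\<^esub> \<tau> i y"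
    "\<And>i m y. i < n \<Longrightarrow> m \<in> carrier C \<Longrightarrow> y \<in> carrier D \<Longrightarrow> \<tau> i (tt m y) = l i y \<odot>\<^bsub>C\<^esub> m"
    and dec: "\<And>x. x \<in> carrier \<Gamma> \<Longrightarrow> lsum \<Gamma> (\<lambda>i. tt (\<tau> i x) (p i)) n = x"
    by (rule tensor_dual_basis[OF d]) (rule that, assumption+)
  have \<tau>s: "\<tau> i (j c \<otimes>\<^bsub>\<Gamma>\<^esub> x) = c \<otimes>\<^bsub>C\<^esub> \<tau> i x" if i: "i < n" and c: "c \<in> carrier C" and x: "x \<in> carrier \<Gamma>" for i c x
    using x
  proof (induction x rule: tensor_induct)
    case (tt m y) then show ?case using i c by (simp add: j_def tt_mult \<tau>(3) C.smult_mult_right lc)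
  next
    case (add x y) then show ?case using i c by (simp add: \<Gamma>.r_distr \<tau>(1,2) C.r_distr)
  qed
  have "dbasis C \<Gamma>C n \<tau> (\<lambda>i. tt \<one>\<^bsub>C\<^esub> (p i))" unfolding dbasis_def
  proof (intro conjI allI impI ballI)
    fix i assume i: "i < n"
    show "tt \<one>\<^bsub>C\<^esub> (p i) \<in> carrier \<Gamma>C" using l(2)[OF i] by simp
    show "lh C \<Gamma>C (reg_module C) (\<tau> i)" by (rule lhI) (simp_all add: \<tau>[OF i] \<tau>s[OF i])
  next
    fix x assume x: "x \<in> carrier \<Gamma>C"
    have "k \<le> n \<Longrightarrow> lsum \<Gamma>C (\<lambda>i. \<tau> i x \<odot>\<^bsub>\<Gamma>C\<^esub> tt \<one>\<^bsub>C\<^esub> (p i)) k = lsum \<Gamma> (\<lambda>i. tt (\<tau> i x) (p i)) k" for k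
      by (induction k) (use x l \<tau>(1) in \<open>simp_all add: j_def tt_mult\<close>)
    then show "x = lsum \<Gamma>C (\<lambda>i. \<tau> i x \<odot>\<^bsub>\<Gamma>C\<^esub> tt \<one>\<^bsub>C\<^esub> (p i)) n" using dec x by simp
  qed
  then show ?thesis using \<Gamma>C_lmodule unfolding fgproj_def by blast
qed

definition block where "block U W = {x \<in> carrier \<Gamma>. \<eta> U \<otimes>\<^bsub>\<Gamma>\<^esub> x \<otimes>\<^bsub>\<Gamma>\<^esub> \<eta> W = x}"

lemma block_iff: "x \<in> block U W \<longleftrightarrow> x \<in> carrier \<Gamma> \<and> \<eta> U \<otimes>\<^bsub>\<Gamma>\<^esub> x = x \<and> x \<otimes>\<^bsub>\<Gamma>\<^esub> \<eta> W = x"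
  unfolding block_def using \<Gamma>.idem_fix[of "\<eta> U" "\<eta> W" x] by auto

lemma j_comm: "c \<in> carrier C \<Longrightarrow> x \<in> carrier \<Gamma> \<Longrightarrow> \<eta> U \<otimes>\<^bsub>\<Gamma>\<^esub> (j c \<otimes>\<^bsub>\<Gamma>\<^esub> x) = j c \<otimes>\<^bsub>\<Gamma>\<^esub> (\<eta> U \<otimes>\<^bsub>\<Gamma>\<^esub> x)"
  by (simp add: j_\<eta> flip: \<Gamma>.m_assoc)

text \<open>Scalars from C enter as c \<otimes> 1 and commute with every \<eta> U, so multiplying by
  \<eta> U on the left and \<eta> W on the right is a C-linear projection of \<Gamma> onto the
  block.\<close>

lemma block_fgproj: "fgproj C (res j ((reg_module \<Gamma>)\<lparr>carrier := block U W\<rparr>))"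
proof -
  have "submod C \<Gamma>C (block U W)"
    by (auto simp: submod_def block_iff \<Gamma>.r_distr \<Gamma>.l_distr j_comm \<Gamma>.m_assoc)
  then have M: "lmodule C (res j ((reg_module \<Gamma>)\<lparr>carrier := block U W\<rparr>))"
    using submod_lmodule[OF \<Gamma>C_lmodule, of "block U W"] by simp
  show ?thesis
  proof (rule fgproj_retract[OF \<Gamma>C_fgproj M])
    show "lh C (res j ((reg_module \<Gamma>)\<lparr>carrier := block U W\<rparr>)) \<Gamma>C (\<lambda>x. x)" by (rule lhI) (auto simp: block_iff)
    show "lh C \<Gamma>C (res j ((reg_module \<Gamma>)\<lparr>carrier := block U W\<rparr>)) (\<lambda>x. \<eta> U \<otimes>\<^bsub>\<Gamma>\<^esub> x \<otimes>\<^bsub>\<Gamma>\<^esub> \<eta> W)"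
      by (rule lhI) (auto simp: block_iff \<Gamma>.r_distr \<Gamma>.l_distr j_comm \<Gamma>.m_assoc \<eta>_mult2)
  qed (auto simp: block_iff)
qed

abbreviation "L U \<equiv> corner \<Gamma> (\<eta> U)"

lemma L_carrier: "carrier (L U) = block U U" by (simp add: block_def)

lemma L_ring: "ring (L U)" by (rule \<Gamma>.corner_ring) simp_all

lemma C_noeth: "noeth C" by (rule assoc_algebra_noeth[OF field_noeth[OF field] C fgC])

text \<open>The corner is finitely generated over C, which maps to it by c \<mapsto> c \<otimes>
  \<epsilon> U.\<close>

lemma L_noeth: "noeth (L U)"
proof -
  let ?h = "\<lambda>c. tt c (\<epsilon> U)"
  have tb: "tt c (\<epsilon> U) \<in> block U U" if "c \<in> carrier C" for c
    using that by (simp add: block_iff \<eta>_def tt_mult \<epsilon>_mult)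
  have h: "?h \<in> ring_hom C (L U)"
    by (rule ring_hom_memI) (simp_all add: L_carrier tb tt_mult tt_add1 \<epsilon>_mult del: corner_simps(1) flip: \<eta>_def)
  have M: "lmodule C (res ?h (reg_module (L U)))" by (rule ring_hom_res_lmodule[OF h C.ring_axioms reg_lmodule[OF L_ring]])
  note B = block_fgproj[of U U]
  have "lh C (res j ((reg_module \<Gamma>)\<lparr>carrier := block U U\<rparr>)) (res ?h (reg_module (L U))) (\<lambda>x. x)"
    by (rule lhI) (auto simp: L_carrier block_iff \<Gamma>.m_assoc simp flip: j_\<eta>(1) simp del: corner_simps(1))
  then have "fg_module C (res ?h (reg_module (L U)))"
    by (rule fg_image[OF fgproj_lmodule[OF B] M fgproj_fg[OF B]]) (simp add: L_carrier del: corner_simps(1))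
  then show ?thesis by (rule noeth_over[OF C_noeth L_ring h])
qed

end

section \<open>Removing a sink\<close>

context directed_tensor begin

lemma sink_zero:
  assumes low: "\<forall>d\<in>carrier D. \<epsilon> W \<otimes>\<^bsub>D\<^esub> d \<otimes>\<^bsub>D\<^esub> \<epsilon> {v} = \<zero>\<^bsub>D\<^esub>" and x: "x \<in> carrier \<Gamma>"
  shows "\<eta> W \<otimes>\<^bsub>\<Gamma>\<^esub> x \<otimes>\<^bsub>\<Gamma>\<^esub> \<eta> {v} = \<zero>\<^bsub>\<Gamma>\<^esub>"
  using x
proof (induction x rule: tensor_induct)
  case (tt m y) then show ?case using low by (simp add: \<eta>_def tt_mult tt_zero2)
next
  case (add x y) then show ?case by (simp add: \<Gamma>.l_distr \<Gamma>.r_distr)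
qed

lemma block_mono:
  assumes x: "x \<in> block U W" and s: "U \<subseteq> U'" "W \<subseteq> W'" shows "x \<in> block U' W'"
proof -
  have xc: "x \<in> carrier \<Gamma>" "\<eta> U \<otimes>\<^bsub>\<Gamma>\<^esub> x = x" "x \<otimes>\<^bsub>\<Gamma>\<^esub> \<eta> W = x" using x by (simp_all add: block_iff)
  have i: "U' \<inter> U = U" "W \<inter> W' = W" using s by auto
  have "\<eta> U' \<otimes>\<^bsub>\<Gamma>\<^esub> x = \<eta> U \<otimes>\<^bsub>\<Gamma>\<^esub> x" using \<eta>_mult2[OF xc(1), of U' U] unfolding xc(2) i .
  moreover have "x \<otimes>\<^bsub>\<Gamma>\<^esub> \<eta> W' = x \<otimes>\<^bsub>\<Gamma>\<^esub> \<eta> W" using \<Gamma>.m_assoc[of x "\<eta> W" "\<eta> W'"] xc(1) by (simp add: xc(3) i)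
  ultimately show ?thesis using xc by (simp add: block_iff)
qed

text \<open>The triangular situation for the corner at U, with e = \<eta> {v} and f = \<eta> (U -
  {v}). Since \<epsilon> {v} D \<epsilon> {v} consists of multiples of \<epsilon> {v}, the corner at
  v is C itself. The bimodule is a block, so its projectivity over C yields both vanishing
  conditions.\<close>

lemma corner_step:
  assumes U: "U \<subseteq> V" and v: "v \<in> U" and low: "\<forall>d\<in>carrier D. \<epsilon> (U - {v}) \<otimes>\<^bsub>D\<^esub> d \<otimes>\<^bsub>D\<^esub> \<epsilon> {v} = \<zero>\<^bsub>D\<^esub>"
  shows "PA (L U) \<Longrightarrow> PA C" and "PA (L (U - {v})) \<Longrightarrow> PA C \<Longrightarrow> PA (L U)"
proof -
  have vV: "v \<in> V" using U v by blast
  define W where "W = U - {v}"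
  have W: "W \<subseteq> U" "v \<notin> W" "{v} \<union> W = U" "{v} \<inter> W = {}" "W \<inter> {v} = {}" "U \<inter> W = W" "W \<inter> U = W" "U \<inter> {v} = {v}" "{v} \<inter> U = {v}"
    using v by (auto simp: W_def)
  define \<alpha> where "\<alpha> c = tt c (\<epsilon> {v})" for c
  \<comment> \<open>\<rho> = 1 \<otimes> \<chi> v reads off the C-coefficient at v.\<close>
  obtain \<rho> where \<rho>c: "\<And>x. x \<in> carrier \<Gamma> \<Longrightarrow> \<rho> x \<in> carrier C"
    and \<rho>a: "\<And>x y. x \<in> carrier \<Gamma> \<Longrightarrow> y \<in> carrier \<Gamma> \<Longrightarrow> \<rho> (x \<oplus>\<^bsub>\<Gamma>\<^esub> y) = \<rho> x \<oplus>\<^bsub>C\<^esub> \<rho> y"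
    and \<rho>t: "\<And>m y. m \<in> carrier C \<Longrightarrow> y \<in> carrier D \<Longrightarrow> \<rho> (tt m y) = \<chi> v y \<odot>\<^bsub>C\<^esub> m"
    by (rule lift_functional[OF \<chi>_lh[OF vV]]) (rule that, assumption+)
  have \<chi>c: "\<chi> v y \<in> carrier K" if "y \<in> carrier D" for y using lh_closed[OF \<chi>_lh[OF vV] that] by simp
  have \<alpha>c: "\<alpha> c \<in> carrier \<Gamma>" if "c \<in> carrier C" for c using that by (simp add: \<alpha>_def)
  have \<alpha>a: "\<alpha> (a \<oplus>\<^bsub>C\<^esub> c) = \<alpha> a \<oplus>\<^bsub>\<Gamma>\<^esub> \<alpha> c" if "a \<in> carrier C" "c \<in> carrier C" for a c
    using that by (simp add: \<alpha>_def tt_add1)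
  have \<alpha>m: "\<alpha> (a \<otimes>\<^bsub>C\<^esub> c) = \<alpha> a \<otimes>\<^bsub>\<Gamma>\<^esub> \<alpha> c" if "a \<in> carrier C" "c \<in> carrier C" for a c
    using that by (simp add: \<alpha>_def tt_mult \<epsilon>_mult)
  have \<alpha>1: "\<alpha> \<one>\<^bsub>C\<^esub> = \<eta> {v}" by (simp add: \<alpha>_def \<eta>_def)
  have \<alpha>\<eta>: "\<eta> U \<otimes>\<^bsub>\<Gamma>\<^esub> \<alpha> c = \<alpha> c" "\<alpha> c \<otimes>\<^bsub>\<Gamma>\<^esub> \<eta> U = \<alpha> c" "\<alpha> c = j c \<otimes>\<^bsub>\<Gamma>\<^esub> \<eta> {v}" if "c \<in> carrier C" for c
    using that by (simp_all add: \<alpha>_def \<eta>_def j_def tt_mult \<epsilon>_mult W)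
  have \<rho>\<alpha>: "\<rho> (\<alpha> c) = c" if "c \<in> carrier C" for c using that by (simp add: \<alpha>_def \<rho>t \<chi>_one[OF vV])
  have \<alpha>\<rho>: "\<alpha> (\<rho> x) = \<eta> {v} \<otimes>\<^bsub>\<Gamma>\<^esub> x \<otimes>\<^bsub>\<Gamma>\<^esub> \<eta> {v}" if x: "x \<in> carrier \<Gamma>" for x
    using x
  proof (induction x rule: tensor_induct)
    case (tt m y) then show ?case by (simp add: \<alpha>_def \<rho>t \<chi>c tt_bal \<eta>_def tt_mult \<epsilon>_\<chi>[OF vV])
  next
    case (add x y)
    have "\<alpha> (\<rho> (x \<oplus>\<^bsub>\<Gamma>\<^esub> y)) = \<alpha> (\<rho> x) \<oplus>\<^bsub>\<Gamma>\<^esub> \<alpha> (\<rho> y)" using add by (simp add: \<rho>a \<alpha>_def \<rho>c tt_add1)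
    then show ?case using add by (simp add: \<Gamma>.l_distr \<Gamma>.r_distr)
  qed
  note low' = sink_zero[OF low[folded W_def]]
  have \<eta>U: "\<eta> U = \<eta> {v} \<oplus>\<^bsub>\<Gamma>\<^esub> \<eta> W" using \<eta>_union[OF W(4)] W(3) by simp
  \<comment> \<open>Le = eLe for the prospective e, and fL = fLf in the next fact: both are needed
    before the locale is available, to see that the compressions are multiplicative.\<close>
  have xv: "\<eta> {v} \<otimes>\<^bsub>\<Gamma>\<^esub> x \<otimes>\<^bsub>\<Gamma>\<^esub> \<eta> {v} = x \<otimes>\<^bsub>\<Gamma>\<^esub> \<eta> {v}" if x: "x \<in> block U U" for x
  proof -
    have xc: "x \<in> carrier \<Gamma>" using x by (simp add: block_iff)
    have "x \<otimes>\<^bsub>\<Gamma>\<^esub> \<eta> {v} = \<eta> U \<otimes>\<^bsub>\<Gamma>\<^esub> x \<otimes>\<^bsub>\<Gamma>\<^esub> \<eta> {v}" using x by (simp add: block_iff)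
    then show ?thesis using xc low'[OF xc] by (simp add: \<eta>U \<Gamma>.l_distr)
  qed
  have Wx: "\<eta> W \<otimes>\<^bsub>\<Gamma>\<^esub> x \<otimes>\<^bsub>\<Gamma>\<^esub> \<eta> W = \<eta> W \<otimes>\<^bsub>\<Gamma>\<^esub> x" if x: "x \<in> block U U" for x
  proof -
    have xc: "x \<in> carrier \<Gamma>" using x by (simp add: block_iff)
    have "\<eta> W \<otimes>\<^bsub>\<Gamma>\<^esub> x = \<eta> W \<otimes>\<^bsub>\<Gamma>\<^esub> x \<otimes>\<^bsub>\<Gamma>\<^esub> \<eta> U" using x xc by (simp add: block_iff \<Gamma>.m_assoc)
    then show ?thesis using xc low'[OF xc] by (simp add: \<eta>U \<Gamma>.r_distr)
  qed
  have bl: "block W W \<subseteq> block U U" using block_mono[OF _ W(1) W(1)] by blast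
  have bm: "x \<otimes>\<^bsub>\<Gamma>\<^esub> y \<in> block U U" if "x \<in> block U U" "y \<in> block U U" for x y
    using ring.ring_simprules(5)[OF L_ring[of U], of x y] that by (simp add: L_carrier del: corner_simps(1))
  have bc: "x \<in> carrier \<Gamma>" if "x \<in> block U U" for x using that by (simp add: block_iff)
  interpret T: triangular "L U" C "L W" \<alpha> \<rho> "\<lambda>x. x" "\<lambda>x. \<eta> W \<otimes>\<^bsub>\<Gamma>\<^esub> x \<otimes>\<^bsub>\<Gamma>\<^esub> \<eta> W"
  proof (rule triangular.intro)
    show "\<rho> \<in> ring_hom (L U) C"
    proof (rule ring_hom_memI; (unfold L_carrier)?)
      fix x y assume xy: "x \<in> block U U" "y \<in> block U U"
      \<comment> \<open>The two sides are compared after applying \<alpha>, which is injective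
        because \<rho> \<alpha> = 1.\<close>
      have "\<alpha> (\<rho> x \<otimes>\<^bsub>C\<^esub> \<rho> y) = (\<eta> {v} \<otimes>\<^bsub>\<Gamma>\<^esub> x \<otimes>\<^bsub>\<Gamma>\<^esub> \<eta> {v}) \<otimes>\<^bsub>\<Gamma>\<^esub> (\<eta> {v} \<otimes>\<^bsub>\<Gamma>\<^esub> y \<otimes>\<^bsub>\<Gamma>\<^esub> \<eta> {v})"
        using xy bc by (simp add: \<alpha>m \<rho>c \<alpha>\<rho>)
      also have "\<dots> = \<eta> {v} \<otimes>\<^bsub>\<Gamma>\<^esub> x \<otimes>\<^bsub>\<Gamma>\<^esub> (\<eta> {v} \<otimes>\<^bsub>\<Gamma>\<^esub> y \<otimes>\<^bsub>\<Gamma>\<^esub> \<eta> {v})"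
        using xy bc by (simp add: \<Gamma>.m_assoc \<eta>_mult2)
      also have "\<dots> = \<alpha> (\<rho> (x \<otimes>\<^bsub>\<Gamma>\<^esub> y))" unfolding xv[OF xy(2)] using xy bc by (simp add: \<alpha>\<rho> \<Gamma>.m_assoc)
      finally have "\<rho> (\<alpha> (\<rho> x \<otimes>\<^bsub>C\<^esub> \<rho> y)) = \<rho> (\<alpha> (\<rho> (x \<otimes>\<^bsub>\<Gamma>\<^esub> y)))" by simp
      then show "\<rho> (x \<otimes>\<^bsub>L U\<^esub> y) = \<rho> x \<otimes>\<^bsub>C\<^esub> \<rho> y" using xy bc by (simp add: \<rho>\<alpha> \<rho>c)
    next
      have "\<rho> (\<alpha> (\<rho> (\<eta> U))) = \<rho> (\<alpha> \<one>\<^bsub>C\<^esub>)" by (simp add: \<alpha>\<rho> \<alpha>1 W)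
      then show "\<rho> \<one>\<^bsub>L U\<^esub> = \<one>\<^bsub>C\<^esub>" by (simp add: \<rho>\<alpha> \<rho>c)
    qed (simp_all add: bc \<rho>c \<rho>a)
    show "(\<lambda>x. \<eta> W \<otimes>\<^bsub>\<Gamma>\<^esub> x \<otimes>\<^bsub>\<Gamma>\<^esub> \<eta> W) \<in> ring_hom (L U) (L W)"
    proof (rule ring_hom_memI; (unfold L_carrier)?)
      fix x y assume xy: "x \<in> block U U" "y \<in> block U U"
      show "\<eta> W \<otimes>\<^bsub>\<Gamma>\<^esub> x \<otimes>\<^bsub>\<Gamma>\<^esub> \<eta> W \<in> block W W" using bc[OF xy(1)] by (simp add: block_iff \<eta>_mult2 \<Gamma>.m_assoc)
      have "\<eta> W \<otimes>\<^bsub>\<Gamma>\<^esub> (x \<otimes>\<^bsub>\<Gamma>\<^esub> y) \<otimes>\<^bsub>\<Gamma>\<^esub> \<eta> W = \<eta> W \<otimes>\<^bsub>\<Gamma>\<^esub> x \<otimes>\<^bsub>\<Gamma>\<^esub> y"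
        unfolding Wx[OF bm[OF xy]] using xy bc by (simp add: \<Gamma>.m_assoc)
      also have "\<dots> = \<eta> W \<otimes>\<^bsub>\<Gamma>\<^esub> x \<otimes>\<^bsub>\<Gamma>\<^esub> \<eta> W \<otimes>\<^bsub>\<Gamma>\<^esub> y" unfolding Wx[OF xy(1)] ..
      also have "\<dots> = (\<eta> W \<otimes>\<^bsub>\<Gamma>\<^esub> x \<otimes>\<^bsub>\<Gamma>\<^esub> \<eta> W) \<otimes>\<^bsub>\<Gamma>\<^esub> (\<eta> W \<otimes>\<^bsub>\<Gamma>\<^esub> y \<otimes>\<^bsub>\<Gamma>\<^esub> \<eta> W)"
        unfolding Wx[OF xy(2)] using xy bc by (simp add: \<Gamma>.m_assoc \<eta>_mult2)
      finally show "\<eta> W \<otimes>\<^bsub>\<Gamma>\<^esub> (x \<otimes>\<^bsub>L U\<^esub> y) \<otimes>\<^bsub>\<Gamma>\<^esub> \<eta> W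
        = \<eta> W \<otimes>\<^bsub>\<Gamma>\<^esub> x \<otimes>\<^bsub>\<Gamma>\<^esub> \<eta> W \<otimes>\<^bsub>L W\<^esub> (\<eta> W \<otimes>\<^bsub>\<Gamma>\<^esub> y \<otimes>\<^bsub>\<Gamma>\<^esub> \<eta> W)" by simp
    qed (simp_all add: bc \<Gamma>.l_distr \<Gamma>.r_distr W)
    show "\<alpha> c \<in> carrier (L U)" if "c \<in> carrier C" for c
      unfolding L_carrier using that by (simp add: block_iff \<alpha>c \<alpha>\<eta>(1,2))
    show "x \<in> carrier (L U)" if "x \<in> carrier (L W)" for x using that bl unfolding L_carrier by blast
    show "\<eta> W \<otimes>\<^bsub>\<Gamma>\<^esub> x \<otimes>\<^bsub>\<Gamma>\<^esub> \<eta> W = x" if "x \<in> carrier (L W)" for x using that by simp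
  qed (use low' in \<open>simp_all add: L_noeth C_noeth \<rho>\<alpha> \<alpha>\<rho> \<alpha>1 \<alpha>m \<alpha>a W flip: \<eta>U\<close>)
  have bim: "T.bimS = block {v} W"
  proof -
    have "x \<in> block U U" if "x \<in> block {v} W" for x using block_mono[OF that _ W(1), of U] v by simp
    then show ?thesis using bc by (auto simp: T.bimS_def L_carrier \<alpha>1 block_iff simp del: corner_simps(1))
  qed
  have "lh C (res \<alpha> T.bim) (res j ((reg_module \<Gamma>)\<lparr>carrier := block {v} W\<rparr>)) (\<lambda>x. x)"
    "lh C (res j ((reg_module \<Gamma>)\<lparr>carrier := block {v} W\<rparr>)) (res \<alpha> T.bim) (\<lambda>x. x)"
    by (rule lhI; auto simp: bim block_iff \<alpha>\<eta>(3) \<Gamma>.m_assoc)+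
  then have F: "fgproj C (res \<alpha> T.bim)"
    by (intro fgproj_retract[OF block_fgproj[of "{v}" W] T.killed_lmodule[OF T.bim_killed]]) simp_all
  note vz = T.fgproj_bim_vz[OF F]
  show "PA (L U) \<Longrightarrow> PA C" by (rule T.PA_down[OF vz(2)])
  show "PA (L (U - {v})) \<Longrightarrow> PA C \<Longrightarrow> PA (L U)" using T.PA_iff[OF vz] unfolding W_def by blast
qed

lemma PA_corner: "PA C \<Longrightarrow> U \<subseteq> V \<Longrightarrow> PA (L U)"
proof (induction "card U" arbitrary: U)
  case 0
  then have U: "U = {}" using finite_subset[OF _ finV] by simp
  \<comment> \<open>The corner at the empty set is the zero ring, over which every module is
    zero.\<close>
  show ?case unfolding PA_def
  proof (intro allI impI)
    fix X :: "(('c \<times> 'd \<Rightarrow>\<^sub>0 int) set, nat \<Rightarrow> ('c \<times> 'd \<Rightarrow>\<^sub>0 int) set) module" assume "X \<in> perp (L U)"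
    then have X: "lmodule (L U) X" by (rule perp_lmodule)
    interpret X: lmodule "L U" X by (rule X)
    have "x = \<zero>\<^bsub>X\<^esub>" if "x \<in> carrier X" for x using X.lsmult_one[OF that] X.ls_lzero[OF that] by (simp add: U \<eta>_empty)
    then have "carrier X = {\<zero>\<^bsub>X\<^esub>}" by auto
    then show "fgproj (L U) X" by (rule zero_fgproj[OF X])
  qed
next
  case (Suc n)
  then have "U \<noteq> {}" by auto
  from sink[OF Suc.prems(2) this] obtain v where v: "v \<in> U"
    "\<forall>d\<in>carrier D. \<epsilon> (U - {v}) \<otimes>\<^bsub>D\<^esub> d \<otimes>\<^bsub>D\<^esub> \<epsilon> {v} = \<zero>\<^bsub>D\<^esub>" by blast
  have "n = card (U - {v})" using Suc.hyps(2) v(1) by simp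
  from Suc.hyps(1)[OF this Suc.prems(1)] have "PA (L (U - {v}))" using Suc.prems(2) by blast
  then show ?case using corner_step(2)[OF Suc.prems(2) v] Suc.prems(1) by blast
qed

lemma L_V: "L V = \<Gamma>"
  unfolding corner_def \<eta>_V by (simp cong: conj_cong)

theorem perp_add_iff:
  assumes V: "V \<noteq> {}"
  shows "(perp \<Gamma> :: ('c \<times> 'd \<Rightarrow>\<^sub>0 int) set fgmod set) = add_modules \<Gamma> \<longleftrightarrow> (perp C :: 'c fgmod set) = add_modules C"
proof -
  \<comment> \<open>Downwards a single sink of V is enough; upwards the vertices are added one by
    one in \<open>PA_corner\<close>.\<close>
  obtain v where "v \<in> V" "\<forall>d\<in>carrier D. \<epsilon> (V - {v}) \<otimes>\<^bsub>D\<^esub> d \<otimes>\<^bsub>D\<^esub> \<epsilon> {v} = \<zero>\<^bsub>D\<^esub>" using sink[OF order_refl V] by blast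
  from corner_step(1)[OF order_refl this] have "PA (L V) \<Longrightarrow> PA C" .
  then have "PA \<Gamma> \<longleftrightarrow> PA C" using PA_corner[OF _ order_refl] unfolding L_V by blast
  moreover have "noeth \<Gamma>" using L_noeth[of V] unfolding L_V .
  ultimately show ?thesis by (simp only: perp_eq_add_iff C_noeth)
qed

end

section \<open>Bound quiver algebras\<close>

lemma ring_image:
  assumes R: "ring R" and s: "carrier R' = q ` carrier R" and z: "\<zero>\<^bsub>R'\<^esub> = q \<zero>\<^bsub>R\<^esub>" and o: "\<one>\<^bsub>R'\<^esub> = q \<one>\<^bsub>R\<^esub>"
    and a: "\<And>x y. x \<in> carrier R \<Longrightarrow> y \<in> carrier R \<Longrightarrow> q x \<oplus>\<^bsub>R'\<^esub> q y = q (x \<oplus>\<^bsub>R\<^esub> y)"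
    and m: "\<And>x y. x \<in> carrier R \<Longrightarrow> y \<in> carrier R \<Longrightarrow> q x \<otimes>\<^bsub>R'\<^esub> q y = q (x \<otimes>\<^bsub>R\<^esub> y)"
  shows "ring R'"
proof -
  interpret R: ring R by fact
  show ?thesis
  proof (rule ringI)
    show "abelian_group R'"
    proof (rule abelian_groupI; (unfold s)?)
      fix y assume "y \<in> q ` carrier R"
      then obtain x where "x \<in> carrier R" "y = q x" by blast
      then show "\<exists>y'\<in>q ` carrier R. y' \<oplus>\<^bsub>R'\<^esub> y = \<zero>\<^bsub>R'\<^esub>"
        by (intro bexI[of _ "q (\<ominus>\<^bsub>R\<^esub> x)"]) (simp_all add: a z R.l_neg)
    qed (auto simp: a z R.a_ac)
    show "monoid R'" by (rule monoidI; (unfold s)?) (auto simp: m o R.m_assoc)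
  qed (auto simp: s a m R.l_distr R.r_distr)
qed

lemma (in abelian_monoid) finsum_only:
  assumes "k \<in> A" "finite A" "g k \<in> carrier G" "\<And>i. i \<in> A \<Longrightarrow> i \<noteq> k \<Longrightarrow> g i = \<zero>"
  shows "finsum G g A = g k"
proof -
  have "finsum G g A = (\<Oplus>i\<in>A. if k = i then g i else \<zero>)"
    by (rule finsum_cong') (use assms in auto)
  also have "\<dots> = finsum G (\<lambda>i. if k = i then g k else \<zero>) A" by (rule finsum_cong') (use assms in auto)
  also have "\<dots> = g k" using finsum_singleton[OF assms(1,2), of "\<lambda>_. g k"] assms(3) by simp
  finally show ?thesis .
qed

locale quiver_algebra =
  fixes K :: "('k, 'x) ring_scheme" and Q :: "('v, 'e) pre_digraph" and J :: "('v \<times> 'e list \<Rightarrow> 'k) set"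
  assumes K: "field K" and fin: "finite_quiver Q" and acyc: "acyclic_quiver Q" and adm: "admissible_ideal K Q J"
begin

abbreviation "P \<equiv> path_algebra K Q"
abbreviation "D \<equiv> quot_algebra P J"

sublocale fin_digraph Q using fin by (simp add: finite_quiver_def)
sublocale K: field K by (rule K)
declare split_paired_All [simp del] awalkE [rule del]

sublocale J: ideal J P using adm by (simp add: admissible_ideal_def)

lemma P_carrier: "f \<in> carrier P \<longleftrightarrow> (\<forall>w. f w \<in> carrier K) \<and> (\<forall>w. w \<notin> quiver_paths Q \<longrightarrow> f w = \<zero>\<^bsub>K\<^esub>) \<and>
    finite {w. f w \<noteq> \<zero>\<^bsub>K\<^esub>}"
  by (simp add: path_algebra_def)

lemma P_val [simp]: "f \<in> carrier P \<Longrightarrow> f w \<in> carrier K" by (simp add: P_carrier)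

lemma P_simps: "\<zero>\<^bsub>P\<^esub> = (\<lambda>_. \<zero>\<^bsub>K\<^esub>)" "(f \<oplus>\<^bsub>P\<^esub> g) w = f w \<oplus>\<^bsub>K\<^esub> g w" "(c \<odot>\<^bsub>P\<^esub> f) w = c \<otimes>\<^bsub>K\<^esub> f w"
  by (simp_all only: path_algebra_def ring.simps module.simps)

lemma P_mult: "(f \<otimes>\<^bsub>P\<^esub> g) (u, p) = (if (u, p) \<in> quiver_paths Q
       then (\<Oplus>\<^bsub>K\<^esub>i\<in>{..length p}. f (awlast u (take i p), drop i p) \<otimes>\<^bsub>K\<^esub> g (u, take i p)) else \<zero>\<^bsub>K\<^esub>)"
  by (simp only: path_algebra_def monoid.simps prod.case)

lemma path_iff: "(u, p) \<in> quiver_paths Q \<longleftrightarrow> awalk u p (awlast u p)"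
  by (auto simp: quiver_paths_def)

lemma cycle_Nil: "awalk u p u \<Longrightarrow> p = []"
  using acyc by (auto simp: acyclic_quiver_def)

text \<open>In an acyclic quiver a walk cannot repeat a vertex, and a finite quiver has only
  finitely many walks without repetition.\<close>

lemma finite_paths: "finite (quiver_paths Q)"
proof -
  have ap: "apath u p v" if w: "awalk u p v" for u p v
  proof (rule ccontr)
    assume "\<not> apath u p v"
    then have "\<not> distinct (awalk_verts u p)" using w by (simp add: apath_def)
    from awalk_not_distinct_decomp[OF w this] obtain r w where "0 < length r" "awalk w r w" by blast
    then show False using cycle_Nil[of w r] by simp
  qed
  have "quiver_paths Q \<subseteq> (\<lambda>(u, p, v). (u, p)) ` {(u, p, v). apath u p v}"
  proof
    fix w assume "w \<in> quiver_paths Q"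
    then obtain u p v where "w = (u, p)" "awalk u p v" by (auto simp: quiver_paths_def)
    then show "w \<in> (\<lambda>(u, p, v). (u, p)) ` {(u, p, v). apath u p v}" using ap[of u p v] by (intro image_eqI[of _ _ "(u, p, v)"]) simp_all
  qed
  then show ?thesis by (rule finite_surj[OF apaths_finite_triple])
qed

lemma smult_closed: assumes "c \<in> carrier K" "f \<in> carrier P" shows "c \<odot>\<^bsub>P\<^esub> f \<in> carrier P"
proof -
  have "{w. c \<otimes>\<^bsub>K\<^esub> f w \<noteq> \<zero>\<^bsub>K\<^esub>} \<subseteq> {w. f w \<noteq> \<zero>\<^bsub>K\<^esub>}" using assms by auto
  then have "finite {w. c \<otimes>\<^bsub>K\<^esub> f w \<noteq> \<zero>\<^bsub>K\<^esub>}" using assms finite_subset by (auto simp: P_carrier)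
  then show ?thesis using assms by (auto simp: P_carrier P_simps)
qed

lemma P_lmodule: "lmodule K P"
  by (unfold_locales) (use J.a_assoc J.a_comm in \<open>auto simp: smult_closed P_simps K.l_distr K.r_distr K.m_assoc fun_eq_iff\<close>)

lemma P_smult_mult:
  assumes "c \<in> carrier K" "f \<in> carrier P" "g \<in> carrier P"
  shows "(c \<odot>\<^bsub>P\<^esub> f) \<otimes>\<^bsub>P\<^esub> g = c \<odot>\<^bsub>P\<^esub> (f \<otimes>\<^bsub>P\<^esub> g)" "f \<otimes>\<^bsub>P\<^esub> (c \<odot>\<^bsub>P\<^esub> g) = c \<odot>\<^bsub>P\<^esub> (f \<otimes>\<^bsub>P\<^esub> g)"
proof -
  have m: "f a \<otimes>\<^bsub>K\<^esub> (c \<otimes>\<^bsub>K\<^esub> g b) = c \<otimes>\<^bsub>K\<^esub> (f a \<otimes>\<^bsub>K\<^esub> g b)" for a b using assms by (simp add: K.m_lcomm)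
  show "(c \<odot>\<^bsub>P\<^esub> f) \<otimes>\<^bsub>P\<^esub> g = c \<odot>\<^bsub>P\<^esub> (f \<otimes>\<^bsub>P\<^esub> g)" "f \<otimes>\<^bsub>P\<^esub> (c \<odot>\<^bsub>P\<^esub> g) = c \<odot>\<^bsub>P\<^esub> (f \<otimes>\<^bsub>P\<^esub> g)"
    using assms by (auto simp: P_simps P_mult fun_eq_iff K.finsum_rdistr m K.m_assoc)
qed

text \<open>The test for being a vertex makes this an element of the path algebra for every set U,
  as the laws for \<epsilon> in \<open>directed_tensor\<close> are stated for all sets.\<close>

definition vs :: "'v set \<Rightarrow> 'v \<times> 'e list \<Rightarrow> 'k" where
  "vs U = (\<lambda>(u, p). if u \<in> U \<and> u \<in> verts Q \<and> p = [] then \<one>\<^bsub>K\<^esub> else \<zero>\<^bsub>K\<^esub>)"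

lemma vs_closed [simp]: "vs U \<in> carrier P"
proof -
  have "{w. vs U w \<noteq> \<zero>\<^bsub>K\<^esub>} \<subseteq> quiver_paths Q"
    by (auto simp: vs_def quiver_paths_def awalk_Nil_iff split: if_splits)
  then show ?thesis using finite_subset[OF _ finite_paths] by (auto simp: P_carrier) (auto simp: vs_def)
qed

text \<open>Products of paths are read right to left, so the left factor sees the final piece of a
  path. That piece is trivial only for the splitting at the very end, where \<open>vs U\<close>
  tests the end vertex; in \<open>vs_right\<close> it is the start vertex.\<close>

lemma vs_left: assumes f: "f \<in> carrier P" shows "(vs U \<otimes>\<^bsub>P\<^esub> f) (u, p) = (if awlast u p \<in> U then f (u, p) else \<zero>\<^bsub>K\<^esub>)"
proof (cases "(u, p) \<in> quiver_paths Q")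
  case True
  have v: "awlast u p \<in> verts Q" using True unfolding path_iff by (rule awalk_last_in_verts)
  have "(\<Oplus>\<^bsub>K\<^esub>i\<in>{..length p}. vs U (awlast u (take i p), drop i p) \<otimes>\<^bsub>K\<^esub> f (u, take i p))
    = vs U (awlast u (take (length p) p), drop (length p) p) \<otimes>\<^bsub>K\<^esub> f (u, take (length p) p)"
    by (rule K.finsum_only) (use f in \<open>auto simp: vs_def\<close>)
  then show ?thesis using True v f by (simp add: P_mult) (simp add: vs_def)
next
  case False then show ?thesis using f by (auto simp: P_mult P_carrier)
qed

lemma vs_right: assumes f: "f \<in> carrier P" shows "(f \<otimes>\<^bsub>P\<^esub> vs U) (u, p) = (if u \<in> U then f (u, p) else \<zero>\<^bsub>K\<^esub>)"
proof (cases "(u, p) \<in> quiver_paths Q")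
  case True
  have v: "u \<in> verts Q" using True unfolding path_iff by (rule awalk_hd_in_verts)
  have "(\<Oplus>\<^bsub>K\<^esub>i\<in>{..length p}. f (awlast u (take i p), drop i p) \<otimes>\<^bsub>K\<^esub> vs U (u, take i p))
    = f (awlast u (take 0 p), drop 0 p) \<otimes>\<^bsub>K\<^esub> vs U (u, take 0 p)"
    by (rule K.finsum_only) (use f in \<open>auto simp: vs_def\<close>)
  then show ?thesis using True v f by (simp add: P_mult) (simp add: vs_def)
next
  case False then show ?thesis using f by (auto simp: P_mult P_carrier)
qed

lemma vs_mult: "vs U \<otimes>\<^bsub>P\<^esub> vs W = vs (U \<inter> W)"
  by (auto simp: fun_eq_iff vs_left) (auto simp: vs_def)

lemma vs_union: "U \<inter> W = {} \<Longrightarrow> vs (U \<union> W) = vs U \<oplus>\<^bsub>P\<^esub> vs W"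
  by (auto simp: fun_eq_iff P_simps vs_def)

lemma vs_empty: "vs {} = \<zero>\<^bsub>P\<^esub>"
  by (auto simp: fun_eq_iff P_simps vs_def)

lemma vs_verts: "vs (verts Q) = \<one>\<^bsub>P\<^esub>"
proof -
  have "\<one>\<^bsub>P\<^esub> = (\<lambda>(u, p). if u \<in> verts Q \<and> p = [] then \<one>\<^bsub>K\<^esub> else \<zero>\<^bsub>K\<^esub>)"
    by (simp only: path_algebra_def monoid.simps)
  then show ?thesis by (simp add: vs_def)
qed

text \<open>By acyclicity the only path from v to itself is the trivial one.\<close>

lemma vs_corner:
  assumes v: "v \<in> verts Q" and f: "f \<in> carrier P"
  shows "vs {v} \<otimes>\<^bsub>P\<^esub> f \<otimes>\<^bsub>P\<^esub> vs {v} = f (v, []) \<odot>\<^bsub>P\<^esub> vs {v}"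
proof
  fix w :: "'v \<times> 'e list" obtain u p where w: "w = (u, p)" by (cases w)
  have "f (u, p) = \<zero>\<^bsub>K\<^esub>" if "u = v" "awlast u p = v" "p \<noteq> []"
  proof -
    have "(u, p) \<notin> quiver_paths Q" using that cycle_Nil by (auto simp: path_iff)
    then show ?thesis using f by (simp add: P_carrier)
  qed
  then show "(vs {v} \<otimes>\<^bsub>P\<^esub> f \<otimes>\<^bsub>P\<^esub> vs {v}) w = (f (v, []) \<odot>\<^bsub>P\<^esub> vs {v}) w"
    unfolding w using f v by (auto simp: vs_right vs_left P_simps) (auto simp: vs_def)
qed

text \<open>Reachability by nontrivial paths is transitive and, by acyclicity, irreflexive, so on
  the finite set U it is well-founded and has an extremal vertex.\<close>

lemma vs_sink:
  assumes U: "U \<subseteq> verts Q" "U \<noteq> {}"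
  shows "\<exists>v\<in>U. \<forall>f\<in>carrier P. vs (U - {v}) \<otimes>\<^bsub>P\<^esub> f \<otimes>\<^bsub>P\<^esub> vs {v} = \<zero>\<^bsub>P\<^esub>"
proof -
  \<comment> \<open>The pairs are oriented so that minimal elements reach no vertex of U; a
    connecting walk may well pass through vertices outside U.\<close>
  define r where "r = {(w, v). v \<in> U \<and> w \<in> U \<and> (\<exists>p. p \<noteq> [] \<and> awalk v p w)}"
  have "finite (U \<times> U)" using finite_subset[OF U(1)] by simp
  then have "finite r" by (rule rev_finite_subset) (auto simp: r_def)
  moreover have "acyclic r"
  proof (rule acyclicI, rule allI)
    have "trans r"
    proof (rule transI)
      fix x y z assume "(x, y) \<in> r" "(y, z) \<in> r"
      then obtain p q where "x \<in> U" "z \<in> U" "awalk y p x" "awalk z q y" "p \<noteq> []" by (auto simp: r_def)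
      then show "(x, z) \<in> r" using awalk_appendI[of z q y p x] by (auto simp: r_def intro!: exI[of _ "q @ p"] simp del: awalk_append_iff)
    qed
    moreover have "(x, x) \<notin> r" for x using cycle_Nil[of x] by (auto simp: r_def)
    ultimately show "(x, x) \<notin> r\<^sup>+" for x by (simp add: trancl_id)
  qed
  ultimately have "wf r" by (rule finite_acyclic_wf)
  obtain v0 where "v0 \<in> U" using U(2) by blast
  then obtain v where v: "v \<in> U" "\<And>w. (w, v) \<in> r \<Longrightarrow> w \<notin> U" by (rule wfE_min[OF \<open>wf r\<close>]) blast
  have z: "f (v, p) = \<zero>\<^bsub>K\<^esub>" if f: "f \<in> carrier P" and p: "awlast v p \<in> U - {v}" for f p
  proof -
    have "\<not> awalk v p (awlast v p)"
    proof
      assume a: "awalk v p (awlast v p)"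
      have "p \<noteq> []" using p by auto
      then have "(awlast v p, v) \<in> r" using a v(1) p by (auto simp: r_def)
      then show False using v(2) p by blast
    qed
    then show ?thesis using f by (simp add: P_carrier path_iff)
  qed
  have "vs (U - {v}) \<otimes>\<^bsub>P\<^esub> f \<otimes>\<^bsub>P\<^esub> vs {v} = \<zero>\<^bsub>P\<^esub>" if f: "f \<in> carrier P" for f
    using f z[OF f] by (auto simp: fun_eq_iff vs_right vs_left) (auto simp: P_simps)
  then show ?thesis using v(1) by blast
qed

text \<open>A trivial path factors only into trivial paths, so taking its coefficient is
  multiplicative.\<close>

lemma triv_hom: assumes v: "v \<in> verts Q" shows "(\<lambda>f. f (v, [])) \<in> ring_hom P K"
proof (rule ring_hom_memI)
  have "(v, []) \<in> quiver_paths Q" using v by (simp add: path_iff awalk_Nil_iff)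
  then show "(f \<otimes>\<^bsub>P\<^esub> g) (v, []) = f (v, []) \<otimes>\<^bsub>K\<^esub> g (v, [])" if "f \<in> carrier P" "g \<in> carrier P" for f g
    using that by (simp add: P_mult)
  show "\<one>\<^bsub>P\<^esub> (v, []) = \<one>\<^bsub>K\<^esub>" using v by (simp add: vs_verts[symmetric] vs_def)
qed (simp_all add: P_simps)

text \<open>Arrows have coefficient zero at trivial paths, so the kernel of the coefficient map
  contains the arrow ideal; J lies in the square of the latter.\<close>

lemma J_triv: assumes f: "f \<in> J" and v: "v \<in> verts Q" shows "f (v, []) = \<zero>\<^bsub>K\<^esub>"
proof -
  let ?N = "a_kernel P K (\<lambda>f. f (v, []))"
  have N: "ideal ?N P"
    by (rule ring_hom_ring.kernel_is_ideal[OF ring_hom_ringI2[OF J.ring_axioms K.ring_axioms triv_hom[OF v]]])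
  interpret N: ideal ?N P by (rule N)
  have "path_elem K (tail Q \<alpha>, [\<alpha>]) \<in> ?N" if "\<alpha> \<in> arcs Q" for \<alpha>
  proof -
    have "awalk (tail Q \<alpha>) [\<alpha>] (head Q \<alpha>)" using that by (simp add: awalk_def)
    then have "(tail Q \<alpha>, [\<alpha>]) \<in> quiver_paths Q" by (auto simp: quiver_paths_def)
    then show ?thesis by (auto simp: a_kernel_def' P_carrier path_elem_def)
  qed
  then have a: "arrow_ideal K Q \<subseteq> ?N" unfolding arrow_ideal_def by (intro J.genideal_minimal[OF N]) auto
  have c: "ideal_prod P (carrier P) (arrow_ideal K Q) \<subseteq> carrier P"
  proof
    fix x assume "x \<in> ideal_prod P (carrier P) (arrow_ideal K Q)"
    then show "x \<in> carrier P"
      by induction (use a N.a_subset in auto)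
  qed
  \<comment> \<open>Unfolding the second power in the monoid of ideals leaves the unit, all of P, as
    first factor. Fact \<open>c\<close> puts the first two factors into P, and the last one already
    lies in the kernel.\<close>
  have "J \<subseteq> ideal_prod P (ideal_prod P (carrier P) (arrow_ideal K Q)) (arrow_ideal K Q)"
    using adm by (simp add: admissible_ideal_def ideals_set_def numeral_2_eq_2)
  also have "\<dots> \<subseteq> ?N"
  proof
    fix x assume "x \<in> ideal_prod P (ideal_prod P (carrier P) (arrow_ideal K Q)) (arrow_ideal K Q)"
    then show "x \<in> ?N"
    proof induction
      case (prod i j)
      have "i \<in> carrier P" "j \<in> ?N" using prod a c by blast+
      then show ?case by (intro N.I_l_closed)
    qed (rule N.a_closed)
  qed
  finally have "f \<in> ?N" using f by (rule subsetD)
  then show ?thesis unfolding a_kernel_def' mem_Collect_eq by (rule conjunct2)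
qed

end

section \<open>The bound quiver algebra\<close>

context quiver_algebra begin

definition q where "q f = J +>\<^bsub>P\<^esub> f"

lemma D_carrier: "carrier D = q ` carrier P"
  by (auto simp: quot_algebra_def ring.defs module.defs FactRing_def A_RCOSETS_defs a_r_coset_def[symmetric] q_def)

lemma D_ops: "\<zero>\<^bsub>D\<^esub> = J" "\<one>\<^bsub>D\<^esub> = q \<one>\<^bsub>P\<^esub>" "X \<oplus>\<^bsub>D\<^esub> Y = X <+>\<^bsub>P\<^esub> Y" "X \<otimes>\<^bsub>D\<^esub> Y = rcoset_mult P J X Y"
  "c \<odot>\<^bsub>D\<^esub> X = (\<Union>x\<in>X. q (c \<odot>\<^bsub>P\<^esub> x))"
  by (simp_all add: quot_algebra_def ring.defs module.defs FactRing_def q_def)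

lemma q_mem: "x \<in> q f \<longleftrightarrow> (\<exists>h\<in>J. x = h \<oplus>\<^bsub>P\<^esub> f)"
  by (auto simp: q_def a_r_coset_def')

lemma q_ops: assumes "f \<in> carrier P" "g \<in> carrier P"
  shows "q f \<oplus>\<^bsub>D\<^esub> q g = q (f \<oplus>\<^bsub>P\<^esub> g)" "q f \<otimes>\<^bsub>D\<^esub> q g = q (f \<otimes>\<^bsub>P\<^esub> g)"
  unfolding D_ops q_def using J.a_rcos_sum[OF assms] J.rcoset_mult_add[OF assms] .

lemma J_zero: "\<zero>\<^bsub>P\<^esub> \<in> J"
  by (rule additive_subgroup.zero_closed[OF J.additive_subgroup_axioms])

lemma q_zero: "\<zero>\<^bsub>D\<^esub> = q \<zero>\<^bsub>P\<^esub>"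
  unfolding D_ops q_def by (rule J.a_rcos_const[OF J_zero, symmetric])

lemma q_J: assumes "h \<in> J" "f \<in> carrier P" shows "q (h \<oplus>\<^bsub>P\<^esub> f) = q f"
proof -
  have hc: "h \<in> carrier P" by (rule J.Icarr[OF assms(1)])
  have "q h = J" unfolding q_def by (rule J.a_rcos_const[OF assms(1)])
  then have "q h = q \<zero>\<^bsub>P\<^esub>" using q_zero by (simp add: D_ops)
  then have "q h \<oplus>\<^bsub>D\<^esub> q f = q \<zero>\<^bsub>P\<^esub> \<oplus>\<^bsub>D\<^esub> q f" by simp
  then show ?thesis using assms(2) hc by (simp add: q_ops)
qed

lemma q_smult: assumes c: "c \<in> carrier K" and f: "f \<in> carrier P" shows "c \<odot>\<^bsub>D\<^esub> q f = q (c \<odot>\<^bsub>P\<^esub> f)"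
proof -
  interpret M: lmodule K P by (rule P_lmodule)
  have "q (c \<odot>\<^bsub>P\<^esub> x) = q (c \<odot>\<^bsub>P\<^esub> f)" if x: "x \<in> q f" for x
  proof -
    obtain h where h: "h \<in> J" "x = h \<oplus>\<^bsub>P\<^esub> f" using x unfolding q_mem by blast
    have hc: "h \<in> carrier P" by (rule J.Icarr[OF h(1)])
    \<comment> \<open>The ideal is closed under scalars because c h = (c 1) h.\<close>
    have "c \<odot>\<^bsub>P\<^esub> h = (c \<odot>\<^bsub>P\<^esub> \<one>\<^bsub>P\<^esub>) \<otimes>\<^bsub>P\<^esub> h" using c hc by (simp add: P_smult_mult)
    also have "\<dots> \<in> J" by (rule J.I_l_closed[OF h(1)]) (simp add: c smult_closed)
    finally have "c \<odot>\<^bsub>P\<^esub> h \<in> J" .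
    from q_J[OF this smult_closed[OF c f]] show ?thesis unfolding h(2) M.lsmult_r_distr[OF c hc f] .
  qed
  moreover have "f \<in> q f" unfolding q_mem using f J_zero by (intro bexI[of _ "\<zero>\<^bsub>P\<^esub>"]) simp_all
  ultimately show ?thesis unfolding D_ops by blast
qed

lemma D_ring: "ring D"
  by (rule ring_image[OF J.ring_axioms D_carrier, OF q_zero D_ops(2) q_ops])

lemma D_lmodule: "lmodule K D" "lh K P D q"
  by (rule lmodule_image[OF P_lmodule D_carrier, OF q_zero q_ops(1) q_smult]; assumption)+

lemma D_algebra: "assoc_algebra K D"
proof -
  interpret D: ring D by (rule D_ring)
  interpret M: lmodule K D by (rule D_lmodule)
  show ?thesis
  proof unfold_locales
    fix c X Y assume c: "c \<in> carrier K" and "X \<in> carrier D" "Y \<in> carrier D"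
    then obtain f g where fg: "X = q f" "Y = q g" "f \<in> carrier P" "g \<in> carrier P" unfolding D_carrier by blast
    show "(c \<odot>\<^bsub>D\<^esub> X) \<otimes>\<^bsub>D\<^esub> Y = c \<odot>\<^bsub>D\<^esub> (X \<otimes>\<^bsub>D\<^esub> Y)" "X \<otimes>\<^bsub>D\<^esub> (c \<odot>\<^bsub>D\<^esub> Y) = c \<odot>\<^bsub>D\<^esub> (X \<otimes>\<^bsub>D\<^esub> Y)"
      unfolding fg(1,2) using c fg(3,4) by (simp_all add: q_smult q_ops smult_closed P_smult_mult)
  qed (simp_all add: M.lsmult_closed M.lsmult_l_distr M.lsmult_r_distr M.lsmult_assoc)
qed

lemma P_fg: "fg_module K P"
proof (rule fgI[OF P_lmodule])
  show "finite (path_elem K ` quiver_paths Q)" by (rule finite_imageI[OF finite_paths])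
  have pe: "path_elem K w \<in> carrier P" if "w \<in> quiver_paths Q" for w
    using that by (auto simp: P_carrier path_elem_def)
  then show "path_elem K ` quiver_paths Q \<subseteq> carrier P" by (rule image_subsetI)
  fix H assume H: "submod K P H" and g: "path_elem K ` quiver_paths Q \<subseteq> H"
  \<comment> \<open>Induction on a finite set containing the support, removing one path at a
    time.\<close>
  have "f \<in> H" if "finite F" "f \<in> carrier P" "{w. f w \<noteq> \<zero>\<^bsub>K\<^esub>} \<subseteq> F" for F f
    using that
  proof (induction F arbitrary: f)
    case empty
    then have "f = \<zero>\<^bsub>P\<^esub>" by (simp add: fun_eq_iff P_simps)
    then show ?case using H by (simp add: submod_def)
  next
    case (insert w F f)
    define f' where "f' = f(w := \<zero>\<^bsub>K\<^esub>)"
    have "{x. f' x \<noteq> \<zero>\<^bsub>K\<^esub>} \<subseteq> {x. f x \<noteq> \<zero>\<^bsub>K\<^esub>}" by (auto simp: f'_def)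
    then have f': "f' \<in> carrier P" using insert.prems(1) finite_subset by (auto simp: P_carrier) (auto simp: f'_def)
    have f'H: "f' \<in> H" by (rule insert.IH[OF f']) (use insert.prems(2) in \<open>auto simp: f'_def\<close>)
    show ?case
    proof (cases "w \<in> quiver_paths Q")
      case True
      have "f = f w \<odot>\<^bsub>P\<^esub> path_elem K w \<oplus>\<^bsub>P\<^esub> f'"
        using insert.prems(1) by (auto simp: fun_eq_iff P_simps path_elem_def f'_def)
      moreover have "f w \<odot>\<^bsub>P\<^esub> path_elem K w \<oplus>\<^bsub>P\<^esub> f' \<in> H"
      proof -
        have "path_elem K w \<in> H" using g True by blast
        moreover have "f w \<in> carrier K" by (rule P_val[OF insert.prems(1)])
        ultimately show ?thesis using H f'H by (simp add: submod_def)
      qed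
      ultimately show ?thesis by simp
    next
      case False
      then have "f' = f" using insert.prems(1) by (auto simp: f'_def P_carrier fun_eq_iff)
      then show ?thesis using f'H by simp
    qed
  qed
  then show "carrier P \<subseteq> H" unfolding P_carrier[abs_def] by (auto simp: P_carrier)
qed

text \<open>Any representative of the coset will do: by \<open>J_triv\<close> all of them have the
  same coefficient at the trivial path.\<close>

definition \<chi> :: "'v \<Rightarrow> ('v \<times> 'e list \<Rightarrow> 'k) set \<Rightarrow> 'k" where "\<chi> v X = (SOME f. f \<in> X) (v, [])"

lemma \<chi>_q: assumes v: "v \<in> verts Q" and f: "f \<in> carrier P" shows "\<chi> v (q f) = f (v, [])"
proof -
  have "f \<in> q f" unfolding q_mem using f J_zero by (intro bexI[of _ "\<zero>\<^bsub>P\<^esub>"]) simp_all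
  then have "(SOME f'. f' \<in> q f) \<in> q f" by (rule someI[of "\<lambda>f'. f' \<in> q f"])
  then obtain h where "h \<in> J" "(SOME f'. f' \<in> q f) = h \<oplus>\<^bsub>P\<^esub> f" unfolding q_mem by blast
  then show ?thesis using J_triv[OF \<open>h \<in> J\<close> v] f by (simp add: \<chi>_def P_simps)
qed

lemma directed_tensor:
  assumes C: "assoc_algebra K C" "fg_module K C"
  shows "directed_tensor K C D (verts Q) (\<lambda>U. q (vs U)) \<chi>"
proof (intro directed_tensor.intro algebra_tensor.intro directed_tensor_axioms.intro)
  show "fg_module K D" by (rule fg_image[OF P_lmodule D_lmodule(1) P_fg D_lmodule(2) D_carrier[symmetric]])
  show "q (vs U) \<in> carrier D" for U unfolding D_carrier by (rule imageI[OF vs_closed])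
  show "q (vs U) \<otimes>\<^bsub>D\<^esub> q (vs W) = q (vs (U \<inter> W))" for U W by (simp add: q_ops vs_mult)
  show "q (vs (U \<union> W)) = q (vs U) \<oplus>\<^bsub>D\<^esub> q (vs W)" if "U \<inter> W = {}" for U W by (simp add: q_ops vs_union[OF that])
  show "q (vs {}) = \<zero>\<^bsub>D\<^esub>" unfolding vs_empty q_zero ..
  show "q (vs (verts Q)) = \<one>\<^bsub>D\<^esub>" unfolding vs_verts D_ops ..
  fix v assume v: "v \<in> verts Q"
  show "\<chi> v (q (vs {v})) = \<one>\<^bsub>K\<^esub>" by (simp add: \<chi>_q[OF v]) (simp add: vs_def v)
  show "lh K D (reg_module K) (\<chi> v)"
    by (rule lhI; (unfold D_carrier)?) (auto simp: \<chi>_q[OF v] q_ops q_smult smult_closed P_simps)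
  fix X assume "X \<in> carrier D"
  then obtain f where f: "X = q f" "f \<in> carrier P" unfolding D_carrier by blast
  show "q (vs {v}) \<otimes>\<^bsub>D\<^esub> X \<otimes>\<^bsub>D\<^esub> q (vs {v}) = \<chi> v X \<odot>\<^bsub>D\<^esub> q (vs {v})"
    using f(2) unfolding f(1) by (simp add: q_ops vs_corner[OF v] \<chi>_q[OF v] q_smult)
next
  fix U assume "U \<subseteq> verts Q" "U \<noteq> {}"
  from vs_sink[OF this] obtain v where v: "v \<in> U"
    and z: "\<And>f. f \<in> carrier P \<Longrightarrow> vs (U - {v}) \<otimes>\<^bsub>P\<^esub> f \<otimes>\<^bsub>P\<^esub> vs {v} = \<zero>\<^bsub>P\<^esub>" by blast
  have "q (vs (U - {v})) \<otimes>\<^bsub>D\<^esub> q f \<otimes>\<^bsub>D\<^esub> q (vs {v}) = \<zero>\<^bsub>D\<^esub>" if "f \<in> carrier P" for f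
    using that by (simp add: q_ops z q_zero)
  then show "\<exists>v\<in>U. \<forall>d\<in>carrier D. q (vs (U - {v})) \<otimes>\<^bsub>D\<^esub> d \<otimes>\<^bsub>D\<^esub> q (vs {v}) = \<zero>\<^bsub>D\<^esub>"
    unfolding D_carrier using v by (intro bexI[of _ v] ballI) auto
qed (use C K D_algebra in simp_all)

end

theorem theorem1p4:
  fixes A :: "'a ring" and B :: "'b ring" and M :: "('a, 'b, 'm) bimodule"
    and K :: "'k ring" and C :: "('k, 'c) module"
    and Q :: "('v, 'e) pre_digraph" and J :: "('v \<times> 'e list \<Rightarrow> 'k) set"
  assumes Lambda: "\<Lambda> = triangular_ring A M B"
    and Gamma: "\<Gamma> = tensor_algebra K C (quot_algebra (path_algebra K Q) J)"
  shows
   "(artin_algebra A \<and> artin_algebra B \<and> bimodule A B M \<and> artin_algebra \<Lambda> \<and>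
     (perp B :: 'b fgmod set) = add_modules B \<and> proj_dim (opp B) (right_module M) < \<infinity> \<and>
     torsionless A M \<and> proj_dim A M < \<infinity>
     \<longrightarrow>
     (weakly_Gorenstein \<Lambda> \<longleftrightarrow> weakly_Gorenstein A) \<and>
     (M \<in> add_modules A \<longrightarrow>
       (weakly_Gorenstein A \<longrightarrow>
         (perp \<Lambda> :: ('a \<times> 'm \<times> 'b) fgmod set) = gp \<Lambda> \<and>
         (gp \<Lambda> :: ('a \<times> 'm \<times> 'b) fgmod set) =
           {Z. lmodule \<Lambda> Z \<and>
               (\<exists>P \<in> (add_modules B :: 'b fgmod set). \<exists>G \<in> (perp A :: 'a fgmod set).
                  lisomorphic \<Lambda> Z
                    (direct_sum
                      (triple_module M B (tensor_module M B P) P (\<lambda>t. t))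
                      (triple_module M B G (zero_module :: ('b, unit) module) (\<lambda>_. \<zero>\<^bsub>G\<^esub>))))}) \<and>
       ((perp \<Lambda> :: ('a \<times> 'm \<times> 'b) fgmod set) = add_modules \<Lambda> \<longleftrightarrow>
        (perp A :: 'a fgmod set) = add_modules A)))
    \<and>
    (field K \<and> fin_dim_algebra K C \<and>
     finite_quiver Q \<and> acyclic_quiver Q \<and> admissible_ideal K Q J
     \<longrightarrow>
     ((perp \<Gamma> :: ('c \<times> ('v \<times> 'e list \<Rightarrow> 'k) set \<Rightarrow>\<^sub>0 int) set fgmod set) = add_modules \<Gamma> \<longleftrightarrow>
      (perp C :: 'c fgmod set) = add_modules C))"
proof (unfold Lambda Gamma, intro conjI impI; elim conjE)
  assume "field K" "fin_dim_algebra K C" "finite_quiver Q" "acyclic_quiver Q" "admissible_ideal K Q J"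
  then interpret quiver_algebra K Q J by (intro quiver_algebra.intro)
  interpret directed_tensor K C "quot_algebra (path_algebra K Q) J" "verts Q" "\<lambda>U. q (vs U)" \<chi>
    by (rule directed_tensor) (use \<open>fin_dim_algebra K C\<close> in \<open>simp_all add: fin_dim_algebra_def\<close>)
  show "(perp (tensor_algebra K C (quot_algebra (path_algebra K Q) J)) ::
      ('c \<times> ('v \<times> 'e list \<Rightarrow> 'k) set \<Rightarrow>\<^sub>0 int) set fgmod set) = add_modules (tensor_algebra K C (quot_algebra (path_algebra K Q) J)) \<longleftrightarrow>
      (perp C :: 'c fgmod set) = add_modules C"
    by (rule perp_add_iff) (use \<open>finite_quiver Q\<close> in \<open>simp add: finite_quiver_def\<close>)
qed (rule triangular_ring_perp; assumption)+

end
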